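(* With $N_1(B),\dots,N_6(B)$ the counting functions defined in the context, as $B\to\infty$ we have $$N_1(B)=\frac{13}{4320}\left(\prod_p\left(1-\frac1p\right)^5\left(1+\frac5p\right)\right)B(\log B)^5+O(B(\log B)^4\log\log B),$$ $$N_2(B)=\frac{1}{32}\left(\prod_p\left(1-\frac1p\right)^3\left(1+\frac3p\right)\right)B(\log B)^4+O(B(\log B)^3\log\log B),$$ $$N_3(B)=\frac18\left(\prod_p\left(1-\frac1p\right)^2\left(1+\frac2p-\frac1{p^2}\right)\right)B(\log B)^3+O(B(\log B)^2\log\log B),$$ $$N_4(B)=2\left(\prod_p\left(1-\frac1p\right)\left(1+\frac1p\right)\right)B(\log B)^2+O(B\log B\log\log B),$$ $$N_5(B)=N_6(B)=\frac{7}{24}\left(\prod_p\left(1-\frac1p\right)^2\left(1+\frac2p\right)\right)B(\log B)^3+O(B(\log B)^2\log\log B).$$ Here all products run over all primes $p$.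
   Context: Let $S\subset\mathbb{P}^4_{\mathbb{Q}}$ be the quartic del Pezzo surface $x_0^2+x_0x_3+x_2x_4=x_1x_3-x_2^2=0$, and let $\mathcal S\subset\mathbb P^4_{\mathbb Z}$ be defined by the same equations. Its singularities are $Q_1=(0:1:0:0:0)$ and $Q_2=(0:0:0:0:1)$, and its lines are $L_1=\{x_0=x_2=x_3=0\}$, $L_2=\{x_0=x_1=x_2=0\}$, $L_3=\{x_0+x_3=x_1=x_2=0\}$. Let $Z_1=Q_1$, $Z_2=Q_2$, $Z_3=Q_1\cup Q_2$, $Z_4=L_1$, $Z_5=L_2$, $Z_6=L_3$, and $\mathcal U_i=\mathcal S\setminus\overline{Z_i}$ (closure in $\mathcal S$). Let $V=S\setminus\{x_2=0\}$ be the complement of the lines. For a point represented by coprime integers $(x_0,\dots,x_4)$, define $H_1=\max\{|x_0|,|x_2|,|x_3|,|x_4|\}$, $H_2=\max\{|x_0|,|x_1|,|x_2|,|x_3|\}$, $H_3=\max\{|x_0|,|x_2|,|x_3|,\min\{|x_1|,|x_4|\}\}$, $H_4=\max\{|x_0|,|x_2|,|x_3|\}$, $H_5=\max\{|x_0|,|x_1|,|x_2|\}$, $H_6=\max\{|x_0+x_3|,|x_1|,|x_2|\}$. Let $N_i(B)=\#\{P\in\mathcal U_i(\mathbb Z)\cap V(\mathbb Q): H_i(P)\le B\}$. Explicitly, $N_i(B)$ is the number of $(x_0,\dots,x_4)\in\mathbb Z^5\setminus\{0\}$ satisfying the two defining equations, $x_2>0$, $H_i(x_0,\dots,x_4)\le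 B$, and the integrality condition - $i=1$: $\gcd(x_0,x_2,x_3,x_4)=1$; - $i=2$: $\gcd(x_0,x_1,x_2,x_3)=1$; - $i=3$: $\gcd(x_0,x_2,x_3,x_4)=1$ and $\gcd(x_0,x_1,x_2,x_3)=1$; - $i=4$: $\gcd(x_0,x_2,x_3)=1$; - $i=5$: $\gcd(x_0,x_1,x_2)=1$; - $i=6$: $\gcd(x_0+x_3,x_1,x_2)=1$. *)

theory Defs
  imports
    "HOL-Analysis.Infinite_Products"
    "HOL-Library.Landau_Symbols"
    "HOL-Computational_Algebra.Primes"
begin

text \<open>
  A rational point of \<open>\<P>\<^sup>4\<close> is given by its coordinates as coprime integers, which are unique up to
  a common sign.
\<close>

type_synonym coords = "int \<times> int \<times> int \<times> int \<times> int"

definition dP4 :: "coords set" where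
  "dP4 = {(x0, x1, x2, x3, x4). (x0, x1, x2, x3, x4) \<noteq> (0, 0, 0, 0, 0) \<and>
            x0\<^sup>2 + x0 * x3 + x2 * x4 = 0 \<and> x1 * x3 - x2\<^sup>2 = 0}"

text \<open>
  The open subset \<open>V\<close> is given by \<open>x2 \<noteq> 0\<close>; requiring \<open>x2 > 0\<close> selects one of the two
  representatives of each point.
\<close>

definition V_reps :: "coords set" where
  "V_reps = {(x0, x1, x2, x3, x4). x2 > 0}"

text \<open>
  \<open>integral\<^sub>i\<close> expresses that the point lies in \<open>\<U>\<^sub>i(\<int>)\<close>: it does not meet the closure of \<open>Z\<^sub>i\<close> modulo
  any prime, i.e. the linear forms that define \<open>Z\<^sub>i\<close> (each of its two components for \<open>i = 3\<close>) take
  coprime values. In each case this implies that the five coordinates are coprime.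
\<close>

definition integral1 :: "coords \<Rightarrow> bool" where
  "integral1 = (\<lambda>(x0, x1, x2, x3, x4). Gcd {x0, x2, x3, x4} = 1)"

definition integral2 :: "coords \<Rightarrow> bool" where
  "integral2 = (\<lambda>(x0, x1, x2, x3, x4). Gcd {x0, x1, x2, x3} = 1)"

definition integral3 :: "coords \<Rightarrow> bool" where
  "integral3 = (\<lambda>(x0, x1, x2, x3, x4). Gcd {x0, x2, x3, x4} = 1 \<and> Gcd {x0, x1, x2, x3} = 1)"

definition integral4 :: "coords \<Rightarrow> bool" where
  "integral4 = (\<lambda>(x0, x1, x2, x3, x4). Gcd {x0, x2, x3} = 1)"

definition integral5 :: "coords \<Rightarrow> bool" where
  "integral5 = (\<lambda>(x0, x1, x2, x3, x4). Gcd {x0, x1, x2} = 1)"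

definition integral6 :: "coords \<Rightarrow> bool" where
  "integral6 = (\<lambda>(x0, x1, x2, x3, x4). Gcd {x0 + x3, x1, x2} = 1)"

definition H1 :: "coords \<Rightarrow> int" where
  "H1 = (\<lambda>(x0, x1, x2, x3, x4). Max {\<bar>x0\<bar>, \<bar>x2\<bar>, \<bar>x3\<bar>, \<bar>x4\<bar>})"

definition H2 :: "coords \<Rightarrow> int" where
  "H2 = (\<lambda>(x0, x1, x2, x3, x4). Max {\<bar>x0\<bar>, \<bar>x1\<bar>, \<bar>x2\<bar>, \<bar>x3\<bar>})"

definition H3 :: "coords \<Rightarrow> int" where
  "H3 = (\<lambda>(x0, x1, x2, x3, x4). Max {\<bar>x0\<bar>, \<bar>x2\<bar>, \<bar>x3\<bar>, min \<bar>x1\<bar> \<bar>x4\<bar>})"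

definition H4 :: "coords \<Rightarrow> int" where
  "H4 = (\<lambda>(x0, x1, x2, x3, x4). Max {\<bar>x0\<bar>, \<bar>x2\<bar>, \<bar>x3\<bar>})"

definition H5 :: "coords \<Rightarrow> int" where
  "H5 = (\<lambda>(x0, x1, x2, x3, x4). Max {\<bar>x0\<bar>, \<bar>x1\<bar>, \<bar>x2\<bar>})"

definition H6 :: "coords \<Rightarrow> int" where
  "H6 = (\<lambda>(x0, x1, x2, x3, x4). Max {\<bar>x0 + x3\<bar>, \<bar>x1\<bar>, \<bar>x2\<bar>})"

text \<open>
  The sets counted below are finite: on \<open>dP4\<close> with \<open>x2 > 0\<close>, both \<open>x1\<close> and \<open>x3\<close> are nonzero, each
  of them is determined by \<open>x2\<close> and the other, and \<open>x4\<close> is determined by \<open>x0\<close>, \<open>x2\<close>, \<open>x3\<close>.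
\<close>

definition point_count :: "(coords \<Rightarrow> bool) \<Rightarrow> (coords \<Rightarrow> int) \<Rightarrow> real \<Rightarrow> nat" where
  "point_count integ H B = card {x \<in> dP4 \<inter> V_reps. integ x \<and> real_of_int (H x) \<le> B}"

definition N1 :: "real \<Rightarrow> nat" where "N1 = point_count integral1 H1"
definition N2 :: "real \<Rightarrow> nat" where "N2 = point_count integral2 H2"
definition N3 :: "real \<Rightarrow> nat" where "N3 = point_count integral3 H3"
definition N4 :: "real \<Rightarrow> nat" where "N4 = point_count integral4 H4"
definition N5 :: "real \<Rightarrow> nat" where "N5 = point_count integral5 H5"
definition N6 :: "real \<Rightarrow> nat" where "N6 = point_count integral6 H6"

definition prime_prod :: "(real \<Rightarrow> real) \<Rightarrow> real" where
  "prime_prod f = (\<Prod>p. if prime (p :: nat) then f (real p) else 1)"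

end

theory Submission
  imports Defs "HOL-Analysis.Analysis" "HOL-Computational_Algebra.Squarefree" "HOL-Computational_Algebra.Nth_Powers" "HOL-Real_Asymp.Real_Asymp"
begin

text \<open>
  Splitting off \<open>x\<^sub>1 x\<^sub>3 = x\<^sub>2\<^sup>2\<close> and \<open>x\<^sub>0 (x\<^sub>0 + x\<^sub>3) = - x\<^sub>2 x\<^sub>4\<close> into coprime factors turns each counting problem
  into a sum over lists of positive integers, subject to local coprimality and squarefreeness conditions, of the
  number of integers in a residue class and an interval. The local conditions are written as a product over
  primes of weights, that is, as a convolution with an absolutely summable function, which leaves the same sum
  over all lists. Its terms are a monotone function of the logarithms of the entries, divided by their product
  (after summing out two of the six variables in the case of \<open>N1\<close>), so the sum is close to an integral. The integral
  gives the rational constant, and the densities of the local weights give the Euler product.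
\<close>

subsection \<open>Logarithmic sums over boxes\<close>

text \<open>The convolution is opened one prime at a time: divisibility by a list \<open>q\<close>
  replaces \<open>m\<close> by \<open>lmul q m\<close>. Hence every estimate is proved for sums
  shifted by an arbitrary list \<open>s\<close>, with error
  \<open>K0 + K1 * ln (prod_list s)\<close>. This logarithm is harmless because the sum of ln p /
  p^2 converges and the convolution coefficients are O(1/p^2) once a single factor p has weight 1 +
  O(1/p). Shifts therefore occur already in the comparison of sums with integrals. In all cases but
  \<open>N1\<close>, an admissible list leaves about 2 B / (product of its entries) choices, up to a
  density; so the constant is 4 times a volume, 2 from the window [-B, B] and 2 from the symmetry
  that changes the sign of \<open>x3\<close>. For \<open>N1\<close> the remaining pair lies on a
  line and satisfies |\<beta> \<delta>| <= B, which leaves about 2 sqrt(B / (a c)) choices, where a,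
  c are the first two entries; this is not of that shape. Summing over a c <= B / d^2 gives 4 (B /
  d) log(B / d^2) with d the product of the other four entries: the shape is restored, but the
  integrand is no longer an indicator function, and the constant is 8 times an integral.\<close>

lemma integrable_antitone:
  fixes g :: "real \<Rightarrow> real"
  assumes "\<And>t u. a \<le> t \<Longrightarrow> t \<le> u \<Longrightarrow> g u \<le> g t"
  shows "g integrable_on {a..b}"
proof -
  have "mono_on {a..b} (\<lambda>t. - g t)"
    using assms by (auto simp: mono_on_def)
  then have "(\<lambda>t. - g t) integrable_on {a..b}"
    by (rule integrable_on_mono_on)
  then show ?thesis
    using integrable_neg by fastforce
qed

lemma ln_Suc_diff_bounds:
  assumes "n \<ge> 1"
  shows "1 / real (Suc n) \<le> ln (real (Suc n)) - ln (real n)"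
    and "ln (real (Suc n)) - ln (real n) \<le> 1 / real n"
proof -
  have p: "real n > 0" using assms by simp
  have "ln (real (Suc n) / real n) \<le> real (Suc n) / real n - 1"
    using p by (intro ln_le_minus_one) auto
  then show "ln (real (Suc n)) - ln (real n) \<le> 1 / real n"
    using p by (simp add: ln_div field_simps)
  have "ln (real n / real (Suc n)) \<le> real n / real (Suc n) - 1"
    using p by (intro ln_le_minus_one) auto
  then show "1 / real (Suc n) \<le> ln (real (Suc n)) - ln (real n)"
    using p by (simp add: ln_div field_simps)
qed

text \<open>The steps from ln n to ln (n + 1) have lengths between 1/(n + 1) and 1/n, so the sum is
  squeezed between integrals of g. The shift \<open>\<sigma>\<close> makes the sum miss the integral
  over [0, \<sigma>], at most \<open>\<sigma> * g 0\<close>; the term n = 1 accounts for the other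
  \<open>g 0\<close>.\<close>

lemma sum_antitone_log:
  fixes g :: "real \<Rightarrow> real"
  assumes anti: "\<And>t u. 0 \<le> t \<Longrightarrow> t \<le> u \<Longrightarrow> g u \<le> g t"
    and nonneg: "\<And>t. 0 \<le> t \<Longrightarrow> 0 \<le> g t"
    and zero: "\<And>t. T < t \<Longrightarrow> g t = 0"
    and T: "0 \<le> T" and s: "0 \<le> \<sigma>"
  shows "\<bar>(\<Sum>n=1..nat \<lfloor>exp T\<rfloor>. g (ln (real n) + \<sigma>) / real n) - integral {0..T} g\<bar> \<le> (1 + \<sigma>) * g 0"
proof -
  define A where "A y = integral {0..y} g" for y
  define N where "N = nat \<lfloor>exp T\<rfloor>"
  have int: "g integrable_on {a..b}" if "0 \<le> a" for a b
    using that by (intro integrable_antitone) (auto intro: anti)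
  have step: "A v - A u \<le> g u * (v - u) \<and> g v * (v - u) \<le> A v - A u" if "0 \<le> u" "u \<le> v" for u v
  proof -
    have "A v = A u + integral {u..v} g"
      unfolding A_def using that int by (simp add: Henstock_Kurzweil_Integration.integral_combine)
    moreover have "integral {u..v} g \<le> integral {u..v} (\<lambda>_. g u)"
      using that by (intro integral_le int) (auto intro: anti)
    moreover have "integral {u..v} (\<lambda>_. g v) \<le> integral {u..v} g"
      using that by (intro integral_le int) (auto intro: anti)
    ultimately show ?thesis using that by (simp add: algebra_simps)
  qed
  have step': "A v - A u \<le> g u * c" if "0 \<le> u" "u \<le> v" "v - u \<le> c" for u v c
    using step[of u v] mult_left_mono[of "v - u" c "g u"] that nonneg[of u] by linarith
  have step'': "g v * c \<le> A v - A u" if "0 \<le> u" "u \<le> v" "c \<le> v - u" for u v c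
    using step[of u v] mult_left_mono[of c "v - u" "g v"] that nonneg[of v] by linarith
  \<comment> \<open>The lower bound takes g at the left end of [ln n, ln (n + 1)], the upper bound
    takes it at the right end of [ln (n - 1), ln n]; the term n = 1 has no interval of the second
    kind and enters as \<open>g \<sigma>\<close>.\<close>
  have main: "A (ln (real (Suc m)) + \<sigma>) - A \<sigma> \<le> (\<Sum>n=1..m. g (ln (real n) + \<sigma>) / real n) \<and>
     (\<Sum>n=1..m. g (ln (real n) + \<sigma>) / real n) \<le> g \<sigma> + A (ln (real m) + \<sigma>) - A \<sigma>" if "m \<ge> 1" for m
    using that
  proof (induction m rule: dec_induct)
    case base
    show ?case using step'[of \<sigma> "ln 2 + \<sigma>" 1] s ln_le_minus_one[of "2::real"] by simp
  next
    case (step m)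
    have 1: "A (ln (real (Suc (Suc m))) + \<sigma>) - A (ln (real (Suc m)) + \<sigma>) \<le> g (ln (real (Suc m)) + \<sigma>) * (1 / real (Suc m))"
      using ln_Suc_diff_bounds[of "Suc m"] s by (intro step') auto
    have 2: "g (ln (real (Suc m)) + \<sigma>) * (1 / real (Suc m)) \<le> A (ln (real (Suc m)) + \<sigma>) - A (ln (real m) + \<sigma>)"
      using ln_Suc_diff_bounds[of "m"] s step.hyps by (intro step'') auto
    show ?case using 1 2 step.IH by simp
  qed
  have AI: "A y = A T" if "T \<le> y" for y
  proof -
    have "A y = A T + integral {T..y} g"
      unfolding A_def using that int T by (simp add: Henstock_Kurzweil_Integration.integral_combine)
    moreover have "integral {T..y} g = integral {T..y} (\<lambda>_. 0)"
      by (rule integral_spike[of "{T}"]) (use zero in auto)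
    ultimately show ?thesis by simp
  qed
  have Amono: "A u \<le> A v" if "0 \<le> u" "u \<le> v" for u v
    using step[OF that] nonneg[of v] that mult_nonneg_nonneg[of "g v" "v - u"] by linarith
  have AleT: "A y \<le> A T" if "0 \<le> y" for y
    using AI[of y] Amono[of y T] that by (cases "y \<le> T") auto
  have A0: "A 0 = 0" by (simp add: A_def)
  have As: "0 \<le> A \<sigma>" "A \<sigma> \<le> g 0 * \<sigma>"
    using step[of 0 \<sigma>] Amono[of 0 \<sigma>] s A0 by auto
  have N1: "N \<ge> 1" using T by (simp add: N_def le_nat_iff le_floor_iff)
  \<comment> \<open>The first argument after the range of summation exceeds T, where g vanishes, so
    the lower bound already contains the whole integral.\<close>
  have "exp T < real (Suc N)" unfolding N_def using T by linarith
  then have "T < ln (real (Suc N))"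
    by (metis exp_gt_zero ln_exp ln_less_cancel_iff of_nat_0_less_iff zero_less_Suc)
  then have "A (ln (real (Suc N)) + \<sigma>) = A T" using s by (intro AI) auto
  moreover have "A (ln (real N) + \<sigma>) \<le> A T" using s N1 by (intro AleT) auto
  moreover have "g \<sigma> \<le> g 0" using s by (intro anti) auto
  moreover have "0 \<le> g 0" by (intro nonneg) auto
  ultimately show ?thesis using main[OF N1] As s unfolding N_def[symmetric] A_def[of T, symmetric]
    by (simp add: algebra_simps abs_le_iff)
qed

definition Box :: "nat \<Rightarrow> nat \<Rightarrow> nat list set" where
  "Box k N = {n. length n = k \<and> set n \<subseteq> {1..N}}"

lemma finite_Box [simp]: "finite (Box k N)"
  using finite_lists_length_eq[of "{1..N}" k] by (simp add: Box_def conj_commute)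

lemma Box_0 [simp]: "Box 0 N = {[]}"
  by (auto simp: Box_def)

lemma Box_Suc: "Box (Suc k) N = (\<lambda>(x, xs). x # xs) ` ({1..N} \<times> Box k N)"
proof (intro set_eqI iffI)
  fix n assume "n \<in> Box (Suc k) N"
  then show "n \<in> (\<lambda>(x, xs). x # xs) ` ({1..N} \<times> Box k N)"
    by (cases n) (auto simp: Box_def)
qed (auto simp: Box_def)

lemma sum_Box_Suc: "(\<Sum>n\<in>Box (Suc k) N. F n) = (\<Sum>x=1..N. \<Sum>xs\<in>Box k N. F (x # xs))"
proof -
  have "inj_on (\<lambda>(x::nat, xs). x # xs) A" for A by (auto simp: inj_on_def)
  then have "(\<Sum>n\<in>Box (Suc k) N. F n) = (\<Sum>(x, xs)\<in>{1..N} \<times> Box k N. F (x # xs))"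
    unfolding Box_Suc by (subst sum.reindex) (auto simp: case_prod_unfold)
  then show ?thesis by (simp add: sum.cartesian_product)
qed

text \<open>Monotonicity replaces continuity: it makes all inner integrals integrable and admits
  indicators of regions given by linear inequalities with nonnegative coefficients. The strict
  \<open>T < t\<close> keeps boundary points in the region.\<close>

definition antitone_cutoff :: "nat \<Rightarrow> real \<Rightarrow> real \<Rightarrow> (real list \<Rightarrow> real) \<Rightarrow> bool" where
  "antitone_cutoff k T M \<Phi> \<longleftrightarrow>
     (\<forall>ts us. length ts = k \<longrightarrow> (\<forall>t\<in>set ts. 0 \<le> t) \<longrightarrow> list_all2 (\<le>) ts us \<longrightarrow>
        0 \<le> \<Phi> us \<and> \<Phi> us \<le> \<Phi> ts \<and> \<Phi> ts \<le> M) \<and>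
     (\<forall>ts. length ts = k \<longrightarrow> (\<forall>t\<in>set ts. 0 \<le> t) \<longrightarrow> (\<exists>t\<in>set ts. T < t) \<longrightarrow> \<Phi> ts = 0)"

primrec iterated_integral :: "nat \<Rightarrow> real \<Rightarrow> (real list \<Rightarrow> real) \<Rightarrow> real" where
  "iterated_integral 0 T \<Phi> = \<Phi> []"
| "iterated_integral (Suc k) T \<Phi> = integral {0..T} (\<lambda>t. iterated_integral k T (\<lambda>ts. \<Phi> (t # ts)))"

lemma antitone_cutoff_Cons:
  assumes "antitone_cutoff (Suc k) T M \<Phi>" "0 \<le> t"
  shows "antitone_cutoff k T M (\<lambda>ts. \<Phi> (t # ts))"
proof -
  have *: "0 \<le> \<Phi> (t # us) \<and> \<Phi> (t # us) \<le> \<Phi> (t # ts) \<and> \<Phi> (t # ts) \<le> M"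
    if "length ts = k" "\<forall>t\<in>set ts. 0 \<le> t" "list_all2 (\<le>) ts us" for ts us
  proof -
    have "length (t # ts) = Suc k" "\<forall>t\<in>set (t # ts). 0 \<le> t" "list_all2 (\<le>) (t # ts) (t # us)"
      using that assms(2) by auto
    then show ?thesis using assms(1) unfolding antitone_cutoff_def by blast
  qed
  have **: "\<Phi> (t # ts) = 0"
    if "length ts = k" "\<forall>t\<in>set ts. 0 \<le> t" "\<exists>t\<in>set ts. T < t" for ts
  proof -
    have "length (t # ts) = Suc k" "\<forall>t\<in>set (t # ts). 0 \<le> t" "\<exists>t\<in>set (t # ts). T < t"
      using that assms(2) by auto
    then show ?thesis using assms(1) unfolding antitone_cutoff_def by blast
  qed
  show ?thesis unfolding antitone_cutoff_def using * ** by blast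
qed

lemma antitone_cutoff_Cons_mono:
  assumes "antitone_cutoff (Suc k) T M \<Phi>" "0 \<le> t" "t \<le> u" "length ts = k" "\<forall>t\<in>set ts. 0 \<le> t"
  shows "\<Phi> (u # ts) \<le> \<Phi> (t # ts)"
proof -
  have "list_all2 (\<le>) (t # ts) (u # ts)" using assms by (simp add: list_all2_same)
  then show ?thesis
    using assms unfolding antitone_cutoff_def by (auto simp del: list_all2_Cons)
qed

lemma antitone_cutoff_bounds:
  assumes "antitone_cutoff k T M \<Phi>" "length ts = k" "\<forall>t\<in>set ts. 0 \<le> t"
  shows "0 \<le> \<Phi> ts" "\<Phi> ts \<le> M"
proof -
  have "list_all2 (\<le>) ts ts" by (rule list_all2_refl) auto
  then have "0 \<le> \<Phi> ts \<and> \<Phi> ts \<le> M"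
    using assms unfolding antitone_cutoff_def by blast
  then show "0 \<le> \<Phi> ts" "\<Phi> ts \<le> M" by auto
qed

lemma list_all2_nonneg:
  "list_all2 (\<le>) ts us \<Longrightarrow> \<forall>t\<in>set ts. 0 \<le> (t::real) \<Longrightarrow> \<forall>t\<in>set us. 0 \<le> t"
  by (induction rule: list_all2_induct) auto

lemma antitone_cutoff_zero:
  assumes "\<And>ts. length ts = k \<Longrightarrow> \<forall>t\<in>set ts. 0 \<le> t \<Longrightarrow> \<Phi> ts = 0"
  shows "antitone_cutoff k T 0 \<Phi>"
  unfolding antitone_cutoff_def
proof (intro conjI allI impI)
  fix ts us :: "real list"
  assume a: "length ts = k" "\<forall>t\<in>set ts. 0 \<le> t" "list_all2 (\<le>) ts us"
  have "\<Phi> us = 0" using a list_all2_nonneg[OF a(3,2)] by (intro assms) (auto dest: list_all2_lengthD)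
  moreover have "\<Phi> ts = 0" using a by (intro assms)
  ultimately show "0 \<le> \<Phi> us" "\<Phi> us \<le> \<Phi> ts" "\<Phi> ts \<le> 0" by simp_all
qed (use assms in auto)

text \<open>Positivity, comparison and upper bound share one induction, because the comparison of
  slices is what makes the outer integrand antitone and hence integrable.\<close>

lemma iterated_integral_mono_bound:
  assumes "0 \<le> T"
  shows "\<lbrakk>antitone_cutoff k T M \<Phi>; antitone_cutoff k T M \<Psi>;
      \<And>ts. length ts = k \<Longrightarrow> \<forall>t\<in>set ts. 0 \<le> t \<Longrightarrow> \<Phi> ts \<le> \<Psi> ts\<rbrakk> \<Longrightarrow>
    0 \<le> iterated_integral k T \<Phi> \<and> iterated_integral k T \<Phi> \<le> iterated_integral k T \<Psi> \<and>
    iterated_integral k T \<Psi> \<le> M * T ^ k"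
proof (induction k arbitrary: \<Phi> \<Psi>)
  case 0
  then show ?case unfolding antitone_cutoff_def by simp
next
  case (Suc k)
  let ?I = "\<lambda>\<Phi> t. iterated_integral k T (\<lambda>ts. \<Phi> (t # ts))"
  have int: "?I \<Phi> integrable_on {0..T}" if "antitone_cutoff (Suc k) T M \<Phi>" for \<Phi>
  proof (rule integrable_antitone)
    fix t u :: real assume "0 \<le> t" "t \<le> u"
    then show "?I \<Phi> u \<le> ?I \<Phi> t"
      using Suc.IH[of "\<lambda>ts. \<Phi> (u # ts)" "\<lambda>ts. \<Phi> (t # ts)"] antitone_cutoff_Cons[OF that]
        antitone_cutoff_Cons_mono[OF that] by auto
  qed
  have ih: "0 \<le> ?I \<Phi> t \<and> ?I \<Phi> t \<le> ?I \<Psi> t \<and> ?I \<Psi> t \<le> M * T ^ k" if "0 \<le> t" for t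
    using Suc.prems that by (intro Suc.IH antitone_cutoff_Cons) auto
  have "integral {0..T} (?I \<Psi>) \<le> integral {0..T} (\<lambda>_. M * T ^ k)"
    using ih by (intro integral_le int Suc.prems) auto
  moreover have "integral {0..T} (?I \<Phi>) \<le> integral {0..T} (?I \<Psi>)"
    using ih by (intro integral_le int Suc.prems) auto
  moreover have "0 \<le> integral {0..T} (?I \<Phi>)"
    using ih by (intro integral_nonneg int Suc.prems) auto
  ultimately show ?case using assms by (simp add: algebra_simps)
qed

lemma sum_inverse_le:
  assumes "1 \<le> x"
  shows "(\<Sum>n=1..nat \<lfloor>x\<rfloor>. 1 / real n) \<le> 1 + ln x"
proof -
  have x: "0 < x" "0 \<le> ln x" using assms by auto
  have "\<bar>(\<Sum>n=1..nat \<lfloor>exp (ln x)\<rfloor>. (if ln (real n) + 0 \<le> ln x then 1 else 0) / real n) -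
      integral {0..ln x} (\<lambda>t. if t \<le> ln x then 1 else (0::real))\<bar> \<le> (1 + 0) * (if 0 \<le> ln x then 1 else 0)"
    using x by (intro sum_antitone_log) auto
  moreover have "(\<Sum>n=1..nat \<lfloor>x\<rfloor>. (if ln (real n) \<le> ln x then 1 else 0) / real n) = (\<Sum>n=1..nat \<lfloor>x\<rfloor>. 1 / real n)"
  proof (intro sum.cong refl)
    fix n assume "n \<in> {1..nat \<lfloor>x\<rfloor>}"
    then have "0 < real n" "real n \<le> x" using assms by (auto, linarith)
    then show "(if ln (real n) \<le> ln x then 1 else 0) / real n = 1 / real n" by simp
  qed
  moreover have "integral {0..ln x} (\<lambda>t. if t \<le> ln x then 1 else (0::real)) = integral {0..ln x} (\<lambda>t. 1)"
    by (intro integral_cong) auto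
  ultimately show ?thesis using x by (simp add: abs_le_iff)
qed

text \<open>One variable is split off: the inner sum becomes the inner integral at the cost of a
  harmonic sum, at most \<open>T + 1\<close>, and the outer sum is compared in one dimension. The
  error is linear in the total shift; when the shifts are logarithms of the entries of a list, this
  is the logarithm of its product, the form that the sieve consumes.\<close>

lemma sum_Box_log:
  assumes T: "0 \<le> T"
  shows "\<lbrakk>antitone_cutoff k T M \<Phi>; length \<sigma> = k; \<forall>s\<in>set \<sigma>. 0 \<le> s\<rbrakk> \<Longrightarrow>
    \<bar>(\<Sum>n\<in>Box k (nat \<lfloor>exp T\<rfloor>). \<Phi> (map2 (\<lambda>x s. ln (real x) + s) n \<sigma>) / real (prod_list n)) - iterated_integral k T \<Phi>\<bar>
      \<le> (real k + sum_list \<sigma>) * (T + 1) ^ (k - 1) * M"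
proof (induction k arbitrary: \<Phi> \<sigma>)
  case 0
  then show ?case by simp
next
  case (Suc k)
  define N where "N = nat \<lfloor>exp T\<rfloor>"
  note ac = Suc.prems(1)
  obtain s \<tau> where \<sigma>: "\<sigma> = s # \<tau>" "length \<tau> = k" "0 \<le> s" "\<forall>s\<in>set \<tau>. 0 \<le> s"
    using Suc.prems(2,3) by (cases \<sigma>) auto
  let ?I = "\<lambda>t. iterated_integral k T (\<lambda>ts. \<Phi> (t # ts))"
  let ?S = "\<lambda>t. \<Sum>n\<in>Box k N. \<Phi> (t # map2 (\<lambda>x s. ln (real x) + s) n \<tau>) / real (prod_list n)"
  let ?E = "(real k + sum_list \<tau>) * (T + 1) ^ (k - 1) * M"
  have M: "0 \<le> M"
    using antitone_cutoff_bounds[OF ac, of "replicate (Suc k) 0"] by simp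
  have E: "0 \<le> ?E" using \<sigma> M T by (intro mult_nonneg_nonneg add_nonneg_nonneg sum_list_nonneg) auto
  have nn: "\<forall>t\<in>set (map2 (\<lambda>x s. ln (real x) + s) n \<tau>). 0 \<le> t" if "n \<in> Box k N" for n
  proof
    fix t assume "t \<in> set (map2 (\<lambda>x s. ln (real x) + s) n \<tau>)"
    then obtain x s' where t: "t = ln (real x) + s'" "x \<in> set n" "s' \<in> set \<tau>"
      by (auto dest: set_zip_leftD set_zip_rightD)
    then have "1 \<le> x" "0 \<le> s'" using that \<sigma>(4) by (auto simp: Box_def)
    then show "0 \<le> t" using t(1) by simp
  qed
  \<comment> \<open>A shifted argument \<open>ln x + s\<close> may exceed T; there the slice
    vanishes together with its integral, so the bound is 0.\<close>
  have Sbd: "\<bar>?S t - ?I t\<bar> \<le> (if t \<le> T then ?E else 0)" if "0 \<le> t" for t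
  proof (cases "t \<le> T")
    case True
    then show ?thesis using Suc.IH[OF antitone_cutoff_Cons[OF ac that] \<sigma>(2,4)] by (simp add: N_def)
  next
    case False
    have z: "\<Phi> (t # ts) = 0" if "length ts = k" "\<forall>t\<in>set ts. 0 \<le> t" for ts
      using ac False \<open>0 \<le> t\<close> that unfolding antitone_cutoff_def by auto
    have "?S t = 0" using z nn \<sigma>(2) by (intro sum.neutral) (auto simp: Box_def)
    moreover have "?I t = 0"
    proof -
      have c: "antitone_cutoff k T 0 (\<lambda>ts. \<Phi> (t # ts))"
        using z by (intro antitone_cutoff_zero)
      show ?thesis using iterated_integral_mono_bound[OF T c c] by simp
    qed
    ultimately show ?thesis using False by simp
  qed
  have zI: "?I t = 0" if "t > T" for t
  proof -
    have "0 \<le> t" using that T by simp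
    have z: "\<Phi> (t # ts) = 0" if "length ts = k" "\<forall>t\<in>set ts. 0 \<le> t" for ts
      using ac \<open>t > T\<close> \<open>0 \<le> t\<close> that unfolding antitone_cutoff_def by auto
    have c: "antitone_cutoff k T 0 (\<lambda>ts. \<Phi> (t # ts))"
      using z by (intro antitone_cutoff_zero)
    show ?thesis using iterated_integral_mono_bound[OF T c c] by simp
  qed
  have Ibd: "0 \<le> ?I t \<and> ?I t \<le> M * T ^ k" if "0 \<le> t" for t
    using iterated_integral_mono_bound[OF T antitone_cutoff_Cons[OF ac that] antitone_cutoff_Cons[OF ac that]] by auto
  have one: "\<bar>(\<Sum>n=1..nat \<lfloor>exp T\<rfloor>. ?I (ln (real n) + s) / real n) - integral {0..T} ?I\<bar> \<le> (1 + s) * ?I 0"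
  proof (rule sum_antitone_log)
    fix t u :: real assume tu: "0 \<le> t" "t \<le> u"
    then show "?I u \<le> ?I t"
      using iterated_integral_mono_bound[OF T antitone_cutoff_Cons[OF ac, of u] antitone_cutoff_Cons[OF ac, of t]]
        antitone_cutoff_Cons_mono[OF ac tu] by auto
  qed (use Ibd zI T \<sigma> in auto)
  have "(\<Sum>n\<in>Box (Suc k) N. \<Phi> (map2 (\<lambda>x s. ln (real x) + s) n \<sigma>) / real (prod_list n))
      = (\<Sum>x=1..N. ?S (ln (real x) + s) / real x)"
    unfolding sum_Box_Suc by (simp add: \<sigma> sum_divide_distrib mult.commute)
  moreover have "\<bar>(\<Sum>x=1..N. ?S (ln (real x) + s) / real x) - (\<Sum>x=1..N. ?I (ln (real x) + s) / real x)\<bar>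
     \<le> (\<Sum>x=1..N. ?E * (1 / real x))"
    unfolding sum_subtractf[symmetric]
  proof (intro order_trans[OF sum_abs] sum_mono)
    fix x assume x: "x \<in> {1..N}"
    then have "0 \<le> ln (real x) + s" using \<sigma> by auto
    from Sbd[OF this] E have "\<bar>?S (ln (real x) + s) - ?I (ln (real x) + s)\<bar> \<le> ?E" by (auto split: if_splits)
    then have "\<bar>?S (ln (real x) + s) - ?I (ln (real x) + s)\<bar> / real x \<le> ?E / real x"
      by (rule divide_right_mono) simp
    then show "\<bar>?S (ln (real x) + s) / real x - ?I (ln (real x) + s) / real x\<bar> \<le> ?E * (1 / real x)"
      by (simp add: diff_divide_distrib[symmetric])
  qed
  moreover have "(\<Sum>x=1..N. ?E * (1 / real x)) \<le> ?E * (T + 1)"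
    unfolding sum_distrib_left[symmetric] N_def using sum_inverse_le[of "exp T"] T E
    by (intro mult_left_mono) auto
  \<comment> \<open>For k = 0 the exponent \<open>k - 1\<close> is truncated to 0, but then
    \<open>?E\<close> is 0 because there are no shifts.\<close>
  moreover have "?E * (T + 1) \<le> (real k + sum_list \<tau>) * (T + 1) ^ k * M"
  proof (cases k)
    case 0
    then show ?thesis using \<sigma>(2) by simp
  qed (simp add: mult_ac)
  moreover have "(1 + s) * ?I 0 \<le> (1 + s) * (M * (T + 1) ^ k)"
  proof -
    have "M * T ^ k \<le> M * (T + 1) ^ k" using T M by (intro mult_left_mono power_mono) auto
    then have "?I 0 \<le> M * (T + 1) ^ k" using Ibd[of 0] by linarith
    then show ?thesis using \<sigma> by (intro mult_left_mono) auto
  qed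
  ultimately show ?case using one unfolding N_def[symmetric] by (simp add: \<sigma> algebra_simps abs_le_iff)
qed

subsection \<open>A sieve for weights given by local conditions\<close>

definition lmul :: "nat list \<Rightarrow> nat list \<Rightarrow> nat list" where
  "lmul a b = map2 (*) a b"

lemma lmul_simps [simp]:
  "lmul [] b = []" "lmul a [] = []" "lmul (x # a) (y # b) = x * y # lmul a b"
  "length (lmul a b) = min (length a) (length b)"
  by (auto simp: lmul_def)

abbreviation ldvd :: "nat list \<Rightarrow> nat list \<Rightarrow> bool" where
  "ldvd \<equiv> list_all2 (dvd)"

lemma lmul_assoc: "lmul (lmul a b) c = lmul a (lmul b c)"
proof (induction a arbitrary: b c)
  case (Cons x a)
  then show ?case by (cases b; cases c) auto
qed simp

lemma prod_list_lmul: "length a = length b \<Longrightarrow> prod_list (lmul a b) = prod_list a * prod_list b"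
  by (induction rule: list_induct2) auto

lemma lmul_pos: "0 \<notin> set a \<Longrightarrow> 0 \<notin> set b \<Longrightarrow> 0 \<notin> set (lmul a b)"
proof (induction a arbitrary: b)
  case (Cons x a)
  then show ?case by (cases b) auto
qed simp

lemma Box_pos: "n \<in> Box k N \<Longrightarrow> 0 \<notin> set n \<and> length n = k"
  by (auto simp: Box_def)

lemma lmul_mem_Box_imp:
  "length s = k \<Longrightarrow> length m = k \<Longrightarrow> 0 \<notin> set s \<Longrightarrow> 0 \<notin> set m \<Longrightarrow> lmul s m \<in> Box k N \<Longrightarrow> m \<in> Box k N"
proof (induction s arbitrary: k m)
  case (Cons x s)
  obtain y t where m: "m = y # t" using Cons.prems(1,2) by (cases m) auto
  have x: "0 < x" using Cons.prems(3) by simp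
  have "y \<le> x * y" using x by simp
  then have "x * y \<le> N \<Longrightarrow> y \<le> N" by (rule le_trans)
  then show ?case using Cons.IH[of "length s" t] Cons.prems unfolding m by (auto simp: Box_def)
qed (auto simp: Box_def)

lemma ldvd_lmul_cancel:
  "length q = length m \<Longrightarrow> 0 \<notin> set q \<Longrightarrow> map2 (\<lambda>a b. b div a) q (lmul q m) = m \<and> ldvd q (lmul q m)"
  by (induction rule: list_induct2) auto

lemma lmul_div_cancel:
  "length q = length n \<Longrightarrow> ldvd q n \<Longrightarrow> lmul q (map2 (\<lambda>a b. b div a) q n) = n"
  by (induction rule: list_induct2) auto

lemma ldiv_pos:
  "length q = length n \<Longrightarrow> ldvd q n \<Longrightarrow> 0 \<notin> set n \<Longrightarrow> 0 \<notin> set (map2 (\<lambda>a b. b div a) q n)"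
  by (induction rule: list_induct2) (auto elim!: dvdE)

text \<open>With this support a sum over the box is a sum over all lists of positive integers, so
  passing to multiples does not disturb the range.\<close>

definition supported :: "nat \<Rightarrow> nat \<Rightarrow> (nat list \<Rightarrow> real) \<Rightarrow> bool" where
  "supported k N \<Phi> \<longleftrightarrow> (\<forall>n. length n = k \<longrightarrow> (0 \<notin> set n) \<longrightarrow> n \<notin> Box k N \<longrightarrow> \<Phi> n = 0)"

lemma supported_lmul:
  assumes "supported k N \<Phi>" "length s = k" "0 \<notin> set s"
  shows "supported k N (\<lambda>m. \<Phi> (lmul s m))"
  unfolding supported_def
proof (intro allI impI)
  fix n assume n: "length n = k" "0 \<notin> set n" "n \<notin> Box k N"
  then have "lmul s n \<notin> Box k N" using lmul_mem_Box_imp[of s k n N] assms by auto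
  moreover have "0 \<notin> set (lmul s n)" using lmul_pos assms n by blast
  ultimately show "\<Phi> (lmul s n) = 0" using assms n unfolding supported_def by simp
qed

lemma sum_Box_ldvd:
  assumes "supported k N \<Phi>" "length q = k" "0 \<notin> set q"
  shows "(\<Sum>n\<in>Box k N. if ldvd q n then F n * \<Phi> n else 0) = (\<Sum>m\<in>Box k N. F (lmul q m) * \<Phi> (lmul q m))"
proof -
  have "(\<Sum>n\<in>Box k N. if ldvd q n then F n * \<Phi> n else 0) = (\<Sum>n\<in>{n\<in>Box k N. ldvd q n}. F n * \<Phi> n)"
    by (simp add: sum.inter_filter)
  also have "\<dots> = (\<Sum>m\<in>{m\<in>Box k N. lmul q m \<in> Box k N}. F (lmul q m) * \<Phi> (lmul q m))"
  proof (rule sum.reindex_bij_witness[where i = "lmul q" and j = "map2 (\<lambda>a b. b div a) q"])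
    fix n assume n: "n \<in> {n \<in> Box k N. ldvd q n}"
    then have l: "length q = length n" "ldvd q n" "0 \<notin> set n" using assms Box_pos by auto
    show e: "lmul q (map2 (\<lambda>a b. b div a) q n) = n" using l by (intro lmul_div_cancel)
    show "map2 (\<lambda>a b. b div a) q n \<in> {m \<in> Box k N. lmul q m \<in> Box k N}"
      using n e assms l ldiv_pos[OF l] lmul_mem_Box_imp[of q k "map2 (\<lambda>a b. b div a) q n" N] by simp
    show "F (lmul q (map2 (\<lambda>a b. b div a) q n)) * \<Phi> (lmul q (map2 (\<lambda>a b. b div a) q n)) = F n * \<Phi> n"
      using e by simp
  next
    fix m assume "m \<in> {m \<in> Box k N. lmul q m \<in> Box k N}"
    then show "map2 (\<lambda>a b. b div a) q (lmul q m) = m" "lmul q m \<in> {n \<in> Box k N. ldvd q n}"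
      using assms ldvd_lmul_cancel[of q m] Box_pos[of m] by auto
  qed
  also have "\<dots> = (\<Sum>m\<in>Box k N. F (lmul q m) * \<Phi> (lmul q m))"
  proof (intro sum.mono_neutral_left)
    have "\<Phi> (lmul q m) = 0" if "m \<in> Box k N" "lmul q m \<notin> Box k N" for m
      using that assms lmul_pos[of q m] Box_pos[OF that(1)] unfolding supported_def by simp
    then show "\<forall>i\<in>Box k N - {m \<in> Box k N. lmul q m \<in> Box k N}. F (lmul q i) * \<Phi> (lmul q i) = 0" by auto
  qed auto
  finally show ?thesis .
qed

lemma ldvd_prime_powers_lmul:
  assumes "prime p" "prime q" "p \<noteq> q"
  shows "length m = length e \<Longrightarrow> ldvd (map ((^) p) d) (lmul (map ((^) q) e) m) \<longleftrightarrow> ldvd (map ((^) p) d) m"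
proof (induction d arbitrary: e m)
  case Nil
  then show ?case by (cases m; cases e) auto
next
  case (Cons a d)
  have "coprime (p ^ a) (q ^ b)" for b using assms by (simp add: primes_coprime)
  then have "p ^ a dvd q ^ b * y \<longleftrightarrow> p ^ a dvd y" for b y by (simp add: coprime_dvd_mult_right_iff)
  then show ?case using Cons by (cases m; cases e) auto
qed

lemma prod_list_map_power: "prod_list (map ((^) p) e) = (p::nat) ^ sum_list e"
  by (induction e) (auto simp: power_add)

text \<open>Induction over the primes with the shift s left free. Expanding the factor at p produces
  sums over multiples of lists of p-powers, to which the induction hypothesis applies with a larger
  shift. The error is multiplied by \<open>h p\<close>, and the logarithm of the additional p-power
  contributes \<open>l p\<close>.\<close>

lemma sieve_finite:
  fixes w :: "nat \<Rightarrow> nat list \<Rightarrow> real" and \<Phi> :: "nat list \<Rightarrow> real"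
  assumes Es: "finite Es" "\<And>e. e \<in> Es \<Longrightarrow> length e = k"
    and w: "\<And>p n. prime p \<Longrightarrow> n \<in> Box k N \<Longrightarrow> w p n = (\<Sum>e\<in>Es. if ldvd (map ((^) p) e) n then g p e else 0)"
    and h1: "\<And>p. prime p \<Longrightarrow> 1 \<le> h p"
    and h: "\<And>p. prime p \<Longrightarrow> (\<Sum>e\<in>Es. \<bar>g p e\<bar> / real p ^ sum_list e) \<le> h p"
    and l: "\<And>p. prime p \<Longrightarrow> (\<Sum>e\<in>Es. \<bar>g p e\<bar> * (real (sum_list e) * ln (real p)) / real p ^ sum_list e) \<le> l p"
    and base: "\<And>s. length s = k \<Longrightarrow> 0 \<notin> set s \<Longrightarrow>
        \<bar>real (prod_list s) * (\<Sum>m\<in>Box k N. \<Phi> (lmul s m)) - M\<bar> \<le> K0 + K1 * ln (real (prod_list s))"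
    and K: "0 \<le> K0" "0 \<le> K1"
    and supp: "supported k N \<Phi>"
  shows "\<lbrakk>finite P; \<forall>p\<in>P. prime p; length s = k; 0 \<notin> set s\<rbrakk> \<Longrightarrow>
    \<bar>real (prod_list s) * (\<Sum>m\<in>Box k N. (\<Prod>p\<in>P. w p m) * \<Phi> (lmul s m)) - (\<Prod>p\<in>P. \<Sum>e\<in>Es. g p e / real p ^ sum_list e) * M\<bar>
      \<le> (\<Prod>p\<in>P. h p) * (K0 + K1 * ln (real (prod_list s)) + K1 * (\<Sum>p\<in>P. l p))"
proof (induction P arbitrary: s rule: finite_induct)
  case empty
  then show ?case using base by simp
next
  case (insert p P)
  have p: "prime p" and P: "\<forall>q\<in>P. prime q" using insert.prems by auto
  have p1: "1 < p" "0 < ln (real p)" using prime_gt_1_nat[OF p] by auto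
  define W where "W m = (\<Prod>p\<in>P. \<Sum>e\<in>Es. if ldvd (map ((^) p) e) m then g p e else 0)" for m
  have WP: "(\<Prod>p\<in>P. w p m) = W m" if "m \<in> Box k N" for m
    unfolding W_def using that w P by (intro prod.cong) auto
  define R where "R = (\<Prod>p\<in>P. \<Sum>e\<in>Es. g p e / real p ^ sum_list e)"
  define H where "H = (\<Prod>p\<in>P. h p)"
  define L where "L = (\<Sum>p\<in>P. l p)"
  define D where "D s = real (prod_list s) * (\<Sum>m\<in>Box k N. W m * \<Phi> (lmul s m))" for s
  have hnn: "0 \<le> h r" if "prime r" for r
    using h1[OF that] by linarith
  have H0: "0 \<le> H"
    unfolding H_def by (rule prod_nonneg) (use P hnn in blast)
  have IH: "\<bar>D s - R * M\<bar> \<le> H * (K0 + K1 * ln (real (prod_list s)) + K1 * L)" if "length s = k" "0 \<notin> set s" for s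
  proof -
    have "(\<Sum>m\<in>Box k N. (\<Prod>p\<in>P. w p m) * \<Phi> (lmul s m)) = (\<Sum>m\<in>Box k N. W m * \<Phi> (lmul s m))"
      using WP by (intro sum.cong) auto
    then show ?thesis using insert.IH[OF P that] unfolding D_def R_def H_def L_def by simp
  qed
  let ?q = "\<lambda>e. map ((^) p) e"
  have q: "length (?q e) = k" "0 \<notin> set (?q e)" if "e \<in> Es" for e
    using that Es p1 by auto
  \<comment> \<open>The weights at the other primes do not see powers of p.\<close>
  have Wq: "W (lmul (?q e) m) = W m" if "e \<in> Es" "m \<in> Box k N" for e m
  proof -
    have "(\<Sum>d\<in>Es. if ldvd (map ((^) r) d) (lmul (?q e) m) then g r d else 0) = (\<Sum>d\<in>Es. if ldvd (map ((^) r) d) m then g r d else 0)"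
      if "r \<in> P" for r
    proof -
      have "ldvd (map ((^) r) d) (lmul (?q e) m) \<longleftrightarrow> ldvd (map ((^) r) d) m" for d
        using that P p insert.hyps \<open>e \<in> Es\<close> \<open>m \<in> Box k N\<close> Es
        by (intro ldvd_prime_powers_lmul) (auto simp: Box_def)
      then show ?thesis by simp
    qed
    then show ?thesis unfolding W_def by (intro prod.cong) auto
  qed
  have lm: "real (prod_list (lmul s (?q e))) = real (prod_list s) * real p ^ sum_list e" if "e \<in> Es" for e
    using q[OF that] insert.prems by (simp add: prod_list_lmul prod_list_map_power)
  have s0: "0 < prod_list s" using insert.prems(3) by (induction s) auto
  have "(\<Sum>m\<in>Box k N. (\<Prod>q\<in>insert p P. w q m) * \<Phi> (lmul s m))
     = (\<Sum>m\<in>Box k N. \<Sum>e\<in>Es. g p e * (if ldvd (?q e) m then W m * \<Phi> (lmul s m) else 0))"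
  proof (intro sum.cong refl)
    fix m assume m: "m \<in> Box k N"
    have "(\<Prod>q\<in>insert p P. w q m) = (\<Sum>e\<in>Es. if ldvd (?q e) m then g p e else 0) * W m"
      using insert.hyps WP[OF m] w[OF p m] by simp
    then show "(\<Prod>q\<in>insert p P. w q m) * \<Phi> (lmul s m) = (\<Sum>e\<in>Es. g p e * (if ldvd (?q e) m then W m * \<Phi> (lmul s m) else 0))"
      by (simp add: sum_distrib_right mult.assoc if_distrib if_distribR cong: if_cong)
  qed
  also have "\<dots> = (\<Sum>e\<in>Es. g p e * (\<Sum>m\<in>Box k N. if ldvd (?q e) m then W m * \<Phi> (lmul s m) else 0))"
    by (subst sum.swap) (simp add: sum_distrib_left)
  also have "\<dots> = (\<Sum>e\<in>Es. g p e * (\<Sum>m\<in>Box k N. W m * \<Phi> (lmul (lmul s (?q e)) m)))"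
  proof (rule sum.cong[OF refl], rule arg_cong2[where f = "(*)", OF refl])
    fix e assume e: "e \<in> Es"
    have "(\<Sum>m\<in>Box k N. if ldvd (?q e) m then W m * \<Phi> (lmul s m) else 0) = (\<Sum>m\<in>Box k N. W (lmul (?q e) m) * \<Phi> (lmul s (lmul (?q e) m)))"
      using q[OF e] insert.prems by (intro sum_Box_ldvd supported_lmul supp) auto
    also have "\<dots> = (\<Sum>m\<in>Box k N. W m * \<Phi> (lmul (lmul s (?q e)) m))"
      using Wq[OF e] by (intro sum.cong) (auto simp: lmul_assoc)
    finally show "(\<Sum>m\<in>Box k N. if ldvd (?q e) m then W m * \<Phi> (lmul s m) else 0) = (\<Sum>m\<in>Box k N. W m * \<Phi> (lmul (lmul s (?q e)) m))" .
  qed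
  finally have fin: "(\<Sum>m\<in>Box k N. (\<Prod>q\<in>insert p P. w q m) * \<Phi> (lmul s m))
      = (\<Sum>e\<in>Es. g p e * (\<Sum>m\<in>Box k N. W m * \<Phi> (lmul (lmul s (?q e)) m)))" .
  have eq: "real (prod_list s) * (\<Sum>m\<in>Box k N. (\<Prod>q\<in>insert p P. w q m) * \<Phi> (lmul s m))
      = (\<Sum>e\<in>Es. g p e / real p ^ sum_list e * D (lmul s (?q e)))"
  proof -
    have "real (prod_list s) * (g p e * x) = g p e / real p ^ sum_list e * (real (prod_list (lmul s (?q e))) * x)"
      if "e \<in> Es" for e x
      using p1 by (simp add: lm[OF that])
    then show ?thesis unfolding fin sum_distrib_left[of "real (prod_list s)"] D_def by (intro sum.cong) auto
  qed
  have "real (prod_list s) * (\<Sum>m\<in>Box k N. (\<Prod>q\<in>insert p P. w q m) * \<Phi> (lmul s m)) - (\<Prod>q\<in>insert p P. \<Sum>e\<in>Es. g q e / real q ^ sum_list e) * M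
      = (\<Sum>e\<in>Es. g p e / real p ^ sum_list e * (D (lmul s (?q e)) - R * M))"
  proof -
    have "(\<Prod>q\<in>insert p P. \<Sum>e\<in>Es. g q e / real q ^ sum_list e) = (\<Sum>e\<in>Es. g p e / real p ^ sum_list e) * R"
      using insert.hyps by (simp add: R_def)
    then show ?thesis unfolding eq
      by (simp only: right_diff_distrib sum_subtractf sum_distrib_right mult.assoc)
  qed
  also have "\<bar>\<dots>\<bar> \<le> (\<Sum>e\<in>Es. \<bar>g p e\<bar> / real p ^ sum_list e * (H * (K0 + K1 * (ln (real (prod_list s)) + real (sum_list e) * ln (real p)) + K1 * L)))"
  proof (intro order_trans[OF sum_abs] sum_mono)
    fix e assume e: "e \<in> Es"
    have "\<bar>D (lmul s (?q e)) - R * M\<bar> \<le> H * (K0 + K1 * ln (real (prod_list (lmul s (?q e)))) + K1 * L)"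
      using IH[of "lmul s (?q e)"] lmul_pos[of s "?q e"] q[OF e] insert.prems by simp
    also have "ln (real (prod_list (lmul s (?q e)))) = ln (real (prod_list s)) + real (sum_list e) * ln (real p)"
      unfolding lm[OF e] using s0 p1 by (simp add: ln_mult ln_realpow)
    finally show "\<bar>g p e / real p ^ sum_list e * (D (lmul s (?q e)) - R * M)\<bar> \<le> \<bar>g p e\<bar> / real p ^ sum_list e * (H * (K0 + K1 * (ln (real (prod_list s)) + real (sum_list e) * ln (real p)) + K1 * L))"
      by (simp add: abs_mult mult_left_mono divide_right_mono)
  qed
  also have "\<dots> = H * ((\<Sum>e\<in>Es. \<bar>g p e\<bar> / real p ^ sum_list e) * (K0 + K1 * ln (real (prod_list s)) + K1 * L)
      + K1 * (\<Sum>e\<in>Es. \<bar>g p e\<bar> * (real (sum_list e) * ln (real p)) / real p ^ sum_list e))"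
    unfolding sum_distrib_left sum_distrib_right distrib_left[of H] sum.distrib[symmetric]
    by (intro sum.cong refl) (simp add: algebra_simps add_divide_distrib)
  also have "\<dots> \<le> H * (h p * (K0 + K1 * ln (real (prod_list s)) + K1 * L) + K1 * l p)"
  proof -
    have lp: "0 \<le> l r" if "prime r" for r
    proof -
      have "0 \<le> (\<Sum>e\<in>Es. \<bar>g r e\<bar> * (real (sum_list e) * ln (real r)) / real r ^ sum_list e)"
        using prime_gt_1_nat[OF that] by (intro sum_nonneg) auto
      then show ?thesis using l[OF that] by linarith
    qed
    have "0 \<le> L" unfolding L_def using lp P by (intro sum_nonneg) auto
    moreover note H0
    moreover have "0 \<le> ln (real (prod_list s))" using s0 by simp
    ultimately show ?thesis using h[OF p] l[OF p] K
      by (intro mult_left_mono add_mono mult_right_mono) auto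
  qed
  \<comment> \<open>Since \<open>1 \<le> h p\<close>, the new logarithmic term may carry the factor
    \<open>h p\<close> too, which restores the shape of the claim.\<close>
  also have "\<dots> \<le> H * (h p * (K0 + K1 * ln (real (prod_list s)) + K1 * L) + h p * (K1 * l p))"
  proof -
    have "0 \<le> (\<Sum>e\<in>Es. \<bar>g p e\<bar> * (real (sum_list e) * ln (real p)) / real p ^ sum_list e)"
      using p1 by (intro sum_nonneg) auto
    then have "0 \<le> l p" using l[OF p] by linarith
    then have "1 * (K1 * l p) \<le> h p * (K1 * l p)" using h1[OF p] K by (intro mult_right_mono) auto
    moreover note H0
    ultimately show ?thesis by (intro mult_left_mono add_left_mono) auto
  qed
  also have "\<dots> = (\<Prod>q\<in>insert p P. h q) * (K0 + K1 * ln (real (prod_list s)) + K1 * (\<Sum>q\<in>insert p P. l q))"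
    using insert.hyps by (simp add: H_def[symmetric] L_def[symmetric] algebra_simps)
  finally show ?case .
qed

section \<open>Finite differences and densities of functions of capped exponents\<close>

primrec exponents :: "nat list \<Rightarrow> nat list set" where
  "exponents [] = {[]}"
| "exponents (c # cs) = (\<lambda>(e, es). e # es) ` ({..c} \<times> exponents cs)"

text \<open>Mixed backward difference of f. For a local factor depending on exponents of p, this is
  the coefficient at a list of p-powers of its Dirichlet convolution with the Moebius function in
  every entry.\<close>

primrec diffs :: "nat list \<Rightarrow> (nat list \<Rightarrow> real) \<Rightarrow> real" where
  "diffs [] f = f []"
| "diffs (e # es) f = diffs es (\<lambda>r. f (e # r)) - (if e = 0 then 0 else diffs es (\<lambda>r. f ((e - 1) # r)))"

text \<open>
  The expected value of \<open>f\<close> at independent random exponents, cut off at \<open>cs\<close>, where an exponent is at least \<open>j\<close>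
  with probability \<open>x ^ j\<close>.
\<close>

primrec density :: "nat list \<Rightarrow> real \<Rightarrow> (nat list \<Rightarrow> real) \<Rightarrow> real" where
  "density [] x f = f []"
| "density (c # cs) x f = (\<Sum>j<c. x ^ j * (1 - x) * density cs x (\<lambda>r. f (j # r))) + x ^ c * density cs x (\<lambda>r. f (c # r))"

lemma finite_exponents [simp]: "finite (exponents cs)"
  by (induction cs) auto

lemma exponents_length: "e \<in> exponents cs \<Longrightarrow> length e = length cs"
  by (induction cs arbitrary: e) auto

lemma exponents_sum_le: "e \<in> exponents cs \<Longrightarrow> sum_list e \<le> sum_list cs"
proof (induction cs arbitrary: e)
  case (Cons c cs)
  then obtain e0 es where "e = e0 # es" "e0 \<le> c" "es \<in> exponents cs" by auto
  then show ?case using Cons.IH[of es] by simp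
qed auto

lemma replicate_0_mem_exponents: "replicate (length cs) 0 \<in> exponents cs"
  by (induction cs) (auto simp: image_iff)

lemma sum_exponents_Cons:
  "(\<Sum>e\<in>exponents (c # cs). F e) = (\<Sum>e\<le>c. \<Sum>es\<in>exponents cs. F (e # es))"
proof -
  have "inj_on (\<lambda>(x::nat, xs). x # xs) A" for A by (auto simp: inj_on_def)
  then have "(\<Sum>e\<in>exponents (c # cs). F e) = (\<Sum>(x, xs)\<in>{..c} \<times> exponents cs. F (x # xs))"
    unfolding exponents.simps by (subst sum.reindex) (auto simp: case_prod_unfold)
  then show ?thesis by (simp add: sum.cartesian_product)
qed

lemma sum_diffs_telescope:
  fixes G :: "nat \<Rightarrow> real"
  shows "(\<Sum>e\<le>c. if e \<le> v then G e - (if e = 0 then 0 else G (e - 1)) else 0) = G (min c v)"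
proof (induction c)
  case (Suc c)
  then show ?case by (cases "Suc c \<le> v") (auto simp: min_def not_less_eq_eq le_Suc_eq)
qed auto

text \<open>Moebius inversion: the differences telescope in each coordinate. Exponents above the cap
  are identified with the cap, so finitely many e suffice.\<close>

lemma sum_diffs:
  "length v = length cs \<Longrightarrow> (\<Sum>e\<in>exponents cs. if list_all2 (\<le>) e v then diffs e f else 0) = f (map2 min cs v)"
proof (induction cs arbitrary: v f)
  case (Cons c cs)
  then obtain a u where v: "v = a # u" "length u = length cs" by (cases v) auto
  let ?G = "\<lambda>e. f (e # map2 min cs u)"
  have "(\<Sum>es\<in>exponents cs. if list_all2 (\<le>) (e # es) v then diffs (e # es) f else 0)
     = (if e \<le> a then ?G e - (if e = 0 then 0 else ?G (e - 1)) else 0)" for e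
  proof (cases "e \<le> a")
    case True
    have "(\<Sum>es\<in>exponents cs. if list_all2 (\<le>) (e # es) v then diffs (e # es) f else 0)
      = (\<Sum>es\<in>exponents cs. if list_all2 (\<le>) es u then diffs es (\<lambda>r. f (e # r)) else 0)
       - (if e = 0 then 0 else (\<Sum>es\<in>exponents cs. if list_all2 (\<le>) es u then diffs es (\<lambda>r. f ((e - 1) # r)) else 0))"
      using True v by (auto simp: sum_subtractf[symmetric] intro!: sum.cong)
    then show ?thesis using Cons.IH[OF v(2)] True by simp
  qed (simp add: v)
  then show ?case unfolding sum_exponents_Cons using sum_diffs_telescope[of a ?G c] by (simp add: v)
qed auto

lemma sum_diffs_power_telescope:
  fixes G :: "nat \<Rightarrow> real"
  shows "(\<Sum>e\<le>c. x ^ e * (G e - (if e = 0 then 0 else G (e - 1)))) = (\<Sum>j<c. x ^ j * (1 - x) * G j) + x ^ c * G c"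
proof (induction c)
  case (Suc c)
  have "(\<Sum>e\<le>Suc c. x ^ e * (G e - (if e = 0 then 0 else G (e - 1))))
     = (\<Sum>j<c. x ^ j * (1 - x) * G j) + x ^ c * G c + x ^ Suc c * (G (Suc c) - G c)"
    using Suc by simp
  then show ?case by (simp add: algebra_simps)
qed auto

text \<open>Summation by parts in each coordinate. At x = 1/p it identifies the Euler factor of the
  convolution coefficients with an expected value, which can be computed from the weight
  directly.\<close>

lemma sum_diffs_power: "(\<Sum>e\<in>exponents cs. diffs e f * x ^ sum_list e) = density cs x f"
proof (induction cs arbitrary: f)
  case (Cons c cs)
  let ?G = "\<lambda>e. density cs x (\<lambda>r. f (e # r))"
  have "(\<Sum>es\<in>exponents cs. diffs (e # es) f * x ^ sum_list (e # es)) = x ^ e * (?G e - (if e = 0 then 0 else ?G (e - 1)))" for e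
  proof -
    have "(\<Sum>es\<in>exponents cs. diffs (e # es) f * x ^ sum_list (e # es))
      = x ^ e * ((\<Sum>es\<in>exponents cs. diffs es (\<lambda>r. f (e # r)) * x ^ sum_list es)
       - (if e = 0 then 0 else (\<Sum>es\<in>exponents cs. diffs es (\<lambda>r. f ((e - 1) # r)) * x ^ sum_list es)))"
    proof (cases "e = 0")
      case False
      then show ?thesis
        unfolding right_diff_distrib sum_distrib_left if_not_P[OF False] sum_subtractf[symmetric]
        by (intro sum.cong) (simp_all add: power_add algebra_simps)
    qed (simp add: sum_distrib_left)
    then show ?thesis by (simp add: Cons.IH)
  qed
  then show ?case unfolding sum_exponents_Cons using sum_diffs_power_telescope[of x ?G c] by simp
qed auto

lemma abs_diffs_le:
  assumes "\<And>r. \<bar>f r\<bar> \<le> M"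
  shows "\<bar>diffs e f\<bar> \<le> 2 ^ length e * M"
  using assms
proof (induction e arbitrary: f)
  case (Cons a e)
  have "\<bar>diffs e (\<lambda>r. f (a # r))\<bar> \<le> 2 ^ length e * M" "\<bar>diffs e (\<lambda>r. f ((a - 1) # r))\<bar> \<le> 2 ^ length e * M"
    using Cons.prems by (auto intro!: Cons.IH)
  moreover have "0 \<le> M" using Cons.prems[of "[]"] by linarith
  ultimately show ?case by (auto simp: abs_le_iff)
qed auto

lemma diffs_replicate_0: "diffs (replicate k 0) f = f (replicate k 0)"
  by (induction k arbitrary: f) auto

text \<open>With a single exponent 1 only one coordinate is differenced; so the coefficient is small
  when one factor p hardly changes the weight.\<close>

lemma diffs_unit: "sum_list e = 1 \<Longrightarrow> diffs e f = f e - f (replicate (length e) 0)"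
proof (induction e arbitrary: f)
  case (Cons a e)
  show ?case
  proof (cases "a = 0")
    case True
    then show ?thesis using Cons.IH[of "\<lambda>r. f (a # r)"] Cons.prems by simp
  next
    case False
    have "a + sum_list e = 1" using Cons.prems by simp
    then have s: "sum_list e = 0" and a: "a = 1" using False by linarith+
    have "e = replicate (length e) 0" using s by (intro replicate_eqI) (auto simp: sum_list_eq_0_iff)
    then obtain m where "e = replicate m 0" by blast
    then show ?thesis using a by (simp add: diffs_replicate_0)
  qed
qed auto

lemma ldvd_prime_power_iff:
  assumes "prime p"
  shows "length e = length n \<Longrightarrow> 0 \<notin> set n \<Longrightarrow> ldvd (map ((^) p) e) n \<longleftrightarrow> list_all2 (\<le>) e (map (multiplicity p) n)"
proof (induction rule: list_induct2)
  case (Cons a e x n)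
  have "p ^ a dvd x \<longleftrightarrow> a \<le> multiplicity p x"
    using Cons.prems assms by (intro power_dvd_iff_le_multiplicity) auto
  then show ?case using Cons by simp
qed auto

section \<open>Convergence of sums and products over primes\<close>

lemma summable_ln_over_square: "summable (\<lambda>n. ln (real n) / real n ^ 2)"
proof (rule summable_comparison_test')
  show "summable (\<lambda>n. 2 * real n powr (- (3/2)))"
    by (intro summable_mult) (simp add: summable_real_powr_iff)
  fix n :: nat assume n: "n \<ge> 1"
  have "ln (sqrt (real n)) \<le> sqrt (real n) - 1" using n by (intro ln_le_minus_one) auto
  then have "ln (real n) \<le> 2 * sqrt (real n)" using n by (simp add: ln_sqrt)
  then have "ln (real n) / real n ^ 2 \<le> 2 * sqrt (real n) / real n ^ 2" by (intro divide_right_mono) auto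
  also have "\<dots> = 2 * real n powr (- (3/2))"
  proof -
    have "real n ^ 2 = real n powr 2" using n by simp
    moreover have "sqrt (real n) = real n powr (1/2)" using n by (simp add: powr_half_sqrt)
    moreover have "real n powr (1/2 - 2) = real n powr (1/2) / real n powr 2" by (rule powr_diff)
    ultimately show ?thesis by simp
  qed
  finally show "norm (ln (real n) / real n ^ 2) \<le> 2 * real n powr (- (3/2))" using n by simp
qed

lemma sum_le_suminf_primes:
  fixes F :: "nat \<Rightarrow> real"
  assumes "summable F" "\<And>n. n \<ge> 1 \<Longrightarrow> 0 \<le> F n" "F 0 = 0" "finite P"
  shows "sum F P \<le> suminf F"
proof (rule sum_le_suminf[OF assms(1,4)])
  fix n assume "n \<in> - P"
  show "0 \<le> F n" using assms(2)[of n] assms(3) by (cases "n = 0") auto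
qed

text \<open>\<open>prime_prod\<close> is a \<open>prodinf\<close>, which carries information only
  once convergence is known. The bound gives absolute convergence, and so the limit of the products
  over primes up to X.\<close>

lemma prime_prod_limit:
  assumes "\<And>p. prime p \<Longrightarrow> \<bar>D (real p) - 1\<bar> \<le> C / real p ^ 2"
  shows "(\<lambda>X. \<Prod>p\<in>{p. prime p \<and> p \<le> X}. D (real p)) \<longlonglongrightarrow> prime_prod D"
proof -
  let ?f = "\<lambda>p. if prime (p::nat) then D (real p) else 1"
  have "summable (\<lambda>p. norm (?f p - 1))"
  proof (rule summable_comparison_test')
    show "summable (\<lambda>n. \<bar>C\<bar> * (1 / real n ^ 2))"
      by (intro summable_mult) (use inverse_power_summable[of 2] in \<open>simp add: inverse_eq_divide power_inverse\<close>)
    fix n :: nat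
    have "C / real n ^ 2 \<le> \<bar>C\<bar> / real n ^ 2" by (intro divide_right_mono) auto
    then show "norm (norm (?f n - 1)) \<le> \<bar>C\<bar> * (1 / real n ^ 2)" using assms[of n] by auto
  qed
  then have "(\<lambda>X. \<Prod>p\<le>X. ?f p) \<longlonglongrightarrow> prodinf ?f"
    by (intro convergent_prod_LIMSEQ abs_convergent_prod_imp_convergent_prod summable_imp_abs_convergent_prod)
  moreover have "(\<Prod>p\<le>X. ?f p) = (\<Prod>p\<in>{p. prime p \<and> p \<le> X}. D (real p))" for X
    by (subst prod.inter_filter[symmetric]) (auto intro!: prod.cong)
  ultimately show ?thesis by (simp add: prime_prod_def)
qed

text \<open>Exponents are cut off at \<open>cs\<close>: cap 1 records divisibility by p, cap 2 also
  divisibility by p^2, as needed for squarefreeness.\<close>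

definition local_weight :: "nat list \<Rightarrow> (nat \<Rightarrow> nat list \<Rightarrow> real) \<Rightarrow> nat \<Rightarrow> nat list \<Rightarrow> real" where
  "local_weight cs f p n = f p (map2 min cs (map (multiplicity p) n))"

definition weight :: "nat list \<Rightarrow> (nat \<Rightarrow> nat list \<Rightarrow> real) \<Rightarrow> nat \<Rightarrow> nat list \<Rightarrow> real" where
  "weight cs f N n = (\<Prod>p\<in>{p. prime p \<and> p \<le> N}. local_weight cs f p n)"

lemma local_weight_eq_1:
  assumes "f p (replicate (length cs) 0) = 1" "n \<in> Box (length cs) N" "p > N"
  shows "local_weight cs f p n = 1"
proof -
  have "multiplicity p x = 0" if "x \<in> set n" for x
  proof (rule not_dvd_imp_multiplicity_0)
    have "0 < x" "x \<le> N" using that assms(2) by (auto simp: Box_def)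
    then show "\<not> p dvd x" using assms(3) by (meson dvd_imp_le leD le_trans)
  qed
  then have "map (multiplicity p) n = replicate (length n) 0"
    by (induction n) auto
  moreover have "length n = length cs" using assms by (auto simp: Box_def)
  moreover have "map2 min cs (replicate (length cs) 0) = replicate (length cs) 0" by (induction cs) auto
  ultimately show ?thesis using assms by (simp add: local_weight_def)
qed

text \<open>The local factor is 1 on lists prime to p and 1 + O(1/p) when p divides just one entry,
  once. The convolution coefficients divided by the matching power of p are then O(1/p^2) apart from
  the leading 1, so the product of the \<open>h p\<close> and the sum of the \<open>l p\<close> in
  \<open>sieve_finite\<close> are bounded independently of the set of primes.\<close>

theorem sieve:
  fixes f :: "nat \<Rightarrow> nat list \<Rightarrow> real"
  assumes bound: "\<And>p r. prime p \<Longrightarrow> \<bar>f p r\<bar> \<le> 1"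
    and zero: "\<And>p. prime p \<Longrightarrow> f p (replicate (length cs) 0) = 1"
    and unit: "\<And>p e. prime p \<Longrightarrow> length e = length cs \<Longrightarrow> sum_list e = 1 \<Longrightarrow> \<bar>f p e - 1\<bar> \<le> C / real p"
    and D: "\<And>p. prime p \<Longrightarrow> density cs (1 / real p) (f p) = D (real p)"
  obtains K where "K \<ge> 0"
    "\<And>N \<Phi> M K0 K1. \<lbrakk>supported (length cs) N \<Phi>; 0 \<le> K0; 0 \<le> K1;
       \<And>s. length s = length cs \<Longrightarrow> 0 \<notin> set s \<Longrightarrow>
         \<bar>real (prod_list s) * (\<Sum>m\<in>Box (length cs) N. \<Phi> (lmul s m)) - M\<bar> \<le> K0 + K1 * ln (real (prod_list s))\<rbrakk> \<Longrightarrow>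
       \<bar>(\<Sum>n\<in>Box (length cs) N. weight cs f N n * \<Phi> n) - prime_prod D * M\<bar> \<le> K * (K0 + K1)"
proof -
  define k where "k = length cs"
  define Es where "Es = exponents cs"
  define g where "g p e = diffs e (f p)" for p e
  define A where "A = max \<bar>C\<bar> (2 ^ k)"
  define C1 where "C1 = real (card Es) * A"
  define C2 where "C2 = C1 * real (sum_list cs)"
  have A0: "0 \<le> A" "\<bar>C\<bar> \<le> A" "2 ^ k \<le> A" by (auto simp: A_def)
  have C10: "0 \<le> C1" "0 \<le> C2" unfolding C1_def C2_def using A0 by auto
  have z: "replicate k 0 \<in> Es" unfolding Es_def k_def by (rule replicate_0_mem_exponents)
  have gz: "g p (replicate k 0) = 1" if "prime p" for p
    using zero[OF that] by (simp add: g_def diffs_replicate_0 k_def)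
  \<comment> \<open>At total exponent 1, one factor 1/p comes from \<open>unit\<close> and one from
    the power of p; from total exponent 2 on, the power of p suffices.\<close>
  have gE: "\<bar>g p e\<bar> / real p ^ sum_list e \<le> A / real p ^ 2" if "prime p" "e \<in> Es" "e \<noteq> replicate k 0" for p e
  proof -
    have p: "1 < real p" using prime_gt_1_nat[OF \<open>prime p\<close>] by simp
    have len: "length e = k" using that exponents_length unfolding Es_def k_def by blast
    have "sum_list e \<noteq> 0" using that(3) len by (auto simp: list_eq_iff_nth_eq)
    then consider "sum_list e = 1" | "sum_list e \<ge> 2" by linarith
    then show ?thesis
    proof cases
      case 1
      then have "\<bar>g p e\<bar> \<le> C / real p"
        using unit[of p e] that len zero unfolding g_def by (simp add: diffs_unit k_def)
      also have "\<dots> \<le> A / real p" using A0 p by (intro divide_right_mono) auto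
      finally have "\<bar>g p e\<bar> / real p \<le> A / real p / real p" using p by (intro divide_right_mono) auto
      then show ?thesis using 1 by (simp add: power2_eq_square)
    next
      case 2
      have "\<bar>g p e\<bar> \<le> A" using abs_diffs_le[of "f p" 1 e] bound[OF that(1)] A0 len unfolding g_def by simp
      moreover have "real p ^ 2 \<le> real p ^ sum_list e" using p 2 by (intro power_increasing) auto
      ultimately show ?thesis using A0 p by (intro frac_le) auto
    qed
  qed
  have card1: "real (card (Es - {replicate k 0})) \<le> real (card Es)"
    by (simp add: card_mono Es_def)
  have sumE: "(\<Sum>e\<in>Es - {replicate k 0}. \<bar>g p e\<bar> / real p ^ sum_list e) \<le> C1 / real p ^ 2" if "prime p" for p
  proof -
    have "(\<Sum>e\<in>Es - {replicate k 0}. \<bar>g p e\<bar> / real p ^ sum_list e) \<le> (\<Sum>e\<in>Es - {replicate k 0}. A / real p ^ 2)"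
      using gE that by (intro sum_mono) auto
    also have "\<dots> = real (card (Es - {replicate k 0})) * (A / real p ^ 2)" by simp
    also have "\<dots> \<le> real (card Es) * (A / real p ^ 2)" using card1 A0 by (intro mult_right_mono) auto
    finally show ?thesis by (simp add: C1_def)
  qed
  have h: "(\<Sum>e\<in>Es. \<bar>g p e\<bar> / real p ^ sum_list e) \<le> 1 + C1 / real p ^ 2" if "prime p" for p
    using sumE[OF that] gz[OF that] sum.remove[of Es "replicate k 0" "\<lambda>e. \<bar>g p e\<bar> / real p ^ sum_list e"] z
    by (simp add: Es_def sum_list_replicate)
  have l: "(\<Sum>e\<in>Es. \<bar>g p e\<bar> * (real (sum_list e) * ln (real p)) / real p ^ sum_list e) \<le> C2 * (ln (real p) / real p ^ 2)" if "prime p" for p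
  proof -
    have p: "1 < real p" using prime_gt_1_nat[OF \<open>prime p\<close>] by simp
    have "(\<Sum>e\<in>Es. \<bar>g p e\<bar> * (real (sum_list e) * ln (real p)) / real p ^ sum_list e)
       = (\<Sum>e\<in>Es - {replicate k 0}. \<bar>g p e\<bar> * (real (sum_list e) * ln (real p)) / real p ^ sum_list e)"
      using sum.remove[of Es "replicate k 0" "\<lambda>e. \<bar>g p e\<bar> * (real (sum_list e) * ln (real p)) / real p ^ sum_list e"] z
      by (simp add: Es_def sum_list_replicate)
    also have "\<dots> \<le> (\<Sum>e\<in>Es - {replicate k 0}. \<bar>g p e\<bar> / real p ^ sum_list e * (real (sum_list cs) * ln (real p)))"
    proof (intro sum_mono)
      fix e assume "e \<in> Es - {replicate k 0}"
      then have "real (sum_list e) * ln (real p) \<le> real (sum_list cs) * ln (real p)"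
        using exponents_sum_le p unfolding Es_def by (intro mult_right_mono) auto
      then have "\<bar>g p e\<bar> / real p ^ sum_list e * (real (sum_list e) * ln (real p)) \<le> \<bar>g p e\<bar> / real p ^ sum_list e * (real (sum_list cs) * ln (real p))"
        by (intro mult_left_mono) auto
      then show "\<bar>g p e\<bar> * (real (sum_list e) * ln (real p)) / real p ^ sum_list e \<le> \<bar>g p e\<bar> / real p ^ sum_list e * (real (sum_list cs) * ln (real p))"
        by simp
    qed
    also have "\<dots> \<le> C1 / real p ^ 2 * (real (sum_list cs) * ln (real p))"
      unfolding sum_distrib_right[symmetric] using p by (intro mult_right_mono sumE that) auto
    finally show ?thesis by (simp add: C2_def)
  qed
  have rho: "(\<Sum>e\<in>Es. g p e / real p ^ sum_list e) = D (real p)" if "prime p" for p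
    unfolding D[OF that, symmetric] sum_diffs_power[symmetric] Es_def g_def
    by (simp add: power_divide)
  have D1: "\<bar>D (real p) - 1\<bar> \<le> C1 / real p ^ 2" if "prime p" for p
  proof -
    have "D (real p) - 1 = (\<Sum>e\<in>Es - {replicate k 0}. g p e / real p ^ sum_list e)"
      using rho[OF that] gz[OF that] sum.remove[of Es "replicate k 0" "\<lambda>e. g p e / real p ^ sum_list e"] z
      by (simp add: Es_def sum_list_replicate)
    also have "\<bar>\<dots>\<bar> \<le> (\<Sum>e\<in>Es - {replicate k 0}. \<bar>g p e / real p ^ sum_list e\<bar>)" by (rule sum_abs)
    also have "\<dots> \<le> C1 / real p ^ 2" using sumE[OF that] by simp
    finally show ?thesis .
  qed
  \<comment> \<open>\<open>Z\<close> bounds the product of the \<open>h p\<close> through 1 + t <=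
    exp t, and \<open>Y\<close> below bounds the sum of the \<open>l p\<close>.\<close>
  define Z where "Z = suminf (\<lambda>n. 1 / real n ^ 2)"
  define Y where "Y = suminf (\<lambda>n. ln (real n) / real n ^ 2)"
  have sz: "summable (\<lambda>n. 1 / real n ^ 2)"
    using inverse_power_summable[of 2, where 'a = real] by (simp add: inverse_eq_divide power_one_over)
  have Z: "(\<Sum>p\<in>P. 1 / real p ^ 2) \<le> Z" if "finite P" for P
    unfolding Z_def using that sz by (intro sum_le_suminf_primes) auto
  have Y: "(\<Sum>p\<in>P. ln (real p) / real p ^ 2) \<le> Y" if "finite P" for P
    unfolding Y_def using that summable_ln_over_square by (intro sum_le_suminf_primes) auto
  have Y0: "0 \<le> Y" using Y[of "{}"] by simp
  define K where "K = exp (C1 * Z) * (1 + C2 * Y)"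
  have "0 \<le> K" unfolding K_def using C10 Y0 by simp
  moreover have "\<bar>(\<Sum>n\<in>Box (length cs) N. weight cs f N n * \<Phi> n) - prime_prod D * M\<bar> \<le> K * (K0 + K1)"
    if supp: "supported (length cs) N \<Phi>" and K01: "0 \<le> K0" "0 \<le> K1"
      and base: "\<And>s. length s = length cs \<Longrightarrow> 0 \<notin> set s \<Longrightarrow>
         \<bar>real (prod_list s) * (\<Sum>m\<in>Box (length cs) N. \<Phi> (lmul s m)) - M\<bar> \<le> K0 + K1 * ln (real (prod_list s))"
    for N \<Phi> M K0 K1
  proof -
    define P where "P X = {p. prime p \<and> p \<le> X}" for X :: nat
    have fP: "finite (P X)" for X unfolding P_def by (rule finite_subset[of _ "{..X}"]) auto
    have w: "local_weight cs f p n = (\<Sum>e\<in>Es. if ldvd (map ((^) p) e) n then g p e else 0)"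
      if "prime p" "n \<in> Box k N" for p n
    proof -
      have n: "length n = k" "0 \<notin> set n" using Box_pos[OF that(2)] by auto
      have "local_weight cs f p n = (\<Sum>e\<in>Es. if list_all2 (\<le>) e (map (multiplicity p) n) then g p e else 0)"
        unfolding local_weight_def Es_def g_def using n by (subst sum_diffs) (auto simp: k_def)
      also have "\<dots> = (\<Sum>e\<in>Es. if ldvd (map ((^) p) e) n then g p e else 0)"
        using n that exponents_length by (intro sum.cong refl if_cong) (auto simp: ldvd_prime_power_iff Es_def k_def)
      finally show ?thesis .
    qed
    \<comment> \<open>Primes between N and X have local weight 1 on the box, so X may tend to
      infinity while the sum stays fixed; this produces the complete Euler product.\<close>
    have "\<bar>(\<Sum>n\<in>Box k N. weight cs f N n * \<Phi> n) - (\<Prod>p\<in>P X. D (real p)) * M\<bar> \<le> K * (K0 + K1)" if X: "X \<ge> N" for X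
    proof -
      have one: "lmul (replicate k 1) m = m" if "m \<in> Box k N" for m
      proof -
        have "lmul (replicate (length m) 1) m = m" by (induction m) auto
        then show ?thesis using Box_pos[OF that] by simp
      qed
      have W: "(\<Prod>p\<in>P X. local_weight cs f p m) = weight cs f N m" if "m \<in> Box k N" for m
        unfolding weight_def P_def[symmetric]
      proof (rule prod.mono_neutral_right[OF fP])
        show "P N \<subseteq> P X" using X by (auto simp: P_def)
        show "\<forall>p\<in>P X - P N. local_weight cs f p m = 1"
        proof
          fix p assume "p \<in> P X - P N"
          then have "prime p" "N < p" by (auto simp: P_def)
          then show "local_weight cs f p m = 1"
            using that by (intro local_weight_eq_1[of f p cs m N] zero) (auto simp: k_def)
        qed
      qed
      have "\<bar>real (prod_list (replicate k 1)) * (\<Sum>m\<in>Box k N. (\<Prod>p\<in>P X. local_weight cs f p m) * \<Phi> (lmul (replicate k 1) m))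
          - (\<Prod>p\<in>P X. \<Sum>e\<in>Es. g p e / real p ^ sum_list e) * M\<bar>
        \<le> (\<Prod>p\<in>P X. 1 + C1 / real p ^ 2) * (K0 + K1 * ln (real (prod_list (replicate k 1))) + K1 * (\<Sum>p\<in>P X. C2 * (ln (real p) / real p ^ 2)))"
      proof (rule sieve_finite[where w = "local_weight cs f" and g = g and Es = Es and k = k])
        show "1 \<le> 1 + C1 / real p ^ 2" for p using C10 by simp
        show "e \<in> Es \<Longrightarrow> length e = k" for e using exponents_length unfolding Es_def k_def by blast
        show "prime p \<Longrightarrow> n \<in> Box k N \<Longrightarrow> local_weight cs f p n = (\<Sum>e\<in>Es. if ldvd (map ((^) p) e) n then g p e else 0)" for p n
          by (rule w)
        show "prime p \<Longrightarrow> (\<Sum>e\<in>Es. \<bar>g p e\<bar> / real p ^ sum_list e) \<le> 1 + C1 / real p ^ 2" for p by (rule h)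
        show "prime p \<Longrightarrow> (\<Sum>e\<in>Es. \<bar>g p e\<bar> * (real (sum_list e) * ln (real p)) / real p ^ sum_list e) \<le> C2 * (ln (real p) / real p ^ 2)" for p
          by (rule l)
        show "\<And>s. length s = k \<Longrightarrow> 0 \<notin> set s \<Longrightarrow>
         \<bar>real (prod_list s) * (\<Sum>m\<in>Box k N. \<Phi> (lmul s m)) - M\<bar> \<le> K0 + K1 * ln (real (prod_list s))"
          unfolding k_def by (rule base)
        show "supported k N \<Phi>" using supp by (simp add: k_def)
        show "0 \<notin> set (replicate k (1::nat))" by simp
        show "\<forall>p\<in>P X. prime p" by (simp add: P_def)
      qed (use K01 fP in \<open>simp_all add: Es_def\<close>)
      moreover have "(\<Sum>m\<in>Box k N. (\<Prod>p\<in>P X. local_weight cs f p m) * \<Phi> (lmul (replicate k 1) m)) = (\<Sum>n\<in>Box k N. weight cs f N n * \<Phi> n)"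
        using one W by (intro sum.cong) auto
      moreover have "(\<Prod>p\<in>P X. \<Sum>e\<in>Es. g p e / real p ^ sum_list e) = (\<Prod>p\<in>P X. D (real p))"
        using rho by (intro prod.cong) (auto simp: P_def)
      moreover have "(\<Prod>p\<in>P X. 1 + C1 / real p ^ 2) * (K0 + K1 * (\<Sum>p\<in>P X. C2 * (ln (real p) / real p ^ 2))) \<le> exp (C1 * Z) * (K0 + K1 * (C2 * Y))"
      proof (rule mult_mono)
        have "(\<Prod>p\<in>P X. 1 + C1 / real p ^ 2) \<le> (\<Prod>p\<in>P X. exp (C1 / real p ^ 2))"
          using C10 by (intro prod_mono) (auto intro: exp_ge_add_one_self)
        also have "\<dots> = exp (C1 * (\<Sum>p\<in>P X. 1 / real p ^ 2))"
          by (simp add: exp_sum[OF fP] sum_distrib_left)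
        also have "\<dots> \<le> exp (C1 * Z)" using C10 Z[OF fP] by (simp add: mult_left_mono)
        finally show "(\<Prod>p\<in>P X. 1 + C1 / real p ^ 2) \<le> exp (C1 * Z)" .
        have "(\<Sum>p\<in>P X. C2 * (ln (real p) / real p ^ 2)) \<le> C2 * Y"
          unfolding sum_distrib_left[symmetric] using C10 Y[OF fP] by (intro mult_left_mono)
        then show "K0 + K1 * (\<Sum>p\<in>P X. C2 * (ln (real p) / real p ^ 2)) \<le> K0 + K1 * (C2 * Y)"
          using K01 by (intro add_left_mono mult_left_mono)
        have "0 \<le> (\<Sum>p\<in>P X. C2 * (ln (real p) / real p ^ 2))"
          using C10 by (intro sum_nonneg mult_nonneg_nonneg divide_nonneg_nonneg) (auto simp: P_def prime_gt_0_nat Suc_leI)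
        then show "0 \<le> K0 + K1 * (\<Sum>p\<in>P X. C2 * (ln (real p) / real p ^ 2))" using K01 by simp
      qed simp
      moreover have "exp (C1 * Z) * (K0 + K1 * (C2 * Y)) \<le> K * (K0 + K1)"
      proof -
        have "K0 + K1 * (C2 * Y) \<le> (1 + C2 * Y) * (K0 + K1)"
          using K01 C10 Y0 by (simp add: algebra_simps)
        then show ?thesis unfolding K_def mult.assoc by (intro mult_left_mono) auto
      qed
      ultimately show ?thesis by simp
    qed
    moreover have "(\<lambda>X. \<bar>(\<Sum>n\<in>Box k N. weight cs f N n * \<Phi> n) - (\<Prod>p\<in>P X. D (real p)) * M\<bar>)
        \<longlonglongrightarrow> \<bar>(\<Sum>n\<in>Box k N. weight cs f N n * \<Phi> n) - prime_prod D * M\<bar>"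
      unfolding P_def by (intro tendsto_intros prime_prod_limit[OF D1])
    ultimately show ?thesis unfolding k_def[symmetric]
      by (intro LIMSEQ_le_const2) auto
  qed
  ultimately show ?thesis by (rule that)
qed

section \<open>The sieve for monotone functions of logarithms\<close>

lemma map_ln_lmul:
  "length s = length m \<Longrightarrow> 0 \<notin> set s \<Longrightarrow> 0 \<notin> set m \<Longrightarrow>
    map (\<lambda>x. ln (real x)) (lmul s m) = map2 (\<lambda>x s. ln (real x) + s) m (map (\<lambda>x. ln (real x)) s)"
  by (induction rule: list_induct2) (auto simp: ln_mult)

lemma ln_prod_list: "0 \<notin> set s \<Longrightarrow> ln (real (prod_list s)) = sum_list (map (\<lambda>x. ln (real x)) s)"
proof (induction s)
  case (Cons a s)
  then have "0 < a" "prod_list s \<noteq> 0" by (auto simp: prod_list_zero_iff)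
  then show ?case using Cons by (simp add: ln_mult)
qed auto

text \<open>Multiplication by s translates the logarithms, so \<open>sum_Box_log\<close> supplies
  the hypothesis of \<open>sieve\<close> with \<open>K1 = (T + 1) ^ (k - 1) * M\<close> and
  \<open>K0 = k * K1\<close>. Against the size \<open>M * T ^ k\<close> of an integral one power of
  T is saved.\<close>

theorem sieve_log:
  fixes f :: "nat \<Rightarrow> nat list \<Rightarrow> real"
  assumes "\<And>p r. prime p \<Longrightarrow> \<bar>f p r\<bar> \<le> 1"
    and "\<And>p. prime p \<Longrightarrow> f p (replicate (length cs) 0) = 1"
    and "\<And>p e. prime p \<Longrightarrow> length e = length cs \<Longrightarrow> sum_list e = 1 \<Longrightarrow> \<bar>f p e - 1\<bar> \<le> C / real p"
    and "\<And>p. prime p \<Longrightarrow> density cs (1 / real p) (f p) = D (real p)"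
  obtains K where "K \<ge> 0"
    "\<And>T M \<Psi>. \<lbrakk>0 \<le> T; antitone_cutoff (length cs) T M \<Psi>\<rbrakk> \<Longrightarrow>
       \<bar>(\<Sum>n\<in>Box (length cs) (nat \<lfloor>exp T\<rfloor>). weight cs f (nat \<lfloor>exp T\<rfloor>) n * (\<Psi> (map (\<lambda>x. ln (real x)) n) / real (prod_list n)))
          - prime_prod D * iterated_integral (length cs) T \<Psi>\<bar> \<le> K * ((T + 1) ^ (length cs - 1) * M)"
proof -
  define k where "k = length cs"
  obtain K where K: "K \<ge> 0" and Kb: "\<And>N \<Phi> M K0 K1. \<lbrakk>supported k N \<Phi>; 0 \<le> K0; 0 \<le> K1;
       \<And>s. length s = k \<Longrightarrow> 0 \<notin> set s \<Longrightarrow>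
         \<bar>real (prod_list s) * (\<Sum>m\<in>Box k N. \<Phi> (lmul s m)) - M\<bar> \<le> K0 + K1 * ln (real (prod_list s))\<rbrakk> \<Longrightarrow>
       \<bar>(\<Sum>n\<in>Box k N. weight cs f N n * \<Phi> n) - prime_prod D * M\<bar> \<le> K * (K0 + K1)"
    unfolding k_def by (rule sieve[of f cs C D, OF assms]) (assumption | blast)+
  have "\<bar>(\<Sum>n\<in>Box k (nat \<lfloor>exp T\<rfloor>). weight cs f (nat \<lfloor>exp T\<rfloor>) n * (\<Psi> (map (\<lambda>x. ln (real x)) n) / real (prod_list n)))
          - prime_prod D * iterated_integral k T \<Psi>\<bar> \<le> (K * (real k + 1)) * ((T + 1) ^ (k - 1) * M)"
    if T: "0 \<le> T" and ac: "antitone_cutoff k T M \<Psi>" for T M \<Psi>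
  proof -
    define N where "N = nat \<lfloor>exp T\<rfloor>"
    define \<Phi> where "\<Phi> n = \<Psi> (map (\<lambda>x. ln (real x)) n) / real (prod_list n)" for n :: "nat list"
    define E where "E = (T + 1) ^ (k - 1) * M"
    have M0: "0 \<le> M" using antitone_cutoff_bounds[OF ac, of "replicate k 0"] by simp
    then have E0: "0 \<le> E" using T by (simp add: E_def)
    have supp: "supported k N \<Phi>"
      unfolding supported_def
    proof (intro allI impI)
      fix n :: "nat list" assume n: "length n = k" "0 \<notin> set n" "n \<notin> Box k N"
      then obtain x where x: "x \<in> set n" "\<not> x \<in> {1..N}" unfolding Box_def by blast
      then have "x \<noteq> 0" using n by metis
      then have "N < x" using x by auto
      then have "exp T < real x" unfolding N_def by linarith
      then have "T < ln (real x)" by (metis exp_gt_zero ln_exp ln_less_cancel_iff less_trans)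
      then have "\<exists>t\<in>set (map (\<lambda>x. ln (real x)) n). T < t" using x by auto
      moreover have "\<forall>t\<in>set (map (\<lambda>x. ln (real x)) n). 0 \<le> t"
      proof -
        have "0 \<le> ln (real y)" if "y \<in> set n" for y
          using that n(2) by (cases "y = 0") auto
        then show ?thesis by simp
      qed
      ultimately show "\<Phi> n = 0" using ac n unfolding antitone_cutoff_def \<Phi>_def by simp
    qed
    have base: "\<bar>real (prod_list s) * (\<Sum>m\<in>Box k N. \<Phi> (lmul s m)) - iterated_integral k T \<Psi>\<bar> \<le> real k * E + E * ln (real (prod_list s))"
      if s: "length s = k" "0 \<notin> set s" for s
    proof -
      define \<sigma> where "\<sigma> = map (\<lambda>x. ln (real x)) s"
      have s0: "prod_list s \<noteq> 0" using s by (simp add: prod_list_zero_iff)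
      have "real (prod_list s) * \<Phi> (lmul s m) = \<Psi> (map2 (\<lambda>x s. ln (real x) + s) m \<sigma>) / real (prod_list m)"
        if "m \<in> Box k N" for m
        using Box_pos[OF that] s s0 unfolding \<Phi>_def \<sigma>_def by (simp add: map_ln_lmul prod_list_lmul)
      then have "real (prod_list s) * (\<Sum>m\<in>Box k N. \<Phi> (lmul s m)) = (\<Sum>m\<in>Box k N. \<Psi> (map2 (\<lambda>x s. ln (real x) + s) m \<sigma>) / real (prod_list m))"
        by (simp add: sum_distrib_left)
      moreover have "\<forall>s\<in>set \<sigma>. 0 \<le> s"
      proof -
        have "0 \<le> ln (real y)" if "y \<in> set s" for y
          using that s(2) by (cases "y = 0") auto
        then show ?thesis by (simp add: \<sigma>_def)
      qed
      ultimately show ?thesis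
        using sum_Box_log[OF T ac, of \<sigma>] s unfolding N_def[symmetric]
        by (simp add: \<sigma>_def ln_prod_list E_def algebra_simps)
    qed
    have "\<bar>(\<Sum>n\<in>Box k N. weight cs f N n * \<Phi> n) - prime_prod D * iterated_integral k T \<Psi>\<bar> \<le> K * (real k * E + E)"
      by (rule Kb) (use supp base E0 in auto)
    then show ?thesis unfolding N_def \<Phi>_def E_def by (simp add: algebra_simps)
  qed
  then show ?thesis using K unfolding k_def by (intro that[of "K * (real (length cs) + 1)"]) auto
qed

subsection \<open>Counting integers in progressions\<close>

lemma card_int_interval:
  assumes "u \<le> (v::real)"
  shows "finite {t::int. u \<le> of_int t \<and> of_int t \<le> v}"
    and "\<bar>real (card {t::int. u \<le> of_int t \<and> of_int t \<le> v}) - (v - u)\<bar> \<le> 1"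
proof -
  have *: "{t::int. u \<le> of_int t \<and> of_int t \<le> v} = {\<lceil>u\<rceil>..\<lfloor>v\<rfloor>}"
    by (auto simp: ceiling_le_iff le_floor_iff)
  then show "finite {t::int. u \<le> of_int t \<and> of_int t \<le> v}" by simp
  \<comment> \<open>This covers intervals without integers: u <= v still gives a nonnegative count,
    namely 0.\<close>
  have "\<lfloor>v\<rfloor> + 1 - \<lceil>u\<rceil> \<ge> 0" using assms by linarith
  then have "real (card {t::int. u \<le> of_int t \<and> of_int t \<le> v}) = of_int (\<lfloor>v\<rfloor> + 1 - \<lceil>u\<rceil>)"
    unfolding * by simp
  then show "\<bar>real (card {t::int. u \<le> of_int t \<and> of_int t \<le> v}) - (v - u)\<bar> \<le> 1"
    unfolding abs_le_iff by (simp, linarith)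
qed

text \<open>The predicate \<open>P\<close> rides along so that the same reparametrisation can be
  used inside a sieve.\<close>

lemma bij_betw_progression:
  assumes "m > 0"
  shows "bij_betw (\<lambda>t. r + int m * t) {t. (u - of_int r) / real m \<le> of_int t \<and> of_int t \<le> (v - of_int r) / real m \<and> P (r + int m * t)}
     {x. u \<le> of_int x \<and> of_int x \<le> v \<and> int m dvd x - r \<and> P x}"
proof (rule bij_betw_imageI)
  show "inj_on (\<lambda>t. r + int m * t) A" for A using assms by (auto simp: inj_on_def)
  have eq: "(u - of_int r) / real m \<le> of_int t \<and> of_int t \<le> (v - of_int r) / real m \<longleftrightarrow>
     u \<le> of_int (r + int m * t) \<and> of_int (r + int m * t) \<le> v" for t
    using assms by (simp add: field_simps)
  show "(\<lambda>t. r + int m * t) ` {t. (u - of_int r) / real m \<le> of_int t \<and> of_int t \<le> (v - of_int r) / real m \<and> P (r + int m * t)} =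
     {x. u \<le> of_int x \<and> of_int x \<le> v \<and> int m dvd x - r \<and> P x}" (is "?A = ?B")
  proof (intro equalityI subsetI)
    fix x assume "x \<in> ?A"
    then obtain t where t: "x = r + int m * t" "P x" "(u - of_int r) / real m \<le> of_int t \<and> of_int t \<le> (v - of_int r) / real m"
      by blast
    show "x \<in> ?B" using t(1,2) t(3)[unfolded eq] by auto
  next
    fix x assume x: "x \<in> ?B"
    then obtain t where "x - r = int m * t" by (auto elim: dvdE)
    then have "x = r + int m * t" by simp
    then show "x \<in> ?A" using x eq[of t] by auto
  qed
qed

lemma card_progression:
  fixes r :: int and u v :: real
  assumes "m > 0" "u \<le> v"
  shows "finite {x::int. u \<le> of_int x \<and> of_int x \<le> v \<and> int m dvd x - r}"
    and "\<bar>real (card {x::int. u \<le> of_int x \<and> of_int x \<le> v \<and> int m dvd x - r}) - (v - u) / real m\<bar> \<le> 1"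
proof -
  note b = bij_betw_progression[OF assms(1), of r u v "\<lambda>_. True", simplified]
  have le: "(u - of_int r) / real m \<le> (v - of_int r) / real m" using assms by (intro divide_right_mono) auto
  note c = card_int_interval[OF le]
  show "finite {x::int. u \<le> of_int x \<and> of_int x \<le> v \<and> int m dvd x - r}"
    using bij_betw_finite[OF b] c by simp
  show "\<bar>real (card {x::int. u \<le> of_int x \<and> of_int x \<le> v \<and> int m dvd x - r}) - (v - u) / real m\<bar> \<le> 1"
    using c(2) bij_betw_same_card[OF b] by (simp add: diff_divide_distrib)
qed

lemma card_affine_preimage:
  assumes "coprime p q" "q > 0" "R \<subseteq> {0..<int q}"
  shows "card {s\<in>{0..<int q}. (r + int p * s) mod int q \<in> R} = card R"
proof -
  let ?f = "\<lambda>s. (r + int p * s) mod int q"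
  have inj: "inj_on ?f {0..<int q}"
  proof (rule inj_onI)
    fix s t assume st: "s \<in> {0..<int q}" "t \<in> {0..<int q}" "?f s = ?f t"
    then have "int q dvd (r + int p * s) - (r + int p * t)" by (meson mod_eq_dvd_iff)
    then have "int q dvd int p * (s - t)" by (simp add: algebra_simps)
    then have "int q dvd s - t" using assms(1) by (simp add: coprime_dvd_mult_right_iff coprime_commute)
    then have "s mod int q = t mod int q" by (simp add: mod_eq_dvd_iff)
    then show "s = t" using st by simp
  qed
  have "?f ` {0..<int q} = {0..<int q}"
  proof (rule card_subset_eq)
    show "?f ` {0..<int q} \<subseteq> {0..<int q}" using assms(2) by auto
  qed (use card_image[OF inj] in auto)
  then have "R \<subseteq> ?f ` {0..<int q}" using assms(3) by simp
  then have "?f ` {s\<in>{0..<int q}. ?f s \<in> R} = R" by auto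
  moreover have "inj_on ?f {s\<in>{0..<int q}. ?f s \<in> R}" using inj by (rule inj_on_subset) auto
  ultimately show ?thesis by (metis (no_types, lifting) card_image)
qed

text \<open>Induction on the moduli: the forbidden classes modulo p are removed from the integers
  that survive \<open>Q\<close>. A class r + p t is an interval in t, shorter by the factor p, whose
  forbidden sets modulo the other primes are affine preimages of the same sizes, so the induction
  hypothesis applies to it. The error counts the terms of the inclusion-exclusion.\<close>

lemma interval_sieve:
  fixes R :: "nat \<Rightarrow> int set"
  shows "\<lbrakk>finite Q; \<forall>q\<in>Q. prime q; \<forall>q\<in>Q. R q \<subseteq> {0..<int q}; u \<le> (v::real)\<rbrakk> \<Longrightarrow>
    \<bar>real (card {t::int. u \<le> of_int t \<and> of_int t \<le> v \<and> (\<forall>q\<in>Q. t mod int q \<notin> R q)}) - (v - u) * (\<Prod>q\<in>Q. 1 - real (card (R q)) / real q)\<bar>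
      \<le> (\<Prod>q\<in>Q. 1 + real (card (R q)))"
proof (induction Q arbitrary: R u v rule: finite_induct)
  case empty
  then show ?case using card_int_interval(2)[of u v] by simp
next
  case (insert p Q)
  have p: "prime p" "0 < p" and Q: "\<forall>q\<in>Q. prime q" and R: "\<forall>q\<in>Q. R q \<subseteq> {0..<int q}" "R p \<subseteq> {0..<int p}"
    using insert.prems by (auto simp: prime_gt_0_nat)
  define good where "good t \<longleftrightarrow> (\<forall>q\<in>Q. t mod int q \<notin> R q)" for t :: int
  define \<pi> where "\<pi> = (\<Prod>q\<in>Q. 1 - real (card (R q)) / real q)"
  define \<epsilon> where "\<epsilon> = (\<Prod>q\<in>Q. 1 + real (card (R q)))"
  define G where "G = {t::int. u \<le> of_int t \<and> of_int t \<le> v \<and> good t}"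
  have finG: "finite G" unfolding G_def
    by (rule finite_subset[OF _ card_int_interval(1)[OF insert.prems(3)]]) auto
  have cG: "\<bar>real (card G) - (v - u) * \<pi>\<bar> \<le> \<epsilon>"
    unfolding G_def good_def \<pi>_def \<epsilon>_def using insert.IH[OF Q R(1) insert.prems(3)] .
  define S where "S r = {t\<in>G. int p dvd t - r}" for r
  have cS: "\<bar>real (card (S r)) - (v - u) / real p * \<pi>\<bar> \<le> \<epsilon>" if "r \<in> R p" for r
  proof -
    define R' where "R' q = {s\<in>{0..<int q}. (r + int p * s) mod int q \<in> R q}" for q
    have cR': "card (R' q) = card (R q)" if "q \<in> Q" for q
    proof -
      have "p \<noteq> q" "prime q" using that insert.hyps Q by auto
      then show ?thesis
        unfolding R'_def using that R p by (intro card_affine_preimage) (auto simp: primes_coprime prime_gt_0_nat)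
    qed
    have gd: "good (r + int p * t) \<longleftrightarrow> (\<forall>q\<in>Q. t mod int q \<notin> R' q)" for t
    proof -
      have "(r + int p * t) mod int q = (r + int p * (t mod int q)) mod int q" for q
        by (metis mod_add_right_eq mod_mult_right_eq)
      moreover have "t mod int q \<in> {0..<int q}" if "q \<in> Q" for q
        using that Q by (simp add: prime_gt_0_nat)
      ultimately show ?thesis unfolding good_def R'_def by auto
    qed
    have "S r = {x. u \<le> of_int x \<and> of_int x \<le> v \<and> int p dvd x - r \<and> good x}"
      unfolding S_def G_def by auto
    then have "card (S r) = card {t. (u - of_int r) / real p \<le> of_int t \<and> of_int t \<le> (v - of_int r) / real p \<and> good (r + int p * t)}"
      using bij_betw_same_card[OF bij_betw_progression[OF p(2), of r u v good]] by simp
    moreover have "\<bar>real (card {t::int. (u - of_int r) / real p \<le> of_int t \<and> of_int t \<le> (v - of_int r) / real p \<and> (\<forall>q\<in>Q. t mod int q \<notin> R' q)})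
        - ((v - of_int r) / real p - (u - of_int r) / real p) * (\<Prod>q\<in>Q. 1 - real (card (R' q)) / real q)\<bar> \<le> (\<Prod>q\<in>Q. 1 + real (card (R' q)))"
      using insert.prems(3) p by (intro insert.IH Q) (auto simp: R'_def divide_right_mono)
    moreover have "(\<Prod>q\<in>Q. 1 - real (card (R' q)) / real q) = \<pi>" "(\<Prod>q\<in>Q. 1 + real (card (R' q))) = \<epsilon>"
      unfolding \<pi>_def \<epsilon>_def using cR' by auto
    moreover have "(v - of_int r) / real p - (u - of_int r) / real p = (v - u) / real p"
      by (simp add: diff_divide_distrib)
    ultimately show ?thesis using gd by simp
  qed
  have eq: "{t::int. u \<le> of_int t \<and> of_int t \<le> v \<and> (\<forall>q\<in>insert p Q. t mod int q \<notin> R q)} = G - (\<Union>r\<in>R p. S r)"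
  proof -
    have "t mod int p \<in> R p \<longleftrightarrow> (\<exists>r\<in>R p. int p dvd t - r)" for t
    proof
      assume "t mod int p \<in> R p"
      then show "\<exists>r\<in>R p. int p dvd t - r" by (intro bexI[of _ "t mod int p"]) auto
    next
      assume "\<exists>r\<in>R p. int p dvd t - r"
      then obtain r where r: "r \<in> R p" "int p dvd t - r" by blast
      then have "t mod int p = r mod int p" by (simp add: mod_eq_dvd_iff)
      moreover have "r mod int p = r" using r(1) R(2) by (intro mod_pos_pos_trivial) auto
      ultimately show "t mod int p \<in> R p" using r by simp
    qed
    then show ?thesis unfolding S_def G_def good_def by auto
  qed
  have fR: "finite (R p)" using R(2) by (rule finite_subset) auto
  have "card (\<Union>r\<in>R p. S r) = (\<Sum>r\<in>R p. card (S r))"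
  proof (rule card_UN_disjoint[OF fR])
    show "\<forall>i\<in>R p. finite (S i)" using finG unfolding S_def by auto
    show "\<forall>i\<in>R p. \<forall>j\<in>R p. i \<noteq> j \<longrightarrow> S i \<inter> S j = {}"
    proof (intro ballI impI)
      fix i j assume ij: "i \<in> R p" "j \<in> R p" "i \<noteq> j"
      have "i = j" if "t \<in> S i" "t \<in> S j" for t
      proof -
        have "i mod int p = j mod int p" using that unfolding S_def
          by (metis (mono_tags, lifting) mem_Collect_eq mod_eq_dvd_iff)
        moreover have "i mod int p = i" "j mod int p = j"
          using ij R(2) by (auto intro!: mod_pos_pos_trivial)
        ultimately show ?thesis by simp
      qed
      then show "S i \<inter> S j = {}" using ij by auto
    qed
  qed
  moreover have "card (G - (\<Union>r\<in>R p. S r)) = card G - card (\<Union>r\<in>R p. S r)"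
    by (intro card_Diff_subset finite_subset[OF _ finG]) (auto simp: S_def)
  moreover have "card (\<Union>r\<in>R p. S r) \<le> card G"
    by (intro card_mono finG) (auto simp: S_def)
  ultimately have "real (card (G - (\<Union>r\<in>R p. S r))) = real (card G) - (\<Sum>r\<in>R p. real (card (S r)))"
    by (simp add: of_nat_diff)
  moreover have "\<bar>(\<Sum>r\<in>R p. real (card (S r))) - (\<Sum>r\<in>R p. (v - u) / real p * \<pi>)\<bar> \<le> (\<Sum>r\<in>R p. \<epsilon>)"
    unfolding sum_subtractf[symmetric] using cS by (intro order_trans[OF sum_abs] sum_mono) auto
  ultimately have "\<bar>real (card (G - (\<Union>r\<in>R p. S r))) - (v - u) * ((1 - real (card (R p)) / real p) * \<pi>)\<bar> \<le> (1 + real (card (R p))) * \<epsilon>"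
    using cG by (simp add: algebra_simps abs_le_iff)
  then show ?case unfolding eq using insert.hyps by (simp add: \<pi>_def \<epsilon>_def)
qed

lemma crt_dvd:
  fixes m1 m2 c :: int
  assumes "coprime m1 m2"
  obtains r where "\<And>x. (m1 dvd x \<and> m2 dvd x + c) \<longleftrightarrow> m1 * m2 dvd x - r"
proof -
  obtain u v where uv: "u * m1 + v * m2 = 1"
    using assms by (metis bezout_int coprime_iff_gcd_eq_1)
  define r where "r = - c * u * m1"
  have r2: "r + c = c * v * m2"
  proof -
    have "r + c = c * (1 - u * m1)" by (simp add: r_def algebra_simps)
    also have "1 - u * m1 = v * m2" using uv by simp
    finally show ?thesis by simp
  qed
  have "(m1 dvd x \<and> m2 dvd x + c) \<longleftrightarrow> m1 * m2 dvd x - r" for x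
  proof -
    have "m1 dvd x \<longleftrightarrow> m1 dvd x - r" by (simp add: r_def dvd_diff_left_iff)
    moreover have "m2 dvd x + c \<longleftrightarrow> m2 dvd x - r"
    proof -
      have "x + c = (x - r) + c * v * m2" using r2 by simp
      then show ?thesis by (metis dvd_add_left_iff dvd_triv_right)
    qed
    ultimately show ?thesis using assms by (metis divides_mult dvd_mult_left dvd_mult_right)
  qed
  then show ?thesis by (rule that)
qed

text \<open>A common factor of a2 and x divides c and is therefore a unit, so the gcd with a1 a2
  sees only a1. The splitting is thus determined by the product and x.\<close>

lemma coprime_split_unique:
  fixes a1 a2 :: nat and c x :: int
  assumes "coprime (int (a1 * a2)) c" "int a1 dvd x" "int a2 dvd x + c"
  shows "int a1 = gcd (int (a1 * a2)) x"
proof -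
  have "coprime (int a2) x"
  proof (rule coprimeI)
    fix d assume d: "d dvd int a2" "d dvd x"
    then have "d dvd c" using assms(3) by (metis dvd_add_right_iff dvd_trans)
    moreover have "d dvd int (a1 * a2)" using d by simp
    ultimately show "is_unit d" using assms(1) by (metis coprime_common_divisor)
  qed
  then have "gcd (int (a1 * a2)) x = gcd (int a1) x"
    by (simp add: gcd_mult_left_right_cancel coprime_commute)
  then show ?thesis using assms(2) by (simp add: gcd_proj1_iff)
qed

text \<open>Take a1 = gcd(a, x). The cofactor a2 is coprime to x / a1, hence divides x + c, and a
  common factor of a1 and a2 would divide c.\<close>

lemma coprime_split_exists:
  fixes a :: nat and c x :: int
  assumes "a > 0" "coprime (int a) c" "int a dvd x * (x + c)"
  obtains a1 a2 where "a = a1 * a2" "coprime a1 a2" "int a1 dvd x" "int a2 dvd x + c"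
proof -
  define a1 where "a1 = nat (gcd (int a) x)"
  have a1: "int a1 = gcd (int a) x" by (simp add: a1_def)
  then have "int a1 dvd int a" by simp
  then obtain a2 where a2: "a = a1 * a2" by (auto elim: dvdE)
  have a10: "int a1 \<noteq> 0" using a2 assms(1) by auto
  obtain y where y: "x = int a1 * y" using a1 by (metis dvdE gcd_dvd2)
  have cop: "coprime (int a2) y"
  proof -
    have "int a1 * gcd (int a2) y = int a1"
      using a1 a2 y by (metis abs_of_nat gcd_mult_distrib_int of_nat_mult)
    then show ?thesis using a10 by (simp add: coprime_iff_gcd_eq_1)
  qed
  have "int a1 * int a2 dvd int a1 * (y * (x + c))" using assms(3) a2 y by (simp add: mult.assoc)
  then have "int a2 dvd y * (x + c)" using a10 by simp
  then have d2: "int a2 dvd x + c" using cop by (simp add: coprime_dvd_mult_right_iff)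
  have "coprime (int a1) (int a2)"
  proof (rule coprimeI)
    fix d assume d: "d dvd int a1" "d dvd int a2"
    have "d dvd x" "d dvd x + c" using d d2 y by (auto intro: dvd_trans)
    then have "d dvd c" by (metis dvd_add_right_iff)
    moreover have "d dvd int a" using d a2 by simp
    ultimately show "is_unit d" using assms(2) by (metis coprime_common_divisor)
  qed
  then show ?thesis using that[OF a2] d2 y by simp
qed

text \<open>The sign change is an involution of the surface, and x1 x3 = x2^2 > 0 keeps
  \<open>x3\<close> away from 0, so each pair contains exactly one point with \<open>x3 > 0\<close>.
  For infinite sets both cardinalities are 0.\<close>

lemma point_count_half:
  assumes "\<And>x0 x1 x2 x3 x4. integ (- x0, - x1, x2, - x3, x4) = integ (x0, x1, x2, x3, x4)"
    and "\<And>x0 x1 x2 x3 x4. H (- x0, - x1, x2, - x3, x4) = H (x0, x1, x2, x3, x4)"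
  shows "point_count integ H B =
    2 * card {(x0, x1, x2, x3, x4). (x0, x1, x2, x3, x4) \<in> dP4 \<and> x2 > 0 \<and> x3 > 0 \<and> integ (x0, x1, x2, x3, x4) \<and> real_of_int (H (x0, x1, x2, x3, x4)) \<le> B}"
    (is "_ = 2 * card ?P")
proof -
  let ?S = "{x \<in> dP4 \<inter> V_reps. integ x \<and> real_of_int (H x) \<le> B}"
  define h where "h = (\<lambda>(x0 :: int, x1 :: int, x2 :: int, x3 :: int, x4 :: int). (- x0, - x1, x2, - x3, x4))"
  have hh: "h (h x) = x" for x by (auto simp: h_def split: prod.splits)
  have inj: "inj_on h A" for A by (metis hh inj_onI)
  define pos where "pos = (\<lambda>(x0 :: int, x1 :: int, x2 :: int, x3 :: int, x4 :: int). x3 > 0)"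
  have hS: "h x \<in> ?S" if "x \<in> ?S" for x
  proof -
    obtain x0 x1 x2 x3 x4 where e: "x = (x0, x1, x2, x3, x4)" by (cases x) auto
    have "h x \<in> dP4 \<inter> V_reps" using that unfolding e h_def
      by (auto simp: dP4_def V_reps_def algebra_simps)
    moreover have "integ (h x) = integ x" "H (h x) = H x" unfolding e h_def by (simp_all add: assms)
    ultimately show ?thesis using that by simp
  qed
  have P: "?P = {x \<in> ?S. pos x}" by (auto simp: pos_def V_reps_def)
  have pos: "pos x \<longleftrightarrow> \<not> pos (h x)" if "x \<in> ?S" for x
  proof -
    obtain x0 x1 x2 x3 x4 where e: "x = (x0, x1, x2, x3, x4)" by (cases x) auto
    have dp: "(x0, x1, x2, x3, x4) \<in> dP4" "x2 > 0" using that e by (auto simp: V_reps_def)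
    then have "x1 * x3 = x2\<^sup>2" by (auto simp: dP4_def)
    then have "x3 \<noteq> 0" using dp by auto
    then show ?thesis unfolding e h_def pos_def by auto
  qed
  define S where "S = ?S"
  define Q where "Q = {x \<in> S. pos x}"
  have "S = Q \<union> h ` Q"
  proof (intro equalityI subsetI)
    fix x assume x: "x \<in> S"
    show "x \<in> Q \<union> h ` Q"
    proof (cases "pos x")
      case False
      then have "h x \<in> Q" using x hS[of x] pos[of x] unfolding Q_def S_def by blast
      then show ?thesis by (metis hh UnI2 image_eqI)
    qed (use x in \<open>simp add: Q_def\<close>)
  next
    fix x assume "x \<in> Q \<union> h ` Q"
    then show "x \<in> S" unfolding Q_def S_def using hS by blast
  qed
  moreover have "Q \<inter> h ` Q = {}" using pos unfolding Q_def S_def by blast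
  moreover have "card (h ` Q) = card Q" by (rule card_image[OF inj])
  ultimately have "card S = 2 * card Q"
    by (cases "finite Q") (simp_all add: card_Un_disjoint finite_image_iff[OF inj])
  moreover have "?P = Q" unfolding Q_def S_def by (rule P)
  ultimately show ?thesis by (simp add: point_count_def S_def)
qed

text \<open>The explicit estimates carry no factor ln (ln B); the shift in \<open>ln B + 1\<close>
  keeps them meaningful down to B = 1. Both differences are absorbed as B tends to infinity.\<close>

lemma bigo_of_bound:
  fixes F :: "real \<Rightarrow> real"
  assumes "\<And>B. B \<ge> 1 \<Longrightarrow> \<bar>F B\<bar> \<le> C * (B * (ln B + 1) ^ k)"
  shows "F \<in> O[at_top](\<lambda>B. B * ln B ^ k * ln (ln B))"
proof -
  have "F \<in> O[at_top](\<lambda>B. B * (ln B + 1) ^ k)"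
  proof (rule bigoI[of _ C])
    show "\<forall>\<^sub>F B in at_top. norm (F B) \<le> C * norm (B * (ln B + 1) ^ k)"
      using eventually_ge_at_top[of 1]
    proof eventually_elim
      case (elim B)
      then show ?case using assms[OF elim] by (simp add: abs_mult)
    qed
  qed
  also have "(\<lambda>B::real. B * (ln B + 1) ^ k) \<in> O[at_top](\<lambda>B. B * ln B ^ k * ln (ln B))"
  proof -
    have "(\<lambda>B::real. ln B + 1) \<in> O[at_top](\<lambda>B. ln B)" by real_asymp
    then have "(\<lambda>B::real. (ln B + 1) ^ k) \<in> O[at_top](\<lambda>B. ln B ^ k)"
      by (rule landau_o.big_power)
    moreover have "(\<lambda>B::real. B) \<in> O[at_top](\<lambda>B. B * ln (ln B))" by real_asymp
    ultimately have "(\<lambda>B::real. B * (ln B + 1) ^ k) \<in> O[at_top](\<lambda>B. (B * ln (ln B)) * ln B ^ k)"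
      by (rule landau_o.big.mult[rotated])
    then show ?thesis by (simp add: mult_ac)
  qed
  finally show ?thesis .
qed

section \<open>Tools for evaluating weights, integrals and heights\<close>

lemma min_1_multiplicity:
  "prime p \<Longrightarrow> 0 < x \<Longrightarrow> min (Suc 0) (multiplicity p x) = (if p dvd x then 1 else 0)" for p x :: nat
  using prime_multiplicity_gt_zero_iff[of p x] by (auto simp: min_def not_dvd_imp_multiplicity_0)

lemma min_2_multiplicity:
  fixes p x :: nat
  assumes "prime p" "0 < x"
  shows "min 2 (multiplicity p x) = (if p ^ 2 dvd x then 2 else if p dvd x then 1 else 0)"
proof -
  have "\<not> is_unit p" using assms not_prime_unit by blast
  then show ?thesis
    using assms(2) power_dvd_iff_le_multiplicity[of x p 2] power_dvd_iff_le_multiplicity[of x p 1]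
    by (cases "p ^ 2 dvd x"; cases "p dvd x") auto
qed

lemma prod_if_zero:
  "finite A \<Longrightarrow> (\<Prod>p\<in>A. if P p then v p else 0) = (if \<forall>p\<in>A. P p then \<Prod>p\<in>A. v p else (0::real))"
  by (induction A rule: finite_induct) auto

lemma coprime_iff_no_prime:
  "coprime a b \<longleftrightarrow> (\<forall>p. prime p \<longrightarrow> p \<le> N \<longrightarrow> \<not> (p dvd a \<and> p dvd b))" if "0 < a" "a \<le> N" for a b N :: nat
proof
  assume "coprime a b"
  then show "\<forall>p. prime p \<longrightarrow> p \<le> N \<longrightarrow> \<not> (p dvd a \<and> p dvd b)"
    by (meson coprime_common_divisor not_prime_unit)
next
  assume *: "\<forall>p. prime p \<longrightarrow> p \<le> N \<longrightarrow> \<not> (p dvd a \<and> p dvd b)"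
  show "coprime a b"
  proof (rule ccontr)
    assume "\<not> coprime a b"
    then obtain p where "prime p" "p dvd gcd a b"
      by (metis coprime_iff_gcd_eq_1 prime_factor_nat)
    moreover from this have "p \<le> a" using that by (auto intro!: dvd_imp_le)
    ultimately show False using * that by auto
  qed
qed

lemma abs_diff_scale: "0 \<le> c \<Longrightarrow> \<bar>u - v\<bar> \<le> e \<Longrightarrow> \<bar>c * u - c * v\<bar> \<le> c * e" for c e u v :: real
  by (metis abs_mult abs_of_nonneg mult_left_mono right_diff_distrib)

lemma le_nat_floor_iff: "0 \<le> B \<Longrightarrow> m \<le> nat \<lfloor>B\<rfloor> \<longleftrightarrow> real m \<le> B"
  by (simp add: le_nat_iff le_floor_iff)

text \<open>Regions are integrated one variable at a time, with an upper limit c that depends on the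
  outer variables.\<close>

lemma integral_cutoff:
  fixes F G :: "real \<Rightarrow> real"
  assumes "0 \<le> c" "c \<le> T" "\<And>t. 0 \<le> t \<Longrightarrow> t \<le> c \<Longrightarrow> (G has_real_derivative F t) (at t)"
  shows "integral {0..T} (\<lambda>t. if t \<le> c then F t else 0) = G c - G 0"
proof -
  have "(F has_integral (G c - G 0)) {0..c}"
    using assms by (intro fundamental_theorem_of_calculus)
      (auto simp: has_real_derivative_iff_has_vector_derivative[symmetric] intro: has_field_derivative_at_within)
  moreover have "{0..c} \<subseteq> {0..T}" using assms by auto
  ultimately have "((\<lambda>t. if t \<in> {0..c} then F t else 0) has_integral (G c - G 0)) {0..T}"
    by (subst has_integral_restrict) auto
  then have "integral {0..T} (\<lambda>t. if t \<in> {0..c} then F t else 0) = G c - G 0" by (rule integral_unique)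
  moreover have "integral {0..T} (\<lambda>t. if t \<le> c then F t else 0) = integral {0..T} (\<lambda>t. if t \<in> {0..c} then F t else 0)"
    by (intro integral_cong) auto
  ultimately show ?thesis by simp
qed

lemma Max_le_real_iff:
  assumes "finite A" "A \<noteq> {}"
  shows "real_of_int (Max A) \<le> B \<longleftrightarrow> (\<forall>x\<in>A. real_of_int x \<le> B)"
  using assms by (simp add: le_floor_iff[symmetric])

lemma H_le_iff:
  "real_of_int (H1 (x0, x1, x2, x3, x4)) \<le> B \<longleftrightarrow> real_of_int \<bar>x0\<bar> \<le> B \<and> real_of_int \<bar>x2\<bar> \<le> B \<and> real_of_int \<bar>x3\<bar> \<le> B \<and> real_of_int \<bar>x4\<bar> \<le> B"
  "real_of_int (H2 (x0, x1, x2, x3, x4)) \<le> B \<longleftrightarrow> real_of_int \<bar>x0\<bar> \<le> B \<and> real_of_int \<bar>x1\<bar> \<le> B \<and> real_of_int \<bar>x2\<bar> \<le> B \<and> real_of_int \<bar>x3\<bar> \<le> B"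
  "real_of_int (H3 (x0, x1, x2, x3, x4)) \<le> B \<longleftrightarrow> real_of_int \<bar>x0\<bar> \<le> B \<and> real_of_int \<bar>x2\<bar> \<le> B \<and> real_of_int \<bar>x3\<bar> \<le> B \<and> (real_of_int \<bar>x1\<bar> \<le> B \<or> real_of_int \<bar>x4\<bar> \<le> B)"
  "real_of_int (H4 (x0, x1, x2, x3, x4)) \<le> B \<longleftrightarrow> real_of_int \<bar>x0\<bar> \<le> B \<and> real_of_int \<bar>x2\<bar> \<le> B \<and> real_of_int \<bar>x3\<bar> \<le> B"
  "real_of_int (H5 (x0, x1, x2, x3, x4)) \<le> B \<longleftrightarrow> real_of_int \<bar>x0\<bar> \<le> B \<and> real_of_int \<bar>x1\<bar> \<le> B \<and> real_of_int \<bar>x2\<bar> \<le> B"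
  unfolding H1_def H2_def H3_def H4_def H5_def prod.case
  by (subst Max_le_real_iff; auto simp: min_def)+

text \<open>Controls the rounding errors for pairs: one unit for each pair with product at most
  B.\<close>

lemma card_multiples_le:
  assumes "1 \<le> B"
  shows "(\<Sum>a=1..nat \<lfloor>B\<rfloor>. real (card {b\<in>{1..nat \<lfloor>B\<rfloor>}. real (a * b) \<le> B})) \<le> B * (ln B + 1)"
proof -
  have "real (card {b\<in>{1..nat \<lfloor>B\<rfloor>}. real (a * b) \<le> B}) \<le> B * (1 / real a)" if "a \<in> {1..nat \<lfloor>B\<rfloor>}" for a
  proof -
    have a: "0 < real a" using that by auto
    have "{b\<in>{1..nat \<lfloor>B\<rfloor>}. real (a * b) \<le> B} \<subseteq> {1..nat \<lfloor>B / real a\<rfloor>}"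
      using a assms by (auto simp: le_nat_floor_iff field_simps)
    then have "card {b\<in>{1..nat \<lfloor>B\<rfloor>}. real (a * b) \<le> B} \<le> nat \<lfloor>B / real a\<rfloor>"
      using card_mono[of "{1..nat \<lfloor>B / real a\<rfloor>}"] by simp
    moreover have "real (nat \<lfloor>B / real a\<rfloor>) \<le> B / real a" using a assms by (intro of_nat_floor) auto
    ultimately show ?thesis by simp
  qed
  then have "(\<Sum>a=1..nat \<lfloor>B\<rfloor>. real (card {b\<in>{1..nat \<lfloor>B\<rfloor>}. real (a * b) \<le> B})) \<le> (\<Sum>a=1..nat \<lfloor>B\<rfloor>. B * (1 / real a))"
    by (intro sum_mono)
  also have "\<dots> \<le> B * (ln B + 1)"
    unfolding sum_distrib_left[symmetric] using sum_inverse_le[OF assms] assms by (intro mult_left_mono) auto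
  finally show ?thesis .
qed

lemma card_residue_window:
  assumes "0 < m" "0 \<le> B"
    and "\<And>x. P x \<longleftrightarrow> int m dvd x - r"
  shows "finite {x::int. real_of_int \<bar>x\<bar> \<le> B \<and> P x}"
    "\<bar>real (card {x::int. real_of_int \<bar>x\<bar> \<le> B \<and> P x}) - 2 * B / real m\<bar> \<le> 1"
proof -
  have eq: "{x::int. real_of_int \<bar>x\<bar> \<le> B \<and> P x} = {x::int. - B \<le> of_int x \<and> of_int x \<le> B \<and> int m dvd x - r}"
    unfolding assms(3) by (auto simp: abs_le_iff)
  show "finite {x::int. real_of_int \<bar>x\<bar> \<le> B \<and> P x}" "\<bar>real (card {x::int. real_of_int \<bar>x\<bar> \<le> B \<and> P x}) - 2 * B / real m\<bar> \<le> 1"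
    unfolding eq using card_progression[of m "- B" B r] assms by auto
qed

subsection \<open>The complement of a line through both singularities\<close>

text \<open>
  By integrality \<open>x\<^sub>3 = \<plusminus>1\<close>; if \<open>x\<^sub>3 = 1\<close>, then \<open>x\<^sub>2\<close> is the product of the entries of a list \<open>[a\<^sub>1, a\<^sub>2]\<close> with \<open>a\<^sub>1 dvd x\<^sub>0\<close> and \<open>a\<^sub>2 dvd x\<^sub>0 + 1\<close>.
\<close>

definition weight4 :: "nat \<Rightarrow> nat list \<Rightarrow> real" where
  "weight4 p r = (if r ! 0 \<ge> 1 \<and> r ! 1 \<ge> 1 then 0 else 1)"

text \<open>The height condition \<open>x2 \<le> B\<close> in logarithms; the bound on
  \<open>x0\<close> is the window of the fibre.\<close>

definition region4 :: "real \<Rightarrow> real list \<Rightarrow> real" where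
  "region4 T ts = (if ts ! 0 + ts ! 1 \<le> T then 1 else 0)"

lemma weight4_eq:
  assumes "a \<in> {1..N}" "b \<in> {1..N}"
  shows "weight [1, 1] weight4 N [a, b] = (if coprime a b then 1 else 0)"
proof -
  have fin: "finite {p. prime p \<and> p \<le> N}" by (rule finite_subset[of _ "{..N}"]) auto
  have "weight [1, 1] weight4 N [a, b] = (\<Prod>p\<in>{p. prime p \<and> p \<le> N}. if \<not> (p dvd a \<and> p dvd b) then 1 else 0)"
    unfolding weight_def local_weight_def using assms
    by (intro prod.cong) (auto simp: weight4_def min_1_multiplicity)
  then show ?thesis unfolding prod_if_zero[OF fin] using assms coprime_iff_no_prime[of a N b] by auto
qed

lemma antitone_cutoff_region4: "0 \<le> T \<Longrightarrow> antitone_cutoff 2 T 1 (region4 T)"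
  unfolding antitone_cutoff_def region4_def
  by (auto simp: numeral_2_eq_2 length_Suc_conv list_all2_Cons1)

lemma integral_region4: "0 \<le> T \<Longrightarrow> iterated_integral 2 T (region4 T) = T ^ 2 / 2"
proof -
  assume T: "0 \<le> T"
  have inner: "integral {0..T} (\<lambda>s. if t + s \<le> T then 1 else 0) = T - t" if "t \<in> {0..T}" for t
  proof -
    have "integral {0..T} (\<lambda>s. if s \<le> T - t then 1 else 0) = (T - t) - 0"
      using that by (intro integral_cutoff) (auto intro!: derivative_eq_intros)
    moreover have "t + s \<le> T \<longleftrightarrow> s \<le> T - t" for s by linarith
    ultimately show ?thesis by simp
  qed
  have "iterated_integral 2 T (region4 T) = integral {0..T} (\<lambda>t. T - t)"
  proof -
    have "iterated_integral 2 T (region4 T) = integral {0..T} (\<lambda>t. integral {0..T} (\<lambda>s. if t + s \<le> T then 1 else 0))"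
      unfolding numeral_2_eq_2 by (simp add: region4_def)
    also have "\<dots> = integral {0..T} (\<lambda>t. T - t)" by (rule integral_cong[OF inner])
    finally show ?thesis .
  qed
  also have "\<dots> = integral {0..T} (\<lambda>t. if t \<le> T then T - t else 0)"
    by (intro integral_cong) auto
  also have "\<dots> = (T * T - T ^ 2 / 2) - (T * 0 - 0 ^ 2 / 2)"
    using T by (intro integral_cutoff) (auto intro!: derivative_eq_intros)
  finally show ?thesis by (simp add: power2_eq_square)
qed

text \<open>The relation may mention only those coordinates that determine a point, so no inverse
  map has to be written down.\<close>

lemma card_eq_relation:
  assumes "\<And>s. s \<in> S \<Longrightarrow> \<exists>t\<in>A. R s t" "\<And>t. t \<in> A \<Longrightarrow> \<exists>s\<in>S. R s t"
    and "\<And>s t t'. s \<in> S \<Longrightarrow> t \<in> A \<Longrightarrow> t' \<in> A \<Longrightarrow> R s t \<Longrightarrow> R s t' \<Longrightarrow> t = t'"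
    and "\<And>s s' t. s \<in> S \<Longrightarrow> s' \<in> S \<Longrightarrow> t \<in> A \<Longrightarrow> R s t \<Longrightarrow> R s' t \<Longrightarrow> s = s'"
  shows "card S = card A"
proof -
  obtain f where f: "\<And>s. s \<in> S \<Longrightarrow> f s \<in> A \<and> R s (f s)" using assms(1) by metis
  have "inj_on f S" by (rule inj_onI) (metis assms(4) f)
  moreover have "f ` S = A"
  proof (intro equalityI subsetI)
    fix t assume "t \<in> A"
    then show "t \<in> f ` S" by (metis assms(2,3) f image_eqI)
  qed (use f in auto)
  ultimately show ?thesis using card_image by fastforce
qed

lemma dP4_determined:
  assumes "(x0, x1, x2, x3, x4) \<in> dP4" "(x0, y1, x2, x3, y4) \<in> dP4" "x2 > 0"
  shows "x1 = y1" "x4 = y4"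
proof -
  have "x1 * x3 = x2\<^sup>2" "y1 * x3 = x2\<^sup>2" using assms by (auto simp: dP4_def)
  moreover from this have "x3 \<noteq> 0" using assms(3) by auto
  ultimately show "x1 = y1" by (metis mult_right_cancel)
  have "x0\<^sup>2 + x0 * x3 + x2 * x4 = 0" "x0\<^sup>2 + x0 * x3 + x2 * y4 = 0" using assms(1,2) by (auto simp: dP4_def)
  then have "x2 * x4 = x2 * y4" by linarith
  then show "x4 = y4" using assms(3) by simp
qed

text \<open>A prime of \<open>x3\<close> passes to \<open>x2\<close> through the second equation and
  then to \<open>x0\<close> through the first. This forces \<open>x3 = \<plusminus>1\<close> when
  \<open>x0\<close>, \<open>x2\<close>, \<open>x3\<close> are coprime, and makes \<open>x1\<close>
  and \<open>x3\<close> coprime when the first four coordinates are.\<close>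

lemma prime_dvd_x0:
  fixes p :: int
  assumes "(x0, x1, x2, x3, x4) \<in> dP4" "prime p" "p dvd x3"
  shows "p dvd x2" "p dvd x0"
proof -
  have eqs: "x0\<^sup>2 + x0 * x3 + x2 * x4 = 0" "x1 * x3 = x2\<^sup>2" using assms(1) by (auto simp: dP4_def)
  have "p dvd x2\<^sup>2" using assms(3) eqs(2) by (metis dvd_mult)
  then show p2: "p dvd x2" using assms(2) by (simp add: prime_dvd_power_iff)
  have "x0\<^sup>2 = - (x0 * x3 + x2 * x4)" using eqs(1) by simp
  then have "p dvd x0\<^sup>2" using assms(3) p2 by (metis dvd_add dvd_minus_iff dvd_mult dvd_mult2)
  then show "p dvd x0" using assms(2) by (simp add: prime_dvd_power_iff)
qed

lemma Gcd_int_eq_1_iff: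
  assumes "finite A"
  shows "Gcd A = (1::int) \<longleftrightarrow> (\<forall>p. prime p \<longrightarrow> \<not> (\<forall>a\<in>A. p dvd a))"
proof
  assume g: "Gcd A = 1"
  show "\<forall>p. prime p \<longrightarrow> \<not> (\<forall>a\<in>A. p dvd a)"
  proof (intro allI impI notI)
    fix p :: int assume "prime p" "\<forall>a\<in>A. p dvd a"
    then have "p dvd Gcd A" by (intro Gcd_greatest) auto
    then show False using g \<open>prime p\<close> not_prime_unit by metis
  qed
next
  assume *: "\<forall>p. prime p \<longrightarrow> \<not> (\<forall>a\<in>A. p dvd a)"
  show "Gcd A = 1"
  proof (rule ccontr)
    assume "Gcd A \<noteq> 1"
    have "\<exists>p. prime p \<and> p dvd Gcd A"
    proof (cases "Gcd A = 0")
      case True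
      have "2 dvd Gcd A" unfolding True by simp
      then show ?thesis using two_is_prime_nat by (intro exI[of _ 2]) simp
    next
      case False
      moreover have "\<not> is_unit (Gcd A)" using \<open>Gcd A \<noteq> 1\<close> by simp
      ultimately show ?thesis using prime_divisor_exists[of "Gcd A"] by blast
    qed
    then show False using * by (meson Gcd_dvd dvd_trans)
  qed
qed

lemma card_N4_solutions:
  assumes B: "B \<ge> 1"
  shows "card {(x0, x1, x2, x3, x4). (x0, x1, x2, x3, x4) \<in> dP4 \<and> x2 > 0 \<and> x3 > 0 \<and> integral4 (x0, x1, x2, x3, x4) \<and> real_of_int (H4 (x0, x1, x2, x3, x4)) \<le> B}
   = card (SIGMA n:{n\<in>Box 2 (nat \<lfloor>B\<rfloor>). coprime (n ! 0) (n ! 1) \<and> real (n ! 0 * n ! 1) \<le> B}. {x::int. real_of_int \<bar>x\<bar> \<le> B \<and> int (n ! 0) dvd x \<and> int (n ! 1) dvd x + 1})"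
  (is "card ?S = card ?A")
proof (rule card_eq_relation[where R = "\<lambda>(x0, x1, x2, x3, x4) (n, x). x0 = x \<and> x2 = int (n ! 0 * n ! 1) \<and> x3 = 1"])
  fix s assume s: "s \<in> ?S"
  obtain x0 x1 x2 x3 x4 where e: "s = (x0, x1, x2, x3, x4)" by (cases s) auto
  have dp: "(x0, x1, x2, x3, x4) \<in> dP4" and pos: "x2 > 0" "x3 > 0"
    and g: "Gcd {x0, x2, x3} = 1" and h: "real_of_int \<bar>x0\<bar> \<le> B" "real_of_int \<bar>x2\<bar> \<le> B"
    using s unfolding e by (auto simp: integral4_def H_le_iff simp del: Gcd_insert)
  have x3: "x3 = 1"
  proof (rule ccontr)
    assume "x3 \<noteq> 1"
    then obtain p where p: "prime p" "p dvd x3" using pos(2) prime_divisor_exists[of x3] by auto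
    then show False using prime_dvd_x0[OF dp p] g Gcd_int_eq_1_iff[of "{x0, x2, x3}"] by auto
  qed
  define a where "a = nat x2"
  have a: "int a = x2" "a > 0" using pos by (auto simp: a_def)
  have "x0 * (x0 + 1) = x2 * (- x4)" using dp x3 by (simp add: dP4_def power2_eq_square algebra_simps)
  then have "int a dvd x0 * (x0 + 1)" using a by simp
  from coprime_split_exists[OF a(2) _ this] obtain a1 a2
    where sp: "a = a1 * a2" "coprime a1 a2" "int a1 dvd x0" "int a2 dvd x0 + 1" by auto
  have a12: "0 < a1" "0 < a2" using sp a by auto
  then have "a1 \<le> a" "a2 \<le> a" using sp by auto
  moreover have aB: "real a \<le> B" using h a by linarith
  ultimately have "[a1, a2] \<in> Box 2 (nat \<lfloor>B\<rfloor>)" using a12 B by (auto simp: Box_def le_nat_floor_iff)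
  then have "([a1, a2], x0) \<in> ?A" using sp h aB by simp
  then show "\<exists>t\<in>?A. (case s of (x0, x1, x2, x3, x4) \<Rightarrow> \<lambda>(n, x). x0 = x \<and> x2 = int (n ! 0 * n ! 1) \<and> x3 = 1) t"
    by (rule bexI[rotated]) (use a sp x3 e in auto)
next
  fix t assume t: "t \<in> ?A"
  obtain n x where e: "t = (n, x)" by (cases t)
  obtain a b where n: "n = [a, b]" "0 < a" "0 < b" using t e by (auto simp: Box_def numeral_2_eq_2 length_Suc_conv)
  have t': "real (a * b) \<le> B" "real_of_int \<bar>x\<bar> \<le> B" "int a dvd x" "int b dvd x + 1" using t e n by auto
  then have "int a * int b dvd x * (x + 1)" by (intro mult_dvd_mono)
  then obtain q where "x * (x + 1) = int (a * b) * q" by (auto elim: dvdE)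
  \<comment> \<open>Here \<open>x1\<close> is x2^2 / x3 with \<open>x3 = 1\<close>, and
    \<open>x4\<close> is solved from the first equation.\<close>
  then have "(x, (int (a * b))\<^sup>2, int (a * b), 1, - q) \<in> ?S"
    using n t' B by (auto simp: dP4_def integral4_def H_le_iff power2_eq_square algebra_simps)
  then show "\<exists>s\<in>?S. (case s of (x0, x1, x2, x3, x4) \<Rightarrow> \<lambda>(n, x). x0 = x \<and> x2 = int (n ! 0 * n ! 1) \<and> x3 = 1) t"
    by (rule bexI[rotated]) (use e n in auto)
next
  fix s t t' assume tt: "t \<in> ?A" "t' \<in> ?A"
    and R: "(case s of (x0, x1, x2, x3, x4) \<Rightarrow> \<lambda>(n, x). x0 = x \<and> x2 = int (n ! 0 * n ! 1) \<and> x3 = 1) t"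
      "(case s of (x0, x1, x2, x3, x4) \<Rightarrow> \<lambda>(n, x). x0 = x \<and> x2 = int (n ! 0 * n ! 1) \<and> x3 = 1) t'"
  obtain n x where e: "t = (n, x)" by (cases t)
  obtain m y where e': "t' = (m, y)" by (cases t')
  obtain a b where n: "n = [a, b]" "0 < a" "0 < b" using tt e by (auto simp: Box_def numeral_2_eq_2 length_Suc_conv)
  obtain c d where m: "m = [c, d]" "0 < c" "0 < d" using tt e' by (auto simp: Box_def numeral_2_eq_2 length_Suc_conv)
  have xy: "x = y" "int (a * b) = int (c * d)" using R e e' n m by (auto split: prod.splits)
  have "int a = gcd (int (a * b)) x"
    using tt e n by (intro coprime_split_unique[of a b 1]) auto
  moreover have "int c = gcd (int (c * d)) y"
    using tt e' m by (intro coprime_split_unique[of c d 1]) auto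
  ultimately have "int a = int c" using xy by metis
  then show "t = t'" using xy n m e e' by simp
next
  fix s s' t assume ss: "s \<in> ?S" "s' \<in> ?S"
    and R: "(case s of (x0, x1, x2, x3, x4) \<Rightarrow> \<lambda>(n, x). x0 = x \<and> x2 = int (n ! 0 * n ! 1) \<and> x3 = 1) t"
      "(case s' of (x0, x1, x2, x3, x4) \<Rightarrow> \<lambda>(n, x). x0 = x \<and> x2 = int (n ! 0 * n ! 1) \<and> x3 = 1) t"
  obtain x0 x1 x2 x3 x4 where e: "s = (x0, x1, x2, x3, x4)" by (cases s) auto
  obtain y0 y1 y2 y3 y4 where e': "s' = (y0, y1, y2, y3, y4)" by (cases s') auto
  have "x0 = y0" "x2 = y2" "x3 = y3" using R e e' by (auto split: prod.splits)
  then show "s = s'" using dP4_determined[of x0 x1 x2 x3 x4 y1 y4] ss e e' by auto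
qed

text \<open>Common last step of the counts: a fibre over an admissible list has size
  \<open>c * v n\<close> up to \<open>e n\<close>, and the sieve evaluates the sum of the
  \<open>v n\<close> through the weighted terms \<open>W n\<close>.\<close>

lemma card_Sigma_asymptotic:
  fixes W v e :: "'a \<Rightarrow> real" and Y :: "'a \<Rightarrow> 'b set"
  assumes fin: "finite S" and c: "0 \<le> c"
    and W: "\<And>n. n \<in> S \<Longrightarrow> W n = (if P n then v n else 0)"
    and Y: "\<And>n. n \<in> S \<Longrightarrow> P n \<Longrightarrow> finite (Y n)" "\<And>n. n \<in> S \<Longrightarrow> P n \<Longrightarrow> \<bar>real (card (Y n)) - c * v n\<bar> \<le> e n"
    and X: "\<bar>(\<Sum>n\<in>S. W n) - X\<bar> \<le> E"
  shows "\<bar>real (card (SIGMA n:{n\<in>S. P n}. Y n)) - c * X\<bar> \<le> c * E + (\<Sum>n\<in>{n\<in>S. P n}. e n)"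
proof -
  let ?A = "{n\<in>S. P n}"
  have "card (SIGMA n:?A. Y n) = (\<Sum>n\<in>?A. card (Y n))" using fin Y(1) by (simp add: card_SigmaI)
  then have card: "real (card (SIGMA n:?A. Y n)) = (\<Sum>n\<in>?A. real (card (Y n)))" by simp
  have "\<bar>(\<Sum>n\<in>?A. real (card (Y n))) - (\<Sum>n\<in>?A. c * v n)\<bar> \<le> (\<Sum>n\<in>?A. e n)"
    unfolding sum_subtractf[symmetric] using Y(2) by (intro order_trans[OF sum_abs] sum_mono) auto
  moreover have "(\<Sum>n\<in>?A. c * v n) = c * (\<Sum>n\<in>S. W n)"
    unfolding sum_distrib_left[symmetric] using W by (simp add: sum.inter_filter[OF fin])
  moreover have "\<bar>c * (\<Sum>n\<in>S. W n) - c * X\<bar> \<le> c * E"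
    by (rule abs_diff_scale[OF c X])
  ultimately show ?thesis unfolding card by linarith
qed

text \<open>A fibre is a residue class modulo a b in [-B, B], of size 2 B / (a b) up to 1. With
  volume T^2 / 2 and the factor 2 from the sign of \<open>x3\<close> the constant is 2.\<close>

lemma asymptotic_N4:
  obtains C where "\<And>B. B \<ge> 1 \<Longrightarrow> \<bar>real (N4 B) - 2 * prime_prod (\<lambda>p. (1 - 1 / p) * (1 + 1 / p)) * B * ln B ^ 2\<bar> \<le> C * (B * (ln B + 1) ^ 1)"
proof -
  let ?D = "\<lambda>p::real. (1 - 1 / p) * (1 + 1 / p)"
  have len: "length [1, 1::nat] = 2" by simp
  obtain K where K: "K \<ge> 0" and Kb: "\<And>T M \<Psi>. \<lbrakk>0 \<le> T; antitone_cutoff 2 T M \<Psi>\<rbrakk> \<Longrightarrow>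
       \<bar>(\<Sum>n\<in>Box 2 (nat \<lfloor>exp T\<rfloor>). weight [1, 1] weight4 (nat \<lfloor>exp T\<rfloor>) n * (\<Psi> (map (\<lambda>x. ln (real x)) n) / real (prod_list n)))
          - prime_prod ?D * iterated_integral 2 T \<Psi>\<bar> \<le> K * ((T + 1) ^ (2 - 1) * M)"
  proof (rule sieve_log[where f = weight4 and cs = "[1, 1]" and C = 0 and D = ?D, unfolded len])
    fix p :: nat and e :: "nat list" assume "prime p" "length e = 2" "sum_list e = 1"
    then show "\<bar>weight4 p e - 1\<bar> \<le> 0 / real p" by (auto simp: numeral_2_eq_2 length_Suc_conv weight4_def)
  qed (auto simp: weight4_def numeral_2_eq_2 algebra_simps)
  have "\<bar>real (N4 B) - 2 * prime_prod ?D * B * ln B ^ 2\<bar> \<le> (4 * K + 2) * (B * (ln B + 1) ^ 1)" if B: "B \<ge> 1" for B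
  proof -
    define T where "T = ln B"
    define N where "N = nat \<lfloor>B\<rfloor>"
    have T: "0 \<le> T" "exp T = B" using B by (auto simp: T_def)
    define P where "P n \<longleftrightarrow> coprime (n ! 0) (n ! 1) \<and> real (n ! 0 * n ! 1) \<le> B" for n :: "nat list"
    define Y where "Y n = {x::int. real_of_int \<bar>x\<bar> \<le> B \<and> int (n ! 0) dvd x \<and> int (n ! 1) dvd x + 1}" for n :: "nat list"
    define W where "W n = weight [1, 1] weight4 N n * (region4 T (map (\<lambda>x. ln (real x)) n) / real (prod_list n))" for n
    have el: "\<exists>a b. n = [a, b] \<and> a \<in> {1..N} \<and> b \<in> {1..N}" if "n \<in> Box 2 N" for n
      using that by (auto simp: Box_def numeral_2_eq_2 length_Suc_conv)
    have main: "\<bar>real (card (SIGMA n:{n\<in>Box 2 N. P n}. Y n)) - 2 * B * (prime_prod ?D * (T ^ 2 / 2))\<bar>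
       \<le> 2 * B * (K * (T + 1)) + (\<Sum>n\<in>{n\<in>Box 2 N. P n}. 1)"
    proof (rule card_Sigma_asymptotic[where W = W and v = "\<lambda>n. 1 / real (prod_list n)"])
      fix n assume n: "n \<in> Box 2 N"
      obtain a b where ab: "n = [a, b]" "a \<in> {1..N}" "b \<in> {1..N}" using el[OF n] by blast
      have "ln (real a) + ln (real b) = ln (real (a * b))" using ab by (simp add: ln_mult)
      then have "ln (real a) + ln (real b) \<le> T \<longleftrightarrow> real (a * b) \<le> B" using ab B by (simp add: T_def)
      then show "W n = (if P n then 1 / real (prod_list n) else 0)"
        using weight4_eq[OF ab(2,3)] by (simp add: W_def P_def ab(1) region4_def)
      assume "P n"
      then have "coprime (int a) (int b)" using ab by (simp add: P_def)
      then obtain r where r: "\<And>x. (int a dvd x \<and> int b dvd x + 1) \<longleftrightarrow> int a * int b dvd x - r"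
        using crt_dvd by metis
      have "Y n = {x::int. real_of_int \<bar>x\<bar> \<le> B \<and> (int a dvd x \<and> int b dvd x + 1)}" by (simp add: Y_def ab)
      then show "finite (Y n)" "\<bar>real (card (Y n)) - 2 * B * (1 / real (prod_list n))\<bar> \<le> 1"
        using card_residue_window[of "a * b" B "\<lambda>x. int a dvd x \<and> int b dvd x + 1" r] r ab B by auto
    next
      show "\<bar>(\<Sum>n\<in>Box 2 N. W n) - prime_prod ?D * (T ^ 2 / 2)\<bar> \<le> K * (T + 1)"
        unfolding W_def using Kb[OF T(1) antitone_cutoff_region4[OF T(1)]] integral_region4[OF T(1)] T by (simp add: N_def)
    qed (use B in auto)
    have "N4 B = 2 * card (SIGMA n:{n\<in>Box 2 N. P n}. Y n)"
      unfolding N4_def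
      unfolding P_def Y_def N_def card_N4_solutions[OF B, symmetric]
      by (rule point_count_half) (simp_all add: integral4_def H4_def)
    moreover have "(\<Sum>n\<in>{n\<in>Box 2 N. P n}. 1) \<le> B * (T + 1)"
    proof -
      have "(\<Sum>n\<in>{n\<in>Box 2 N. P n}. 1) \<le> (\<Sum>n\<in>Box 2 N. if real (n ! 0 * n ! 1) \<le> B then 1 else (0::real))"
        unfolding P_def sum.inter_filter[OF finite_Box] by (intro sum_mono) auto
      also have "\<dots> = (\<Sum>a=1..N. \<Sum>b=1..N. if real (a * b) \<le> B then 1 else (0::real))"
        unfolding numeral_2_eq_2 by (simp add: sum_Box_Suc)
      also have "\<dots> = (\<Sum>a=1..N. real (card {b\<in>{1..N}. real (a * b) \<le> B}))"
        by (intro sum.cong refl) (simp add: sum.inter_filter[symmetric])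
      also have "\<dots> \<le> B * (T + 1)" using card_multiples_le[OF B] by (simp add: N_def T_def)
      finally show ?thesis .
    qed
    ultimately show ?thesis using main unfolding T_def by (simp add: algebra_simps abs_le_iff)
  qed
  then show ?thesis by (rule that)
qed

subsection \<open>Solutions for which \<open>x\<^sub>1\<close> and \<open>x\<^sub>3\<close> are squares\<close>

lemma squarefree_pos: "squarefree b \<Longrightarrow> 0 < b" for b :: nat
proof -
  assume b: "squarefree b"
  have False if "b = 0"
    using squarefreeD[OF b, of 0] that by simp
  then show "0 < b" by blast
qed

text \<open>Write b = g c with g = gcd(b, y). Coprimality of c and y / g forces c to divide g, so
  c^2 divides b and c = 1.\<close>

lemma squarefree_dvd_square_imp:
  fixes b y :: nat
  assumes "squarefree b" "b dvd y ^ 2"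
  shows "b dvd y"
proof -
  define g where "g = gcd b y"
  have b0: "b \<noteq> 0" using squarefree_pos[OF assms(1)] by simp
  then have g0: "g \<noteq> 0" by (simp add: g_def)
  obtain c z where c: "b = g * c" "y = g * z" by (metis dvdE g_def gcd_dvd1 gcd_dvd2)
  have "g * gcd c z = g" using c by (metis g_def gcd_mult_distrib_nat)
  then have cop: "coprime c z" using g0 by (simp add: coprime_iff_gcd_eq_1)
  have "g * c dvd g * (g * z ^ 2)" using assms(2) c by (simp add: power2_eq_square mult_ac)
  then have "c dvd g * z ^ 2" using g0 by simp
  then have "c dvd g" using cop by (simp add: coprime_dvd_mult_left_iff)
  then have "c ^ 2 dvd b" using c by (simp add: power2_eq_square mult_dvd_mono)
  then have "c dvd 1" using assms(1) squarefreeD by blast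
  then have "b = g" using c(1) by simp
  moreover have "g dvd y" by (simp add: g_def)
  ultimately show ?thesis by metis
qed

text \<open>At each prime the squarefree factor has exponent at most 1, so halving the total
  exponent recovers that of c. This is the uniqueness of the factorisation b c^2.\<close>

lemma square_part_squarefree_times_square:
  fixes b c :: nat
  assumes "squarefree b" "c > 0"
  shows "square_part (b * c ^ 2) = c"
proof -
  have b0: "b \<noteq> 0" using squarefree_pos[OF assms(1)] by simp
  have "normalize (square_part (b * c ^ 2)) = normalize c"
  proof (rule multiplicity_eq_imp_eq)
    fix p :: nat assume p: "prime p"
    have "multiplicity p b \<le> 1" using assms(1) p b0 by (simp add: squarefree_factorial_semiring'')
    moreover have "multiplicity p (b * c ^ 2) = multiplicity p b + 2 * multiplicity p c"
      using p b0 assms(2) by (simp add: prime_elem_multiplicity_mult_distrib prime_elem_multiplicity_power_distrib)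
    ultimately show "multiplicity p (square_part (b * c ^ 2)) = multiplicity p c"
      using p by (simp add: prime_multiplicity_square_part)
  qed (use b0 assms in auto)
  then show ?thesis by simp
qed

text \<open>First c^2 cancels, then a squarefree b dividing a square divides the root. The condition
  on x^2 thus becomes linear and defines a residue class, which is the reason for splitting b into
  b1 b2^2.\<close>

lemma squarefree_square_dvd_square_iff:
  fixes b c :: nat and x :: int
  assumes "squarefree b" "c > 0"
  shows "int (b * c ^ 2) dvd x ^ 2 \<longleftrightarrow> int b * int c dvd x"
proof
  assume "int (b * c ^ 2) dvd x ^ 2"
  then have d: "b * c ^ 2 dvd (nat \<bar>x\<bar>) ^ 2"
    by (metis int_dvd_int_iff nat_abs_int_diff of_nat_power power2_abs abs_ge_zero int_nat_eq)
  then have "c ^ 2 dvd (nat \<bar>x\<bar>) ^ 2" by (rule dvd_mult_right)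
  then have "c dvd nat \<bar>x\<bar>" by simp
  then obtain y where y: "nat \<bar>x\<bar> = c * y" by (rule dvdE)
  have "c ^ 2 * b dvd c ^ 2 * y ^ 2" using d unfolding y by (simp add: power_mult_distrib mult.commute)
  then have "b dvd y ^ 2" using assms(2) by simp
  then have "b dvd y" by (rule squarefree_dvd_square_imp[OF assms(1)])
  then have "b * c dvd nat \<bar>x\<bar>" unfolding y by (simp add: mult.commute mult_dvd_mono)
  then show "int b * int c dvd x" by (metis int_dvd_int_iff of_nat_mult abs_ge_zero dvd_abs_iff int_nat_eq)
next
  assume "int b * int c dvd x"
  then obtain y where "x = int b * int c * y" by (auto elim: dvdE)
  then show "int (b * c ^ 2) dvd x ^ 2" by (simp add: power2_eq_square mult_ac)
qed

text \<open>Modulo b the factor x + b^2 is x, and the coprime moduli separate.\<close>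

lemma dvd_iff_coprime_factors:
  fixes a b x :: int
  assumes "coprime a b"
  shows "a * b dvd x * (x + b ^ 2) \<longleftrightarrow> a dvd x * (x + b ^ 2) \<and> b dvd x ^ 2"
proof -
  have "x * (x + b ^ 2) = x ^ 2 + b * (b * x)" by (simp add: power2_eq_square algebra_simps)
  then have "b dvd x * (x + b ^ 2) \<longleftrightarrow> b dvd x ^ 2" by (metis dvd_add_left_iff dvd_triv_left)
  then show ?thesis using assms by (metis divides_mult dvd_mult_left dvd_mult_right)
qed

text \<open>A common prime of \<open>x1\<close> and \<open>x3\<close> would divide \<open>x2\<close>
  and \<open>x0\<close> as well, which \<open>cop\<close> excludes; so \<open>x1\<close> and
  \<open>x3\<close> are positive and coprime with square product, hence squares. The first equation
  then says a b | x0 (x0 + b^2), which separates into a condition modulo a and b | x0^2.\<close>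

lemma square_param:
  assumes dp: "(x0, x1, x2, x3, x4) \<in> dP4" and pos: "x2 > 0" "x3 > 0"
    and cop: "\<And>p. prime p \<Longrightarrow> p dvd x0 \<Longrightarrow> p dvd x1 \<Longrightarrow> p dvd x2 \<Longrightarrow> p dvd x3 \<Longrightarrow> False"
  obtains a b b1 b2 :: nat where "a > 0" "b > 0" "b1 > 0" "b2 > 0" "squarefree b1" "b = b1 * b2 ^ 2" "coprime a b"
    "x1 = (int a)\<^sup>2" "x2 = int a * int b" "x3 = (int b)\<^sup>2"
    "- (int a * int b * x4) = x0 * (x0 + (int b)\<^sup>2)"
    "int a dvd x0 * (x0 + (int b)\<^sup>2)" "int b1 * int b2 dvd x0"
proof -
  have eqs: "x0\<^sup>2 + x0 * x3 + x2 * x4 = 0" "x1 * x3 = x2\<^sup>2" using dp by (auto simp: dP4_def)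
  have x1: "x1 > 0" using eqs(2) pos by (metis zero_less_mult_pos2 zero_less_power)
  have "coprime x1 x3"
  proof (rule ccontr)
    assume "\<not> coprime x1 x3"
    then have "gcd x1 x3 \<noteq> 1" by (simp add: coprime_iff_gcd_eq_1)
    then have "\<not> is_unit (gcd x1 x3)" by simp
    moreover have "gcd x1 x3 \<noteq> 0" using pos by simp
    ultimately obtain p where p: "prime p" "p dvd gcd x1 x3" using prime_divisor_exists by blast
    then have "p dvd x1" "p dvd x3" by auto
    then show False using cop[OF p(1)] prime_dvd_x0[OF dp p(1)] by blast
  qed
  then have c: "coprime (nat x1) (nat x3)" using x1 pos by (simp add: coprime_int_iff[symmetric])
  have e: "nat x1 * nat x3 = (nat x2) ^ 2"
    using eqs(2) x1 pos by (simp add: nat_mult_distrib[symmetric] nat_power_eq)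
  then have "is_nth_power 2 (nat x1 * nat x3)" unfolding is_nth_power_def by blast
  then have "is_nth_power 2 (nat x1)" "is_nth_power 2 (nat x3)"
    using is_nth_power_mult_coprime_natD[OF c] x1 pos by auto
  then obtain a b where ab: "nat x1 = a ^ 2" "nat x3 = b ^ 2" unfolding is_nth_power_def by auto
  then have x13: "x1 = (int a)\<^sup>2" "x3 = (int b)\<^sup>2" using x1 pos by (metis int_nat_eq less_le of_nat_power)+
  have a0: "a > 0" "b > 0" using x13 x1 pos by (auto intro: Nat.gr0I)
  have "(int a * int b)\<^sup>2 = x2\<^sup>2" using eqs(2) x13 by (simp add: power_mult_distrib)
  then have x2: "x2 = int a * int b" using pos by (simp add: power2_eq_iff_nonneg)
  have cab: "coprime a b" using c ab by simp
  have x4: "- (int a * int b * x4) = x0 * (x0 + (int b)\<^sup>2)"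
    using eqs(1) x2 x13 by (simp add: power2_eq_square algebra_simps)
  then have "int a * int b dvd x0 * (x0 + (int b)\<^sup>2)" by (metis dvd_minus_iff dvd_triv_left)
  then have d: "int a dvd x0 * (x0 + (int b)\<^sup>2)" "int b dvd x0 ^ 2"
    using dvd_iff_coprime_factors[of "int a" "int b"] cab by auto
  define b1 b2 where "b1 = squarefree_part b" and "b2 = square_part b"
  have b: "b = b1 * b2 ^ 2" unfolding b1_def b2_def by (rule squarefree_decompose)
  have b12: "squarefree b1" "b2 > 0" "b1 > 0"
  proof -
    show sf: "squarefree b1" by (simp add: b1_def)
    show "b1 > 0" by (rule squarefree_pos[OF sf])
    show "b2 > 0" using a0(2) unfolding b by (cases "b2 = 0") auto
  qed
  have "int b1 * int b2 dvd x0" using d(2) squarefree_square_dvd_square_iff[OF b12(1,2), of x0] unfolding b[symmetric] by simp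
  then show ?thesis using that a0 b b12 cab x13 x2 x4 d by blast
qed

lemma dP4_of_param:
  fixes a b1 b2 :: nat and x :: int
  assumes "a > 0" "b2 > 0" "squarefree b1" "coprime a (b1 * b2 ^ 2)"
    and "int a dvd x * (x + (int (b1 * b2 ^ 2))\<^sup>2)" "int b1 * int b2 dvd x"
  shows "\<exists>x4. (x, (int a)\<^sup>2, int a * int (b1 * b2 ^ 2), (int (b1 * b2 ^ 2))\<^sup>2, x4) \<in> dP4"
proof -
  define b where "b = b1 * b2 ^ 2"
  have b: "b > 0" using assms by (auto simp: b_def intro: Nat.gr0I)
  have "int b dvd x ^ 2" using squarefree_square_dvd_square_iff[of b1 b2 x] assms by (simp add: b_def)
  moreover have "coprime (int a) (int b)" using assms(4) by (simp add: b_def)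
  ultimately have "int a * int b dvd x * (x + (int b)\<^sup>2)"
    using dvd_iff_coprime_factors[of "int a" "int b"] assms(5) by (simp add: b_def)
  then obtain q where "x * (x + (int b)\<^sup>2) = int a * int b * q" by (auto elim: dvdE)
  then have "(x, (int a)\<^sup>2, int a * int b, (int b)\<^sup>2, - q) \<in> dP4"
    using b assms(1) by (auto simp: dP4_def power2_eq_square algebra_simps)
  then show ?thesis unfolding b_def by blast
qed

text \<open>A point with \<open>x2 > 0\<close> is determined by \<open>x0\<close>,
  \<open>x1\<close>, \<open>x3\<close>: \<open>x2\<close> is the positive root of x1 x3, and
  \<open>x4\<close> follows. So it suffices to give the roots \<open>\<alpha>\<close>,
  \<open>\<beta>\<close> of \<open>x1\<close>, \<open>x3\<close> and the value \<open>\<xi>\<close>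
  of \<open>x0\<close>.\<close>

lemma card_param:
  fixes \<alpha> \<beta> :: "nat list \<Rightarrow> nat" and \<xi> :: "nat list \<Rightarrow> int \<Rightarrow> int"
  assumes S: "\<And>x0 x1 x2 x3 x4. (x0, x1, x2, x3, x4) \<in> S \<Longrightarrow> (x0, x1, x2, x3, x4) \<in> dP4 \<and> x2 > 0"
    and 1: "\<And>x0 x1 x2 x3 x4. (x0, x1, x2, x3, x4) \<in> S \<Longrightarrow> \<exists>n x. (n, x) \<in> A \<and> x0 = \<xi> n x \<and> x1 = (int (\<alpha> n))\<^sup>2 \<and> x3 = (int (\<beta> n))\<^sup>2"
    and 2: "\<And>n x. (n, x) \<in> A \<Longrightarrow> \<exists>x4. (\<xi> n x, (int (\<alpha> n))\<^sup>2, int (\<alpha> n) * int (\<beta> n), (int (\<beta> n))\<^sup>2, x4) \<in> S"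
    and 3: "\<And>n m x y. (n, x) \<in> A \<Longrightarrow> (m, y) \<in> A \<Longrightarrow> \<alpha> n = \<alpha> m \<Longrightarrow> \<beta> n = \<beta> m \<Longrightarrow> \<xi> n x = \<xi> m y \<Longrightarrow> n = m \<and> x = y"
  shows "card S = card A"
proof (rule card_eq_relation[where R = "\<lambda>(x0, x1, x2, x3, x4) (n, x). x0 = \<xi> n x \<and> x1 = (int (\<alpha> n))\<^sup>2 \<and> x3 = (int (\<beta> n))\<^sup>2"])
  fix s assume "s \<in> S"
  then show "\<exists>t\<in>A. (case s of (x0, x1, x2, x3, x4) \<Rightarrow> \<lambda>(n, x). x0 = \<xi> n x \<and> x1 = (int (\<alpha> n))\<^sup>2 \<and> x3 = (int (\<beta> n))\<^sup>2) t"
    using 1 by (cases s) fastforce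
next
  fix t assume "t \<in> A"
  then show "\<exists>s\<in>S. (case s of (x0, x1, x2, x3, x4) \<Rightarrow> \<lambda>(n, x). x0 = \<xi> n x \<and> x1 = (int (\<alpha> n))\<^sup>2 \<and> x3 = (int (\<beta> n))\<^sup>2) t"
    using 2 by (cases t) fastforce
next
  fix s t t'
  assume tt: "t \<in> A" "t' \<in> A"
    and R: "(case s of (x0, x1, x2, x3, x4) \<Rightarrow> \<lambda>(n, x). x0 = \<xi> n x \<and> x1 = (int (\<alpha> n))\<^sup>2 \<and> x3 = (int (\<beta> n))\<^sup>2) t"
      "(case s of (x0, x1, x2, x3, x4) \<Rightarrow> \<lambda>(n, x). x0 = \<xi> n x \<and> x1 = (int (\<alpha> n))\<^sup>2 \<and> x3 = (int (\<beta> n))\<^sup>2) t'"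
  obtain n x m y where e: "t = (n, x)" "t' = (m, y)" by (cases t; cases t')
  have "\<xi> n x = \<xi> m y" "(int (\<alpha> n))\<^sup>2 = (int (\<alpha> m))\<^sup>2" "(int (\<beta> n))\<^sup>2 = (int (\<beta> m))\<^sup>2"
    using R e by (auto split: prod.splits)
  then have "\<xi> n x = \<xi> m y" "\<alpha> n = \<alpha> m" "\<beta> n = \<beta> m" by (auto simp: power2_eq_iff_nonneg)
  then show "t = t'" using 3 tt e by blast
next
  fix s s' t
  assume ss: "s \<in> S" "s' \<in> S"
    and R: "(case s of (x0, x1, x2, x3, x4) \<Rightarrow> \<lambda>(n, x). x0 = \<xi> n x \<and> x1 = (int (\<alpha> n))\<^sup>2 \<and> x3 = (int (\<beta> n))\<^sup>2) t"
      "(case s' of (x0, x1, x2, x3, x4) \<Rightarrow> \<lambda>(n, x). x0 = \<xi> n x \<and> x1 = (int (\<alpha> n))\<^sup>2 \<and> x3 = (int (\<beta> n))\<^sup>2) t"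
  obtain x0 x1 x2 x3 x4 where e: "s = (x0, x1, x2, x3, x4)" by (cases s) auto
  obtain y0 y1 y2 y3 y4 where e': "s' = (y0, y1, y2, y3, y4)" by (cases s') auto
  have eq: "x0 = y0" "x1 = y1" "x3 = y3" using R e e' by (auto split: prod.splits)
  have dp: "(x0, x1, x2, x3, x4) \<in> dP4" "x2 > 0" "(y0, y1, y2, y3, y4) \<in> dP4" "y2 > 0"
    using S ss e e' by auto
  then have "x2\<^sup>2 = y2\<^sup>2" using eq by (auto simp: dP4_def)
  then have "x2 = y2" using dp by (simp add: power2_eq_iff_nonneg)
  then show "s = s'" using dP4_determined[of x0 x1 x2 x3 x4 y1 y4] dp eq e e' by auto
qed

lemma sum_inverse_squares_le: "(\<Sum>n=1..N. 1 / real n ^ 2) \<le> 2"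
proof -
  have "(\<Sum>n=1..N. 1 / real n ^ 2) \<le> 2 - 1 / real N" if "N \<ge> 1"
    using that
  proof (induction N rule: dec_induct)
    case (step n)
    have "1 / real (Suc n) ^ 2 \<le> 1 / real n - 1 / real (Suc n)"
    proof -
      have "1 / real n - 1 / real (Suc n) = 1 / (real n * real (Suc n))" using step.hyps by (simp add: field_simps)
      moreover have "1 / real (Suc n) ^ 2 \<le> 1 / (real n * real (Suc n))"
        using step.hyps unfolding power2_eq_square by (intro divide_left_mono mult_right_mono) auto
      ultimately show ?thesis by simp
    qed
    then show ?case using step.IH by simp
  qed simp
  then show ?thesis by (cases "N \<ge> 1") (auto intro: order_trans)
qed

lemma sum_inverse_floor_le: "1 \<le> B \<Longrightarrow> (\<Sum>n=1..nat \<lfloor>B\<rfloor>. 1 / real n) \<le> ln B + 1"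
  using sum_inverse_le[of B] by simp

subsection \<open>The complements of the other two lines\<close>

text \<open>
  If \<open>x\<^sub>3 > 0\<close>, then \<open>x\<^sub>1 = a\<^sup>2\<close>, \<open>x\<^sub>2 = a b\<close>, \<open>x\<^sub>3 = b\<^sup>2\<close> with \<open>b = b\<^sub>1 b\<^sub>2\<^sup>2\<close> and \<open>b\<^sub>1\<close> squarefree, so that \<open>b dvd x\<^sub>0\<^sup>2\<close> becomes
  \<open>b\<^sub>1 b\<^sub>2 dvd x\<^sub>0\<close>; lists are ordered as \<open>[a, b\<^sub>2, b\<^sub>1]\<close>.
\<close>

definition weight5 :: "nat \<Rightarrow> nat list \<Rightarrow> real" where
  "weight5 p r = (if r ! 2 \<le> 1 \<and> \<not> (r ! 0 \<ge> 1 \<and> (r ! 1 \<ge> 1 \<or> r ! 2 \<ge> 1)) then 1 else 0)"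

text \<open>The conditions x1 = a^2 <= B and x2 = a b1 b2^2 <= B; this height does not bound
  \<open>x3\<close>.\<close>

definition region5 :: "real \<Rightarrow> real list \<Rightarrow> real" where
  "region5 T ts = (if 2 * ts ! 0 \<le> T \<and> ts ! 0 + 2 * ts ! 1 + ts ! 2 \<le> T then 1 else 0)"

lemma finite_primes_le: "finite {p::nat. prime p \<and> p \<le> N}"
  by (rule finite_subset[of _ "{..N}"]) auto

lemma squarefree_iff_primes_le:
  fixes b :: nat
  assumes "b \<in> {1..N}"
  shows "squarefree b \<longleftrightarrow> (\<forall>p. prime p \<longrightarrow> p \<le> N \<longrightarrow> \<not> p ^ 2 dvd b)"
proof -
  have "p \<le> N" if "p ^ 2 dvd b" for p
  proof -
    have "p dvd b" using that by (metis dvd_mult_left power2_eq_square)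
    then have "p \<le> b" using assms by (intro dvd_imp_le) auto
    then show ?thesis using assms by simp
  qed
  then show ?thesis using assms by (subst squarefree_factorial_semiring) auto
qed

lemma weight5_eq:
  assumes "a \<in> {1..N}" "c \<in> {1..N}" "b \<in> {1..N}"
  shows "weight [1, 1, 2] weight5 N [a, c, b] = (if squarefree b \<and> coprime a (b * c) then 1 else 0)"
proof -
  have "weight [1, 1, 2] weight5 N [a, c, b] =
      (\<Prod>p\<in>{p. prime p \<and> p \<le> N}. if \<not> p ^ 2 dvd b \<and> \<not> (p dvd a \<and> p dvd c) \<and> \<not> (p dvd a \<and> p dvd b) then 1 else 0)"
    unfolding weight_def local_weight_def
  proof (intro prod.cong refl)
    fix p assume "p \<in> {p. prime p \<and> p \<le> N}"
    moreover have "p dvd b" if "p ^ 2 dvd b" using that by (metis dvd_mult_left power2_eq_square)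
    ultimately show "weight5 p (map2 min [1, 1, 2] (map (multiplicity p) [a, c, b])) =
        (if \<not> p ^ 2 dvd b \<and> \<not> (p dvd a \<and> p dvd c) \<and> \<not> (p dvd a \<and> p dvd b) then 1 else 0)"
      using assms by (auto simp: weight5_def min_1_multiplicity min_2_multiplicity)
  qed
  then show ?thesis unfolding prod_if_zero[OF finite_primes_le]
    using assms coprime_iff_no_prime[of a N c] coprime_iff_no_prime[of a N b] squarefree_iff_primes_le[of b N]
    by auto
qed

lemma antitone_cutoff_if:
  assumes "\<And>ts us. length ts = k \<Longrightarrow> \<forall>t\<in>set ts. 0 \<le> t \<Longrightarrow> list_all2 (\<le>) ts us \<Longrightarrow> Q us \<Longrightarrow> Q ts"
    and "\<And>ts. length ts = k \<Longrightarrow> \<forall>t\<in>set ts. 0 \<le> t \<Longrightarrow> Q ts \<Longrightarrow> \<forall>t\<in>set ts. t \<le> T"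
  shows "antitone_cutoff k T 1 (\<lambda>ts. if Q ts then 1 else 0)"
  unfolding antitone_cutoff_def
proof (intro conjI allI impI)
  fix ts us :: "real list" assume "length ts = k" "\<forall>t\<in>set ts. 0 \<le> t" "list_all2 (\<le>) ts us"
  then have "Q us \<Longrightarrow> Q ts" by (rule assms(1))
  then show "(if Q us then 1 else 0) \<le> (if Q ts then 1 else (0::real))" by auto
next
  fix ts :: "real list" assume "length ts = k" "\<forall>t\<in>set ts. 0 \<le> t" "\<exists>t\<in>set ts. T < t"
  then have "\<not> Q ts" using assms(2)[of ts] by force
  then show "(if Q ts then 1 else 0) = (0::real)" by simp
qed auto

lemma antitone_cutoff_region5: "0 \<le> T \<Longrightarrow> antitone_cutoff 3 T 1 (region5 T)"
  unfolding region5_def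
proof (rule antitone_cutoff_if)
  fix ts us :: "real list"
  assume ts: "length ts = 3" "\<forall>t\<in>set ts. 0 \<le> t"
  obtain a b c where abc: "ts = [a, b, c]" using ts(1) by (auto simp: numeral_3_eq_3 length_Suc_conv)
  { assume "list_all2 (\<le>) ts us" "2 * us ! 0 \<le> T \<and> us ! 0 + 2 * us ! 1 + us ! 2 \<le> T"
    then obtain a' b' c' where "us = [a', b', c']" "a \<le> a'" "b \<le> b'" "c \<le> c'" "2 * a' \<le> T" "a' + 2 * b' + c' \<le> T"
      unfolding abc list_all2_Cons1 by auto
    then show "2 * ts ! 0 \<le> T \<and> ts ! 0 + 2 * ts ! 1 + ts ! 2 \<le> T" unfolding abc by simp }
  { assume "2 * ts ! 0 \<le> T \<and> ts ! 0 + 2 * ts ! 1 + ts ! 2 \<le> T"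
    then show "\<forall>t\<in>set ts. t \<le> T" using ts(2) unfolding abc by simp }
qed

text \<open>The slice at t <= T/2 has area (T - t)^2 / 4. The 7 is 8 - 1, from the cubes of T and
  T/2 at the two ends, and 4 * 7 / 96 = 7 / 24.\<close>

lemma integral_region5:
  assumes T: "0 \<le> T"
  shows "iterated_integral 3 T (region5 T) = 7 * T ^ 3 / 96"
proof -
  have 1: "integral {0..T} (\<lambda>u. if 2 * t \<le> T \<and> t + 2 * s + u \<le> T then 1 else 0)
      = (if s \<le> (T - t) / 2 then if 2 * t \<le> T then T - t - 2 * s else 0 else 0)" if "t \<in> {0..T}" "s \<in> {0..T}" for t s
  proof (cases "s \<le> (T - t) / 2 \<and> 2 * t \<le> T")
    case True
    then have "integral {0..T} (\<lambda>u. if u \<le> T - t - 2 * s then 1 else 0) = (T - t - 2 * s) - 0"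
      using that by (intro integral_cutoff) (auto intro!: derivative_eq_intros)
    moreover have "t + 2 * s + u \<le> T \<longleftrightarrow> u \<le> T - t - 2 * s" for u by linarith
    ultimately show ?thesis using True by simp
  next
    case False
    then have "integral {0..T} (\<lambda>u. if 2 * t \<le> T \<and> t + 2 * s + u \<le> T then 1 else 0) = integral {0..T} (\<lambda>u. 0 :: real)"
      by (intro integral_cong) auto
    then show ?thesis using False by auto
  qed
  have 2: "integral {0..T} (\<lambda>s. if s \<le> (T - t) / 2 then if 2 * t \<le> T then T - t - 2 * s else 0 else 0)
      = (if t \<le> T / 2 then (T - t) ^ 2 / 4 else 0)" if "t \<in> {0..T}" for t
  proof (cases "2 * t \<le> T")
    case True
    have "integral {0..T} (\<lambda>s. if s \<le> (T - t) / 2 then T - t - 2 * s else 0)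
        = ((T - t) * ((T - t) / 2) - ((T - t) / 2) ^ 2) - ((T - t) * 0 - 0 ^ 2)"
      using that by (intro integral_cutoff) (auto intro!: derivative_eq_intros)
    also have "\<dots> = (T - t) ^ 2 / 4" by (simp add: power2_eq_square field_simps)
    finally have *: "integral {0..T} (\<lambda>s. if s \<le> (T - t) / 2 then T - t - 2 * s else 0) = (T - t) ^ 2 / 4" .
    have "t \<le> T / 2" using True by simp
    then show ?thesis by (simp only: True if_True *)
  next
    case False
    then have "\<not> t \<le> T / 2" by simp
    then show ?thesis by (simp only: False if_False if_cancel integral_0)
  qed
  have "iterated_integral 3 T (region5 T) = integral {0..T} (\<lambda>t. integral {0..T} (\<lambda>s. integral {0..T} (\<lambda>u. if 2 * t \<le> T \<and> t + 2 * s + u \<le> T then 1 else 0)))"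
    unfolding numeral_3_eq_3 by (simp add: region5_def)
  also have "\<dots> = integral {0..T} (\<lambda>t. integral {0..T} (\<lambda>s. if s \<le> (T - t) / 2 then if 2 * t \<le> T then T - t - 2 * s else 0 else 0))"
    by (intro integral_cong 1)
  also have "\<dots> = integral {0..T} (\<lambda>t. if t \<le> T / 2 then (T - t) ^ 2 / 4 else 0)"
    by (intro integral_cong 2)
  also have "\<dots> = (\<lambda>t. 0 - (T - t) ^ 3 / 12) (T / 2) - (\<lambda>t. 0 - (T - t) ^ 3 / 12) 0"
    using T by (intro integral_cutoff[where G = "\<lambda>t. 0 - (T - t) ^ 3 / 12"]) (auto intro!: derivative_eq_intros simp: power2_eq_square)
  finally show ?thesis by (simp add: power3_eq_cube field_simps)
qed

lemma card_N5_solutions: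
  assumes B: "B \<ge> 1"
  shows "card {(x0, x1, x2, x3, x4). (x0, x1, x2, x3, x4) \<in> dP4 \<and> x2 > 0 \<and> x3 > 0 \<and> integral5 (x0, x1, x2, x3, x4) \<and> real_of_int (H5 (x0, x1, x2, x3, x4)) \<le> B}
   = card (SIGMA n:{n\<in>Box 3 (nat \<lfloor>B\<rfloor>). (squarefree (n ! 2) \<and> coprime (n ! 0) (n ! 2 * n ! 1)) \<and> real ((n ! 0) ^ 2) \<le> B \<and> real (n ! 0 * (n ! 2 * (n ! 1) ^ 2)) \<le> B}.
      {x::int. real_of_int \<bar>x\<bar> \<le> B \<and> int (n ! 2) * int (n ! 1) dvd x \<and> int (n ! 0) dvd x + (int (n ! 2 * (n ! 1) ^ 2))\<^sup>2})"
  (is "card ?S = card ?A")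
proof (rule card_param[where \<alpha> = "\<lambda>n. n ! 0" and \<beta> = "\<lambda>n. n ! 2 * (n ! 1) ^ 2" and \<xi> = "\<lambda>n x. x"])
  fix x0 x1 x2 x3 x4 assume "(x0, x1, x2, x3, x4) \<in> ?S"
  then have dp: "(x0, x1, x2, x3, x4) \<in> dP4" and pos: "x2 > 0" "x3 > 0"
    and g: "Gcd {x0, x1, x2} = 1" and h: "real_of_int \<bar>x0\<bar> \<le> B" "real_of_int \<bar>x1\<bar> \<le> B" "real_of_int \<bar>x2\<bar> \<le> B"
    by (auto simp: integral5_def H_le_iff simp del: Gcd_insert)
  have cop: False if "prime p" "p dvd x0" "p dvd x1" "p dvd x2" for p
    using g that Gcd_int_eq_1_iff[of "{x0, x1, x2}"] by auto
  then show "(x0, x1, x2, x3, x4) \<in> dP4 \<and> 0 < x2" using dp pos by simp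
  obtain a b b1 b2 :: nat where p: "a > 0" "b > 0" "b1 > 0" "b2 > 0" "squarefree b1" "b = b1 * b2 ^ 2" "coprime a b"
    "x1 = (int a)\<^sup>2" "x2 = int a * int b" "x3 = (int b)\<^sup>2"
    "int a dvd x0 * (x0 + (int b)\<^sup>2)" "int b1 * int b2 dvd x0"
    by (rule square_param[OF dp pos]) (use cop in blast)+
  \<comment> \<open>A prime common to a and \<open>x0\<close> would divide x1 = a^2 and x2 = a b,
    against integrality. So all of a divides the other factor x0 + x3.\<close>
  have "coprime (int a) x0"
  proof (rule ccontr)
    assume "\<not> coprime (int a) x0"
    then have "\<not> is_unit (gcd (int a) x0)" by (simp add: coprime_iff_gcd_eq_1)
    moreover have "gcd (int a) x0 \<noteq> 0" using p by simp
    ultimately obtain q where "prime q" "q dvd gcd (int a) x0" using prime_divisor_exists by blast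
    then show False using cop[of q] p by (simp add: power2_eq_square)
  qed
  then have d: "int a dvd x0 + (int b)\<^sup>2" using p(11) by (simp add: coprime_dvd_mult_right_iff)
  have r: "real (a ^ 2) \<le> B" "real (a * b) \<le> B"
    using h(2,3) p(8,9) by (simp_all add: abs_mult)
  have le: "a \<le> a ^ 2" "b1 \<le> a * b" "b2 \<le> a * b"
  proof -
    show "a \<le> a ^ 2" using p by (simp add: power2_eq_square)
    have "b1 * 1 \<le> b1 * (a * b2 ^ 2)" using p by (intro mult_le_mono2) (simp add: Suc_leI)
    then show "b1 \<le> a * b" using p by (simp add: mult_ac)
    have "b2 * 1 \<le> b2 * (a * b1 * b2)" using p by (intro mult_le_mono2) (simp add: Suc_leI)
    then show "b2 \<le> a * b" using p by (simp add: power2_eq_square mult_ac)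
  qed
  then have "real a \<le> B" "real b1 \<le> B" "real b2 \<le> B" using r by (meson of_nat_mono order_trans)+
  then have "[a, b2, b1] \<in> Box 3 (nat \<lfloor>B\<rfloor>)" using p B by (auto simp: Box_def le_nat_floor_iff)
  then have "([a, b2, b1], x0) \<in> ?A" using p d r h by (simp add: coprime_mult_right_iff)
  then show "\<exists>n x. (n, x) \<in> ?A \<and> x0 = x \<and> x1 = (int (n ! 0))\<^sup>2 \<and> x3 = (int (n ! 2 * (n ! 1)\<^sup>2))\<^sup>2"
    using p by (intro exI[of _ "[a, b2, b1]"] exI[of _ x0]) simp
next
  fix n x assume t: "(n, x) \<in> ?A"
  obtain a b2 b1 where n: "n = [a, b2, b1]" "0 < a" "0 < b2" "0 < b1" using t by (auto simp: Box_def numeral_3_eq_3 length_Suc_conv)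
  define b where "b = b1 * b2 ^ 2"
  have b: "b > 0" using n by (simp add: b_def)
  have t': "squarefree b1" "coprime a (b1 * b2)" "real (a ^ 2) \<le> B" "real (a * b) \<le> B"
    "real_of_int \<bar>x\<bar> \<le> B" "int b1 * int b2 dvd x" "int a dvd x + (int b)\<^sup>2" using t n by (auto simp: b_def)
  have cop: "coprime a b" using t' by (simp add: b_def coprime_mult_right_iff)
  obtain x4 where x4: "(x, (int a)\<^sup>2, int a * int b, (int b)\<^sup>2, x4) \<in> dP4"
    using dP4_of_param[of a b2 b1 x] n t' cop unfolding b_def[symmetric] by auto
  have "integral5 (x, (int a)\<^sup>2, int a * int b, (int b)\<^sup>2, x4)"
  proof -
    have "\<forall>p. prime p \<longrightarrow> \<not> (\<forall>y\<in>{x, (int a)\<^sup>2, int a * int b}. p dvd y)"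
    proof (intro allI impI notI)
      fix p :: int assume p: "prime p" "\<forall>y\<in>{x, (int a)\<^sup>2, int a * int b}. p dvd y"
      then have "p dvd x" "p dvd int a" by (auto simp: prime_dvd_power_iff)
      then have "p dvd (int b)\<^sup>2" using t'(7) by (metis dvd_add_right_iff dvd_trans)
      then have "p dvd int b" using p by (simp add: prime_dvd_power_iff)
      then show False using \<open>p dvd int a\<close> cop p by (metis coprime_common_divisor coprime_int_iff not_prime_unit)
    qed
    then show ?thesis by (simp add: integral5_def Gcd_int_eq_1_iff del: Gcd_insert)
  qed
  moreover have "real_of_int (H5 (x, (int a)\<^sup>2, int a * int b, (int b)\<^sup>2, x4)) \<le> B"
    unfolding H_le_iff using t' by (simp add: abs_mult)
  ultimately show "\<exists>x4. (x, (int (n ! 0))\<^sup>2, int (n ! 0) * int (n ! 2 * (n ! 1)\<^sup>2), (int (n ! 2 * (n ! 1)\<^sup>2))\<^sup>2, x4) \<in> ?S"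
    using x4 n b unfolding b_def by auto
next
  fix n m x y assume t: "(n, x) \<in> ?A" "(m, y) \<in> ?A" "n ! 0 = m ! 0" "n ! 2 * (n ! 1)\<^sup>2 = m ! 2 * (m ! 1)\<^sup>2" "x = y"
  obtain a b2 b1 where n: "n = [a, b2, b1]" "0 < a" "0 < b2" "0 < b1" using t by (auto simp: Box_def numeral_3_eq_3 length_Suc_conv)
  obtain c d2 d1 where m: "m = [c, d2, d1]" "0 < c" "0 < d2" "0 < d1" using t by (auto simp: Box_def numeral_3_eq_3 length_Suc_conv)
  have "b2 = d2" using square_part_squarefree_times_square[of b1 b2] square_part_squarefree_times_square[of d1 d2] t n m by auto
  moreover from this have "b1 = d1" using t n m by auto
  ultimately show "n = m \<and> x = y" using t n m by auto
qed

lemma sum_Box_prod: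
  "(\<Sum>n\<in>Box (length fs) N. prod_list (map2 (\<lambda>f x. f x) fs n)) = prod_list (map (\<lambda>f. \<Sum>x=1..N. f x) (fs :: (nat \<Rightarrow> real) list))"
proof (induction fs)
  case (Cons f fs)
  have "(\<Sum>n\<in>Box (length (f # fs)) N. prod_list (map2 (\<lambda>f x. f x) (f # fs) n))
      = (\<Sum>x=1..N. f x * (\<Sum>n\<in>Box (length fs) N. prod_list (map2 (\<lambda>f x. f x) fs n)))"
    by (simp add: sum_Box_Suc sum_distrib_left)
  then show ?case by (simp only: Cons.IH sum_distrib_right[symmetric] list.map prod_list.Cons)
qed simp

lemma double_count_bound:
  fixes c c2 X Y E S U R :: real
  assumes "c2 = 2 * c" "\<bar>c - X\<bar> \<le> E + S" "S \<le> U" "2 * X = Y" "R = 2 * (E + U)"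
  shows "\<bar>c2 - Y\<bar> \<le> R"
proof -
  have "- (E + S) \<le> c - X" "c - X \<le> E + S" using assms(2) by linarith+
  then show ?thesis unfolding abs_le_iff using assms(1,3-5) by simp
qed

lemma asymptotic_N5:
  obtains C where "\<And>B. B \<ge> 1 \<Longrightarrow> \<bar>real (N5 B) - 7 / 24 * prime_prod (\<lambda>p. (1 - 1 / p) ^ 2 * (1 + 2 / p)) * B * ln B ^ 3\<bar> \<le> C * (B * (ln B + 1) ^ 2)"
proof -
  let ?D = "\<lambda>p::real. (1 - 1 / p) ^ 2 * (1 + 2 / p)"
  have len: "length [1, 1, 2::nat] = 3" by simp
  have dens: "density [1, 1, 2] x (weight5 p) = (1 - x) ^ 2 * (1 + 2 * x)" for x p
    by (simp add: weight5_def numeral_2_eq_2 algebra_simps power2_eq_square)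
  obtain K where K: "K \<ge> 0" and Kb: "\<And>T M \<Psi>. \<lbrakk>0 \<le> T; antitone_cutoff 3 T M \<Psi>\<rbrakk> \<Longrightarrow>
       \<bar>(\<Sum>n\<in>Box 3 (nat \<lfloor>exp T\<rfloor>). weight [1, 1, 2] weight5 (nat \<lfloor>exp T\<rfloor>) n * (\<Psi> (map (\<lambda>x. ln (real x)) n) / real (prod_list n)))
          - prime_prod ?D * iterated_integral 3 T \<Psi>\<bar> \<le> K * ((T + 1) ^ (3 - 1) * M)"
  proof (rule sieve_log[where f = weight5 and cs = "[1, 1, 2]" and C = 0 and D = ?D, unfolded len])
    fix p :: nat and e :: "nat list" assume e: "length e = 3" "sum_list e = 1"
    obtain a b c where abc: "e = [a, b, c]" using e(1) by (auto simp: numeral_3_eq_3 length_Suc_conv)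
    then have "a + b + c = 1" using e(2) by simp
    then have "[a, b, c] \<in> {[1, 0, 0], [0, 1, 0], [0, 0, 1]}" by (auto simp: add_is_1)
    then show "\<bar>weight5 p e - 1\<bar> \<le> 0 / real p" unfolding abc by (auto simp: weight5_def)
  next
    show "density [1, 1, 2] (1 / real p) (weight5 p) = ?D (real p)" for p
      unfolding dens by simp
  qed (simp_all add: weight5_def)
  have "\<bar>real (N5 B) - 7 / 24 * prime_prod ?D * B * ln B ^ 3\<bar> \<le> (4 * K + 4) * (B * (ln B + 1) ^ 2)" if B: "B \<ge> 1" for B
  proof -
    define T where "T = ln B"
    define N where "N = nat \<lfloor>B\<rfloor>"
    have T: "0 \<le> T" "exp T = B" using B by (auto simp: T_def)
    define P where "P n \<longleftrightarrow> (squarefree (n ! 2) \<and> coprime (n ! 0) (n ! 2 * n ! 1)) \<and> real ((n ! 0) ^ 2) \<le> B \<and> real (n ! 0 * (n ! 2 * (n ! 1) ^ 2)) \<le> B" for n :: "nat list"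
    define Y where "Y n = {x::int. real_of_int \<bar>x\<bar> \<le> B \<and> int (n ! 2) * int (n ! 1) dvd x \<and> int (n ! 0) dvd x + (int (n ! 2 * (n ! 1) ^ 2))\<^sup>2}" for n :: "nat list"
    define W where "W n = weight [1, 1, 2] weight5 N n * (region5 T (map (\<lambda>x. ln (real x)) n) / real (prod_list n))" for n
    have el: "\<exists>a c b. n = [a, c, b] \<and> a \<in> {1..N} \<and> c \<in> {1..N} \<and> b \<in> {1..N}" if "n \<in> Box 3 N" for n
      using that by (auto simp: Box_def numeral_3_eq_3 length_Suc_conv)
    have main: "\<bar>real (card (SIGMA n:{n\<in>Box 3 N. P n}. Y n)) - 2 * B * (prime_prod ?D * (7 * T ^ 3 / 96))\<bar>
       \<le> 2 * B * (K * (T + 1) ^ 2) + (\<Sum>n\<in>{n\<in>Box 3 N. P n}. 1)"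
    proof (rule card_Sigma_asymptotic[where W = W and v = "\<lambda>n. 1 / real (prod_list n)"])
      fix n assume n: "n \<in> Box 3 N"
      obtain a c b where abc: "n = [a, c, b]" "a \<in> {1..N}" "c \<in> {1..N}" "b \<in> {1..N}" using el[OF n] by blast
      have "2 * ln (real a) = ln (real (a ^ 2))" "ln (real a) + 2 * ln (real c) + ln (real b) = ln (real (a * (b * c ^ 2)))"
        using abc by (simp_all add: ln_mult ln_realpow)
      then have "2 * ln (real a) \<le> T \<and> ln (real a) + 2 * ln (real c) + ln (real b) \<le> T \<longleftrightarrow> real (a ^ 2) \<le> B \<and> real (a * (b * c ^ 2)) \<le> B"
        using abc B by (simp add: T_def)
      then show "W n = (if P n then 1 / real (prod_list n) else 0)"
        using weight5_eq[OF abc(2,3,4)] by (auto simp: W_def P_def abc(1) region5_def coprime_mult_right_iff)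
      assume "P n"
      then have "coprime (int b * int c) (int a)" using abc by (simp add: P_def coprime_commute coprime_mult_left_iff coprime_mult_right_iff)
      then obtain r where r: "\<And>x. (int b * int c dvd x \<and> int a dvd x + (int (b * c ^ 2))\<^sup>2) \<longleftrightarrow> int b * int c * int a dvd x - r"
        using crt_dvd by metis
      have "Y n = {x::int. real_of_int \<bar>x\<bar> \<le> B \<and> (int b * int c dvd x \<and> int a dvd x + (int (b * c ^ 2))\<^sup>2)}" by (simp add: Y_def abc)
      then show "finite (Y n)" "\<bar>real (card (Y n)) - 2 * B * (1 / real (prod_list n))\<bar> \<le> 1"
        using card_residue_window[of "b * c * a" B "\<lambda>x. int b * int c dvd x \<and> int a dvd x + (int (b * c ^ 2))\<^sup>2" r] r abc B by (auto simp: mult_ac)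
    next
      show "\<bar>(\<Sum>n\<in>Box 3 N. W n) - prime_prod ?D * (7 * T ^ 3 / 96)\<bar> \<le> K * (T + 1) ^ 2"
        unfolding W_def using Kb[OF T(1) antitone_cutoff_region5[OF T(1)]] integral_region5[OF T(1)] T by (simp add: N_def)
    qed (use B in auto)
    have "N5 B = 2 * card (SIGMA n:{n\<in>Box 3 N. P n}. Y n)"
      unfolding N5_def
      unfolding P_def Y_def N_def card_N5_solutions[OF B, symmetric]
      by (rule point_count_half) (simp_all add: integral5_def H5_def)
    then have card: "real (N5 B) = 2 * real (card (SIGMA n:{n\<in>Box 3 N. P n}. Y n))" by simp
    \<comment> \<open>Each admissible list costs a rounding error of 1. By a b c^2 <= B this is at
      most B / (a b c^2), whose sum over c converges, so two logarithms remain.\<close>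
    have err: "(\<Sum>n\<in>{n\<in>Box 3 N. P n}. 1) \<le> B * (2 * (T + 1) ^ 2)"
    proof -
      let ?fs = "[\<lambda>a. 1 / real a, \<lambda>c. 1 / real c ^ 2, \<lambda>b. 1 / real b]"
      have "(\<Sum>n\<in>{n\<in>Box 3 N. P n}. 1) \<le> (\<Sum>n\<in>Box 3 N. B * prod_list (map2 (\<lambda>f x. f x) ?fs n))"
        unfolding sum.inter_filter[OF finite_Box]
      proof (intro sum_mono)
        fix n assume n: "n \<in> Box 3 N"
        obtain a c b where abc: "n = [a, c, b]" "a \<in> {1..N}" "c \<in> {1..N}" "b \<in> {1..N}" using el[OF n] by blast
        show "(if P n then 1 else 0) \<le> B * prod_list (map2 (\<lambda>f x. f x) ?fs n)"
          using abc B by (auto simp: P_def divide_simps mult_ac)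
      qed
      also have "\<dots> = B * ((\<Sum>a=1..N. 1 / real a) * ((\<Sum>c=1..N. 1 / real c ^ 2) * (\<Sum>b=1..N. 1 / real b)))"
        using sum_Box_prod[of ?fs N] by (simp add: sum_distrib_left[symmetric] numeral_3_eq_3)
      also have "\<dots> \<le> B * ((T + 1) * (2 * (T + 1)))"
        using sum_inverse_floor_le[OF B] sum_inverse_squares_le[of N] B T unfolding N_def T_def
        by (intro mult_left_mono mult_mono mult_nonneg_nonneg sum_nonneg) auto
      finally show ?thesis by (simp add: power2_eq_square algebra_simps)
    qed
    have "2 * (2 * B * (prime_prod ?D * (7 * T ^ 3 / 96))) = 7 / 24 * prime_prod ?D * B * T ^ 3" by simp
    moreover have "(4 * K + 4) * (B * (T + 1) ^ 2) = 2 * (2 * B * (K * (T + 1) ^ 2) + B * (2 * (T + 1) ^ 2))"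
      by (simp add: algebra_simps)
    ultimately show ?thesis unfolding T_def[symmetric] by (intro double_count_bound[OF card main err])
  qed
  then show ?thesis by (rule that)
qed

text \<open>Replacing x0 by -(x0 + x3) preserves the product x0 (x0 + x3), hence the surface. It
  exchanges the two lines together with their gcd conditions and heights.\<close>

lemma N5_eq_N6: "N5 B = N6 B"
proof -
  let ?S5 = "{x \<in> dP4 \<inter> V_reps. integral5 x \<and> real_of_int (H5 x) \<le> B}"
  let ?S6 = "{x \<in> dP4 \<inter> V_reps. integral6 x \<and> real_of_int (H6 x) \<le> B}"
  define h where "h = (\<lambda>(x0 :: int, x1 :: int, x2 :: int, x3 :: int, x4 :: int). (- (x0 + x3), x1, x2, x3, x4))"
  have hh: "h (h x) = x" for x by (auto simp: h_def split: prod.splits)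
  have dp: "h x \<in> dP4 \<inter> V_reps \<longleftrightarrow> x \<in> dP4 \<inter> V_reps" for x
    by (cases x) (auto simp: h_def dP4_def V_reps_def power2_eq_square algebra_simps)
  have i: "integral6 (h x) = integral5 x" and H: "H6 (h x) = H5 x" for x
    by (cases x; simp add: h_def integral5_def integral6_def H5_def H6_def)+
  have "bij_betw h ?S5 ?S6"
  proof (rule bij_betw_byWitness[where f' = h])
    show "h ` ?S5 \<subseteq> ?S6"
    proof
      fix y assume "y \<in> h ` ?S5"
      then obtain x where "x \<in> ?S5" "y = h x" by blast
      then show "y \<in> ?S6" using dp i H by simp
    qed
    show "h ` ?S6 \<subseteq> ?S5"
    proof
      fix y assume "y \<in> h ` ?S6"
      then obtain x where x: "x \<in> ?S6" "y = h x" by blast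
      then have "integral5 y = integral6 x" "H5 y = H6 x" using i[of y] H[of y] hh by simp_all
      then show "y \<in> ?S5" using x dp by simp
    qed
  qed (use hh in auto)
  then show ?thesis unfolding N5_def N6_def point_count_def by (rule bij_betw_same_card)
qed

subsection \<open>The complement of the second singularity\<close>

text \<open>
  As for the lines, with \<open>a = a\<^sub>1 a\<^sub>2\<close> where \<open>a\<^sub>1 dvd x\<^sub>0\<close> and \<open>a\<^sub>2 dvd x\<^sub>0 + x\<^sub>3\<close>; lists are ordered as \<open>[a\<^sub>1, a\<^sub>2, b\<^sub>2, b\<^sub>1]\<close>.
\<close>

definition weight2 :: "nat \<Rightarrow> nat list \<Rightarrow> real" where
  "weight2 p r = (if r ! 3 \<le> 1 \<and> \<not> (r ! 0 \<ge> 1 \<and> r ! 1 \<ge> 1) \<and> \<not> ((r ! 0 \<ge> 1 \<or> r ! 1 \<ge> 1) \<and> (r ! 2 \<ge> 1 \<or> r ! 3 \<ge> 1)) then 1 else 0)"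

text \<open>The conditions x1 = (a1 a2)^2 <= B and x3 = (b1 b2^2)^2 <= B; the bound on
  \<open>x2\<close>, their geometric mean, follows.\<close>

definition region2 :: "real \<Rightarrow> real list \<Rightarrow> real" where
  "region2 T ts = (if 2 * (ts ! 0 + ts ! 1) \<le> T \<and> 2 * (2 * ts ! 2 + ts ! 3) \<le> T then 1 else 0)"

lemma numeral_4_eq_4: "4 = Suc (Suc (Suc (Suc 0)))"
  by simp

lemma weight2_eq:
  assumes "a1 \<in> {1..N}" "a2 \<in> {1..N}" "c \<in> {1..N}" "b \<in> {1..N}"
  shows "weight [1, 1, 1, 2] weight2 N [a1, a2, c, b] = (if squarefree b \<and> coprime a1 a2 \<and> coprime (a1 * a2) (b * c) then 1 else 0)"
proof -
  have "weight [1, 1, 1, 2] weight2 N [a1, a2, c, b] =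
      (\<Prod>p\<in>{p. prime p \<and> p \<le> N}. if \<not> p ^ 2 dvd b \<and> \<not> (p dvd a1 \<and> p dvd a2) \<and> \<not> (p dvd a1 \<and> p dvd c) \<and> \<not> (p dvd a1 \<and> p dvd b)
         \<and> \<not> (p dvd a2 \<and> p dvd c) \<and> \<not> (p dvd a2 \<and> p dvd b) then 1 else 0)"
    unfolding weight_def local_weight_def
  proof (intro prod.cong refl)
    fix p assume "p \<in> {p. prime p \<and> p \<le> N}"
    moreover have "p dvd b" if "p ^ 2 dvd b" using that by (metis dvd_mult_left power2_eq_square)
    ultimately show "weight2 p (map2 min [1, 1, 1, 2] (map (multiplicity p) [a1, a2, c, b])) =
        (if \<not> p ^ 2 dvd b \<and> \<not> (p dvd a1 \<and> p dvd a2) \<and> \<not> (p dvd a1 \<and> p dvd c) \<and> \<not> (p dvd a1 \<and> p dvd b)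
         \<and> \<not> (p dvd a2 \<and> p dvd c) \<and> \<not> (p dvd a2 \<and> p dvd b) then 1 else 0)"
      using assms by (auto simp: weight2_def min_1_multiplicity min_2_multiplicity)
  qed
  also have "\<dots> = (if squarefree b \<and> coprime a1 a2 \<and> coprime a1 c \<and> coprime a1 b \<and> coprime a2 c \<and> coprime a2 b then 1 else 0)"
    unfolding prod_if_zero[OF finite_primes_le]
    using assms coprime_iff_no_prime[of a1 N a2] coprime_iff_no_prime[of a1 N c] coprime_iff_no_prime[of a1 N b]
      coprime_iff_no_prime[of a2 N c] coprime_iff_no_prime[of a2 N b] squarefree_iff_primes_le[of b N]
    by auto
  finally show ?thesis by (simp add: coprime_mult_left_iff coprime_mult_right_iff conj_ac)
qed

lemma antitone_cutoff_region2: "0 \<le> T \<Longrightarrow> antitone_cutoff 4 T 1 (region2 T)"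
  unfolding region2_def
proof (rule antitone_cutoff_if)
  fix ts us :: "real list"
  assume ts: "length ts = 4" "\<forall>t\<in>set ts. 0 \<le> t"
  obtain a b c d where abc: "ts = [a, b, c, d]" using ts(1) by (auto simp: numeral_4_eq_4 length_Suc_conv)
  { assume "list_all2 (\<le>) ts us" "2 * (us ! 0 + us ! 1) \<le> T \<and> 2 * (2 * us ! 2 + us ! 3) \<le> T"
    then obtain a' b' c' d' where "us = [a', b', c', d']" "a \<le> a'" "b \<le> b'" "c \<le> c'" "d \<le> d'" "2 * (a' + b') \<le> T" "2 * (2 * c' + d') \<le> T"
      unfolding abc list_all2_Cons1 by auto
    then show "2 * (ts ! 0 + ts ! 1) \<le> T \<and> 2 * (2 * ts ! 2 + ts ! 3) \<le> T" unfolding abc by simp }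
  { assume "2 * (ts ! 0 + ts ! 1) \<le> T \<and> 2 * (2 * ts ! 2 + ts ! 3) \<le> T"
    then show "\<forall>t\<in>set ts. t \<le> T" using ts(2) unfolding abc by simp }
qed

text \<open>The region is a product of two triangles, of area T^2 / 8 in the logarithms of a1, a2
  and of area T^2 / 16 in those of b2, b1.\<close>

lemma integral_region2:
  assumes T: "0 \<le> T"
  shows "iterated_integral 4 T (region2 T) = T ^ 4 / 128"
proof -
  have cases: "integral {0..T} (\<lambda>t. if Q t \<and> R then f t else 0) = (if R then integral {0..T} (\<lambda>t. if Q t then f t else 0) else 0)"
    for Q R and f :: "real \<Rightarrow> real" by (cases R) auto
  have 1: "integral {0..T} (\<lambda>v. if 2 * (t + s) \<le> T \<and> 2 * (2 * u + v) \<le> T then 1 else 0)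
      = (if u \<le> T / 4 \<and> 2 * (t + s) \<le> T then T / 2 - 2 * u else 0)" if "u \<in> {0..T}" for t s u
  proof (cases "u \<le> T / 4 \<and> 2 * (t + s) \<le> T")
    case True
    then have "integral {0..T} (\<lambda>v. if v \<le> T / 2 - 2 * u then 1 else 0) = (T / 2 - 2 * u) - 0"
      using that T by (intro integral_cutoff) (auto intro!: derivative_eq_intros)
    moreover have "2 * (2 * u + v) \<le> T \<longleftrightarrow> v \<le> T / 2 - 2 * u" for v by (auto simp: field_simps)
    ultimately show ?thesis using True by simp
  next
    case False
    then have "integral {0..T} (\<lambda>v. if 2 * (t + s) \<le> T \<and> 2 * (2 * u + v) \<le> T then 1 else 0) = integral {0..T} (\<lambda>u. 0 :: real)"
      by (intro integral_cong) auto
    then show ?thesis using False by auto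
  qed
  have 2: "integral {0..T} (\<lambda>u. if u \<le> T / 4 \<and> 2 * (t + s) \<le> T then T / 2 - 2 * u else 0) = (if s \<le> T / 2 - t then T ^ 2 / 16 else 0)" for t s
  proof -
    have "integral {0..T} (\<lambda>u. if u \<le> T / 4 then T / 2 - 2 * u else 0) = (\<lambda>u. T / 2 * u - u ^ 2) (T / 4) - (\<lambda>u. T / 2 * u - u ^ 2) 0"
      using T by (intro integral_cutoff[where G = "\<lambda>u. T / 2 * u - u ^ 2"]) (auto intro!: derivative_eq_intros)
    also have "\<dots> = T ^ 2 / 16" by (simp add: power2_eq_square)
    finally have *: "integral {0..T} (\<lambda>u. if u \<le> T / 4 then T / 2 - 2 * u else 0) = T ^ 2 / 16" .
    have "2 * (t + s) \<le> T \<longleftrightarrow> s \<le> T / 2 - t" by (auto simp: field_simps)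
    then show ?thesis unfolding cases * by simp
  qed
  have 3: "integral {0..T} (\<lambda>s. if s \<le> T / 2 - t then T ^ 2 / 16 else 0) = (if t \<le> T / 2 then T ^ 2 / 16 * (T / 2 - t) else 0)" if "t \<in> {0..T}" for t
  proof (cases "t \<le> T / 2")
    case True
    have "integral {0..T} (\<lambda>s. if s \<le> T / 2 - t then T ^ 2 / 16 else 0) = T ^ 2 / 16 * (T / 2 - t) - T ^ 2 / 16 * 0"
      using that True T by (intro integral_cutoff[where G = "\<lambda>s. T ^ 2 / 16 * s"]) (auto intro!: derivative_eq_intros)
    then show ?thesis using True by simp
  next
    case False
    then have "integral {0..T} (\<lambda>s. if s \<le> T / 2 - t then T ^ 2 / 16 else 0) = integral {0..T} (\<lambda>s. 0)"
      by (intro integral_cong) auto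
    then show ?thesis using False by simp
  qed
  have "iterated_integral 4 T (region2 T) = integral {0..T} (\<lambda>t. integral {0..T} (\<lambda>s. integral {0..T} (\<lambda>u. integral {0..T} (\<lambda>v. if 2 * (t + s) \<le> T \<and> 2 * (2 * u + v) \<le> T then 1 else 0))))"
    unfolding numeral_4_eq_4 by (simp add: region2_def)
  also have "\<dots> = integral {0..T} (\<lambda>t. integral {0..T} (\<lambda>s. integral {0..T} (\<lambda>u. if u \<le> T / 4 \<and> 2 * (t + s) \<le> T then T / 2 - 2 * u else 0)))"
    by (intro integral_cong 1)
  also have "\<dots> = integral {0..T} (\<lambda>t. if t \<le> T / 2 then T ^ 2 / 16 * (T / 2 - t) else 0)"
    unfolding 2 by (intro integral_cong 3)
  also have "\<dots> = (\<lambda>t. T ^ 2 / 16 * (T / 2 * t - t ^ 2 / 2)) (T / 2) - (\<lambda>t. T ^ 2 / 16 * (T / 2 * t - t ^ 2 / 2)) 0"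
    using T by (intro integral_cutoff[where G = "\<lambda>t. T ^ 2 / 16 * (T / 2 * t - t ^ 2 / 2)"]) (auto intro!: derivative_eq_intros)
  finally show ?thesis by (simp add: power2_eq_square power4_eq_xxxx field_simps)
qed

text \<open>Here primes of a may divide \<open>x0\<close>, so a is split by its gcd with
  \<open>x0\<close>. This works because a is coprime to b, hence to the difference b^2 of the two
  factors. The conditions modulo a1 b1 b2 and modulo a2 are independent.\<close>

lemma card_N2_solutions:
  assumes B: "B \<ge> 1"
  shows "card {(x0, x1, x2, x3, x4). (x0, x1, x2, x3, x4) \<in> dP4 \<and> x2 > 0 \<and> x3 > 0 \<and> integral2 (x0, x1, x2, x3, x4) \<and> real_of_int (H2 (x0, x1, x2, x3, x4)) \<le> B}
   = card (SIGMA n:{n\<in>Box 4 (nat \<lfloor>B\<rfloor>). (squarefree (n ! 3) \<and> coprime (n ! 0) (n ! 1) \<and> coprime (n ! 0 * n ! 1) (n ! 3 * n ! 2)) \<and> real ((n ! 0 * n ! 1) ^ 2) \<le> B \<and> real ((n ! 3 * (n ! 2) ^ 2) ^ 2) \<le> B}.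
      {x::int. real_of_int \<bar>x\<bar> \<le> B \<and> int (n ! 0) * (int (n ! 3) * int (n ! 2)) dvd x \<and> int (n ! 1) dvd x + (int (n ! 3 * (n ! 2) ^ 2))\<^sup>2})"
  (is "card ?S = card ?A")
proof (rule card_param[where \<alpha> = "\<lambda>n. n ! 0 * n ! 1" and \<beta> = "\<lambda>n. n ! 3 * (n ! 2) ^ 2" and \<xi> = "\<lambda>n x. x"])
  fix x0 x1 x2 x3 x4 assume "(x0, x1, x2, x3, x4) \<in> ?S"
  then have dp: "(x0, x1, x2, x3, x4) \<in> dP4" and pos: "x2 > 0" "x3 > 0"
    and g: "Gcd {x0, x1, x2, x3} = 1" and h: "real_of_int \<bar>x0\<bar> \<le> B" "real_of_int \<bar>x1\<bar> \<le> B" "real_of_int \<bar>x3\<bar> \<le> B"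
    by (auto simp: integral2_def H_le_iff simp del: Gcd_insert)
  have cop: False if "prime p" "p dvd x0" "p dvd x1" "p dvd x2" "p dvd x3" for p
    using g that Gcd_int_eq_1_iff[of "{x0, x1, x2, x3}"] by auto
  then show "(x0, x1, x2, x3, x4) \<in> dP4 \<and> 0 < x2" using dp pos by simp
  obtain a b b1 b2 :: nat where p: "a > 0" "b > 0" "b1 > 0" "b2 > 0" "squarefree b1" "b = b1 * b2 ^ 2" "coprime a b"
    "x1 = (int a)\<^sup>2" "x2 = int a * int b" "x3 = (int b)\<^sup>2"
    "int a dvd x0 * (x0 + (int b)\<^sup>2)" "int b1 * int b2 dvd x0"
    by (rule square_param[OF dp pos]) (use cop in blast)+
  obtain a1 a2 where s: "a = a1 * a2" "coprime a1 a2" "int a1 dvd x0" "int a2 dvd x0 + (int b)\<^sup>2"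
    using coprime_split_exists[OF p(1) _ p(11)] p(7) by auto
  have s0: "0 < a1" "0 < a2" using s p by auto
  have cab: "coprime (a1 * a2) (b1 * b2)" using p(6,7) s by (simp add: coprime_mult_right_iff)
  then have "coprime (int a1) (int b1 * int b2)" by (simp add: coprime_mult_left_iff coprime_mult_right_iff)
  then have d: "int a1 * (int b1 * int b2) dvd x0" using s p(12) by (simp add: divides_mult)
  have r: "real (a ^ 2) \<le> B" "real (b ^ 2) \<le> B"
    using h(2,3) p(8,10) by simp_all
  have le: "a1 \<le> a ^ 2" "a2 \<le> a ^ 2" "b1 \<le> b ^ 2" "b2 \<le> b ^ 2"
  proof -
    have "a1 \<le> a" "a2 \<le> a" using s s0 by auto
    moreover have "a \<le> a ^ 2" using p by (simp add: power2_eq_square)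
    ultimately show "a1 \<le> a ^ 2" "a2 \<le> a ^ 2" by auto
    have "b1 \<le> b" using p by (simp add: Suc_leI)
    have "b2 * 1 \<le> b2 * (b1 * b2)" using p by (intro mult_le_mono2) (simp add: Suc_leI)
    then have "b2 \<le> b" using p by (simp add: power2_eq_square mult_ac)
    moreover have "b \<le> b ^ 2" using p(2) by (simp add: power2_eq_square)
    ultimately show "b1 \<le> b ^ 2" "b2 \<le> b ^ 2" using \<open>b1 \<le> b\<close> by auto
  qed
  then have "real a1 \<le> B" "real a2 \<le> B" "real b1 \<le> B" "real b2 \<le> B" using r by (meson of_nat_mono order_trans)+
  then have "[a1, a2, b2, b1] \<in> Box 4 (nat \<lfloor>B\<rfloor>)" using p s0 B by (auto simp: Box_def le_nat_floor_iff)
  then have "([a1, a2, b2, b1], x0) \<in> ?A" using p(5) s d r h cab p(6) by simp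
  then show "\<exists>n x. (n, x) \<in> ?A \<and> x0 = x \<and> x1 = (int (n ! 0 * n ! 1))\<^sup>2 \<and> x3 = (int (n ! 3 * (n ! 2)\<^sup>2))\<^sup>2"
    using p s by (intro exI[of _ "[a1, a2, b2, b1]"] exI[of _ x0]) simp
next
  fix n x assume t: "(n, x) \<in> ?A"
  obtain a1 a2 b2 b1 where n: "n = [a1, a2, b2, b1]" "0 < a1" "0 < a2" "0 < b2" "0 < b1"
    using t by (auto simp: Box_def numeral_4_eq_4 length_Suc_conv)
  define b where "b = b1 * b2 ^ 2"
  define a where "a = a1 * a2"
  have b: "b > 0" "a > 0" using n by (simp_all add: b_def a_def)
  have t': "squarefree b1" "coprime a (b1 * b2)" "real (a ^ 2) \<le> B" "real (b ^ 2) \<le> B"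
    "real_of_int \<bar>x\<bar> \<le> B" "int a1 * (int b1 * int b2) dvd x" "int a2 dvd x + (int b)\<^sup>2" using t n by (auto simp: b_def a_def)
  have cop: "coprime a b" using t' by (simp add: b_def coprime_mult_right_iff)
  have dv: "int b1 * int b2 dvd x" "int a1 dvd x" using t'(6) by (auto dest: dvd_mult_left dvd_mult_right)
  then have "int a dvd x * (x + (int b)\<^sup>2)" using t'(7) by (simp add: a_def mult_dvd_mono)
  then obtain x4 where x4: "(x, (int a)\<^sup>2, int a * int b, (int b)\<^sup>2, x4) \<in> dP4"
    using dP4_of_param[of a b2 b1 x] n b t' cop dv unfolding b_def[symmetric] by auto
  have "integral2 (x, (int a)\<^sup>2, int a * int b, (int b)\<^sup>2, x4)"
  proof -
    have "\<forall>p. prime p \<longrightarrow> \<not> (\<forall>y\<in>{x, (int a)\<^sup>2, int a * int b, (int b)\<^sup>2}. p dvd y)"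
    proof (intro allI impI notI)
      fix p :: int assume p: "prime p" "\<forall>y\<in>{x, (int a)\<^sup>2, int a * int b, (int b)\<^sup>2}. p dvd y"
      then have "p dvd int b" "p dvd int a" by (auto simp: prime_dvd_power_iff)
      then show False using cop p by (metis coprime_common_divisor coprime_int_iff not_prime_unit)
    qed
    then show ?thesis by (simp add: integral2_def Gcd_int_eq_1_iff del: Gcd_insert)
  qed
  moreover have "real_of_int (H2 (x, (int a)\<^sup>2, int a * int b, (int b)\<^sup>2, x4)) \<le> B"
  proof -
    \<comment> \<open>This bounds x2 = a b by the mean of \<open>x1\<close> and
      \<open>x3\<close>.\<close>
    have "2 * (real a * real b) \<le> real a ^ 2 + real b ^ 2" using sum_squares_bound[of "real a" "real b"] by simp
    then show ?thesis unfolding H_le_iff using t' by (simp add: abs_mult)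
  qed
  ultimately show "\<exists>x4. (x, (int (n ! 0 * n ! 1))\<^sup>2, int (n ! 0 * n ! 1) * int (n ! 3 * (n ! 2)\<^sup>2), (int (n ! 3 * (n ! 2)\<^sup>2))\<^sup>2, x4) \<in> ?S"
    using x4 n b unfolding b_def a_def by auto
next
  fix n m x y assume t: "(n, x) \<in> ?A" "(m, y) \<in> ?A" "n ! 0 * n ! 1 = m ! 0 * m ! 1" "n ! 3 * (n ! 2)\<^sup>2 = m ! 3 * (m ! 2)\<^sup>2" "x = y"
  obtain a1 a2 b2 b1 where n: "n = [a1, a2, b2, b1]" "0 < a1" "0 < a2" "0 < b2" "0 < b1"
    using t by (auto simp: Box_def numeral_4_eq_4 length_Suc_conv)
  obtain c1 c2 d2 d1 where m: "m = [c1, c2, d2, d1]" "0 < c1" "0 < c2" "0 < d2" "0 < d1"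
    using t by (auto simp: Box_def numeral_4_eq_4 length_Suc_conv)
  have xn: "squarefree b1" "coprime (a1 * a2) (b1 * b2)" "int a1 * (int b1 * int b2) dvd x" "int a2 dvd x + (int (b1 * b2\<^sup>2))\<^sup>2"
    using t(1) unfolding n by auto
  have xm: "squarefree d1" "coprime (c1 * c2) (d1 * d2)" "int c1 * (int d1 * int d2) dvd y" "int c2 dvd y + (int (d1 * d2\<^sup>2))\<^sup>2"
    using t(2) unfolding m by auto
  have eq: "a1 * a2 = c1 * c2" "b1 * b2\<^sup>2 = d1 * d2\<^sup>2" using t(3,4) unfolding n m by auto
  have "b2 = square_part (b1 * b2\<^sup>2)" using square_part_squarefree_times_square xn n by simp
  also have "\<dots> = d2" unfolding eq(2) using square_part_squarefree_times_square xm m by simp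
  finally have b2: "b2 = d2" .
  then have b1: "b1 = d1" using eq(2) n by simp
  have "int a1 = gcd (int (a1 * a2)) x"
  proof (rule coprime_split_unique)
    show "coprime (int (a1 * a2)) ((int (b1 * b2\<^sup>2))\<^sup>2)" using xn(2) by (simp add: coprime_mult_left_iff coprime_mult_right_iff)
  qed (use xn in \<open>auto dest: dvd_mult_left\<close>)
  moreover have "int c1 = gcd (int (c1 * c2)) y"
  proof (rule coprime_split_unique)
    show "coprime (int (c1 * c2)) ((int (d1 * d2\<^sup>2))\<^sup>2)" using xm(2) by (simp add: coprime_mult_left_iff coprime_mult_right_iff)
  qed (use xm in \<open>auto dest: dvd_mult_left\<close>)
  ultimately have "int a1 = int c1" using eq t(5) by metis
  then show "n = m \<and> x = y" using eq t(5) b1 b2 unfolding n(1) m(1) using n by simp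
qed

lemma asymptotic_N2:
  obtains C where "\<And>B. B \<ge> 1 \<Longrightarrow> \<bar>real (N2 B) - 1 / 32 * prime_prod (\<lambda>p. (1 - 1 / p) ^ 3 * (1 + 3 / p)) * B * ln B ^ 4\<bar> \<le> C * (B * (ln B + 1) ^ 3)"
proof -
  let ?D = "\<lambda>p::real. (1 - 1 / p) ^ 3 * (1 + 3 / p)"
  have len: "length [1, 1, 1, 2::nat] = 4" by simp
  have dens: "density [1, 1, 1, 2] x (weight2 p) = (1 - x) ^ 3 * (1 + 3 * x)" for x p
    by (simp add: weight2_def numeral_2_eq_2 algebra_simps power2_eq_square power3_eq_cube)
  obtain K where K: "K \<ge> 0" and Kb: "\<And>T M \<Psi>. \<lbrakk>0 \<le> T; antitone_cutoff 4 T M \<Psi>\<rbrakk> \<Longrightarrow>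
       \<bar>(\<Sum>n\<in>Box 4 (nat \<lfloor>exp T\<rfloor>). weight [1, 1, 1, 2] weight2 (nat \<lfloor>exp T\<rfloor>) n * (\<Psi> (map (\<lambda>x. ln (real x)) n) / real (prod_list n)))
          - prime_prod ?D * iterated_integral 4 T \<Psi>\<bar> \<le> K * ((T + 1) ^ (4 - 1) * M)"
  proof (rule sieve_log[where f = weight2 and cs = "[1, 1, 1, 2]" and C = 0 and D = ?D, unfolded len])
    fix p :: nat and e :: "nat list" assume e: "length e = 4" "sum_list e = 1"
    obtain a b c d where abcd: "e = [a, b, c, d]" using e(1) by (auto simp: numeral_4_eq_4 length_Suc_conv)
    then have "a + b + c + d = 1" using e(2) by simp
    then have "[a, b, c, d] \<in> {[1, 0, 0, 0], [0, 1, 0, 0], [0, 0, 1, 0], [0, 0, 0, 1]}" by (auto simp: add_is_1)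
    then show "\<bar>weight2 p e - 1\<bar> \<le> 0 / real p" unfolding abcd by (auto simp: weight2_def)
  next
    show "density [1, 1, 1, 2] (1 / real p) (weight2 p) = ?D (real p)" for p
      unfolding dens by simp
  qed (simp_all add: weight2_def)
  have "\<bar>real (N2 B) - 1 / 32 * prime_prod ?D * B * ln B ^ 4\<bar> \<le> (4 * K + 4) * (B * (ln B + 1) ^ 3)" if B: "B \<ge> 1" for B
  proof -
    define T where "T = ln B"
    define N where "N = nat \<lfloor>B\<rfloor>"
    have T: "0 \<le> T" "exp T = B" using B by (auto simp: T_def)
    define P where "P n \<longleftrightarrow> (squarefree (n ! 3) \<and> coprime (n ! 0) (n ! 1) \<and> coprime (n ! 0 * n ! 1) (n ! 3 * n ! 2)) \<and> real ((n ! 0 * n ! 1) ^ 2) \<le> B \<and> real ((n ! 3 * (n ! 2) ^ 2) ^ 2) \<le> B" for n :: "nat list"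
    define Y where "Y n = {x::int. real_of_int \<bar>x\<bar> \<le> B \<and> int (n ! 0) * (int (n ! 3) * int (n ! 2)) dvd x \<and> int (n ! 1) dvd x + (int (n ! 3 * (n ! 2) ^ 2))\<^sup>2}" for n :: "nat list"
    define W where "W n = weight [1, 1, 1, 2] weight2 N n * (region2 T (map (\<lambda>x. ln (real x)) n) / real (prod_list n))" for n
    have el: "\<exists>a1 a2 c b. n = [a1, a2, c, b] \<and> a1 \<in> {1..N} \<and> a2 \<in> {1..N} \<and> c \<in> {1..N} \<and> b \<in> {1..N}" if "n \<in> Box 4 N" for n
      using that by (auto simp: Box_def numeral_4_eq_4 length_Suc_conv)
    have main: "\<bar>real (card (SIGMA n:{n\<in>Box 4 N. P n}. Y n)) - 2 * B * (prime_prod ?D * (T ^ 4 / 128))\<bar>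
       \<le> 2 * B * (K * (T + 1) ^ 3) + (\<Sum>n\<in>{n\<in>Box 4 N. P n}. 1)"
    proof (rule card_Sigma_asymptotic[where W = W and v = "\<lambda>n. 1 / real (prod_list n)"])
      fix n assume n: "n \<in> Box 4 N"
      obtain a1 a2 c b where abc: "n = [a1, a2, c, b]" "a1 \<in> {1..N}" "a2 \<in> {1..N}" "c \<in> {1..N}" "b \<in> {1..N}" using el[OF n] by blast
      have "2 * (ln (real a1) + ln (real a2)) = ln (real ((a1 * a2) ^ 2))" "2 * (2 * ln (real c) + ln (real b)) = ln (real ((b * c ^ 2) ^ 2))"
        using abc by (simp_all add: ln_mult ln_realpow)
      then have "2 * (ln (real a1) + ln (real a2)) \<le> T \<and> 2 * (2 * ln (real c) + ln (real b)) \<le> T \<longleftrightarrow> real ((a1 * a2) ^ 2) \<le> B \<and> real ((b * c ^ 2) ^ 2) \<le> B"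
        using abc B by (simp add: T_def)
      then show "W n = (if P n then 1 / real (prod_list n) else 0)"
        using weight2_eq[OF abc(2-5)] by (auto simp: W_def P_def abc(1) region2_def)
      assume "P n"
      then have "coprime (int a1 * (int b * int c)) (int a2)"
        using abc by (simp add: P_def coprime_commute coprime_mult_left_iff coprime_mult_right_iff)
      then obtain r where r: "\<And>x. (int a1 * (int b * int c) dvd x \<and> int a2 dvd x + (int (b * c ^ 2))\<^sup>2) \<longleftrightarrow> int a1 * (int b * int c) * int a2 dvd x - r"
        using crt_dvd by metis
      have "Y n = {x::int. real_of_int \<bar>x\<bar> \<le> B \<and> (int a1 * (int b * int c) dvd x \<and> int a2 dvd x + (int (b * c ^ 2))\<^sup>2)}" by (simp add: Y_def abc)
      then show "finite (Y n)" "\<bar>real (card (Y n)) - 2 * B * (1 / real (prod_list n))\<bar> \<le> 1"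
        using card_residue_window[of "a1 * (b * c) * a2" B "\<lambda>x. int a1 * (int b * int c) dvd x \<and> int a2 dvd x + (int (b * c ^ 2))\<^sup>2" r] r abc B by (auto simp: mult_ac)
    next
      show "\<bar>(\<Sum>n\<in>Box 4 N. W n) - prime_prod ?D * (T ^ 4 / 128)\<bar> \<le> K * (T + 1) ^ 3"
        unfolding W_def using Kb[OF T(1) antitone_cutoff_region2[OF T(1)]] integral_region2[OF T(1)] T by (simp add: N_def)
    qed (use B in auto)
    have "N2 B = 2 * card (SIGMA n:{n\<in>Box 4 N. P n}. Y n)"
      unfolding N2_def
      unfolding P_def Y_def N_def card_N2_solutions[OF B, symmetric]
      by (rule point_count_half) (simp_all add: integral2_def H2_def)
    then have card: "real (N2 B) = 2 * real (card (SIGMA n:{n\<in>Box 4 N. P n}. Y n))" by simp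
    \<comment> \<open>The same mean inequality gives a1 a2 b c^2 <= B, so the rounding errors are
      again dominated by a product of which the factor in c has a convergent sum.\<close>
    have err: "(\<Sum>n\<in>{n\<in>Box 4 N. P n}. 1) \<le> B * (2 * (T + 1) ^ 3)"
    proof -
      let ?fs = "[\<lambda>a. 1 / real a, \<lambda>a. 1 / real a, \<lambda>c. 1 / real c ^ 2, \<lambda>b. 1 / real b]"
      have "(\<Sum>n\<in>{n\<in>Box 4 N. P n}. 1) \<le> (\<Sum>n\<in>Box 4 N. B * prod_list (map2 (\<lambda>f x. f x) ?fs n))"
        unfolding sum.inter_filter[OF finite_Box]
      proof (intro sum_mono)
        fix n assume n: "n \<in> Box 4 N"
        obtain a1 a2 c b where abc: "n = [a1, a2, c, b]" "a1 \<in> {1..N}" "a2 \<in> {1..N}" "c \<in> {1..N}" "b \<in> {1..N}" using el[OF n] by blast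
        have "2 * (u * v) \<le> u ^ 2 + v ^ 2" for u v :: real using sum_squares_bound[of u v] by simp
        from this[of "real (a1 * a2)" "real (b * c ^ 2)"] have "P n \<Longrightarrow> real (a1 * a2) * real (b * c ^ 2) \<le> B"
          unfolding P_def abc by simp
        then show "(if P n then 1 else 0) \<le> B * prod_list (map2 (\<lambda>f x. f x) ?fs n)"
          using abc B by (auto simp: divide_simps mult_ac)
      qed
      also have "\<dots> = B * ((\<Sum>a=1..N. 1 / real a) * ((\<Sum>a=1..N. 1 / real a) * ((\<Sum>c=1..N. 1 / real c ^ 2) * (\<Sum>b=1..N. 1 / real b))))"
        using sum_Box_prod[of ?fs N] by (simp add: sum_distrib_left[symmetric] numeral_4_eq_4)
      also have "\<dots> \<le> B * ((T + 1) * ((T + 1) * (2 * (T + 1))))"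
        using sum_inverse_floor_le[OF B] sum_inverse_squares_le[of N] B T unfolding N_def T_def
        by (intro mult_left_mono mult_mono mult_nonneg_nonneg sum_nonneg) auto
      finally show ?thesis by (simp add: power3_eq_cube mult_ac)
    qed
    have "2 * (2 * B * (prime_prod ?D * (T ^ 4 / 128))) = 1 / 32 * prime_prod ?D * B * T ^ 4" by simp
    moreover have "(4 * K + 4) * (B * (T + 1) ^ 3) = 2 * (2 * B * (K * (T + 1) ^ 3) + B * (2 * (T + 1) ^ 3))"
      by (simp add: algebra_simps)
    ultimately show ?thesis unfolding T_def[symmetric] by (intro double_count_bound[OF card main err])
  qed
  then show ?thesis by (rule that)
qed

section \<open>Elementary sums and a bound for the number of prime factors\<close>

lemma sum_inverse_sqrt_le:
  assumes "0 \<le> x"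
  shows "(\<Sum>n=1..nat \<lfloor>x\<rfloor>. 1 / sqrt (real n)) \<le> 2 * sqrt x"
proof -
  have "(\<Sum>n=1..N. 1 / sqrt (real n)) \<le> 2 * sqrt (real N)" for N
  proof (induction N)
    case (Suc N)
    let ?u = "sqrt (real N)" and ?v = "sqrt (real (Suc N))"
    have v: "0 < ?v" "0 \<le> ?u" "?u \<le> ?v" by auto
    have "?v ^ 2 - ?u ^ 2 = 1" by simp
    then have "(?v - ?u) * (?v + ?u) = 1" by (simp add: power2_eq_square algebra_simps)
    moreover have "(?v - ?u) * (?v + ?u) \<le> (?v - ?u) * (2 * ?v)" using v by (intro mult_left_mono) auto
    ultimately have "1 \<le> (?v - ?u) * (2 * ?v)" by linarith
    then have "1 / ?v \<le> (?v - ?u) * (2 * ?v) / ?v" using v(1) by (intro divide_right_mono) auto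
    also have "\<dots> = 2 * (?v - ?u)" using v(1) by simp
    finally have "1 / ?v \<le> 2 * (?v - ?u)" .
    then show ?case using Suc.IH by simp
  qed simp
  from this[of "nat \<lfloor>x\<rfloor>"] have "(\<Sum>n=1..nat \<lfloor>x\<rfloor>. 1 / sqrt (real n)) \<le> 2 * sqrt (real (nat \<lfloor>x\<rfloor>))" .
  also have "\<dots> \<le> 2 * sqrt x" using assms by (intro mult_left_mono real_sqrt_le_mono of_nat_floor) auto
  finally show ?thesis .
qed

text \<open>For consecutive square roots u, v this makes the sum of n^(-3/2) telescope; it rests on
  (v - u) (v + u) = 1 and u <= v.\<close>

lemma inverse_cube_le:
  fixes u v :: real
  assumes "0 < u" "u \<le> v" "v ^ 2 - u ^ 2 = 1"
  shows "1 / (v * v * v) \<le> 2 / u - 2 / v"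
proof -
  have v: "0 < v" using assms by simp
  have *: "(v - u) * (v + u) = 1" using assms(3) by (simp add: power2_eq_square algebra_simps)
  have "u * v * (v + u) \<le> v * v * (v + v)" using assms v by (intro mult_mono) auto
  then have "2 / (v * v * (v + v)) \<le> 2 / (u * v * (v + u))"
    using assms v by (intro divide_left_mono mult_pos_pos add_pos_pos) auto
  moreover have "2 / (v * v * (v + v)) = 1 / (v * v * v)" using v by (simp add: field_simps)
  moreover have "2 / (u * v * (v + u)) = 2 * ((v - u) * (v + u)) / (u * v * (v + u))" using * by simp
  moreover have "2 * ((v - u) * (v + u)) / (u * v * (v + u)) = 2 / u - 2 / v"
  proof -
    have "2 * ((v - u) * (v + u)) / (u * v * (v + u)) = (2 * (v - u)) * (v + u) / ((u * v) * (v + u))" by (simp only: mult.assoc)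
    also have "\<dots> = (2 * (v - u)) / (u * v)" using v assms(1) by (intro mult_divide_mult_cancel_right) auto
    also have "\<dots> = 2 / u - 2 / v" using v assms(1) by (simp add: field_simps)
    finally show ?thesis .
  qed
  ultimately show ?thesis by linarith
qed

lemma sum_inverse_three_halves_le: "(\<Sum>n=1..N. sqrt (real n) / real n ^ 2) \<le> 3"
proof -
  have "(\<Sum>n=1..N. sqrt (real n) / real n ^ 2) \<le> 3 - 2 / sqrt (real N)" if "N \<ge> 1"
    using that
  proof (induction N rule: dec_induct)
    case (step n)
    let ?u = "sqrt (real n)" and ?v = "sqrt (real (Suc n))"
    have v: "0 < ?v" "0 < ?u" "?u \<le> ?v" using step.hyps by auto
    have d: "?v ^ 2 - ?u ^ 2 = 1" by simp
    have "v / ((v * v) * (v * v)) = 1 / (v * v * v)" if "v > 0" for v :: real using that by (simp add: field_simps)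
    from this[OF v(1)] have "?v / real (Suc n) ^ 2 = 1 / (?v * ?v * ?v)"
      by (simp only: power2_eq_square real_sqrt_mult_self abs_of_nat)
    also have "\<dots> \<le> 2 / ?u - 2 / ?v" by (rule inverse_cube_le[OF v(2,3) d])
    finally have "?v / real (Suc n) ^ 2 \<le> 2 / ?u - 2 / ?v" .
    then show ?case using step.IH by simp
  qed simp
  then show ?thesis by (cases "N \<ge> 1") (auto intro: order_trans)
qed

lemma prod_sqrt: "finite A \<Longrightarrow> (\<Prod>x\<in>A. sqrt (f x)) = sqrt (\<Prod>x\<in>A. f x)"
  by (induction A rule: finite_induct) (auto simp: real_sqrt_mult)

text \<open>From p >= 9 on, 3 <= sqrt p; below 9 there are only the primes 2, 3, 5, 7, whence 81 =
  3^4. Any exponent below 1 would serve, because such sieve errors are later weighted by 1 /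
  c^2.\<close>

lemma prod_prime_factors_3_le:
  assumes "c > (0::nat)"
  shows "(\<Prod>p\<in>prime_factors c. 3) \<le> 81 * sqrt (real c)"
proof -
  have "(\<Prod>p\<in>prime_factors c. 3) \<le> (\<Prod>p\<in>prime_factors c. (if p < 9 then 3 else 1) * sqrt (real p))"
  proof (intro prod_mono conjI)
    fix p assume "p \<in> prime_factors c"
    then have "1 \<le> real p" by (simp add: prime_factors_multiplicity Suc_leI prime_gt_0_nat)
    then have "1 \<le> sqrt (real p)" by simp
    moreover have "3 \<le> sqrt (real p)" if "\<not> p < 9" using that real_sqrt_le_mono[of "3 ^ 2" "real p"] by simp
    ultimately show "3 \<le> (if p < 9 then 3 else 1) * sqrt (real p)" by auto
  qed auto
  also have "\<dots> = (\<Prod>p\<in>prime_factors c. (if p < 9 then 3 else 1)) * sqrt (\<Prod>p\<in>prime_factors c. real p)"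
    by (simp add: prod.distrib prod_sqrt)
  also have "\<dots> \<le> 81 * sqrt (real c)"
  proof (intro mult_mono real_sqrt_le_mono)
    have "(\<Prod>p\<in>prime_factors c. (if p < 9 then 3 else (1::real))) = (\<Prod>p\<in>{p\<in>prime_factors c. p < 9}. 3)"
      by (rule prod.inter_filter[symmetric]) simp
    also have "\<dots> = 3 ^ card {p\<in>prime_factors c. p < 9}" by simp
    also have "\<dots> \<le> 3 ^ 4"
    proof (intro power_increasing)
      have "{p\<in>prime_factors c. p < 9} \<subseteq> {2, 3, 5, 7}"
      proof
        fix p assume "p \<in> {p\<in>prime_factors c. p < 9}"
        then have "prime p" "p < 9" by (auto simp: prime_factors_multiplicity)
        moreover from this have "p \<noteq> 0" "p \<noteq> 1" by (auto simp: prime_gt_0_nat)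
        moreover have "\<not> prime (4::nat)" "\<not> prime (6::nat)" "\<not> prime (8::nat)" by (simp_all add: prime_nat_numeral_eq)
        ultimately have "p = 2 \<or> p = 3 \<or> p = 4 \<or> p = 5 \<or> p = 6 \<or> p = 7 \<or> p = 8" by linarith
        then show "p \<in> {2, 3, 5, 7}" using \<open>prime p\<close> \<open>\<not> prime (4::nat)\<close> \<open>\<not> prime (6::nat)\<close> \<open>\<not> prime (8::nat)\<close> by auto
      qed
      from card_mono[OF _ this] show "card {p\<in>prime_factors c. p < 9} \<le> 4" by simp
    qed simp
    finally show "(\<Prod>p\<in>prime_factors c. (if p < 9 then 3 else (1::real))) \<le> 81" by simp
    have "(\<Prod>p\<in>prime_factors c. real p) \<le> (\<Prod>p\<in>prime_factors c. real (p ^ multiplicity p c))"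
    proof (intro prod_mono conjI)
      fix p assume "p \<in> prime_factors c"
      then have "0 < multiplicity p c" "1 \<le> p" by (auto simp: prime_factors_multiplicity Suc_leI prime_gt_0_nat)
      then have "p ^ 1 \<le> p ^ multiplicity p c" by (intro power_increasing) auto
      then show "real p \<le> real (p ^ multiplicity p c)" by simp
    qed auto
    also have "\<dots> = real c" using prime_factorization_nat[OF assms] by (metis of_nat_prod)
    finally show "(\<Prod>p\<in>prime_factors c. real p) \<le> real c" .
  qed (auto intro!: prod_nonneg)
  finally show ?thesis .
qed

subsection \<open>The complement of both singularities\<close>

text \<open>
  Here integrality forces \<open>b = c\<^sup>2\<close>, and \<open>x\<^sub>0 = c y\<close> with \<open>a\<^sub>1 dvd y\<close> and \<open>a\<^sub>2 dvd y + c\<^sup>3\<close>; lists are ordered as \<open>[c, a\<^sub>1, a\<^sub>2]\<close>.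
\<close>

definition weight3 :: "nat \<Rightarrow> nat list \<Rightarrow> real" where
  "weight3 p r = (if \<not> (r ! 0 \<ge> 1 \<and> r ! 1 \<ge> 1) \<and> \<not> (r ! 0 \<ge> 1 \<and> r ! 2 \<ge> 1) \<and> \<not> (r ! 1 \<ge> 1 \<and> r ! 2 \<ge> 1)
     then if r ! 0 \<ge> 1 then 1 - 1 / real p else 1 else 0)"

text \<open>The conditions x3 = c^4 <= B and x1 = (a1 a2)^2 <= B. The height also admits larger
  \<open>x1\<close> if \<open>x4\<close> is small; those points go into the error term.\<close>

definition region3 :: "real \<Rightarrow> real list \<Rightarrow> real" where
  "region3 T ts = (if 4 * ts ! 0 \<le> T \<and> 2 * (ts ! 1 + ts ! 2) \<le> T then 1 else 0)"

lemma prod_prime_factors_le: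
  fixes c N :: nat
  assumes "c \<in> {1..N}"
  shows "(\<Prod>p\<in>{p. prime p \<and> p \<le> N}. if p dvd c then h p else 1) = (\<Prod>p\<in>prime_factors c. h p :: real)"
proof -
  have "{p \<in> {p. prime p \<and> p \<le> N}. p dvd c} = prime_factors c"
  proof -
    have "c \<noteq> 0" using assms by auto
    then show ?thesis unfolding prime_factors_dvd[OF \<open>c \<noteq> 0\<close>] using assms by (auto intro: order_trans[OF dvd_imp_le])
  qed
  then show ?thesis unfolding prod.inter_filter[OF finite_primes_le, symmetric] by (rule arg_cong)
qed

text \<open>A prime of c contributes 1 - 1/p, the proportion of integers y that it does not divide;
  the product is the density of the y coprime to c in a fibre.\<close>

lemma weight3_eq:
  assumes "c \<in> {1..N}" "a \<in> {1..N}" "b \<in> {1..N}"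
  shows "weight [1, 1, 1] weight3 N [c, a, b] = (if coprime c a \<and> coprime c b \<and> coprime a b then \<Prod>p\<in>prime_factors c. 1 - 1 / real p else 0)"
proof -
  have "weight [1, 1, 1] weight3 N [c, a, b] =
      (\<Prod>p\<in>{p. prime p \<and> p \<le> N}. if \<not> (p dvd c \<and> p dvd a) \<and> \<not> (p dvd c \<and> p dvd b) \<and> \<not> (p dvd a \<and> p dvd b) then if p dvd c then 1 - 1 / real p else 1 else 0)"
    unfolding weight_def local_weight_def
    using assms by (intro prod.cong refl) (auto simp: weight3_def min_1_multiplicity)
  then show ?thesis unfolding prod_if_zero[OF finite_primes_le] prod_prime_factors_le[OF assms(1)]
    using assms coprime_iff_no_prime[of c N a] coprime_iff_no_prime[of c N b] coprime_iff_no_prime[of a N b]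
    by auto
qed

lemma antitone_cutoff_region3: "0 \<le> T \<Longrightarrow> antitone_cutoff 3 T 1 (region3 T)"
  unfolding region3_def
proof (rule antitone_cutoff_if)
  fix ts us :: "real list"
  assume ts: "length ts = 3" "\<forall>t\<in>set ts. 0 \<le> t"
  obtain a b c where abc: "ts = [a, b, c]" using ts(1) by (auto simp: numeral_3_eq_3 length_Suc_conv)
  { assume "list_all2 (\<le>) ts us" "4 * us ! 0 \<le> T \<and> 2 * (us ! 1 + us ! 2) \<le> T"
    then obtain a' b' c' where "us = [a', b', c']" "a \<le> a'" "b \<le> b'" "c \<le> c'" "4 * a' \<le> T" "2 * (b' + c') \<le> T"
      unfolding abc list_all2_Cons1 by auto
    then show "4 * ts ! 0 \<le> T \<and> 2 * (ts ! 1 + ts ! 2) \<le> T" unfolding abc by simp }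
  { assume "4 * ts ! 0 \<le> T \<and> 2 * (ts ! 1 + ts ! 2) \<le> T"
    then show "\<forall>t\<in>set ts. t \<le> T" using ts(2) unfolding abc by simp }
qed

text \<open>An interval of length T / 4 times a triangle of area T^2 / 8.\<close>

lemma integral_region3:
  assumes T: "0 \<le> T"
  shows "iterated_integral 3 T (region3 T) = T ^ 3 / 32"
proof -
  have 1: "integral {0..T} (\<lambda>u. if 4 * t \<le> T \<and> 2 * (s + u) \<le> T then 1 else 0)
      = (if s \<le> T / 2 then if t \<le> T / 4 then T / 2 - s else 0 else 0)" if "t \<in> {0..T}" "s \<in> {0..T}" for t s
  proof (cases "s \<le> T / 2 \<and> t \<le> T / 4")
    case True
    then have "integral {0..T} (\<lambda>u. if u \<le> T / 2 - s then 1 else 0) = (T / 2 - s) - 0"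
      using that by (intro integral_cutoff) (auto intro!: derivative_eq_intros)
    moreover have "2 * (s + u) \<le> T \<longleftrightarrow> u \<le> T / 2 - s" for u by (auto simp: field_simps)
    ultimately show ?thesis using True by simp
  next
    case False
    then have "integral {0..T} (\<lambda>u. if 4 * t \<le> T \<and> 2 * (s + u) \<le> T then 1 else 0) = integral {0..T} (\<lambda>u. 0 :: real)"
      by (intro integral_cong) auto
    then show ?thesis using False by auto
  qed
  have 2: "integral {0..T} (\<lambda>s. if s \<le> T / 2 then if t \<le> T / 4 then T / 2 - s else 0 else 0)
      = (if t \<le> T / 4 then T ^ 2 / 8 else 0)" for t
  proof (cases "t \<le> T / 4")
    case True
    have "integral {0..T} (\<lambda>s. if s \<le> T / 2 then T / 2 - s else 0) = (T / 2 * (T / 2) - (T / 2) ^ 2 / 2) - (T / 2 * 0 - 0 ^ 2 / 2)"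
      using T by (intro integral_cutoff[where G = "\<lambda>s. T / 2 * s - s ^ 2 / 2"]) (auto intro!: derivative_eq_intros)
    also have "\<dots> = T ^ 2 / 8" by (simp add: power2_eq_square)
    finally have *: "integral {0..T} (\<lambda>s. if s \<le> T / 2 then T / 2 - s else 0) = T ^ 2 / 8" .
    then show ?thesis by (simp only: True if_True *)
  next
    case False
    then show ?thesis by (simp only: if_False if_cancel integral_0)
  qed
  have "iterated_integral 3 T (region3 T) = integral {0..T} (\<lambda>t. integral {0..T} (\<lambda>s. integral {0..T} (\<lambda>u. if 4 * t \<le> T \<and> 2 * (s + u) \<le> T then 1 else 0)))"
    unfolding numeral_3_eq_3 by (simp add: region3_def)
  also have "\<dots> = integral {0..T} (\<lambda>t. integral {0..T} (\<lambda>s. if s \<le> T / 2 then if t \<le> T / 4 then T / 2 - s else 0 else 0))"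
    by (intro integral_cong 1)
  also have "\<dots> = integral {0..T} (\<lambda>t. if t \<le> T / 4 then T ^ 2 / 8 else 0)"
    unfolding 2 ..
  also have "\<dots> = T ^ 2 / 8 * (T / 4) - T ^ 2 / 8 * 0"
    using T by (intro integral_cutoff[where G = "\<lambda>t. T ^ 2 / 8 * t"]) (auto intro!: derivative_eq_intros)
  finally show ?thesis by (simp add: power2_eq_square power3_eq_cube)
qed

lemma card_N3_solutions:
  assumes B: "B \<ge> 1"
  shows "card {(x0, x1, x2, x3, x4). (x0, x1, x2, x3, x4) \<in> dP4 \<and> x2 > 0 \<and> x3 > 0 \<and> integral3 (x0, x1, x2, x3, x4) \<and> real_of_int (H3 (x0, x1, x2, x3, x4)) \<le> B}
   = card (SIGMA n:{n\<in>Box 3 (nat \<lfloor>B\<rfloor>). (coprime (n ! 0) (n ! 1) \<and> coprime (n ! 0) (n ! 2) \<and> coprime (n ! 1) (n ! 2)) \<and> real ((n ! 0) ^ 4) \<le> B \<and> real (n ! 1 * n ! 2 * (n ! 0) ^ 2) \<le> B}.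
      {y::int. real_of_int \<bar>int (n ! 0) * y\<bar> \<le> B \<and> coprime y (int (n ! 0)) \<and> int (n ! 1) dvd y \<and> int (n ! 2) dvd y + (int (n ! 0)) ^ 3
         \<and> (real ((n ! 1 * n ! 2) ^ 2) \<le> B \<or> real_of_int \<bar>y * (y + (int (n ! 0)) ^ 3)\<bar> \<le> B * real (n ! 1 * n ! 2))})"
  (is "card ?S = card ?A")
proof (rule card_param[where \<alpha> = "\<lambda>n. n ! 1 * n ! 2" and \<beta> = "\<lambda>n. (n ! 0) ^ 2" and \<xi> = "\<lambda>n y. int (n ! 0) * y"])
  fix x0 x1 x2 x3 x4 assume "(x0, x1, x2, x3, x4) \<in> ?S"
  then have dp: "(x0, x1, x2, x3, x4) \<in> dP4" and pos: "x2 > 0" "x3 > 0"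
    and g: "Gcd {x0, x2, x3, x4} = 1" "Gcd {x0, x1, x2, x3} = 1"
    and h: "real_of_int \<bar>x0\<bar> \<le> B" "real_of_int \<bar>x2\<bar> \<le> B" "real_of_int \<bar>x3\<bar> \<le> B" "real_of_int \<bar>x1\<bar> \<le> B \<or> real_of_int \<bar>x4\<bar> \<le> B"
    by (auto simp: integral3_def H_le_iff simp del: Gcd_insert)
  have cop: False if "prime p" "p dvd x0" "p dvd x1" "p dvd x2" "p dvd x3" for p
    using g(2) that Gcd_int_eq_1_iff[of "{x0, x1, x2, x3}"] by auto
  have cop4: False if "prime p" "p dvd x3" "p dvd x4" for p
    using g(1) that prime_dvd_x0[OF dp that(1,2)] Gcd_int_eq_1_iff[of "{x0, x2, x3, x4}"] by auto
  show "(x0, x1, x2, x3, x4) \<in> dP4 \<and> 0 < x2" using dp pos by simp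
  obtain a b b1 c :: nat where p: "a > 0" "b > 0" "b1 > 0" "c > 0" "squarefree b1" "b = b1 * c ^ 2" "coprime a b"
    "x1 = (int a)\<^sup>2" "x2 = int a * int b" "x3 = (int b)\<^sup>2"
    "- (int a * int b * x4) = x0 * (x0 + (int b)\<^sup>2)" "int b1 * int c dvd x0"
    by (rule square_param[OF dp pos]) (use cop in blast)+
  obtain z where z: "x0 = int b1 * int c * z" using p(12) by (rule dvdE)
  have "(int b1 * int c ^ 2) * - (int a * x4) = (int b1 * int c ^ 2) * (int b1 * (z * (z + int b1 * int c ^ 3)))"
    using p(11) unfolding z p(6) by (simp add: power2_eq_square power3_eq_cube algebra_simps)
  moreover have "int b1 * int c ^ 2 \<noteq> 0" using p(3,4) by simp
  ultimately have ax4: "- (int a * x4) = int b1 * (z * (z + int b1 * int c ^ 3))" by (metis mult_left_cancel)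
  have dvd4: "q dvd x4" if "prime q" "q dvd int b" "q dvd int a * x4" for q
  proof -
    have "\<not> q dvd int a" using that p(7) by (metis coprime_common_divisor coprime_int_iff not_prime_unit)
    then show ?thesis using that by (simp add: prime_dvd_mult_iff)
  qed
  \<comment> \<open>A prime q of b1 divides b and hence \<open>x3\<close>. By \<open>ax4\<close> it
    divides a x4 but not a, so it divides \<open>x4\<close>, against the first gcd
    condition.\<close>
  have b1: "b1 = 1"
  proof (rule ccontr)
    assume "b1 \<noteq> 1"
    then obtain q :: nat where q: "prime q" "q dvd b1" using prime_factor_nat by blast
    then have iq: "prime (int q)" "int q dvd int b1" by simp_all
    then have "int q dvd - (int a * x4)" unfolding ax4 by simp
    then have "int q dvd int a * x4" by simp
    moreover have "int q dvd int b" using iq p(6) by simp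
    ultimately have "int q dvd x4" using dvd4 iq by blast
    moreover have "int q dvd x3" using p(10) \<open>int q dvd int b\<close> by (simp add: power2_eq_square)
    ultimately show False using cop4 iq by blast
  qed
  have b: "b = c ^ 2" and x0: "x0 = int c * z" and ax: "- (int a * x4) = z * (z + int c ^ 3)"
    using p(6) z ax4 b1 by simp_all
  \<comment> \<open>A prime common to z and c would likewise divide \<open>x3\<close> and
    \<open>x4\<close>.\<close>
  have zc: "coprime z (int c)"
  proof (rule ccontr)
    assume "\<not> coprime z (int c)"
    then have "\<not> is_unit (gcd z (int c))" by (simp add: coprime_iff_gcd_eq_1)
    moreover have "gcd z (int c) \<noteq> 0" using p by simp
    ultimately obtain q where "prime q" "q dvd gcd z (int c)" using prime_divisor_exists by blast
    then have q: "prime q" "q dvd z" "q dvd int c" by auto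
    then have qb: "q dvd int b" unfolding b by (simp add: prime_dvd_power_iff)
    have "q dvd - (int a * x4)" unfolding ax using q by simp
    then have "q dvd int a * x4" by simp
    then have "q dvd x4" using dvd4 q(1) qb by blast
    moreover have "q dvd x3" using p(10) qb by (simp add: power2_eq_square)
    ultimately show False using cop4 q by blast
  qed
  have ac: "coprime a c" using p(7) unfolding b by simp
  have "int a dvd z * (z + int c ^ 3)" unfolding ax[symmetric] by simp
  moreover have "coprime (int a) (int c ^ 3)" using ac by simp
  ultimately obtain a1 a2 where s: "a = a1 * a2" "coprime a1 a2" "int a1 dvd z" "int a2 dvd z + int c ^ 3"
    using coprime_split_exists[OF p(1)] by metis
  have s0: "0 < a1" "0 < a2" using s p by auto
  have r: "real (c ^ 4) \<le> B" "real (a1 * a2 * c ^ 2) \<le> B"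
    using h(2,3) p(9,10) unfolding b s(1) by (simp_all add: abs_mult)
  have le: "a1 \<le> a1 * a2 * c ^ 2" "a2 \<le> a1 * a2 * c ^ 2" "c \<le> a1 * a2 * c ^ 2"
  proof -
    have "a1 * 1 \<le> a1 * (a2 * c ^ 2)" "a2 * 1 \<le> a2 * (a1 * c ^ 2)" "c * 1 \<le> c * (a1 * a2 * c)"
      using p(4) s0 by (intro mult_le_mono2; simp add: Suc_leI)+
    then show "a1 \<le> a1 * a2 * c ^ 2" "a2 \<le> a1 * a2 * c ^ 2" "c \<le> a1 * a2 * c ^ 2"
      by (simp_all add: power2_eq_square mult_ac)
  qed
  then have "real a1 \<le> B" "real a2 \<le> B" "real c \<le> B" using r(2) by (meson of_nat_mono order_trans)+
  then have bx: "[c, a1, a2] \<in> Box 3 (nat \<lfloor>B\<rfloor>)" using p(4) s0 B by (auto simp: Box_def le_nat_floor_iff)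
  have h4: "real ((a1 * a2) ^ 2) \<le> B \<or> real_of_int \<bar>z * (z + (int c) ^ 3)\<bar> \<le> B * real (a1 * a2)"
    using h(4)
  proof
    assume "real_of_int \<bar>x1\<bar> \<le> B"
    then show ?thesis using p(8) s(1) by simp
  next
    assume x4: "real_of_int \<bar>x4\<bar> \<le> B"
    have "real_of_int \<bar>z * (z + (int c) ^ 3)\<bar> = real a * real_of_int \<bar>x4\<bar>"
      unfolding ax[symmetric] by (simp add: abs_mult)
    also have "\<dots> \<le> real a * B" using x4 by (intro mult_left_mono) auto
    finally show ?thesis using s(1) by (simp add: mult.commute)
  qed
  have "([c, a1, a2], z) \<in> ?A" using bx s zc ac r h4 h(1) x0 by (simp add: coprime_commute)
  then show "\<exists>n x. (n, x) \<in> ?A \<and> x0 = int (n ! 0) * x \<and> x1 = (int (n ! 1 * n ! 2))\<^sup>2 \<and> x3 = (int ((n ! 0)\<^sup>2))\<^sup>2"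
    using p(8,10) s(1) b x0 by (intro exI[of _ "[c, a1, a2]"] exI[of _ z]) simp
next
  fix n y assume t: "(n, y) \<in> ?A"
  obtain c a1 a2 where n: "n = [c, a1, a2]" "0 < c" "0 < a1" "0 < a2"
    using t by (auto simp: Box_def numeral_3_eq_3 length_Suc_conv)
  define a where "a = a1 * a2"
  have a: "a > 0" using n by (simp add: a_def)
  have t': "coprime c a1" "coprime c a2" "coprime a1 a2" "real (c ^ 4) \<le> B" "real (a * c ^ 2) \<le> B"
    "real_of_int \<bar>int c * y\<bar> \<le> B" "coprime y (int c)" "int a1 dvd y" "int a2 dvd y + int c ^ 3"
    "real (a ^ 2) \<le> B \<or> real_of_int \<bar>y * (y + int c ^ 3)\<bar> \<le> B * real a" using t n by (auto simp: a_def)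
  have ac: "coprime a c" using t' by (simp add: a_def coprime_mult_left_iff coprime_commute)
  have "int a dvd y * (y + int c ^ 3)" using t'(8,9) by (simp add: a_def mult_dvd_mono)
  then obtain q where q: "y * (y + int c ^ 3) = int a * q" by (rule dvdE)
  have "(int c * y) ^ 2 + int c * y * ((int (c ^ 2))\<^sup>2) + int a * int (c ^ 2) * (- q) = int c ^ 2 * (y * (y + int c ^ 3) - int a * q)"
    by (simp add: power2_eq_square power3_eq_cube algebra_simps)
  then have dp: "(int c * y, (int a)\<^sup>2, int a * int (c ^ 2), (int (c ^ 2))\<^sup>2, - q) \<in> dP4"
    using q n a by (auto simp: dP4_def power_mult_distrib)
  have "integral3 (int c * y, (int a)\<^sup>2, int a * int (c ^ 2), (int (c ^ 2))\<^sup>2, - q)"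
  proof -
    have dc: "p dvd int c" if "prime p" "p dvd (int (c ^ 2))\<^sup>2" for p
      using that by (simp add: prime_dvd_power_iff)
    have "\<forall>p. prime p \<longrightarrow> \<not> (\<forall>z\<in>{int c * y, (int a)\<^sup>2, int a * int (c ^ 2), (int (c ^ 2))\<^sup>2}. p dvd z)"
    proof (intro allI impI notI)
      fix p :: int assume p: "prime p" "\<forall>z\<in>{int c * y, (int a)\<^sup>2, int a * int (c ^ 2), (int (c ^ 2))\<^sup>2}. p dvd z"
      then have "p dvd int c" using dc by blast
      moreover have "p dvd int a" using p by (simp add: prime_dvd_power_iff)
      ultimately show False using ac p by (metis coprime_common_divisor coprime_int_iff not_prime_unit)
    qed
    moreover have "\<forall>p. prime p \<longrightarrow> \<not> (\<forall>z\<in>{int c * y, int a * int (c ^ 2), (int (c ^ 2))\<^sup>2, - q}. p dvd z)"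
    proof (intro allI impI notI)
      fix p :: int assume p: "prime p" "\<forall>z\<in>{int c * y, int a * int (c ^ 2), (int (c ^ 2))\<^sup>2, - q}. p dvd z"
      then have pc: "p dvd int c" using dc by blast
      have "p dvd q" using p by simp
      then have "p dvd y * (y + int c ^ 3)" unfolding q by simp
      then have "p dvd y \<or> p dvd y + int c ^ 3" using p(1) by (simp add: prime_dvd_mult_iff)
      moreover have "p dvd int c ^ 3" using pc by (simp add: dvd_power_same dvd_trans[OF pc dvd_power])
      ultimately have "p dvd y" by (metis dvd_add_left_iff)
      then show False using pc t'(7) p(1) by (metis coprime_common_divisor not_prime_unit)
    qed
    ultimately show ?thesis by (simp add: integral3_def Gcd_int_eq_1_iff del: Gcd_insert)
  qed
  moreover have "real_of_int (H3 (int c * y, (int a)\<^sup>2, int a * int (c ^ 2), (int (c ^ 2))\<^sup>2, - q)) \<le> B"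
  proof -
    have "real_of_int \<bar>q\<bar> \<le> B" if "real_of_int \<bar>y * (y + int c ^ 3)\<bar> \<le> B * real a"
    proof -
      have "real_of_int \<bar>y * (y + int c ^ 3)\<bar> = real a * real_of_int \<bar>q\<bar>" unfolding q by (simp add: abs_mult)
      then have "real a * real_of_int \<bar>q\<bar> \<le> real a * B" using that by (simp add: mult.commute)
      then show ?thesis using a by simp
    qed
    then show ?thesis unfolding H_le_iff using t'(4,5,6,10) by (auto simp: abs_mult)
  qed
  ultimately show "\<exists>x4. (int (n ! 0) * y, (int (n ! 1 * n ! 2))\<^sup>2, int (n ! 1 * n ! 2) * int ((n ! 0)\<^sup>2), (int ((n ! 0)\<^sup>2))\<^sup>2, x4) \<in> ?S"
    using dp n a unfolding a_def by (intro exI[of _ "- q"]) simp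
next
  fix n m x y assume t: "(n, x) \<in> ?A" "(m, y) \<in> ?A" "n ! 1 * n ! 2 = m ! 1 * m ! 2" "(n ! 0)\<^sup>2 = (m ! 0)\<^sup>2" "int (n ! 0) * x = int (m ! 0) * y"
  obtain c a1 a2 where n: "n = [c, a1, a2]" "0 < c" "0 < a1" "0 < a2"
    using t(1) by (auto simp: Box_def numeral_3_eq_3 length_Suc_conv)
  obtain d b1 b2 where m: "m = [d, b1, b2]" "0 < d" "0 < b1" "0 < b2"
    using t(2) by (auto simp: Box_def numeral_3_eq_3 length_Suc_conv)
  have xn: "coprime c a1" "coprime c a2" "int a1 dvd x" "int a2 dvd x + int c ^ 3"
    using t(1) unfolding n by auto
  have xm: "coprime d b1" "coprime d b2" "int b1 dvd y" "int b2 dvd y + int d ^ 3"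
    using t(2) unfolding m by auto
  have eq: "a1 * a2 = b1 * b2" "c = d" using t(3,4) unfolding n m by (auto simp: power2_eq_iff_nonneg)
  then have xy: "x = y" using t(5) n unfolding m n by simp
  have "int a1 = gcd (int (a1 * a2)) x"
  proof (rule coprime_split_unique)
    show "coprime (int (a1 * a2)) (int c ^ 3)" using xn by (simp add: coprime_mult_left_iff coprime_commute)
  qed (use xn in auto)
  moreover have "int b1 = gcd (int (b1 * b2)) y"
  proof (rule coprime_split_unique)
    show "coprime (int (b1 * b2)) (int d ^ 3)" using xm by (simp add: coprime_mult_left_iff coprime_commute)
  qed (use xm in auto)
  ultimately have "int a1 = int b1" using eq xy by metis
  then show "n = m \<and> x = y" using eq xy unfolding n(1) m(1) using n by simp
qed

section \<open>Progressions with a coprimality condition and short windows\<close>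

lemma coprime_int_iff_prime_factors:
  fixes y :: int and c :: nat
  assumes "c > 0"
  shows "coprime y (int c) \<longleftrightarrow> (\<forall>q\<in>prime_factors c. \<not> int q dvd y)"
proof
  assume c: "coprime y (int c)"
  show "\<forall>q\<in>prime_factors c. \<not> int q dvd y"
  proof (intro ballI notI)
    fix q assume "q \<in> prime_factors c" "int q dvd y"
    then have "prime q" "int q dvd int c" "int q dvd y" using in_prime_factors_iff by auto
    then have "is_unit (int q)" using c by (metis coprime_common_divisor)
    then have "q = 1" by simp
    then show False using \<open>prime q\<close> by simp
  qed
next
  assume *: "\<forall>q\<in>prime_factors c. \<not> int q dvd y"
  show "coprime y (int c)"
  proof (rule ccontr)
    assume "\<not> coprime y (int c)"
    then have "\<not> is_unit (gcd y (int c))" by (simp add: coprime_iff_gcd_eq_1)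
    moreover have "gcd y (int c) \<noteq> 0" using assms by simp
    ultimately obtain p where p: "prime p" "p dvd gcd y (int c)" using prime_divisor_exists by blast
    define q where "q = nat p"
    have "0 \<le> p \<and> prime (nat p)" using p(1) by (rule iffD1[OF prime_int_nat_transfer])
    then have q: "p = int q" "prime q" by (simp_all add: q_def)
    have "int q dvd y" "int q dvd int c" using p(2) unfolding q(1) by simp_all
    moreover from this have "q \<in> prime_factors c" using q(2) assms by (simp add: in_prime_factors_iff)
    ultimately show False using * by blast
  qed
qed

text \<open>In y = r + a t each prime of c forbids exactly one residue of t, because a is invertible
  modulo it. The error of the sieve is bounded by 3 to the number of prime factors of c.\<close>

lemma card_coprime_progression:
  fixes r :: int and u v :: real and a c :: nat
  assumes "0 < a" "0 < c" "coprime a c" "u \<le> v"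
  shows "finite {y::int. u \<le> of_int y \<and> of_int y \<le> v \<and> int a dvd y - r \<and> coprime y (int c)}"
    and "\<bar>real (card {y::int. u \<le> of_int y \<and> of_int y \<le> v \<and> int a dvd y - r \<and> coprime y (int c)})
       - (v - u) / real a * (\<Prod>p\<in>prime_factors c. 1 - 1 / real p)\<bar> \<le> 81 * sqrt (real c)"
proof -
  define R where "R q = {s\<in>{0..<int q}. (r + int a * s) mod int q \<in> {0}}" for q
  have R: "card (R q) = 1" "R q \<subseteq> {0..<int q}" if "q \<in> prime_factors c" for q
  proof -
    have q: "prime q" "q dvd c" using that by (simp_all add: in_prime_factors_iff)
    then have "coprime a q" using coprime_divisors[of a a q c] assms(3) by simp
    then show "card (R q) = 1" unfolding R_def using q by (subst card_affine_preimage) (auto simp: prime_gt_0_nat)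
  qed (auto simp: R_def)
  have cop: "coprime (r + int a * t) (int c) \<longleftrightarrow> (\<forall>q\<in>prime_factors c. t mod int q \<notin> R q)" for t
  proof -
    have "int q dvd r + int a * t \<longleftrightarrow> t mod int q \<in> R q" if "q \<in> prime_factors c" for q
    proof -
      have q: "prime q" using that by (auto simp: in_prime_factors_iff)
      have "(r + int a * t) mod int q = (r + int a * (t mod int q)) mod int q"
        by (metis mod_add_right_eq mod_mult_right_eq)
      then show ?thesis unfolding R_def using q by (auto simp: dvd_eq_mod_eq_0 prime_gt_0_nat)
    qed
    then show ?thesis unfolding coprime_int_iff_prime_factors[OF assms(2)] by blast
  qed
  have le: "(u - of_int r) / real a \<le> (v - of_int r) / real a" using assms by (intro divide_right_mono) auto
  have "finite {y::int. u \<le> of_int y \<and> of_int y \<le> v \<and> int a dvd y - r}" by (rule card_progression[OF assms(1,4)])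
  then show "finite {y::int. u \<le> of_int y \<and> of_int y \<le> v \<and> int a dvd y - r \<and> coprime y (int c)}"
    by (rule rev_finite_subset) auto
  have "\<bar>real (card {t::int. (u - of_int r) / real a \<le> of_int t \<and> of_int t \<le> (v - of_int r) / real a \<and> (\<forall>q\<in>prime_factors c. t mod int q \<notin> R q)})
      - ((v - of_int r) / real a - (u - of_int r) / real a) * (\<Prod>q\<in>prime_factors c. 1 - real (card (R q)) / real q)\<bar>
      \<le> (\<Prod>q\<in>prime_factors c. 1 + real (card (R q)))"
    using R le by (intro interval_sieve) (auto simp: in_prime_factors_iff)
  moreover have "(\<Prod>q\<in>prime_factors c. 1 - real (card (R q)) / real q) = (\<Prod>p\<in>prime_factors c. 1 - 1 / real p)"
    using R by (intro prod.cong) auto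
  moreover have "(\<Prod>q\<in>prime_factors c. 1 + real (card (R q))) \<le> (\<Prod>q\<in>prime_factors c. 3)"
    using R by (intro prod_mono) auto
  moreover have "card {t::int. (u - of_int r) / real a \<le> of_int t \<and> of_int t \<le> (v - of_int r) / real a \<and> coprime (r + int a * t) (int c)}
     = card {y::int. u \<le> of_int y \<and> of_int y \<le> v \<and> int a dvd y - r \<and> coprime y (int c)}"
    by (rule bij_betw_same_card[OF bij_betw_progression[OF assms(1)]])
  moreover have "(v - of_int r) / real a - (u - of_int r) / real a = (v - u) / real a"
    by (simp add: diff_divide_distrib)
  ultimately show "\<bar>real (card {y::int. u \<le> of_int y \<and> of_int y \<le> v \<and> int a dvd y - r \<and> coprime y (int c)})
       - (v - u) / real a * (\<Prod>p\<in>prime_factors c. 1 - 1 / real p)\<bar> \<le> 81 * sqrt (real c)"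
    using prod_prime_factors_3_le[OF assms(2)] unfolding cop by simp
qed

text \<open>With M = sqrt(B a), the product condition confines y to [-M - c^3, M]. From c^12 <= B^3
  <= B^2 a^2 = M^4 follows c^3 <= M, so the window has length at most 3 M; and a <= B gives a <= M,
  so the rounding error 1 is at most M / a.\<close>

lemma card_short_window:
  fixes B :: real and a c :: nat and r :: int
  assumes a: "0 < a" and c: "0 < c" and ca: "real c ^ 4 \<le> B" "B < real a ^ 2" "real a \<le> B"
  shows "finite {y::int. int a dvd y - r \<and> real_of_int \<bar>y * (y + int c ^ 3)\<bar> \<le> B * real a}"
    and "real (card {y::int. int a dvd y - r \<and> real_of_int \<bar>y * (y + int c ^ 3)\<bar> \<le> B * real a}) \<le> 4 * sqrt (B / real a)"
proof -
  define M where "M = sqrt (B * real a)"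
  have B: "0 < B" using a ca by linarith
  have M: "0 < M" "M ^ 2 = B * real a" using B a by (auto simp: M_def)
  have c3: "real c ^ 3 \<le> M"
  proof -
    have "(real c ^ 3) ^ 4 = (real c ^ 4) ^ 3" by simp
    also have "\<dots> \<le> B ^ 3" using ca(1) by (intro power_mono) auto
    also have "\<dots> = B ^ 2 * B" by (simp add: power2_eq_square power3_eq_cube)
    also have "\<dots> \<le> B ^ 2 * real a ^ 2" using ca(2) by (intro mult_left_mono) auto
    also have "\<dots> = M ^ 4" using M by (simp add: power_mult_distrib[symmetric] power4_eq_xxxx power2_eq_square)
    finally have "(real c ^ 3) ^ 4 \<le> M ^ 4" .
    then show ?thesis using M(1) by (subst (asm) power_mono_iff) auto
  qed
  have sub: "{y::int. int a dvd y - r \<and> real_of_int \<bar>y * (y + int c ^ 3)\<bar> \<le> B * real a}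
     \<subseteq> {y::int. - M - real c ^ 3 \<le> of_int y \<and> of_int y \<le> M \<and> int a dvd y - r}"
  proof
    fix y assume "y \<in> {y::int. int a dvd y - r \<and> real_of_int \<bar>y * (y + int c ^ 3)\<bar> \<le> B * real a}"
    then have y: "int a dvd y - r" "real_of_int y * (real_of_int y + real c ^ 3) \<le> M ^ 2" using M by auto
    have c0: "0 \<le> real c ^ 3" by simp
    have "real_of_int y \<le> M"
    proof (rule ccontr)
      assume "\<not> real_of_int y \<le> M"
      then have "M < real_of_int y" "M < real_of_int y + real c ^ 3" using c0 by linarith+
      then have "M * M < real_of_int y * (real_of_int y + real c ^ 3)" using M(1) by (intro mult_strict_mono) simp_all
      then show False using y(2) by (simp add: power2_eq_square)
    qed
    moreover have "- M - real c ^ 3 \<le> real_of_int y"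
    proof (rule ccontr)
      assume "\<not> - M - real c ^ 3 \<le> real_of_int y"
      then have "M < - real_of_int y" "M < - real_of_int y - real c ^ 3" using c0 by linarith+
      then have "M * M < (- real_of_int y) * (- real_of_int y - real c ^ 3)" using M(1) by (intro mult_strict_mono) simp_all
      then show False using y(2) by (simp add: power2_eq_square algebra_simps)
    qed
    ultimately show "y \<in> {y::int. - M - real c ^ 3 \<le> of_int y \<and> of_int y \<le> M \<and> int a dvd y - r}" using y by simp
  qed
  have "0 \<le> real c ^ 3" by simp
  then have le: "- M - real c ^ 3 \<le> M" using M(1) by linarith
  note w = card_progression[OF a le, of r]
  show "finite {y::int. int a dvd y - r \<and> real_of_int \<bar>y * (y + int c ^ 3)\<bar> \<le> B * real a}"
    by (rule finite_subset[OF sub w(1)])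
  have "real (card {y::int. int a dvd y - r \<and> real_of_int \<bar>y * (y + int c ^ 3)\<bar> \<le> B * real a}) \<le>
     real (card {y::int. - M - real c ^ 3 \<le> of_int y \<and> of_int y \<le> M \<and> int a dvd y - r})"
    using card_mono[OF w(1) sub] by simp
  also have "\<dots> \<le> (2 * M + real c ^ 3) / real a + 1" using w(2) by simp
  also have "\<dots> \<le> (3 * M) / real a + M / real a"
  proof (rule add_mono)
    show "(2 * M + real c ^ 3) / real a \<le> 3 * M / real a" using c3 by (intro divide_right_mono) auto
    have "real a ^ 2 = real a * real a" by (rule power2_eq_square)
    also have "\<dots> \<le> B * real a" using ca(3) by (intro mult_right_mono) auto
    also have "\<dots> = M ^ 2" by (rule M(2)[symmetric])
    finally have "real a \<le> M" using M(1) by (rule power2_le_imp_le[OF _ less_imp_le])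
    then show "1 \<le> M / real a" using a by simp
  qed
  also have "\<dots> = 4 * sqrt (B / real a)"
  proof -
    have "B / real a = B * real a / (real a)\<^sup>2" using a by (simp add: power2_eq_square)
    then have "sqrt (B / real a) = sqrt (B * real a) / sqrt ((real a)\<^sup>2)" by (simp only: real_sqrt_divide)
    also have "\<dots> = M / real a" by (simp add: M_def)
    finally show ?thesis by simp
  qed
  finally show "real (card {y::int. int a dvd y - r \<and> real_of_int \<bar>y * (y + int c ^ 3)\<bar> \<le> B * real a}) \<le> 4 * sqrt (B / real a)" .
qed

lemma N3_half:
  "N3 B = 2 * card {(x0, x1, x2, x3, x4). (x0, x1, x2, x3, x4) \<in> dP4 \<and> x2 > 0 \<and> x3 > 0 \<and> integral3 (x0, x1, x2, x3, x4) \<and> real_of_int (H3 (x0, x1, x2, x3, x4)) \<le> B}"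
  unfolding N3_def
proof (rule point_count_half)
  show "integral3 (- x0, - x1, x2, - x3, x4) = integral3 (x0, x1, x2, x3, x4)" for x0 x1 x2 x3 x4
    by (simp add: integral3_def)
  show "H3 (- x0, - x1, x2, - x3, x4) = H3 (x0, x1, x2, x3, x4)" for x0 x1 x2 x3 x4
    by (simp add: H3_def)
qed

lemma sum_Box_3: "(\<Sum>n\<in>Box 3 N. F n) = (\<Sum>a=1..N. \<Sum>b=1..N. \<Sum>c=1..N. F [a, b, c])"
  unfolding numeral_3_eq_3 sum_Box_Suc by simp

lemma asymptotic_N3:
  obtains C where "\<And>B. B \<ge> 1 \<Longrightarrow> \<bar>real (N3 B) - 1 / 8 * prime_prod (\<lambda>p. (1 - 1 / p) ^ 2 * (1 + 2 / p - 1 / p ^ 2)) * B * ln B ^ 3\<bar> \<le> C * (B * (ln B + 1) ^ 2)"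
proof -
  let ?D = "\<lambda>p::real. (1 - 1 / p) ^ 2 * (1 + 2 / p - 1 / p ^ 2)"
  have len: "length [1, 1, 1::nat] = 3" by simp
  obtain K where K: "K \<ge> 0" and Kb: "\<And>T M \<Psi>. \<lbrakk>0 \<le> T; antitone_cutoff 3 T M \<Psi>\<rbrakk> \<Longrightarrow>
       \<bar>(\<Sum>n\<in>Box 3 (nat \<lfloor>exp T\<rfloor>). weight [1, 1, 1] weight3 (nat \<lfloor>exp T\<rfloor>) n * (\<Psi> (map (\<lambda>x. ln (real x)) n) / real (prod_list n)))
          - prime_prod ?D * iterated_integral 3 T \<Psi>\<bar> \<le> K * ((T + 1) ^ (3 - 1) * M)"
  proof (rule sieve_log[where f = weight3 and cs = "[1, 1, 1]" and C = 1 and D = ?D, unfolded len])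
    fix p :: nat and e :: "nat list" assume p: "prime p" and e: "length e = 3" "sum_list e = 1"
    obtain a b c where abc: "e = [a, b, c]" using e(1) by (auto simp: numeral_3_eq_3 length_Suc_conv)
    then have "a + b + c = 1" using e(2) by simp
    then have "[a, b, c] \<in> {[1, 0, 0], [0, 1, 0], [0, 0, 1]}" by (auto simp: add_is_1)
    then show "\<bar>weight3 p e - 1\<bar> \<le> 1 / real p" unfolding abc by (auto simp: weight3_def)
  next
    fix p :: nat assume p: "prime p"
    then have "1 < real p" using prime_gt_1_nat by simp
    then show "\<bar>weight3 p r\<bar> \<le> 1" for r by (simp add: weight3_def)
    define x where "x = 1 / real p"
    have "density [1, 1, 1] x (weight3 p) = (1 - x) ^ 2 * (1 + 2 * x - x ^ 2)"
      by (simp add: weight3_def x_def[symmetric] algebra_simps power2_eq_square)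
    then show "density [1, 1, 1] (1 / real p) (weight3 p) = ?D (real p)" unfolding x_def by (simp add: power_divide)
  qed (simp_all add: weight3_def)
  have "\<bar>real (N3 B) - 1 / 8 * prime_prod ?D * B * ln B ^ 3\<bar> \<le> (4 * K + 502) * (B * (ln B + 1) ^ 2)" if B: "B \<ge> 1" for B
  proof -
    define T where "T = ln B"
    define N where "N = nat \<lfloor>B\<rfloor>"
    have T: "0 \<le> T" "exp T = B" using B by (auto simp: T_def)
    define cop where "cop n \<longleftrightarrow> coprime (n ! 0) (n ! 1) \<and> coprime (n ! 0) (n ! 2) \<and> coprime (n ! 1) (n ! 2)" for n :: "nat list"
    define P where "P n \<longleftrightarrow> cop n \<and> real ((n ! 0) ^ 4) \<le> B \<and> real ((n ! 1 * n ! 2) ^ 2) \<le> B" for n :: "nat list"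
    \<comment> \<open>\<open>P\<close> carries the main term. On \<open>Q\<close> the coordinate
      \<open>x1\<close> exceeds B, so \<open>x4\<close> must be small, and all these fibres together
      have the size of the error.\<close>
    define Q where "Q n \<longleftrightarrow> cop n \<and> real ((n ! 0) ^ 4) \<le> B \<and> real (n ! 1 * n ! 2 * (n ! 0) ^ 2) \<le> B \<and> \<not> real ((n ! 1 * n ! 2) ^ 2) \<le> B" for n :: "nat list"
    define Y where "Y n = {y::int. real_of_int \<bar>int (n ! 0) * y\<bar> \<le> B \<and> coprime y (int (n ! 0)) \<and> int (n ! 1) dvd y \<and> int (n ! 2) dvd y + (int (n ! 0)) ^ 3
         \<and> (real ((n ! 1 * n ! 2) ^ 2) \<le> B \<or> real_of_int \<bar>y * (y + (int (n ! 0)) ^ 3)\<bar> \<le> B * real (n ! 1 * n ! 2))}" for n :: "nat list"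
    define W where "W n = weight [1, 1, 1] weight3 N n * (region3 T (map (\<lambda>x. ln (real x)) n) / real (prod_list n))" for n
    have el: "\<exists>c a b. n = [c, a, b] \<and> c \<in> {1..N} \<and> a \<in> {1..N} \<and> b \<in> {1..N}" if "n \<in> Box 3 N" for n
      using that by (auto simp: Box_def numeral_3_eq_3 length_Suc_conv)
    \<comment> \<open>The mean of (a b)^2 and c^4 dominates a b c^2, so on \<open>P\<close> the
      bound on \<open>x2\<close> is automatic.\<close>
    have PB: "real (a * b * c ^ 2) \<le> B" if "real (c ^ 4) \<le> B" "real ((a * b) ^ 2) \<le> B" for a b c :: nat
    proof -
      have "2 * (real (a * b) * real (c ^ 2)) \<le> real (a * b) ^ 2 + real (c ^ 2) ^ 2"
        using sum_squares_bound[of "real (a * b)" "real (c ^ 2)"] by simp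
      then show ?thesis using that by simp
    qed
    have crt: "\<exists>r. \<forall>y. (int a dvd y \<and> int b dvd y + int c ^ 3) \<longleftrightarrow> int (a * b) dvd y - r" if "coprime a b" for a b c
    proof -
      have "coprime (int a) (int b)" using that by simp
      then obtain r where "\<And>x. (int a dvd x \<and> int b dvd x + int c ^ 3) \<longleftrightarrow> int a * int b dvd x - r"
        using crt_dvd by metis
      then show ?thesis by auto
    qed
    have main: "\<bar>real (card (SIGMA n:{n\<in>Box 3 N. P n}. Y n)) - 2 * B * (prime_prod ?D * (T ^ 3 / 32))\<bar>
       \<le> 2 * B * (K * (T + 1) ^ 2) + (\<Sum>n\<in>{n\<in>Box 3 N. P n}. 81 * sqrt (real (n ! 0)))"
      and fin1: "\<And>n. n \<in> Box 3 N \<Longrightarrow> P n \<Longrightarrow> finite (Y n)"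
    proof -
      have Y: "finite (Y n)" "\<bar>real (card (Y n)) - 2 * B * ((\<Prod>p\<in>prime_factors (n ! 0). 1 - 1 / real p) / real (prod_list n))\<bar> \<le> 81 * sqrt (real (n ! 0))"
        if n: "n \<in> Box 3 N" and P: "P n" for n
      proof -
        obtain c a b where abc: "n = [c, a, b]" "c \<in> {1..N}" "a \<in> {1..N}" "b \<in> {1..N}" using el[OF n] by blast
        have P': "coprime c a" "coprime c b" "coprime a b" "real ((a * b) ^ 2) \<le> B" using P by (auto simp: P_def cop_def abc)
        obtain r where r: "\<And>y. (int a dvd y \<and> int b dvd y + int c ^ 3) \<longleftrightarrow> int (a * b) dvd y - r" using crt[OF P'(3)] by blast
        have "real_of_int \<bar>int c * y\<bar> \<le> B \<longleftrightarrow> - (B / real c) \<le> real_of_int y \<and> real_of_int y \<le> B / real c" for y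
        proof -
          have "real_of_int \<bar>int c * y\<bar> \<le> B \<longleftrightarrow> \<bar>real_of_int y\<bar> \<le> B / real c"
            using abc by (simp add: abs_mult pos_le_divide_eq mult.commute)
          then show ?thesis by (auto simp: abs_le_iff)
        qed
        then have Y: "Y n = {y::int. - (B / real c) \<le> real_of_int y \<and> real_of_int y \<le> B / real c \<and> int (a * b) dvd y - r \<and> coprime y (int c)}"
          unfolding Y_def abc using P'(4) r by auto
        have le: "- (B / real c) \<le> B / real c" using B by simp
        have ab: "0 < a * b" "0 < c" "coprime (a * b) c" using abc P' by (auto simp: coprime_commute)
        show "finite (Y n)" unfolding Y by (rule card_coprime_progression(1)[OF ab le])
        show "\<bar>real (card (Y n)) - 2 * B * ((\<Prod>p\<in>prime_factors (n ! 0). 1 - 1 / real p) / real (prod_list n))\<bar> \<le> 81 * sqrt (real (n ! 0))"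
          using card_coprime_progression(2)[OF ab le, of r] unfolding Y by (simp add: abc(1) mult_ac)
      qed
      show "\<And>n. n \<in> Box 3 N \<Longrightarrow> P n \<Longrightarrow> finite (Y n)" by (rule Y)
      show "\<bar>real (card (SIGMA n:{n\<in>Box 3 N. P n}. Y n)) - 2 * B * (prime_prod ?D * (T ^ 3 / 32))\<bar>
       \<le> 2 * B * (K * (T + 1) ^ 2) + (\<Sum>n\<in>{n\<in>Box 3 N. P n}. 81 * sqrt (real (n ! 0)))"
      proof (rule card_Sigma_asymptotic[where W = W and v = "\<lambda>n. (\<Prod>p\<in>prime_factors (n ! 0). 1 - 1 / real p) / real (prod_list n)"])
        fix n assume n: "n \<in> Box 3 N"
        obtain c a b where abc: "n = [c, a, b]" "c \<in> {1..N}" "a \<in> {1..N}" "b \<in> {1..N}" using el[OF n] by blast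
        have "4 * ln (real c) = ln (real (c ^ 4))" "2 * (ln (real a) + ln (real b)) = ln (real ((a * b) ^ 2))"
          using abc by (simp_all add: ln_mult ln_realpow)
        then have "4 * ln (real c) \<le> T \<and> 2 * (ln (real a) + ln (real b)) \<le> T \<longleftrightarrow> real (c ^ 4) \<le> B \<and> real ((a * b) ^ 2) \<le> B"
          using abc B by (simp add: T_def)
        then show "W n = (if P n then (\<Prod>p\<in>prime_factors (n ! 0). 1 - 1 / real p) / real (prod_list n) else 0)"
          using weight3_eq[OF abc(2,3,4)] by (auto simp: W_def P_def cop_def abc(1) region3_def)
      next
        show "\<bar>(\<Sum>n\<in>Box 3 N. W n) - prime_prod ?D * (T ^ 3 / 32)\<bar> \<le> K * (T + 1) ^ 2"
          unfolding W_def using Kb[OF T(1) antitone_cutoff_region3[OF T(1)]] integral_region3[OF T(1)] T by (simp add: N_def)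
      qed (use B Y in auto)
    qed
    have QY: "finite (Y n)" "real (card (Y n)) \<le> 4 * sqrt (B / real (n ! 1 * n ! 2))" if n: "n \<in> Box 3 N" and Q: "Q n" for n
    proof -
      obtain c a b where abc: "n = [c, a, b]" "c \<in> {1..N}" "a \<in> {1..N}" "b \<in> {1..N}" using el[OF n] by blast
      have Q': "coprime a b" "real c ^ 4 \<le> B" "B < real (a * b) ^ 2" "real (a * b * c ^ 2) \<le> B" using Q by (auto simp: Q_def cop_def abc)
      have "a * b * 1 \<le> a * b * c ^ 2" using abc by (intro mult_le_mono2) (simp add: Suc_leI)
      then have abB: "real (a * b) \<le> B" using Q'(4) by (metis mult.right_neutral of_nat_mono order_trans)
      obtain r where r: "\<And>y. (int a dvd y \<and> int b dvd y + int c ^ 3) \<longleftrightarrow> int (a * b) dvd y - r" using crt[OF Q'(1)] by blast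
      have ab: "0 < a * b" "0 < c" using abc by auto
      note w = card_short_window[OF ab Q'(2,3) abB, of r]
      have sub: "Y n \<subseteq> {y::int. int (a * b) dvd y - r \<and> real_of_int \<bar>y * (y + int c ^ 3)\<bar> \<le> B * real (a * b)}"
        unfolding Y_def abc using Q'(3) r by auto
      show "finite (Y n)" by (rule finite_subset[OF sub w(1)])
      have "real (card (Y n)) \<le> real (card {y::int. int (a * b) dvd y - r \<and> real_of_int \<bar>y * (y + int c ^ 3)\<bar> \<le> B * real (a * b)})"
        using card_mono[OF w(1) sub] by simp
      also note w(2)
      finally show "real (card (Y n)) \<le> 4 * sqrt (B / real (n ! 1 * n ! 2))" by (simp add: abc)
    qed
    have split: "(SIGMA n:{n\<in>Box 3 N. cop n \<and> real ((n ! 0) ^ 4) \<le> B \<and> real (n ! 1 * n ! 2 * (n ! 0) ^ 2) \<le> B}. Y n)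
       = (SIGMA n:{n\<in>Box 3 N. P n}. Y n) \<union> (SIGMA n:{n\<in>Box 3 N. Q n}. Y n)"
    proof -
      have "(cop n \<and> real ((n ! 0) ^ 4) \<le> B \<and> real (n ! 1 * n ! 2 * (n ! 0) ^ 2) \<le> B) \<longleftrightarrow> P n \<or> Q n" for n
        unfolding P_def Q_def using PB[of "n ! 0" "n ! 1" "n ! 2"] by argo
      then show ?thesis by auto
    qed
    have "N3 B = 2 * card (SIGMA n:{n\<in>Box 3 N. cop n \<and> real ((n ! 0) ^ 4) \<le> B \<and> real (n ! 1 * n ! 2 * (n ! 0) ^ 2) \<le> B}. Y n)"
      unfolding N3_half card_N3_solutions[OF B] cop_def Y_def N_def by (rule refl)
    also have "card (SIGMA n:{n\<in>Box 3 N. cop n \<and> real ((n ! 0) ^ 4) \<le> B \<and> real (n ! 1 * n ! 2 * (n ! 0) ^ 2) \<le> B}. Y n)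
       = card (SIGMA n:{n\<in>Box 3 N. P n}. Y n) + card (SIGMA n:{n\<in>Box 3 N. Q n}. Y n)"
      unfolding split
    proof (rule card_Un_disjoint)
      show "finite (SIGMA n:{n\<in>Box 3 N. P n}. Y n)" "finite (SIGMA n:{n\<in>Box 3 N. Q n}. Y n)"
        using fin1 QY(1) by (auto intro!: finite_SigmaI)
      show "(SIGMA n:{n\<in>Box 3 N. P n}. Y n) \<inter> (SIGMA n:{n\<in>Box 3 N. Q n}. Y n) = {}"
      proof -
        have "\<not> (P n \<and> Q n)" for n unfolding P_def Q_def by argo
        then show ?thesis by auto
      qed
    qed
    finally have card: "real (N3 B) = 2 * (real (card (SIGMA n:{n\<in>Box 3 N. P n}. Y n)) + real (card (SIGMA n:{n\<in>Box 3 N. Q n}. Y n)))" by simp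
    \<comment> \<open>The fibre error 81 sqrt c is multiplied by B / (a b c^2) >= 1; the sum over c
      then converges to at most 3, and 243 = 81 * 3.\<close>
    have err1: "(\<Sum>n\<in>{n\<in>Box 3 N. P n}. 81 * sqrt (real (n ! 0))) \<le> B * (243 * (T + 1) ^ 2)"
    proof -
      let ?fs = "[\<lambda>c. 81 * (sqrt (real c) / real c ^ 2), \<lambda>a. 1 / real a, \<lambda>b. 1 / real b]"
      have "(\<Sum>n\<in>{n\<in>Box 3 N. P n}. 81 * sqrt (real (n ! 0))) \<le> (\<Sum>n\<in>Box 3 N. B * prod_list (map2 (\<lambda>f x. f x) ?fs n))"
        unfolding sum.inter_filter[OF finite_Box]
      proof (intro sum_mono)
        fix n assume n: "n \<in> Box 3 N"
        obtain c a b where abc: "n = [c, a, b]" "c \<in> {1..N}" "a \<in> {1..N}" "b \<in> {1..N}" using el[OF n] by blast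
        have e: "B * prod_list (map2 (\<lambda>f x. f x) ?fs n) = 81 * sqrt (real c) * (B / real (a * b * c ^ 2))"
          unfolding abc by (simp add: mult_ac)
        show "(if P n then 81 * sqrt (real (n ! 0)) else 0) \<le> B * prod_list (map2 (\<lambda>f x. f x) ?fs n)"
        proof (cases "P n")
          case True
          then have "real (a * b * c ^ 2) \<le> B" using PB unfolding P_def abc by simp
          moreover have "0 < real (a * b * c ^ 2)" using abc by simp
          ultimately have "1 \<le> B / real (a * b * c ^ 2)" by (simp add: le_divide_eq_1_pos del: of_nat_mult)
          then have "81 * sqrt (real c) * 1 \<le> 81 * sqrt (real c) * (B / real (a * b * c ^ 2))" by (intro mult_left_mono) auto
          then show ?thesis unfolding e using True by (simp add: abc)
        next
          case False
          then show ?thesis unfolding e using B by simp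
        qed
      qed
      also have "\<dots> = B * (81 * (\<Sum>c=1..N. sqrt (real c) / real c ^ 2) * ((\<Sum>a=1..N. 1 / real a) * (\<Sum>b=1..N. 1 / real b)))"
      proof -
        have "length ?fs = 3" by simp
        then have "(\<Sum>n\<in>Box 3 N. prod_list (map2 (\<lambda>f x. f x) ?fs n)) = (\<Sum>c=1..N. 81 * (sqrt (real c) / real c ^ 2)) * ((\<Sum>a=1..N. 1 / real a) * (\<Sum>b=1..N. 1 / real b))"
          using sum_Box_prod[of ?fs N] by (simp only: list.map prod_list.Cons prod_list.Nil mult_1_right)
        moreover have "(\<Sum>c=1..N. 81 * (sqrt (real c) / real c ^ 2)) = 81 * (\<Sum>c=1..N. sqrt (real c) / real c ^ 2)"
          by (rule sum_distrib_left[symmetric])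
        ultimately show ?thesis by (simp only: sum_distrib_left[symmetric])
      qed
      also have "\<dots> \<le> B * (81 * 3 * ((T + 1) * (T + 1)))"
        using sum_inverse_floor_le[OF B] sum_inverse_three_halves_le[of N] B T unfolding N_def T_def
        by (intro mult_left_mono mult_mono mult_nonneg_nonneg sum_nonneg) auto
      finally show ?thesis by (simp add: power2_eq_square)
    qed
    \<comment> \<open>Only a b c^2 <= B is kept. Summing sqrt(B / (a b)) over b up to B / (a c^2)
      leaves a multiple of B / (a c), hence two logarithms.\<close>
    have err2: "real (card (SIGMA n:{n\<in>Box 3 N. Q n}. Y n)) \<le> B * (8 * (T + 1) ^ 2)"
    proof -
      have "real (card (SIGMA n:{n\<in>Box 3 N. Q n}. Y n)) = (\<Sum>n\<in>{n\<in>Box 3 N. Q n}. real (card (Y n)))"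
        using QY(1) by (simp add: card_SigmaI)
      also have "\<dots> \<le> (\<Sum>n\<in>{n\<in>Box 3 N. Q n}. 4 * sqrt (B / real (n ! 1 * n ! 2)))"
        using QY(2) by (intro sum_mono) auto
      also have "\<dots> \<le> (\<Sum>n\<in>Box 3 N. if real (n ! 1 * n ! 2 * (n ! 0) ^ 2) \<le> B then 4 * sqrt (B / real (n ! 1 * n ! 2)) else 0)"
        unfolding sum.inter_filter[OF finite_Box] using B by (intro sum_mono) (auto simp: Q_def)
      also have "\<dots> = (\<Sum>c=1..N. \<Sum>a=1..N. \<Sum>b=1..N. if real (a * b * c ^ 2) \<le> B then 4 * sqrt (B / real (a * b)) else 0)"
        unfolding sum_Box_3 by (simp cong: if_cong)
      also have "\<dots> \<le> (\<Sum>c=1..N. \<Sum>a=1..N. 8 * B * (1 / real c * (1 / real a)))"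
      proof (intro sum_mono)
        fix c a assume ca: "c \<in> {1..N}" "a \<in> {1..N}"
        define x where "x = B / (real a * real c ^ 2)"
        have x: "0 \<le> x" using B by (simp add: x_def)
        have iff: "real (a * b * c ^ 2) \<le> B \<longleftrightarrow> b \<in> {..nat \<lfloor>x\<rfloor>}" for b
          using ca x by (simp add: le_nat_floor_iff x_def pos_le_divide_eq mult_ac)
        have "(\<Sum>b=1..N. if real (a * b * c ^ 2) \<le> B then 4 * sqrt (B / real (a * b)) else 0)
            = (\<Sum>b\<in>{b\<in>{1..N}. b \<in> {..nat \<lfloor>x\<rfloor>}}. 4 * sqrt (B / real (a * b)))"
          unfolding iff by (rule sum.inter_filter[symmetric]) simp
        also have "\<dots> \<le> (\<Sum>b=1..nat \<lfloor>x\<rfloor>. 4 * sqrt (B / real (a * b)))"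
          using B by (intro sum_mono2) auto
        also have "\<dots> = 4 * sqrt (B / real a) * (\<Sum>b=1..nat \<lfloor>x\<rfloor>. 1 / sqrt (real b))"
          unfolding sum_distrib_left by (intro sum.cong refl) (simp add: real_sqrt_divide real_sqrt_mult)
        also have "\<dots> \<le> 4 * sqrt (B / real a) * (2 * sqrt x)"
          using B sum_inverse_sqrt_le[OF x] by (intro mult_left_mono) auto
        also have "\<dots> = 8 * B * (1 / real c * (1 / real a))"
        proof -
          have "sqrt (B / real a) * sqrt x = sqrt ((B / (real a * real c)) ^ 2)"
            unfolding x_def real_sqrt_mult[symmetric] by (simp add: power2_eq_square)
          also have "\<dots> = B / (real a * real c)" using B by simp
          finally have "sqrt (B / real a) * sqrt x = B / (real a * real c)" .
          moreover have "4 * sqrt (B / real a) * (2 * sqrt x) = 8 * (sqrt (B / real a) * sqrt x)" by simp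
          ultimately show ?thesis by simp
        qed
        finally show "(\<Sum>b=1..N. if real (a * b * c ^ 2) \<le> B then 4 * sqrt (B / real (a * b)) else 0) \<le> 8 * B * (1 / real c * (1 / real a))" .
      qed
      also have "\<dots> = 8 * B * ((\<Sum>c=1..N. 1 / real c) * (\<Sum>a=1..N. 1 / real a))"
        by (simp only: sum_distrib_left[symmetric] sum_product)
      also have "\<dots> \<le> 8 * B * ((T + 1) * (T + 1))"
        using sum_inverse_floor_le[OF B] B T unfolding N_def T_def
        by (intro mult_left_mono mult_mono mult_nonneg_nonneg sum_nonneg) auto
      finally show ?thesis by (simp add: power2_eq_square mult_ac)
    qed
    have main': "\<bar>(real (card (SIGMA n:{n\<in>Box 3 N. P n}. Y n)) + real (card (SIGMA n:{n\<in>Box 3 N. Q n}. Y n))) - 2 * B * (prime_prod ?D * (T ^ 3 / 32))\<bar>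
      \<le> 2 * B * (K * (T + 1) ^ 2) + ((\<Sum>n\<in>{n\<in>Box 3 N. P n}. 81 * sqrt (real (n ! 0))) + real (card (SIGMA n:{n\<in>Box 3 N. Q n}. Y n)))"
      using main by linarith
    have "2 * (2 * B * (prime_prod ?D * (T ^ 3 / 32))) = 1 / 8 * prime_prod ?D * B * T ^ 3" by simp
    moreover have "(4 * K + 502) * (B * (T + 1) ^ 2) = 2 * (2 * B * (K * (T + 1) ^ 2) + (B * (243 * (T + 1) ^ 2) + B * (8 * (T + 1) ^ 2)))"
      by (simp add: algebra_simps)
    ultimately show ?thesis unfolding T_def[symmetric]
      by (intro double_count_bound[OF card main' add_mono[OF err1 err2]])
  qed
  then show ?thesis by (rule that)
qed

section \<open>Factorisation into a squarefree number, a square and a cube\<close>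

lemma cubefree_decomposition:
  fixes e :: nat
  assumes "e > 0"
  obtains e1 e2 e3 where "squarefree e1" "squarefree e2" "coprime e1 e2" "e3 > 0" "e = e1 * e2 ^ 2 * e3 ^ 3"
proof -
  let ?C = "{c. c ^ 3 dvd e}"
  have sub: "?C \<subseteq> {..e}"
  proof
    fix c assume "c \<in> ?C"
    then have "c dvd e" by (auto intro: dvd_trans[of c "c ^ 3"] simp: dvd_power)
    then show "c \<in> {..e}" using assms by (auto dest: dvd_imp_le)
  qed
  then have fin: "finite ?C" by (rule finite_subset) simp
  \<comment> \<open>Maximality of e3 makes the cofactor m cubefree; a square factor of e2 or a
    common prime of e1 and e2 would produce a cube dividing m.\<close>
  define e3 where "e3 = Max ?C"
  have "1 ^ 3 dvd e" by simp
  then have "?C \<noteq> {}" by blast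
  then have "e3 \<in> ?C" unfolding e3_def by (rule Max_in[OF fin])
  then obtain m where m: "e = e3 ^ 3 * m" by (auto elim: dvdE)
  have e30: "e3 > 0" "m > 0" using m assms by (auto intro: Nat.gr0I)
  have cubefree: "c = 1" if "c ^ 3 dvd m" for c
  proof -
    have "(e3 * c) ^ 3 dvd e" using that unfolding m power_mult_distrib by (intro mult_dvd_mono) auto
    then have "e3 * c \<le> e3" unfolding e3_def using fin by (intro Max_ge) auto
    moreover have "c \<noteq> 0" using that e30 by (auto intro: Nat.gr0I)
    ultimately show ?thesis using e30 by simp
  qed
  define e1 e2 where "e1 = squarefree_part m" and "e2 = square_part m"
  have m12: "m = e1 * e2 ^ 2" unfolding e1_def e2_def by (rule squarefree_decompose)
  have "squarefree e1" by (simp add: e1_def)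
  moreover have "squarefree e2"
  proof (rule squarefreeI)
    fix x assume "x ^ 2 dvd e2"
    then have "x * x dvd e2 * e2" by (intro mult_dvd_mono) (auto intro: dvd_trans[of x "x ^ 2"])
    have "x ^ 3 dvd (x ^ 2) ^ 2" by (simp add: le_imp_power_dvd power_mult[symmetric])
    also have "(x ^ 2) ^ 2 dvd e2 ^ 2" using \<open>x ^ 2 dvd e2\<close> by (rule dvd_power_same)
    also have "e2 ^ 2 dvd m" unfolding m12 by simp
    finally have "x = 1" by (rule cubefree)
    then show "x dvd 1" by simp
  qed
  moreover have "coprime e1 e2"
  proof (rule ccontr)
    assume "\<not> coprime e1 e2"
    then obtain p where p: "prime p" "p dvd gcd e1 e2"
      by (metis coprime_iff_gcd_eq_1 prime_factor_nat)
    then have "p * p ^ 2 dvd e1 * e2 ^ 2" by (intro mult_dvd_mono dvd_power_same) auto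
    then have "p ^ 3 dvd m" unfolding m12 by (simp add: power3_eq_cube power2_eq_square mult.assoc)
    then have "p = 1" by (rule cubefree)
    then show False using p(1) by simp
  qed
  ultimately show ?thesis using that e30 m m12 by (simp add: mult_ac)
qed

lemma multiplicity_cubefree_decomposition:
  fixes e1 e2 e3 p :: nat
  assumes "squarefree e1" "squarefree e2" "coprime e1 e2" "e3 > 0" "prime p"
  shows "multiplicity p (e1 * e2 ^ 2 * e3 ^ 3) = multiplicity p e1 + 2 * multiplicity p e2 + 3 * multiplicity p e3"
    and "multiplicity p e1 + multiplicity p e2 \<le> 1"
proof -
  have pos: "e1 > 0" "e2 > 0" using assms squarefree_pos by auto
  show "multiplicity p (e1 * e2 ^ 2 * e3 ^ 3) = multiplicity p e1 + 2 * multiplicity p e2 + 3 * multiplicity p e3"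
    using assms pos by (simp add: prime_elem_multiplicity_mult_distrib prime_elem_multiplicity_power_distrib)
  have "multiplicity p e1 \<le> 1" "multiplicity p e2 \<le> 1"
    using assms pos by (simp_all add: squarefree_factorial_semiring'')
  moreover have "multiplicity p e1 = 0 \<or> multiplicity p e2 = 0"
  proof -
    have "\<not> p dvd e1 \<or> \<not> p dvd e2" using assms(3,5) by (meson coprime_common_divisor not_prime_unit)
    then show ?thesis by (auto simp: not_dvd_imp_multiplicity_0)
  qed
  ultimately show "multiplicity p e1 + multiplicity p e2 \<le> 1" by linarith
qed

text \<open>At each prime at most one of e1, e2 has exponent 1 and the other has 0, so e1 e2^2 has
  exponent 0, 1 or 2: the remainder modulo 3 of the exponent of e. The quotient belongs to
  e3.\<close>

lemma cubefree_decomposition_unique: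
  fixes e1 e2 e3 f1 f2 f3 :: nat
  assumes e: "squarefree e1" "squarefree e2" "coprime e1 e2" "e3 > 0"
    and f: "squarefree f1" "squarefree f2" "coprime f1 f2" "f3 > 0"
    and eq: "e1 * e2 ^ 2 * e3 ^ 3 = f1 * f2 ^ 2 * f3 ^ 3"
  shows "e1 = f1" "e2 = f2" "e3 = f3"
proof -
  have *: "multiplicity p e1 = multiplicity p f1 \<and> multiplicity p e2 = multiplicity p f2 \<and> multiplicity p e3 = multiplicity p f3"
    if "prime p" for p
  proof -
    have arith: "a = a' \<and> b = b' \<and> c = c'" if "a + 2 * b + 3 * c = a' + 2 * b' + 3 * c'" "a + b \<le> 1" "a' + b' \<le> 1" for a b c a' b' c' :: nat
    proof -
      have lt: "a + 2 * b < 3" "a' + 2 * b' < 3" using that(2,3) by linarith+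
      have "c = (a + 2 * b + 3 * c) div 3" using lt by simp
      also have "\<dots> = c'" unfolding that(1) using lt by simp
      finally have c: "c = c'" .
      have "(a = 0 \<and> b = 0) \<or> (a = 1 \<and> b = 0) \<or> (a = 0 \<and> b = 1)" "(a' = 0 \<and> b' = 0) \<or> (a' = 1 \<and> b' = 0) \<or> (a' = 0 \<and> b' = 1)"
        using that(2,3) by linarith+
      then show ?thesis using c that(1) by auto
    qed
    show ?thesis
    proof (rule arith)
      show "multiplicity p e1 + 2 * multiplicity p e2 + 3 * multiplicity p e3 = multiplicity p f1 + 2 * multiplicity p f2 + 3 * multiplicity p f3"
        using multiplicity_cubefree_decomposition(1)[OF e that] multiplicity_cubefree_decomposition(1)[OF f that] unfolding eq by (rule trans[OF sym])
    qed (rule multiplicity_cubefree_decomposition(2)[OF e that] multiplicity_cubefree_decomposition(2)[OF f that])+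
  qed
  have pos: "e1 > 0" "e2 > 0" "f1 > 0" "f2 > 0" using e f squarefree_pos by auto
  have "x = y" if "x > 0" "y > 0" "\<And>p. prime p \<Longrightarrow> multiplicity p x = multiplicity p y" for x y :: nat
    using multiplicity_eq_imp_eq[of x y] that by simp
  then show "e1 = f1" "e2 = f2" "e3 = f3" using * pos e(4) f(4) by blast+
qed

text \<open>At each prime the exponent of e3 e2 e1 is a third of the exponent of e1 e2^2 e3^3,
  rounded up. This turns a condition on d^3 into plain divisibility of d, with a free cofactor
  k.\<close>

lemma cubefree_decomposition_dvd:
  fixes e1 e2 e3 d :: nat
  assumes e: "squarefree e1" "squarefree e2" "coprime e1 e2" "e3 > 0"
    and d: "d > 0" "e1 * e2 ^ 2 * e3 ^ 3 dvd d ^ 3"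
  shows "e3 * e2 * e1 dvd d"
proof (rule multiplicity_le_imp_dvd)
  have pos: "e1 > 0" "e2 > 0" using e squarefree_pos by auto
  then show "e3 * e2 * e1 \<noteq> 0" using e by simp
  fix p :: nat assume p: "prime p"
  have "multiplicity p (e1 * e2 ^ 2 * e3 ^ 3) \<le> multiplicity p (d ^ 3)"
    using d by (intro dvd_imp_multiplicity_le) auto
  also have "\<dots> = 3 * multiplicity p d" using p d by (simp add: prime_elem_multiplicity_power_distrib)
  finally have "multiplicity p e1 + 2 * multiplicity p e2 + 3 * multiplicity p e3 \<le> 3 * multiplicity p d"
    using multiplicity_cubefree_decomposition(1)[OF e p] by simp
  moreover have "multiplicity p (e3 * e2 * e1) = multiplicity p e3 + multiplicity p e2 + multiplicity p e1"
    using p pos e by (simp add: prime_elem_multiplicity_mult_distrib)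
  ultimately show "multiplicity p (e3 * e2 * e1) \<le> multiplicity p d"
    using multiplicity_cubefree_decomposition(2)[OF e p] by linarith
qed

subsection \<open>The complement of the first singularity\<close>

text \<open>
  A solution with \<open>x\<^sub>3 > 0\<close> factors as \<open>- x\<^sub>0 = d \<alpha> \<beta>\<close>, \<open>x\<^sub>0 + x\<^sub>3 = d \<gamma> \<delta>\<close>, \<open>x\<^sub>2 = d\<^sup>2 \<alpha> \<gamma>\<close>, \<open>x\<^sub>4 = \<beta> \<delta>\<close>,
  \<open>x\<^sub>3 = d e\<close> with \<open>\<alpha> \<beta> + \<gamma> \<delta> = e\<close> and \<open>e dvd d\<^sup>3\<close>. The last condition is resolved by
  \<open>e = e\<^sub>1 e\<^sub>2\<^sup>2 e\<^sub>3\<^sup>3\<close> and \<open>d = e\<^sub>3 e\<^sub>2 e\<^sub>1 k\<close>; lists are ordered as \<open>[\<alpha>, \<gamma>, e\<^sub>3, e\<^sub>2, e\<^sub>1, k]\<close>.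
\<close>

definition d_of :: "nat list \<Rightarrow> nat" where
  "d_of n = n ! 2 * n ! 3 * n ! 4 * n ! 5"

definition e_of :: "nat list \<Rightarrow> nat" where
  "e_of n = n ! 4 * (n ! 3) ^ 2 * (n ! 2) ^ 3"

text \<open>Conditions on the list alone: the normal form of e, and coprimality of the first two
  entries with each other and with e, expressed through the factors of e. The last entry k is
  unrestricted.\<close>

definition admissible1 :: "nat list \<Rightarrow> bool" where
  "admissible1 n \<longleftrightarrow> squarefree (n ! 4) \<and> squarefree (n ! 3) \<and> coprime (n ! 4) (n ! 3) \<and> coprime (n ! 0) (n ! 1) \<and> coprime (n ! 0 * n ! 1) (n ! 2 * n ! 3 * n ! 4)"

text \<open>What remains free once the list is fixed: points on a line. Of the heights only those of
  \<open>x0\<close> and \<open>x4\<close> involve \<beta> and \<delta>; \<open>x2\<close> and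
  \<open>x3\<close> depend on the list alone.\<close>

definition fibre1 :: "real \<Rightarrow> nat list \<Rightarrow> (int \<times> int) set" where
  "fibre1 B n = {(\<beta>, \<delta>). int (n ! 0) * \<beta> + int (n ! 1) * \<delta> = int (e_of n) \<and> coprime \<beta> (int (d_of n)) \<and> coprime \<delta> (int (d_of n))
     \<and> real_of_int \<bar>int (d_of n * n ! 0) * \<beta>\<bar> \<le> B \<and> real_of_int \<bar>\<beta> * \<delta>\<bar> \<le> B}"

lemma Box_6_cases:
  assumes "n \<in> Box 6 N"
  obtains a c e3 e2 e1 k where "n = [a, c, e3, e2, e1, k]" "a \<in> {1..N}" "c \<in> {1..N}" "e3 \<in> {1..N}" "e2 \<in> {1..N}" "e1 \<in> {1..N}" "k \<in> {1..N}"
proof -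
  have "6 = Suc (Suc (Suc (Suc (Suc (Suc 0)))))" by simp
  then have "length n = Suc (Suc (Suc (Suc (Suc (Suc 0)))))" "set n \<subseteq> {1..N}" using assms by (auto simp: Box_def)
  then show ?thesis using that by (auto simp: length_Suc_conv)
qed

lemma not_coprime_int_prime:
  fixes x y :: int
  assumes "\<not> coprime x y"
  obtains p where "prime p" "p dvd x" "p dvd y"
proof (cases "gcd x y = 0")
  case True
  then show ?thesis using that[of 2] two_is_prime_nat by auto
next
  case False
  have "\<not> is_unit (gcd x y)" using assms by (simp add: coprime_iff_gcd_eq_1)
  then obtain p where "prime p" "p dvd gcd x y" using prime_divisor_exists False by blast
  then show ?thesis using that by auto
qed

text \<open>The relation u v = x2 x4 for u = -x0, v = x0 + x3 is resolved by two gcds. A = gcd(u,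
  x2) gives u = A \<beta>, x2 = A C, v = C \<delta>, x4 = \<beta> \<delta>; then D = gcd(A, C)
  divides x3 = u + v. A prime of A and \<delta> would divide u, v, x2 and x4, so integrality makes
  these coprime. Cancelling D in x1 x3 = x2^2 leaves e dividing D^3, as e is coprime to a c.\<close>

lemma N1_solution_param:
  assumes dp: "(x0, x1, x2, x3, x4) \<in> dP4" and pos: "x2 > 0" "x3 > 0"
    and g: "\<And>p. prime p \<Longrightarrow> p dvd x0 \<Longrightarrow> p dvd x2 \<Longrightarrow> p dvd x3 \<Longrightarrow> p dvd x4 \<Longrightarrow> False"
  obtains d e a c :: nat and \<beta> \<delta> :: int
  where "d > 0" "e > 0" "a > 0" "c > 0" "x0 = - (int (d * a) * \<beta>)" "x2 = int (d ^ 2 * a * c)" "x3 = int (d * e)" "x4 = \<beta> * \<delta>"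
    "int a * \<beta> + int c * \<delta> = int e" "coprime \<beta> (int d)" "coprime \<delta> (int d)" "coprime a c" "coprime (a * c) e" "e dvd d ^ 3"
proof -
  define u where "u = - x0"
  define v where "v = x0 + x3"
  have uv: "u * v = x2 * x4" "u + v = x3" using dp by (auto simp: dP4_def u_def v_def power2_eq_square algebra_simps)
  have x13: "x1 * x3 = x2 ^ 2" using dp by (simp add: dP4_def)
  have g': False if "prime p" "p dvd u" "p dvd v" "p dvd x2" "p dvd x4" for p
  proof -
    have "p dvd x3" using that uv(2) by (metis dvd_add)
    moreover have "p dvd x0" using that by (simp add: u_def)
    ultimately show False using g that by blast
  qed
  define A where "A = gcd u x2"
  have A: "A > 0" unfolding A_def using pos by simp
  obtain \<beta> where b: "u = A * \<beta>" unfolding A_def by (metis dvdE gcd_dvd1)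
  obtain C where C: "x2 = A * C" unfolding A_def by (metis dvdE gcd_dvd2)
  have C0: "C > 0" using C A pos by (simp add: zero_less_mult_iff)
  have "A * gcd \<beta> C = A" using b C A by (metis A_def abs_of_pos gcd_mult_distrib_int)
  then have copbC: "coprime \<beta> C" using A by (simp add: coprime_iff_gcd_eq_1)
  have "A * (\<beta> * v) = A * (C * x4)" using uv(1) b C by (simp add: mult.assoc)
  then have bv: "\<beta> * v = C * x4" using A by simp
  then have "C dvd \<beta> * v" by simp
  then have "C dvd v" using copbC by (simp add: coprime_dvd_mult_right_iff coprime_commute)
  then obtain \<delta> where dl: "v = C * \<delta>" by (rule dvdE)
  have x4: "x4 = \<beta> * \<delta>" using bv dl C0 by simp
  have copAd: "coprime A \<delta>"
  proof (rule ccontr)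
    assume "\<not> coprime A \<delta>"
    then obtain p where "prime p" "p dvd A" "p dvd \<delta>" by (rule not_coprime_int_prime)
    then show False using g'[of p] b C dl x4 by simp
  qed
  define D where "D = gcd A C"
  have D: "D > 0" unfolding D_def using A by simp
  obtain a where a: "A = D * a" unfolding D_def by (metis dvdE gcd_dvd1)
  obtain c where c: "C = D * c" unfolding D_def by (metis dvdE gcd_dvd2)
  have ac0: "a > 0" "c > 0" using a c A C0 D by (simp_all add: zero_less_mult_iff)
  have "D * gcd a c = D" using a c D by (metis D_def abs_of_pos gcd_mult_distrib_int)
  then have copac: "coprime a c" using D by (simp add: coprime_iff_gcd_eq_1)
  define e where "e = a * \<beta> + c * \<delta>"
  have x3: "x3 = D * e" using uv(2) b dl a c by (simp add: e_def algebra_simps)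
  have e0: "e > 0" using x3 pos D by (simp add: zero_less_mult_iff)
  have cbD: "coprime \<beta> D" "coprime \<beta> c" using copbC c by simp_all
  have cdD: "coprime \<delta> D" "coprime \<delta> a" using copAd a by (simp_all add: coprime_commute)
  have "coprime a e"
  proof (rule coprimeI)
    fix x assume x: "x dvd a" "x dvd e"
    then have "x dvd c * \<delta>" unfolding e_def by (metis dvd_add_right_iff dvd_mult2)
    moreover have "coprime a (c * \<delta>)" using copac cdD(2) by (simp add: coprime_commute)
    ultimately show "is_unit x" using x(1) by (metis coprime_common_divisor)
  qed
  moreover have "coprime c e"
  proof (rule coprimeI)
    fix x assume x: "x dvd c" "x dvd e"
    then have "x dvd a * \<beta>" unfolding e_def by (metis dvd_add_left_iff dvd_mult2)
    moreover have "coprime c (a * \<beta>)" using copac cbD(2) by (simp add: coprime_commute)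
    ultimately show "is_unit x" using x(1) by (metis coprime_common_divisor)
  qed
  ultimately have cope: "coprime (a * c) e" by simp
  have "D * (x1 * e) = D * (D ^ 3 * (a * c) ^ 2)"
    using x13 x3 C a c by (simp add: power2_eq_square power3_eq_cube algebra_simps)
  then have "x1 * e = D ^ 3 * (a * c) ^ 2" using D by simp
  then have "e dvd D ^ 3 * (a * c) ^ 2" by (metis dvd_triv_right)
  moreover have "coprime e ((a * c) ^ 2)" using cope by (simp add: coprime_commute)
  ultimately have eD: "e dvd D ^ 3" by (simp add: coprime_dvd_mult_left_iff)
  obtain d' e' a' c' :: nat where nat: "D = int d'" "e = int e'" "a = int a'" "c = int c'"
    using D e0 ac0 by (metis less_imp_le nonneg_int_cases)
  show ?thesis
  proof (rule that[of d' e' a' c' \<beta> \<delta>])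
    show "x0 = - (int (d' * a') * \<beta>)" using b a nat by (simp add: u_def)
    show "x2 = int (d'\<^sup>2 * a' * c')" using C a c nat by (simp add: power2_eq_square)
    show "x3 = int (d' * e')" using x3 nat by simp
    show "int a' * \<beta> + int c' * \<delta> = int e'" using e_def nat by simp
    show "coprime (a' * c') e'" using cope nat by (metis coprime_int_iff of_nat_mult)
    show "e' dvd d' ^ 3" using eD nat by (metis int_dvd_int_iff of_nat_power)
  qed (use D e0 ac0 nat x4 cbD cdD copac in auto)
qed

text \<open>d a is the gcd of \<open>x0\<close> and \<open>x2\<close>, because \<beta> is coprime to
  d and to c; then d is the gcd of d a and d c.\<close>

lemma N1_solution_unique:
  fixes d e a c d' e' a' c' :: nat and \<beta> \<delta> \<beta>' \<delta>' :: int
  assumes "d > 0" "a > 0" "c > 0" "int a * \<beta> + int c * \<delta> = int e" "coprime \<beta> (int d)" "coprime a c" "coprime (a * c) e"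
    and "d' > 0" "a' > 0" "c' > 0" "int a' * \<beta>' + int c' * \<delta>' = int e'" "coprime \<beta>' (int d')" "coprime a' c'" "coprime (a' * c') e'"
    and "int (d * a) * \<beta> = int (d' * a') * \<beta>'" "d ^ 2 * a * c = d' ^ 2 * a' * c'" "d * e = d' * e'"
  shows "d = d'" "a = a'" "c = c'" "e = e'" "\<beta> = \<beta>'" "\<delta> = \<delta>'"
proof -
  have g: "int (d * a) = gcd (int (d * a) * \<beta>) (int (d ^ 2 * a * c))"
    if h: "d > 0" "a > 0" "c > 0" "int a * \<beta> + int c * \<delta> = int e" "coprime \<beta> (int d)" "coprime a c" "coprime (a * c) e"
    for d a c e :: nat and \<beta> \<delta> :: int
  proof -
    have "coprime \<beta> (int c)"
    proof (rule coprimeI)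
      fix x assume x: "x dvd \<beta>" "x dvd int c"
      then have "x dvd int e" unfolding h(4)[symmetric] by simp
      moreover have "coprime (int c) (int e)" using h(7) by simp
      ultimately show "is_unit x" using x(2) by (metis coprime_common_divisor)
    qed
    then have "gcd \<beta> (int (d * c)) = 1" using h(5) by simp
    moreover have "gcd (int (d * a) * \<beta>) (int (d ^ 2 * a * c)) = int (d * a) * gcd \<beta> (int (d * c))"
    proof -
      have "int (d ^ 2 * a * c) = int (d * a) * int (d * c)" by (simp add: power2_eq_square)
      then show ?thesis using gcd_mult_distrib_int[of "int (d * a)" \<beta> "int (d * c)"] by (simp only: abs_of_nat)
    qed
    ultimately show ?thesis by simp
  qed
  have "int (d * a) = gcd (int (d' * a') * \<beta>') (int (d' ^ 2 * a' * c'))"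
    using g[OF assms(1-7)] unfolding assms(15,16) .
  also have "\<dots> = int (d' * a')" by (rule g[OF assms(8-14), symmetric])
  finally have da: "d * a = d' * a'" by (simp only: of_nat_eq_iff)
  have "(d * a) * (d * c) = (d' * a') * (d' * c')" using assms(16) by (simp add: power2_eq_square mult_ac)
  then have dc: "d * c = d' * c'" using da assms by simp
  have "d = gcd (d * a) (d * c)" using gcd_mult_distrib_nat[of d a c] assms(6) by (simp add: coprime_iff_gcd_eq_1)
  also have "\<dots> = d'" unfolding da dc using gcd_mult_distrib_nat[of d' a' c'] assms(13) by (simp add: coprime_iff_gcd_eq_1)
  finally show d: "d = d'" .
  show a: "a = a'" and c: "c = c'" and e: "e = e'" using d da dc assms(1,17) by simp_all
  show b: "\<beta> = \<beta>'" using assms(15) unfolding d a using assms(8,9) by simp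
  have "int a * \<beta> + int c * \<delta> = int a * \<beta> + int c * \<delta>'" using assms(4,11) a b c e by metis
  then show "\<delta> = \<delta>'" using assms(3) by simp
qed

lemma card_N1_solutions:
  assumes B: "B \<ge> 1"
  shows "card {(x0, x1, x2, x3, x4). (x0, x1, x2, x3, x4) \<in> dP4 \<and> x2 > 0 \<and> x3 > 0 \<and> integral1 (x0, x1, x2, x3, x4) \<and> real_of_int (H1 (x0, x1, x2, x3, x4)) \<le> B}
   = card (SIGMA n:{n\<in>Box 6 (nat \<lfloor>B\<rfloor>). admissible1 n \<and> real (d_of n ^ 2 * n ! 0 * n ! 1) \<le> B \<and> real (d_of n * e_of n) \<le> B}. fibre1 B n)"
  (is "card ?S = card ?A")
proof -
  define R where "R = (\<lambda>(x0, x1 :: int, x2, x3, x4) (n, \<beta>, \<delta>). x0 = - (int (d_of n * n ! 0) * \<beta>) \<and> x2 = int (d_of n ^ 2 * n ! 0 * n ! 1) \<and> x3 = int (d_of n * e_of n) \<and> x4 = \<beta> * \<delta>)"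
  have Rs: "R (x0, x1, x2, x3, x4) (n, \<beta>, \<delta>) \<longleftrightarrow> x0 = - (int (d_of n * n ! 0) * \<beta>) \<and> x2 = int (d_of n ^ 2 * n ! 0 * n ! 1) \<and> x3 = int (d_of n * e_of n) \<and> x4 = \<beta> * \<delta>" for x0 x1 x2 x3 x4 n \<beta> \<delta>
    by (simp add: R_def)
  show ?thesis
  proof (rule card_eq_relation[where R = R])
    fix s assume s: "s \<in> ?S"
    obtain x0 x1 x2 x3 x4 where sx: "s = (x0, x1, x2, x3, x4)" by (cases s) auto
    have dp: "(x0, x1, x2, x3, x4) \<in> dP4" and pos: "x2 > 0" "x3 > 0"
      and g: "Gcd {x0, x2, x3, x4} = 1" and h: "real_of_int \<bar>x0\<bar> \<le> B" "real_of_int \<bar>x2\<bar> \<le> B" "real_of_int \<bar>x3\<bar> \<le> B" "real_of_int \<bar>x4\<bar> \<le> B"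
      using s unfolding sx by (auto simp: integral1_def H_le_iff simp del: Gcd_insert)
    have g': False if "prime p" "p dvd x0" "p dvd x2" "p dvd x3" "p dvd x4" for p
      using g that Gcd_int_eq_1_iff[of "{x0, x2, x3, x4}"] by auto
    obtain d e a c \<beta> \<delta> where p: "d > 0" "e > 0" "a > 0" "c > 0" "x0 = - (int (d * a) * \<beta>)" "x2 = int (d ^ 2 * a * c)" "x3 = int (d * e)" "x4 = \<beta> * \<delta>"
      "int a * \<beta> + int c * \<delta> = int e" "coprime \<beta> (int d)" "coprime \<delta> (int d)" "coprime a c" "coprime (a * c) e" "e dvd d ^ 3"
      by (rule N1_solution_param[OF dp pos]) (use g' in blast)+
    obtain e1 e2 e3 where e: "squarefree e1" "squarefree e2" "coprime e1 e2" "e3 > 0" "e = e1 * e2 ^ 2 * e3 ^ 3"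
      by (rule cubefree_decomposition[OF p(2)])
    have "e3 * e2 * e1 dvd d" using cubefree_decomposition_dvd[OF e(1-4) p(1)] p(14) e(5) by simp
    then obtain k where k: "d = e3 * e2 * e1 * k" by (rule dvdE)
    define n where "n = [a, c, e3, e2, e1, k]"
    have dn: "d_of n = d" "e_of n = e" "n ! 0 = a" "n ! 1 = c" using k e(5) by (simp_all add: n_def d_of_def e_of_def)
    have kp: "k > 0" "e1 > 0" "e2 > 0" using k p(1) by (auto intro: Nat.gr0I)
    have r: "real (d ^ 2 * a * c) \<le> B" "real (d * e) \<le> B"
      using h(2,3) p(6,7) by simp_all
    have ddvd: "x \<le> d ^ 2 * a * c" if "x dvd d \<or> x dvd a \<or> x dvd c" for x
    proof -
      have "x dvd d ^ 2 * a * c" using that by (auto simp: power2_eq_square intro: dvd_mult dvd_mult2)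
      then show ?thesis using p by (intro dvd_imp_le) auto
    qed
    have "a \<le> d ^ 2 * a * c" "c \<le> d ^ 2 * a * c" "e3 \<le> d ^ 2 * a * c" "e2 \<le> d ^ 2 * a * c" "e1 \<le> d ^ 2 * a * c" "k \<le> d ^ 2 * a * c"
      by (rule ddvd, simp add: k)+
    then have "real a \<le> B" "real c \<le> B" "real e3 \<le> B" "real e2 \<le> B" "real e1 \<le> B" "real k \<le> B"
      using r(1) by (meson of_nat_mono order_trans)+
    then have bx: "n \<in> Box 6 (nat \<lfloor>B\<rfloor>)" using p e kp B by (auto simp: n_def Box_def le_nat_floor_iff)
    have "coprime (a * c) (e3 * e2 * e1)" using p(13) kp e(4) unfolding e(5) by simp
    then have adm: "admissible1 n" using e(1-3) p(12) by (simp add: admissible1_def n_def)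
    have "(\<beta>, \<delta>) \<in> fibre1 B n" using p(9-11) h(1,4) p(5,8) unfolding fibre1_def dn by simp
    then have "(n, \<beta>, \<delta>) \<in> ?A" using bx adm r by (simp add: dn[unfolded One_nat_def] dn)
    moreover have "R s (n, \<beta>, \<delta>)" unfolding sx Rs dn using p(5-8) by simp
    ultimately show "\<exists>t\<in>?A. R s t" by blast
  next
    fix t assume t: "t \<in> ?A"
    obtain n \<beta> \<delta> where tn: "t = (n, \<beta>, \<delta>)" by (cases t) auto
    have n: "n \<in> Box 6 (nat \<lfloor>B\<rfloor>)" using t tn by simp
    obtain a c e3 e2 e1 k where nl: "n = [a, c, e3, e2, e1, k]" "a \<in> {1..nat \<lfloor>B\<rfloor>}" "c \<in> {1..nat \<lfloor>B\<rfloor>}" "e3 \<in> {1..nat \<lfloor>B\<rfloor>}"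
      "e2 \<in> {1..nat \<lfloor>B\<rfloor>}" "e1 \<in> {1..nat \<lfloor>B\<rfloor>}" "k \<in> {1..nat \<lfloor>B\<rfloor>}" by (rule Box_6_cases[OF n])
    define d e where "d = d_of n" and "e = e_of n"
    have de: "d = e3 * e2 * e1 * k" "e = e1 * e2 ^ 2 * e3 ^ 3" by (simp_all add: d_def e_def d_of_def e_of_def nl(1))
    have d0: "d > 0" "e > 0" "a > 0" "c > 0" unfolding de using nl by auto
    have "(\<beta>, \<delta>) \<in> fibre1 B n" using t tn by simp
    then have f: "int a * \<beta> + int c * \<delta> = int e" "coprime \<beta> (int d)" "coprime \<delta> (int d)" "real_of_int \<bar>int (d * a) * \<beta>\<bar> \<le> B" "real_of_int \<bar>\<beta> * \<delta>\<bar> \<le> B"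
      unfolding fibre1_def d_def[symmetric] e_def[symmetric] by (simp_all add: nl(1))
    have r: "real (d ^ 2 * a * c) \<le> B" "real (d * e) \<le> B" using t tn unfolding d_def[symmetric] e_def[symmetric]
      by (simp_all add: nl(1) d_def e_def)
    \<comment> \<open>The second entry is x2^2 / x3. It is an integer because d^3 / e = e1^2 e2 k^3,
      which is the form that e | d^3 takes in these parameters.\<close>
    define s where "s = (- (int (d * a) * \<beta>), int (e1 ^ 2 * e2 * k ^ 3 * a ^ 2 * c ^ 2), int (d ^ 2 * a * c), int (d * e), \<beta> * \<delta>)"
    have "(int (d * a) * \<beta>) ^ 2 - int (d * a) * \<beta> * int (d * e) + int (d ^ 2 * a * c) * (\<beta> * \<delta>) = int d ^ 2 * int a * \<beta> * (int a * \<beta> + int c * \<delta> - int e)"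
      by (simp add: power2_eq_square algebra_simps)
    also have "\<dots> = 0" using f(1) by simp
    finally have eq1: "(int (d * a) * \<beta>) ^ 2 - int (d * a) * \<beta> * int (d * e) + int (d ^ 2 * a * c) * (\<beta> * \<delta>) = 0" .
    have "(e1 ^ 2 * e2 * k ^ 3 * a ^ 2 * c ^ 2) * (d * e) = (d ^ 2 * a * c) ^ 2"
      unfolding de by (simp add: power2_eq_square power3_eq_cube mult_ac)
    then have eq2: "int (e1 ^ 2 * e2 * k ^ 3 * a ^ 2 * c ^ 2) * int (d * e) = int (d ^ 2 * a * c) ^ 2"
      by (metis of_nat_mult of_nat_power)
    have dp: "s \<in> dP4" unfolding s_def dP4_def using eq1 eq2 d0 by simp
    have "integral1 s"
    proof -
      have "\<forall>p. prime p \<longrightarrow> \<not> (\<forall>y\<in>{- (int (d * a) * \<beta>), int (d ^ 2 * a * c), int (d * e), \<beta> * \<delta>}. p dvd y)"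
      proof (intro allI impI notI)
        fix p :: int assume p: "prime p" "\<forall>y\<in>{- (int (d * a) * \<beta>), int (d ^ 2 * a * c), int (d * e), \<beta> * \<delta>}. p dvd y"
        then have "p dvd int (d * e)" by blast
        then have "p dvd int d \<or> p dvd int e" using p(1) by (simp add: prime_dvd_mult_iff)
        \<comment> \<open>Every prime of e divides d = e3 e2 e1 k, so coprimality of \<beta> and
          \<delta> to d is enough for integrality.\<close>
        then have pd: "p dvd int d" using p(1) unfolding de by (auto simp: prime_dvd_mult_iff prime_dvd_power_iff)
        have "p dvd \<beta> * \<delta>" using p(2) by blast
        then have "p dvd \<beta> \<or> p dvd \<delta>" using p(1) by (simp add: prime_dvd_mult_iff)
        then show False using pd f(2,3) p(1) by (metis coprime_common_divisor not_prime_unit)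
      qed
      then show ?thesis unfolding s_def by (simp add: integral1_def Gcd_int_eq_1_iff del: Gcd_insert of_nat_mult of_nat_power)
    qed
    moreover have "real_of_int (H1 s) \<le> B" unfolding s_def H_le_iff using f(4,5) r by simp
    ultimately have "s \<in> ?S" using dp d0 unfolding s_def by simp
    moreover have "R s t" unfolding s_def tn Rs d_def[symmetric] e_def[symmetric] by (simp add: nl(1) d_def e_def)
    ultimately show "\<exists>s\<in>?S. R s t" by blast
  next
    fix s t t' assume s: "s \<in> ?S" and tt: "t \<in> ?A" "t' \<in> ?A" and R: "R s t" "R s t'"
    obtain x0 x1 x2 x3 x4 where sx: "s = (x0, x1, x2, x3, x4)" by (cases s) auto
    obtain n \<beta> \<delta> where tn: "t = (n, \<beta>, \<delta>)" by (cases t) auto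
    obtain m \<beta>' \<delta>' where tm: "t' = (m, \<beta>', \<delta>')" by (cases t') auto
    have n: "n \<in> Box 6 (nat \<lfloor>B\<rfloor>)" "m \<in> Box 6 (nat \<lfloor>B\<rfloor>)" using tt tn tm by simp_all
    obtain a c e3 e2 e1 k where nl: "n = [a, c, e3, e2, e1, k]" "a \<in> {1..nat \<lfloor>B\<rfloor>}" "c \<in> {1..nat \<lfloor>B\<rfloor>}" "e3 \<in> {1..nat \<lfloor>B\<rfloor>}"
      "e2 \<in> {1..nat \<lfloor>B\<rfloor>}" "e1 \<in> {1..nat \<lfloor>B\<rfloor>}" "k \<in> {1..nat \<lfloor>B\<rfloor>}" by (rule Box_6_cases[OF n(1)])
    obtain a' c' e3' e2' e1' k' where ml: "m = [a', c', e3', e2', e1', k']" "a' \<in> {1..nat \<lfloor>B\<rfloor>}" "c' \<in> {1..nat \<lfloor>B\<rfloor>}" "e3' \<in> {1..nat \<lfloor>B\<rfloor>}"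
      "e2' \<in> {1..nat \<lfloor>B\<rfloor>}" "e1' \<in> {1..nat \<lfloor>B\<rfloor>}" "k' \<in> {1..nat \<lfloor>B\<rfloor>}" by (rule Box_6_cases[OF n(2)])
    define d e where "d = d_of n" and "e = e_of n"
    define d' e' where "d' = d_of m" and "e' = e_of m"
    have de: "d = e3 * e2 * e1 * k" "e = e1 * e2 ^ 2 * e3 ^ 3" by (simp_all add: d_def e_def d_of_def e_of_def nl(1))
    have de': "d' = e3' * e2' * e1' * k'" "e' = e1' * e2' ^ 2 * e3' ^ 3" by (simp_all add: d'_def e'_def d_of_def e_of_def ml(1))
    have d0: "d > 0" "a > 0" "c > 0" "d' > 0" "a' > 0" "c' > 0" unfolding de de' using nl ml by auto
    have adm: "admissible1 n" "admissible1 m" using tt tn tm by simp_all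
    have fib: "(\<beta>, \<delta>) \<in> fibre1 B n" "(\<beta>', \<delta>') \<in> fibre1 B m" using tt tn tm by simp_all
    have f: "int a * \<beta> + int c * \<delta> = int e" "coprime \<beta> (int d)" "int a' * \<beta>' + int c' * \<delta>' = int e'" "coprime \<beta>' (int d')"
      using fib unfolding fibre1_def d_def[symmetric] e_def[symmetric] d'_def[symmetric] e'_def[symmetric] by (simp_all add: nl(1) ml(1))
    have sf: "squarefree e1" "squarefree e2" "coprime e1 e2" "squarefree e1'" "squarefree e2'" "coprime e1' e2'" "coprime a c" "coprime a' c'"
      and cop: "coprime (a * c) (e3 * e2 * e1)" "coprime (a' * c') (e3' * e2' * e1')"
      using adm by (simp_all add: admissible1_def nl(1) ml(1))
    have cop': "coprime (a * c) e" "coprime (a' * c') e'" using cop unfolding de de' by auto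
    have eqs: "int (d * a) * \<beta> = int (d' * a') * \<beta>'" "int (d ^ 2 * a * c) = int (d' ^ 2 * a' * c')" "int (d * e) = int (d' * e')"
      using R unfolding sx tn tm Rs d_def[symmetric] e_def[symmetric] d'_def[symmetric] e'_def[symmetric] by (simp_all add: nl(1) ml(1))
    then have eqs': "d ^ 2 * a * c = d' ^ 2 * a' * c'" "d * e = d' * e'" by (metis of_nat_eq_iff)+
    note u = N1_solution_unique[OF d0(1-3) f(1,2) sf(7) cop'(1) d0(4-6) f(3,4) sf(8) cop'(2) eqs(1) eqs']
    have e30: "e3 > 0" "e3' > 0" using nl ml by auto
    note ue = cubefree_decomposition_unique[OF sf(1-3) e30(1) sf(4-6) e30(2) u(4)[unfolded de de']]
    have "k = k'" using u(1) d0(1) unfolding de de' ue by simp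
    then show "t = t'" unfolding tn tm nl(1) ml(1) using u ue by simp
  next
    fix s s' t assume ss: "s \<in> ?S" "s' \<in> ?S" and R: "R s t" "R s' t"
    obtain x0 x1 x2 x3 x4 where sx: "s = (x0, x1, x2, x3, x4)" by (cases s) auto
    obtain y0 y1 y2 y3 y4 where sy: "s' = (y0, y1, y2, y3, y4)" by (cases s') auto
    obtain n \<beta> \<delta> where tn: "t = (n, \<beta>, \<delta>)" by (cases t) auto
    have "x0 = y0" "x2 = y2" "x3 = y3" using R unfolding sx sy tn Rs by simp_all
    then show "s = s'" using dP4_determined[of x0 x1 x2 x3 x4 y1 y4] ss sx sy by auto
  qed
qed

text \<open>For h <= 2 s the parabola x (x - h) stays above -s^2, so the solutions form the single
  interval between the roots of x (x - h) = s^2. Its length q exceeds 2 s by at most h^2 / (4 s).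
  The lower root is at least -s >= -Y; the upper one is at most h + s, so Y cuts it off only if Y <
  4 s, with a loss of at most h.\<close>

lemma quadratic_window:
  fixes s h Y :: real
  assumes s: "0 < s" and h: "0 \<le> h" "h \<le> 2 * s" and Y: "s \<le> Y"
  defines "q \<equiv> sqrt (h ^ 2 + 4 * s ^ 2)"
  defines "lo \<equiv> (h - q) / 2" and "hi \<equiv> (h + q) / 2"
  shows "\<bar>x * (x - h)\<bar> \<le> s ^ 2 \<and> \<bar>x\<bar> \<le> Y \<longleftrightarrow> lo \<le> x \<and> x \<le> min hi Y"
    and "lo \<le> min hi Y"
    and "\<bar>(min hi Y - lo) - 2 * s\<bar> \<le> h ^ 2 / (4 * s) + (if Y < 4 * s then h else 0)"
proof -
  have q2: "q ^ 2 = h ^ 2 + 4 * s ^ 2" unfolding q_def by simp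
  have q0: "0 \<le> q" unfolding q_def by simp
  have "(2 * s) ^ 2 \<le> q ^ 2" unfolding q2 by (simp add: power_mult_distrib)
  then have q1: "2 * s \<le> q" using q0 by (rule power2_le_imp_le)
  have "q ^ 2 \<le> (h + 2 * s) ^ 2" unfolding q2 using h s by (simp add: power2_sum power_mult_distrib)
  then have q3: "q \<le> h + 2 * s" by (rule power2_le_imp_le) (use h s in simp)
  have id: "(2 * x - h) ^ 2 = q ^ 2 + 4 * (x * (x - h) - s ^ 2)" unfolding q2 by (simp add: power2_eq_square algebra_simps)
  have sq: "x * (x - h) \<le> s ^ 2 \<longleftrightarrow> lo \<le> x \<and> x \<le> hi"
  proof -
    have "x * (x - h) \<le> s ^ 2 \<longleftrightarrow> (2 * x - h) ^ 2 \<le> q ^ 2" unfolding id by auto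
    also have "\<dots> \<longleftrightarrow> \<bar>2 * x - h\<bar> \<le> q" using q0 by (metis abs_le_square_iff abs_of_nonneg)
    also have "\<dots> \<longleftrightarrow> lo \<le> x \<and> x \<le> hi" unfolding lo_def hi_def by (auto simp: abs_le_iff)
    finally show ?thesis .
  qed
  have "h ^ 2 \<le> (2 * s) ^ 2" using h(2,1) by (rule power_mono)
  then have "h ^ 2 \<le> 4 * s ^ 2" by (simp only: power_mult_distrib) simp
  moreover have "0 \<le> q ^ 2 + 4 * (x * (x - h) - s ^ 2)" unfolding id[symmetric] by (rule zero_le_power2)
  ultimately have low: "- (s ^ 2) \<le> x * (x - h)" unfolding q2 by (simp add: algebra_simps)
  have lo: "- s \<le> lo" "lo \<le> 0" using q1 q3 h unfolding lo_def by simp_all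
  show "\<bar>x * (x - h)\<bar> \<le> s ^ 2 \<and> \<bar>x\<bar> \<le> Y \<longleftrightarrow> lo \<le> x \<and> x \<le> min hi Y"
    using sq low lo Y s by (auto simp: abs_le_iff)
  have hi: "s \<le> hi" "hi \<le> h + s" using q1 q3 h unfolding hi_def by simp_all
  show "lo \<le> min hi Y" using lo hi Y s by simp
  have "(q - 2 * s) * (4 * s) \<le> (q - 2 * s) * (q + 2 * s)" using q1 by (intro mult_left_mono) auto
  also have "\<dots> = h ^ 2" using q2 by (simp add: power2_eq_square algebra_simps)
  finally have "q - 2 * s \<le> h ^ 2 / (4 * s)" using s by (simp add: pos_le_divide_eq)
  then have qs: "0 \<le> q - 2 * s" "q - 2 * s \<le> h ^ 2 / (4 * s)" using q1 by auto
  have len: "hi - lo = q" unfolding hi_def lo_def diff_divide_distrib[symmetric] by simp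
  show "\<bar>(min hi Y - lo) - 2 * s\<bar> \<le> h ^ 2 / (4 * s) + (if Y < 4 * s then h else 0)"
  proof (cases "hi \<le> Y")
    case True
    then show ?thesis using len qs h by (auto simp: min_def)
  next
    case False
    then have "Y < 4 * s" using hi h s by linarith
    moreover have "hi - Y \<le> h" using hi Y by linarith
    moreover have "min hi Y = Y" using False by simp
    ultimately show ?thesis using len qs h False by (simp add: abs_le_iff)
  qed
qed

text \<open>For a c coprime to e, the number of residues modulo p at which p divides \<beta> or
  \<delta> on the line of solutions. If p divides e, both conditions coincide. Otherwise they
  exclude each other, and the one for \<beta> (for \<delta>) is never met when p divides c (divides
  a).\<close>

definition omega1 :: "nat \<Rightarrow> nat \<Rightarrow> nat \<Rightarrow> nat \<Rightarrow> nat" where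
  "omega1 a c e p = (if p dvd e then 1 else (if p dvd c then 0 else 1) + (if p dvd a then 0 else 1))"

lemma linear_solutions_image:
  fixes a c :: nat and \<beta>0 \<delta>0 e :: int
  assumes "c > 0" "coprime a c" "int a * \<beta>0 + int c * \<delta>0 = e"
  shows "{(\<beta>, \<delta>). int a * \<beta> + int c * \<delta> = e \<and> P \<beta> \<delta>} = (\<lambda>t. (\<beta>0 + int c * t, \<delta>0 - int a * t)) ` {t. P (\<beta>0 + int c * t) (\<delta>0 - int a * t)}"
proof (intro equalityI subsetI)
  fix z assume "z \<in> {(\<beta>, \<delta>). int a * \<beta> + int c * \<delta> = e \<and> P \<beta> \<delta>}"
  then obtain \<beta> \<delta> where z: "z = (\<beta>, \<delta>)" "int a * \<beta> + int c * \<delta> = e" "P \<beta> \<delta>" by auto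
  have eq: "int a * (\<beta> - \<beta>0) = int c * (\<delta>0 - \<delta>)" using z(2) assms(3) by (simp add: algebra_simps)
  then have "int c dvd int a * (\<beta> - \<beta>0)" by simp
  moreover have "coprime (int c) (int a)" using assms(2) by (simp add: coprime_commute)
  ultimately have "int c dvd \<beta> - \<beta>0" by (simp add: coprime_dvd_mult_right_iff)
  then obtain t where t: "\<beta> - \<beta>0 = int c * t" by (rule dvdE)
  then have "int c * (int a * t) = int c * (\<delta>0 - \<delta>)" using eq by (simp add: mult_ac)
  then have "int a * t = \<delta>0 - \<delta>" using assms(1) by simp
  then have "\<beta> = \<beta>0 + int c * t" "\<delta> = \<delta>0 - int a * t" using t by simp_all
  then show "z \<in> (\<lambda>t. (\<beta>0 + int c * t, \<delta>0 - int a * t)) ` {t. P (\<beta>0 + int c * t) (\<delta>0 - int a * t)}" using z by blast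
next
  fix z assume "z \<in> (\<lambda>t. (\<beta>0 + int c * t, \<delta>0 - int a * t)) ` {t. P (\<beta>0 + int c * t) (\<delta>0 - int a * t)}"
  then obtain t where "z = (\<beta>0 + int c * t, \<delta>0 - int a * t)" "P (\<beta>0 + int c * t) (\<delta>0 - int a * t)" by blast
  moreover have "int a * (\<beta>0 + int c * t) + int c * (\<delta>0 - int a * t) = e" using assms(3) by (simp add: algebra_simps)
  ultimately show "z \<in> {(\<beta>, \<delta>). int a * \<beta> + int c * \<delta> = e \<and> P \<beta> \<delta>}" by simp
qed

lemma card_forbidden_residues:
  fixes a c e q :: nat and \<beta>0 \<delta>0 :: int
  assumes q: "prime q" and cop: "coprime (a * c) e" and sol: "int a * \<beta>0 + int c * \<delta>0 = int e"
  shows "card {s\<in>{0..<int q}. int q dvd \<beta>0 + int c * s \<or> int q dvd \<delta>0 - int a * s} = omega1 a c e q"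
proof -
  let ?R1 = "{s\<in>{0..<int q}. int q dvd \<beta>0 + int c * s}"
  let ?R2 = "{s\<in>{0..<int q}. int q dvd \<delta>0 - int a * s}"
  have q0: "0 < q" using q by (simp add: prime_gt_0_nat)
  have iq: "prime (int q)" using q by simp
  have one: "card {s\<in>{0..<int q}. int q dvd r + int b * s} = 1" if "\<not> q dvd b" for r b
  proof -
    have "coprime b q" using that q by (metis coprime_commute prime_imp_coprime)
    then have "card {s\<in>{0..<int q}. (r + int b * s) mod int q \<in> {0}} = card {0::int}"
      using q0 by (intro card_affine_preimage) auto
    then show ?thesis by (simp add: dvd_eq_mod_eq_0)
  qed
  have R1: "card ?R1 = (if q dvd c then 0 else 1)"
  proof (cases "q dvd c")
    case True
    have "\<not> int q dvd \<beta>0 + int c * s" for s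
    proof
      assume "int q dvd \<beta>0 + int c * s"
      then have "int q dvd \<beta>0" using True by (metis dvd_add_left_iff dvd_mult2 int_dvd_int_iff)
      then have "int q dvd int e" unfolding sol[symmetric] using True by simp
      then have "q dvd e" "q dvd a * c" using True by simp_all
      then show False using cop q by (metis coprime_common_divisor_nat not_prime_unit nat_dvd_1_iff_1)
    qed
    then show ?thesis using True by simp
  qed (use one in simp)
  have R2': "?R2 = {s\<in>{0..<int q}. int q dvd - \<delta>0 + int a * s}"
  proof -
    have "int q dvd \<delta>0 - int a * s \<longleftrightarrow> int q dvd - (\<delta>0 - int a * s)" for s by (simp only: dvd_minus_iff)
    then show ?thesis by (simp add: algebra_simps)
  qed
  have R2: "card ?R2 = (if q dvd a then 0 else 1)"
  proof (cases "q dvd a")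
    case True
    have "\<not> int q dvd \<delta>0 - int a * s" for s
    proof
      assume "int q dvd \<delta>0 - int a * s"
      then have "int q dvd \<delta>0 - int a * s + int a * s" using True by (intro dvd_add) auto
      then have "int q dvd \<delta>0" by simp
      then have "int q dvd int e" unfolding sol[symmetric] using True by simp
      then have "q dvd e" "q dvd a * c" using True by simp_all
      then show False using cop q by (metis coprime_common_divisor_nat not_prime_unit nat_dvd_1_iff_1)
    qed
    then show ?thesis using True by simp
  next
    case False
    then show ?thesis unfolding R2' using one[of a "- \<delta>0"] by simp
  qed
  have rel: "int a * (\<beta>0 + int c * s) + int c * (\<delta>0 - int a * s) = int e" for s
    using sol by (simp add: algebra_simps)
  have un: "{s\<in>{0..<int q}. int q dvd \<beta>0 + int c * s \<or> int q dvd \<delta>0 - int a * s} = ?R1 \<union> ?R2" by blast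
  show ?thesis
  proof (cases "q dvd e")
    case True
    have nac: "\<not> q dvd a" "\<not> q dvd c"
      using True cop q by (metis coprime_common_divisor_nat dvd_mult dvd_mult2 not_prime_unit nat_dvd_1_iff_1)+
    have "int q dvd \<beta>0 + int c * s \<longleftrightarrow> int q dvd \<delta>0 - int a * s" for s
    proof -
      have "int q dvd int e" using True by simp
      then have "int q dvd int a * (\<beta>0 + int c * s) \<longleftrightarrow> int q dvd int c * (\<delta>0 - int a * s)"
        unfolding rel[of s, symmetric] by (metis dvd_add_left_iff dvd_add_right_iff)
      then show ?thesis using iq nac by (simp add: prime_dvd_mult_iff)
    qed
    then have "?R1 \<union> ?R2 = ?R1" by blast
    then show ?thesis unfolding un using R1 nac True by (simp add: omega1_def)
  next
    case False
    have "?R1 \<inter> ?R2 = {}"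
    proof -
      have "\<not> (int q dvd \<beta>0 + int c * s \<and> int q dvd \<delta>0 - int a * s)" for s
      proof
        assume "int q dvd \<beta>0 + int c * s \<and> int q dvd \<delta>0 - int a * s"
        then have "int q dvd int e" unfolding rel[of s, symmetric] by simp
        then show False using False by simp
      qed
      then show ?thesis by blast
    qed
    moreover have "finite ?R1" "finite ?R2" by (rule finite_subset[of _ "{0..<int q}"]; auto)+
    ultimately have "card (?R1 \<union> ?R2) = card ?R1 + card ?R2" by (intro card_Un_disjoint)
    then show ?thesis unfolding un using R1 R2 False by (simp add: omega1_def)
  qed
qed

lemma omega1_le: "omega1 a c e p \<le> 2"
  by (simp add: omega1_def)

text \<open>Along the line \<beta> runs through a class modulo c and determines \<delta>, so
  |\<beta> \<delta>| <= B becomes |\<beta> (\<beta> - h)| <= s^2 with h = e / a and s^2 = B c / a.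
  Division by c turns s into \<open>R\<close> and h into \<open>q\<close>; sieving by the primes of
  d yields \<open>w\<close>. The last error term arises only if the bound on \<open>x0\<close> cuts
  the window, and 83 = 81 + 2.\<close>

lemma card_fibre1:
  assumes B: "B \<ge> 1" and n: "n = [a, c, e3, e2, e1, k]" "0 < a" "0 < c" "0 < e3" "0 < e2" "0 < e1" "0 < k"
    and adm: "admissible1 n" and bd: "real (d_of n ^ 2 * a * c) \<le> B"
  defines "w \<equiv> \<Prod>p\<in>prime_factors (d_of n). 1 - real (omega1 a c (e_of n) p) / real p"
  defines "R \<equiv> sqrt (B / real (a * c))" and "q \<equiv> real (e_of n) / real (a * c)"
  shows "finite (fibre1 B n)"
    and "\<bar>real (card (fibre1 B n)) - w * (2 * R)\<bar> \<le> 83 * sqrt (real (d_of n)) + 4 * min R (q ^ 2 / R) + (if B \<le> 16 * real (d_of n ^ 2 * a * c) then q else 0)"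
proof -
  define d e where "d = d_of n" and "e = e_of n"
  have d0: "d > 0" "e > 0" using n by (auto simp: d_def e_def d_of_def e_of_def)
  have cop: "coprime a c" "coprime (a * c) e"
    using adm n by (auto simp: admissible1_def e_def e_of_def)
  obtain \<beta>0 \<delta>0 where sol: "int a * \<beta>0 + int c * \<delta>0 = int e"
  proof -
    obtain u v where "u * int a + v * int c = gcd (int a) (int c)" using bezout_int by blast
    also have "\<dots> = 1" using cop(1) by simp
    finally have uv: "u * int a + v * int c = 1" .
    have "int a * (u * int e) + int c * (v * int e) = (u * int a + v * int c) * int e" by (simp add: algebra_simps)
    also have "\<dots> = int e" unfolding uv by simp
    finally have "int a * (u * int e) + int c * (v * int e) = int e" .
    then show ?thesis by (rule that)
  qed
  define s where "s = sqrt (B * real c / real a)"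
  define h where "h = real e / real a"
  define Y where "Y = B / real (d * a)"
  have s0: "0 < s" unfolding s_def using B n by simp
  have s2: "s ^ 2 = B * real c / real a" unfolding s_def using B n by simp
  have h0: "0 \<le> h" unfolding h_def by simp
  have sR: "s / real c = R"
  proof -
    have "R = sqrt ((B * real c / real a) / (real c) ^ 2)" unfolding R_def using n by (simp add: power2_eq_square)
    also have "\<dots> = s / real c" unfolding s_def real_sqrt_divide using n by simp
    finally show ?thesis by simp
  qed
  have R0: "0 < R" using sR s0 n by (metis divide_pos_pos of_nat_0_less_iff)
  have hq: "h / real c = q" unfolding h_def q_def e_def by simp
  have q0: "0 \<le> q" unfolding q_def by simp
  \<comment> \<open>This is the bound d^2 a c <= B on \<open>x2\<close>, solved for the window
    lengths.\<close>
  have sY: "s \<le> Y"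
  proof (rule power2_le_imp_le)
    have "real (d ^ 2 * a * c) * B \<le> B * B" using bd B unfolding d_def by (intro mult_right_mono) auto
    then have "B * real c * (real d ^ 2 * real a) \<le> B ^ 2" by (simp add: power2_eq_square mult_ac)
    then have "B * real c / real a \<le> B ^ 2 / (real d ^ 2 * real a ^ 2)"
      using n d0 by (simp add: field_simps power2_eq_square)
    then show "s ^ 2 \<le> Y ^ 2" unfolding s2 Y_def by (simp add: power_divide power_mult_distrib)
    show "0 \<le> Y" unfolding Y_def using B by simp
  qed
  define \<phi> where "\<phi> t = (\<beta>0 + int c * t, \<delta>0 - int a * t)" for t
  define \<beta> where "\<beta> t = \<beta>0 + int c * t" for t
  define Z where "Z = {t. (coprime (\<beta> t) (int d) \<and> coprime (\<delta>0 - int a * t) (int d)) \<and> \<bar>real_of_int (\<beta> t) * (real_of_int (\<beta> t) - h)\<bar> \<le> s ^ 2 \<and> \<bar>real_of_int (\<beta> t)\<bar> \<le> Y}"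
  have inj: "inj \<phi>" unfolding \<phi>_def inj_def using n by simp
  have fib: "fibre1 B n = \<phi> ` Z"
  proof -
    have cond: "real_of_int \<bar>int (d * a) * \<beta> t\<bar> \<le> B \<longleftrightarrow> \<bar>real_of_int (\<beta> t)\<bar> \<le> Y" for t
    proof -
      have "real_of_int \<bar>int (d * a) * \<beta> t\<bar> = \<bar>real_of_int (\<beta> t)\<bar> * real (d * a)" by (simp add: abs_mult)
      moreover have "0 < real (d * a)" using n d0 by simp
      ultimately show ?thesis unfolding Y_def by (simp only: pos_le_divide_eq)
    qed
    have cond2: "real_of_int \<bar>\<beta> t * (\<delta>0 - int a * t)\<bar> \<le> B \<longleftrightarrow> \<bar>real_of_int (\<beta> t) * (real_of_int (\<beta> t) - h)\<bar> \<le> s ^ 2" for t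
    proof -
      have "int c * (\<delta>0 - int a * t) = int e - int a * \<beta> t" using sol by (simp add: \<beta>_def algebra_simps)
      then have "real c * real_of_int (\<delta>0 - int a * t) = real e - real a * real_of_int (\<beta> t)"
        by (metis of_int_diff of_int_mult of_int_of_nat_eq)
      then have "real_of_int (\<beta> t) * (real c * real_of_int (\<delta>0 - int a * t)) = real_of_int (\<beta> t) * (real e - real a * real_of_int (\<beta> t))" by (rule arg_cong)
      also have "\<dots> = - real a * (real_of_int (\<beta> t) * (real_of_int (\<beta> t) - h))"
        using n by (simp add: h_def field_simps)
      finally have "real c * real_of_int (\<beta> t * (\<delta>0 - int a * t)) = - real a * (real_of_int (\<beta> t) * (real_of_int (\<beta> t) - h))"
        by (simp only: of_int_mult mult.left_commute)
      then have "\<bar>real c * real_of_int (\<beta> t * (\<delta>0 - int a * t))\<bar> = \<bar>- real a * (real_of_int (\<beta> t) * (real_of_int (\<beta> t) - h))\<bar>" by simp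
      then have eq: "real c * real_of_int \<bar>\<beta> t * (\<delta>0 - int a * t)\<bar> = real a * \<bar>real_of_int (\<beta> t) * (real_of_int (\<beta> t) - h)\<bar>"
        by (simp add: abs_mult)
      have "real_of_int \<bar>\<beta> t * (\<delta>0 - int a * t)\<bar> \<le> B \<longleftrightarrow> real c * real_of_int \<bar>\<beta> t * (\<delta>0 - int a * t)\<bar> \<le> real c * B" using n by simp
      also have "\<dots> \<longleftrightarrow> real a * \<bar>real_of_int (\<beta> t) * (real_of_int (\<beta> t) - h)\<bar> \<le> real a * s ^ 2" unfolding eq s2 using n by (simp add: mult.commute)
      also have "\<dots> \<longleftrightarrow> \<bar>real_of_int (\<beta> t) * (real_of_int (\<beta> t) - h)\<bar> \<le> s ^ 2" using n by simp
      finally show ?thesis .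
    qed
    have "fibre1 B n = {(\<beta>', \<delta>). int a * \<beta>' + int c * \<delta> = int e \<and> (coprime \<beta>' (int d) \<and> coprime \<delta> (int d)
     \<and> real_of_int \<bar>int (d * a) * \<beta>'\<bar> \<le> B \<and> real_of_int \<bar>\<beta>' * \<delta>\<bar> \<le> B)}"
      unfolding fibre1_def d_def[symmetric] e_def[symmetric] by (simp add: n(1))
    also have "\<dots> = \<phi> ` {t. (coprime (\<beta>0 + int c * t) (int d) \<and> coprime (\<delta>0 - int a * t) (int d)
     \<and> real_of_int \<bar>int (d * a) * (\<beta>0 + int c * t)\<bar> \<le> B \<and> real_of_int \<bar>(\<beta>0 + int c * t) * (\<delta>0 - int a * t)\<bar> \<le> B)}"
      unfolding \<phi>_def by (rule linear_solutions_image[OF n(3) cop(1) sol])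
    finally show ?thesis unfolding Z_def \<beta>_def[symmetric] cond cond2 by (simp add: conj_ac)
  qed
  have card: "card (fibre1 B n) = card Z" unfolding fib using inj by (intro card_image inj_on_subset[OF inj]) auto
  have win: "u \<le> real_of_int (\<beta> t) \<and> real_of_int (\<beta> t) \<le> v \<longleftrightarrow> (u - of_int \<beta>0) / real c \<le> of_int t \<and> of_int t \<le> (v - of_int \<beta>0) / real c" for t u v
    unfolding \<beta>_def using n by (simp add: pos_divide_le_eq pos_le_divide_eq algebra_simps)
  have w01: "0 \<le> w" "w \<le> 1"
  proof -
    have "0 \<le> 1 - real (omega1 a c (e_of n) p) / real p \<and> 1 - real (omega1 a c (e_of n) p) / real p \<le> 1" if "p \<in> prime_factors (d_of n)" for p
    proof -
      have "2 \<le> p" using that by (auto simp: in_prime_factors_iff prime_ge_2_nat)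
      then have "real (omega1 a c (e_of n) p) \<le> real p" using omega1_le[of a c "e_of n" p] by linarith
      then show ?thesis using \<open>2 \<le> p\<close> by simp
    qed
    then show "0 \<le> w" "w \<le> 1" unfolding w_def by (auto intro!: prod_nonneg prod_le_1)
  qed
  have sd1: "1 \<le> sqrt (real d)" using d0 by simp
  have "finite Z \<and> \<bar>real (card Z) - w * (2 * R)\<bar> \<le> 83 * sqrt (real d) + 4 * min R (q ^ 2 / R) + (if B \<le> 16 * real (d ^ 2 * a * c) then q else 0)"
  proof (cases "h \<le> 2 * s")
    case True
    define lo where "lo = (h - sqrt (h ^ 2 + 4 * s ^ 2)) / 2"
    define hi where "hi = (h + sqrt (h ^ 2 + 4 * s ^ 2)) / 2"
    note qw = quadratic_window[OF s0 h0 True sY, folded lo_def hi_def]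
    define RR where "RR p = {s\<in>{0..<int p}. int p dvd \<beta>0 + int c * s \<or> int p dvd \<delta>0 - int a * s}" for p
    have RR: "card (RR p) = omega1 a c e p" "RR p \<subseteq> {0..<int p}" if "p \<in> prime_factors d" for p
    proof -
      have "prime p" using that by (simp add: in_prime_factors_iff)
      then show "card (RR p) = omega1 a c e p" unfolding RR_def by (rule card_forbidden_residues[OF _ cop(2) sol])
    qed (auto simp: RR_def)
    have cc: "coprime (\<beta> t) (int d) \<and> coprime (\<delta>0 - int a * t) (int d) \<longleftrightarrow> (\<forall>p\<in>prime_factors d. t mod int p \<notin> RR p)" for t
    proof -
      have "t mod int p \<in> RR p \<longleftrightarrow> int p dvd \<beta> t \<or> int p dvd \<delta>0 - int a * t" if "p \<in> prime_factors d" for p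
      proof -
        have p: "0 < int p" using that by (simp add: in_prime_factors_iff prime_gt_0_nat)
        define m k where "m = t mod int p" and "k = t div int p"
        have t: "t = m + int p * k" unfolding m_def k_def by simp
        have "\<beta> t = (\<beta>0 + int c * m) + int p * (int c * k)" "\<delta>0 - int a * t = (\<delta>0 - int a * m) + int p * (- int a * k)"
          unfolding \<beta>_def t by (simp_all add: algebra_simps)
        then have "int p dvd \<beta> t \<longleftrightarrow> int p dvd \<beta>0 + int c * m" "int p dvd \<delta>0 - int a * t \<longleftrightarrow> int p dvd \<delta>0 - int a * m"
          by (simp_all only: dvd_add_left_iff dvd_triv_left)
        moreover have "m \<in> {0..<int p}" unfolding m_def using p by simp
        ultimately have "m \<in> RR p \<longleftrightarrow> int p dvd \<beta> t \<or> int p dvd \<delta>0 - int a * t" unfolding RR_def by simp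
        then show ?thesis unfolding m_def .
      qed
      then show ?thesis unfolding coprime_int_iff_prime_factors[OF d0(1)] by blast
    qed
    have Z: "Z = {t. (lo - of_int \<beta>0) / real c \<le> of_int t \<and> of_int t \<le> (min hi Y - of_int \<beta>0) / real c \<and> (\<forall>p\<in>prime_factors d. t mod int p \<notin> RR p)}"
      unfolding Z_def cc qw(1) win by blast
    have le: "(lo - of_int \<beta>0) / real c \<le> (min hi Y - of_int \<beta>0) / real c" using qw(2) by (intro divide_right_mono) auto
    have fin: "finite Z" unfolding Z by (rule finite_subset[OF _ card_int_interval(1)[OF le]]) auto
    have "\<bar>real (card Z) - ((min hi Y - of_int \<beta>0) / real c - (lo - of_int \<beta>0) / real c) * (\<Prod>p\<in>prime_factors d. 1 - real (card (RR p)) / real p)\<bar>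
       \<le> (\<Prod>p\<in>prime_factors d. 1 + real (card (RR p)))"
      unfolding Z using RR le by (intro interval_sieve) (auto simp: in_prime_factors_iff)
    moreover have "(\<Prod>p\<in>prime_factors d. 1 - real (card (RR p)) / real p) = w"
      unfolding w_def d_def[symmetric] e_def[symmetric] using RR by (intro prod.cong) auto
    moreover have "(\<Prod>p\<in>prime_factors d. 1 + real (card (RR p))) \<le> 81 * sqrt (real d)"
    proof -
      have "(\<Prod>p\<in>prime_factors d. 1 + real (card (RR p))) \<le> (\<Prod>p\<in>prime_factors d. 3)"
      proof (intro prod_mono conjI)
        fix p assume p: "p \<in> prime_factors d"
        show "1 + real (card (RR p)) \<le> 3" using RR(1)[OF p] omega1_le[of a c e p] by simp
      qed auto
      then show ?thesis using prod_prime_factors_3_le[OF d0(1)] by linarith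
    qed
    moreover have "(min hi Y - of_int \<beta>0) / real c - (lo - of_int \<beta>0) / real c = (min hi Y - lo) / real c" by (simp add: diff_divide_distrib)
    ultimately have 1: "\<bar>real (card Z) - (min hi Y - lo) / real c * w\<bar> \<le> 81 * sqrt (real d)" by simp
    have 2: "\<bar>(min hi Y - lo) / real c * w - w * (2 * R)\<bar> \<le> q ^ 2 / (4 * R) + (if Y < 4 * s then q else 0)"
    proof -
      have "(min hi Y - lo) / real c * w - w * (2 * R) = w * (((min hi Y - lo) - 2 * s) / real c)"
        unfolding sR[symmetric] by (simp add: algebra_simps diff_divide_distrib add_divide_distrib)
      also have "\<bar>\<dots>\<bar> = w * (\<bar>(min hi Y - lo) - 2 * s\<bar> / real c)" using w01 by (simp add: abs_mult)
      also have "\<dots> \<le> 1 * ((h ^ 2 / (4 * s) + (if Y < 4 * s then h else 0)) / real c)"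
        using w01 qw(3) by (intro mult_mono divide_right_mono) auto
      also have "\<dots> = q ^ 2 / (4 * R) + (if Y < 4 * s then q else 0)"
        unfolding hq[symmetric] sR[symmetric] using n s0 by (simp add: field_simps power2_eq_square)
      finally show ?thesis .
    qed
    have qR: "q \<le> 2 * R" unfolding hq[symmetric] sR[symmetric] using True by (simp add: divide_right_mono)
    have 3: "q ^ 2 / (4 * R) \<le> 4 * min R (q ^ 2 / R)"
    proof -
      have "q ^ 2 \<le> (2 * R) ^ 2" using qR q0 by (intro power_mono)
      then have "q ^ 2 / (4 * R) \<le> R" using R0 by (simp add: pos_divide_le_eq power2_eq_square)
      moreover have "q ^ 2 / (4 * R) \<le> q ^ 2 / R" using R0 by (intro divide_left_mono) auto
      ultimately show ?thesis using R0 by (auto simp: min_def)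
    qed
    have 4: "B \<le> 16 * real (d ^ 2 * a * c)" if "Y < 4 * s"
    proof -
      have "Y ^ 2 \<le> (4 * s) ^ 2" using that sY s0 by (intro power_mono) auto
      then have "B ^ 2 / (real (d * a)) ^ 2 \<le> 16 * (B * real c / real a)" unfolding Y_def by (simp add: power_divide power_mult_distrib s2)
      then have "B ^ 2 \<le> 16 * (B * real c / real a) * (real (d * a)) ^ 2" using n d0 by (simp add: pos_divide_le_eq)
      also have "\<dots> = B * (16 * real (d ^ 2 * a * c))" using n by (simp add: power2_eq_square)
      finally show ?thesis using B by (simp add: power2_eq_square)
    qed
    have "\<bar>real (card Z) - w * (2 * R)\<bar> \<le> 81 * sqrt (real d) + (4 * min R (q ^ 2 / R) + (if Y < 4 * s then q else 0))"
      using 1 2 3 by linarith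
    moreover have "(if Y < 4 * s then q else 0) \<le> (if B \<le> 16 * real (d ^ 2 * a * c) then q else 0)" using 4 q0 by auto
    ultimately show ?thesis using fin sd1 by linarith
  next
    case False
    let ?Z1 = "{t. (- s - of_int \<beta>0) / real c \<le> real_of_int t \<and> of_int t \<le> (s - of_int \<beta>0) / real c}"
    let ?Z2 = "{t. (h - s - of_int \<beta>0) / real c \<le> real_of_int t \<and> of_int t \<le> (h + s - of_int \<beta>0) / real c}"
    \<comment> \<open>The two factors cannot both exceed s in absolute value, so \<beta> lies within
      s of 0 or of h. A crude count suffices: q > 2 R makes the minimum in the error equal to R,
      which absorbs the main term.\<close>
    have sub: "Z \<subseteq> ?Z1 \<union> ?Z2"
    proof
      fix t assume t: "t \<in> Z"
      have "(- s \<le> real_of_int (\<beta> t) \<and> real_of_int (\<beta> t) \<le> s) \<or> (h - s \<le> real_of_int (\<beta> t) \<and> real_of_int (\<beta> t) \<le> h + s)"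
      proof (rule ccontr)
        assume "\<not> ?thesis"
        then have "s < \<bar>real_of_int (\<beta> t)\<bar>" "s < \<bar>real_of_int (\<beta> t) - h\<bar>" by linarith+
        then have "s * s < \<bar>real_of_int (\<beta> t)\<bar> * \<bar>real_of_int (\<beta> t) - h\<bar>" using s0 by (intro mult_strict_mono) auto
        then show False using t unfolding Z_def by (simp add: abs_mult power2_eq_square)
      qed
      then show "t \<in> ?Z1 \<union> ?Z2" unfolding win by blast
    qed
    have le: "(- s - of_int \<beta>0) / real c \<le> (s - of_int \<beta>0) / real c" "(h - s - of_int \<beta>0) / real c \<le> (h + s - of_int \<beta>0) / real c"
      using s0 by (intro divide_right_mono; simp)+
    note c1 = card_int_interval[OF le(1)] and c2 = card_int_interval[OF le(2)]
    have fin: "finite Z" by (rule finite_subset[OF sub]) (use c1 c2 in simp)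
    have "card Z \<le> card (?Z1 \<union> ?Z2)" using c1(1) c2(1) sub by (intro card_mono) auto
    also have "\<dots> \<le> card ?Z1 + card ?Z2" by (rule card_Un_le)
    finally have "real (card Z) \<le> real (card ?Z1) + real (card ?Z2)" by linarith
    moreover have "(s - of_int \<beta>0) / real c - (- s - of_int \<beta>0) / real c = 2 * R" "(h + s - of_int \<beta>0) / real c - (h - s - of_int \<beta>0) / real c = 2 * R"
      unfolding sR[symmetric] by (simp_all add: diff_divide_distrib add_divide_distrib)
    ultimately have cz: "real (card Z) \<le> 4 * R + 2" using c1(2) c2(2) by linarith
    have "q > 2 * R" unfolding hq[symmetric] sR[symmetric] using False n by (simp add: divide_strict_right_mono)
    then have "R * R \<le> q ^ 2" using R0 unfolding power2_eq_square by (intro mult_mono) auto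
    then have "R \<le> q ^ 2 / R" using R0 by (simp add: pos_le_divide_eq)
    then have m: "min R (q ^ 2 / R) = R" by simp
    have "w * (2 * R) \<le> 1 * (2 * R)" using w01 R0 by (intro mult_right_mono) auto
    moreover have "0 \<le> w * (2 * R)" using w01 R0 by simp
    ultimately have "\<bar>real (card Z) - w * (2 * R)\<bar> \<le> 4 * R + 2" using cz R0 by linarith
    then have "\<bar>real (card Z) - w * (2 * R)\<bar> \<le> 83 * sqrt (real d) + 4 * R" using sd1 by linarith
    moreover have "0 \<le> (if B \<le> 16 * real (d ^ 2 * a * c) then q else 0)" using q0 by simp
    ultimately show ?thesis unfolding m using fin by linarith
  qed
  then show "finite (fibre1 B n)"
    and "\<bar>real (card (fibre1 B n)) - w * (2 * R)\<bar> \<le> 83 * sqrt (real (d_of n)) + 4 * min R (q ^ 2 / R) + (if B \<le> 16 * real (d_of n ^ 2 * a * c) then q else 0)"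
    unfolding card d_def[symmetric] using fib by simp_all
qed

section \<open>Summing the errors of the fibres\<close>

lemma sum_Box_add_2:
  "(\<Sum>n\<in>Box (Suc (Suc k)) N. F n) = (\<Sum>ns\<in>Box k N. \<Sum>a=1..N. \<Sum>c=1..N. F (a # c # ns))"
proof -
  have "(\<Sum>n\<in>Box (Suc (Suc k)) N. F n) = (\<Sum>a=1..N. \<Sum>ns\<in>Box k N. \<Sum>c=1..N. F (a # c # ns))"
    unfolding sum_Box_Suc by (intro sum.cong refl sum.swap)
  also have "\<dots> = (\<Sum>ns\<in>Box k N. \<Sum>a=1..N. \<Sum>c=1..N. F (a # c # ns))" by (rule sum.swap)
  finally show ?thesis .
qed

lemma numeral_6_eq_6: "(6::nat) = Suc (Suc 4)"
  by simp

lemma Box_4_cases: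
  assumes "ns \<in> Box 4 N"
  obtains e3 e2 e1 k where "ns = [e3, e2, e1, k]" "e3 \<in> {1..N}" "e2 \<in> {1..N}" "e1 \<in> {1..N}" "k \<in> {1..N}"
  using assms that by (auto simp: Box_def numeral_4_eq_4 length_Suc_conv)

text \<open>The increments of \<open>y \<mapsto> \<surd>x \<surd>y / (\<surd>x + \<surd>y)\<close> dominate the summands up to a constant.\<close>

lemma sum_min_inverse_sqrt_le:
  fixes x :: real
  assumes "0 < x"
  shows "(\<Sum>n=1..N. min (1 / sqrt (real n)) (x / (real n * sqrt (real n)))) \<le> 8 * sqrt x"
proof -
  define r where "r = sqrt x"
  have r: "0 < r" "x = r ^ 2" using assms by (auto simp: r_def)
  have "(\<Sum>n=1..N. min (1 / sqrt (real n)) (x / (real n * sqrt (real n)))) \<le> 8 * (r * sqrt (real N) / (r + sqrt (real N)))"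
  proof (induction N)
    case (Suc N)
    define u v where "u = sqrt (real (Suc N))" and "v = sqrt (real N)"
    have u: "0 < u" "0 \<le> v" "v \<le> u" by (auto simp: u_def v_def)
    have u2: "real (Suc N) = u ^ 2" by (simp add: u_def)
    have "u ^ 2 - v ^ 2 = 1" by (simp add: u_def v_def)
    then have "(u - v) * (u + v) = 1" by (simp add: power2_eq_square algebra_simps)
    then have uv: "u - v = 1 / (u + v)" using u by (simp add: eq_divide_eq)
    define m where "m = max r u"
    have m: "0 < m" "r \<le> m" "u \<le> m" using u r by (auto simp: m_def)
    have "min (1 / u) (x / (u ^ 2 * u)) = r ^ 2 / (u * m ^ 2)"
    proof (cases "r \<le> u")
      case True
      then have "r ^ 2 \<le> u ^ 2" using r by (intro power_mono) auto
      then have "x / (u ^ 2 * u) \<le> 1 / u" using u r by (simp add: field_simps)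
      then show ?thesis using True r u by (simp add: m_def mult_ac)
    next
      case False
      then have "u ^ 2 \<le> r ^ 2" using u by (intro power_mono) auto
      then have "1 / u \<le> x / (u ^ 2 * u)" using u r by (simp add: field_simps)
      then show ?thesis using False r u by (simp add: m_def)
    qed
    also have "\<dots> = 8 * (r ^ 2 / ((2 * u) * ((2 * m) * (2 * m))))" by (simp add: power2_eq_square)
    also have "\<dots> \<le> 8 * (r ^ 2 / ((u + v) * ((r + u) * (r + v))))"
      using u r m by (intro mult_left_mono divide_left_mono mult_mono mult_pos_pos) auto
    also have "r ^ 2 / ((u + v) * ((r + u) * (r + v))) = r ^ 2 * (u - v) / ((r + u) * (r + v))" unfolding uv by simp
    also have "\<dots> = r * u / (r + u) - r * v / (r + v)"
    proof -
      have "r + u \<noteq> 0" "r + v \<noteq> 0" using u r by auto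
      then show ?thesis by (simp add: diff_frac_eq) (simp add: power2_eq_square algebra_simps)
    qed
    finally have "min (1 / u) (x / (u ^ 2 * u)) \<le> 8 * (r * u / (r + u)) - 8 * (r * v / (r + v))" by simp
    moreover have "(\<Sum>n=1..Suc N. min (1 / sqrt (real n)) (x / (real n * sqrt (real n))))
      = (\<Sum>n=1..N. min (1 / sqrt (real n)) (x / (real n * sqrt (real n)))) + min (1 / u) (x / (u ^ 2 * u))"
      unfolding u2[symmetric] by (simp add: u_def)
    ultimately show ?case using Suc unfolding u_def[symmetric] v_def[symmetric] by linarith
  qed simp
  also have "r * sqrt (real N) / (r + sqrt (real N)) \<le> r" using r by (simp add: pos_divide_le_eq add_pos_nonneg algebra_simps)
  finally show ?thesis by (simp add: r_def)
qed

lemma card_le_floor: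
  assumes "0 \<le> x"
  shows "real (card {c\<in>{1..N}. real c \<le> x}) \<le> x"
proof -
  have "{c\<in>{1..N}. real c \<le> x} \<subseteq> {1..nat \<lfloor>x\<rfloor>}" using assms by (auto simp: le_nat_floor_iff)
  then have "card {c\<in>{1..N}. real c \<le> x} \<le> nat \<lfloor>x\<rfloor>" using card_mono[of "{1..nat \<lfloor>x\<rfloor>}"] by simp
  then show ?thesis using assms by (simp add: le_nat_floor_iff)
qed

text \<open>The two entries of the minimum cross at c = x = e^2 / (a B); after scaling,
  \<open>sum_min_inverse_sqrt_le\<close> gives 4 * 8 = 32. The cut-off term occurs only for X / 16
  <= c <= X with X = B / (d^2 a): at most X values, each at most 16 e / (a X).\<close>

lemma sum_min_window_le:
  fixes a d e :: nat
  assumes B: "0 < B" and pos: "0 < a" "0 < d" "0 < e"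
  shows "(\<Sum>c=1..N. 4 * min (sqrt (B / real (a * c))) ((real e / real (a * c)) ^ 2 / sqrt (B / real (a * c)))
      + (if real (d ^ 2 * a * c) \<le> B \<and> B \<le> 16 * real (d ^ 2 * a * c) then real e / real (a * c) else 0)) \<le> 48 * (real e * (1 / real a))"
proof -
  define x where "x = real e ^ 2 / (real a * B)"
  have x: "0 < x" using assms by (simp add: x_def)
  have m: "min (sqrt (B / real (a * c))) ((real e / real (a * c)) ^ 2 / sqrt (B / real (a * c))) = sqrt (B / real a) * min (1 / sqrt (real c)) (x / (real c * sqrt (real c)))"
    if c: "c \<in> {1..N}" for c
  proof -
    define A C S where "A = sqrt (real a)" and "C = sqrt (real c)" and "S = sqrt B"
    have ACS: "0 < A" "0 < C" "0 < S" using c assms by (auto simp: A_def C_def S_def)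
    have sq: "real a = A ^ 2" "real c = C ^ 2" "B = S ^ 2" using B by (auto simp: A_def C_def S_def)
    have e1: "sqrt (B / real (a * c)) = S / (A * C)" "sqrt (B / real a) = S / A" "sqrt (real c) = C"
      by (simp_all add: real_sqrt_divide real_sqrt_mult A_def C_def S_def)
    have 1: "sqrt (B / real (a * c)) = sqrt (B / real a) * (1 / sqrt (real c))" unfolding e1 by simp
    have 2: "(real e / real (a * c)) ^ 2 / sqrt (B / real (a * c)) = sqrt (B / real a) * (x / (real c * sqrt (real c)))"
      unfolding e1 unfolding x_def of_nat_mult sq using ACS by (simp add: field_simps power2_eq_square)
    have "sqrt (B / real a) * min (1 / sqrt (real c)) (x / (real c * sqrt (real c))) = min (sqrt (B / real a) * (1 / sqrt (real c))) (sqrt (B / real a) * (x / (real c * sqrt (real c))))"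
      using B by (simp add: min_mult_distrib_left)
    then show ?thesis unfolding 2 by (simp only: 1)
  qed
  have "(\<Sum>c=1..N. 4 * min (sqrt (B / real (a * c))) ((real e / real (a * c)) ^ 2 / sqrt (B / real (a * c))))
     = 4 * (sqrt (B / real a) * (\<Sum>c=1..N. min (1 / sqrt (real c)) (x / (real c * sqrt (real c)))))"
    unfolding sum_distrib_left using m by (intro sum.cong) auto
  also have "\<dots> \<le> 4 * (sqrt (B / real a) * (8 * sqrt x))"
    using B sum_min_inverse_sqrt_le[OF x] by (intro mult_left_mono) auto
  also have "\<dots> = 32 * (real e * (1 / real a))"
  proof -
    have "sqrt (B / real a) * sqrt x = sqrt ((real e / real a) ^ 2)"
      unfolding x_def real_sqrt_mult[symmetric] using B by (simp add: power2_eq_square)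
    then have "sqrt (B / real a) * sqrt x = real e / real a" by simp
    then show ?thesis by simp
  qed
  finally have s1: "(\<Sum>c=1..N. 4 * min (sqrt (B / real (a * c))) ((real e / real (a * c)) ^ 2 / sqrt (B / real (a * c)))) \<le> 32 * (real e * (1 / real a))" .
  define X where "X = B / real (d ^ 2 * a)"
  have X: "0 < X" using assms by (simp add: X_def)
  have "(\<Sum>c=1..N. if real (d ^ 2 * a * c) \<le> B \<and> B \<le> 16 * real (d ^ 2 * a * c) then real e / real (a * c) else 0)
     \<le> (\<Sum>c=1..N. if real c \<le> X then 16 * (real e * (1 / real a)) / X else 0)"
  proof (intro sum_mono)
    fix c assume c: "c \<in> {1..N}"
    have "real c \<le> X" "real e / real (a * c) \<le> 16 * (real e * (1 / real a)) / X" if "real (d ^ 2 * a * c) \<le> B" "B \<le> 16 * real (d ^ 2 * a * c)"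
    proof -
      show "real c \<le> X" using that assms by (simp add: X_def pos_le_divide_eq mult_ac)
      have "X \<le> 16 * real c" using that assms by (simp add: X_def pos_divide_le_eq mult_ac)
      then have "X * (real e / real (a * c)) \<le> 16 * real c * (real e / real (a * c))" by (intro mult_right_mono) auto
      also have "\<dots> = 16 * (real e * (1 / real a))" using c pos by simp
      finally show "real e / real (a * c) \<le> 16 * (real e * (1 / real a)) / X" unfolding pos_le_divide_eq[OF X] by (simp only: mult.commute[of X])
    qed
    then show "(if real (d ^ 2 * a * c) \<le> B \<and> B \<le> 16 * real (d ^ 2 * a * c) then real e / real (a * c) else 0)
       \<le> (if real c \<le> X then 16 * (real e * (1 / real a)) / X else 0)" using X by auto
  qed
  also have "\<dots> = real (card {c\<in>{1..N}. real c \<le> X}) * (16 * (real e * (1 / real a)) / X)"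
    by (subst sum.inter_filter[symmetric]) auto
  also have "\<dots> \<le> X * (16 * (real e * (1 / real a)) / X)"
    using X by (intro mult_right_mono card_le_floor) auto
  also have "\<dots> = 16 * (real e * (1 / real a))" using X by simp
  finally show ?thesis using s1 by (simp add: sum.distrib)
qed

text \<open>The sum over k is taken first: k runs up to B / (e3 e2 e1 e), which cancels the summand
  e and leaves three harmonic sums.\<close>

lemma sum_e_of_le:
  assumes B: "1 \<le> B"
  shows "(\<Sum>ns\<in>Box 4 (nat \<lfloor>B\<rfloor>). if real (d_of (a # c # ns) * e_of (a # c # ns)) \<le> B then real (e_of (a # c # ns)) else 0) \<le> B * (ln B + 1) ^ 3"
proof -
  let ?N = "nat \<lfloor>B\<rfloor>"
  have "(\<Sum>ns\<in>Box 4 ?N. if real (d_of (a # c # ns) * e_of (a # c # ns)) \<le> B then real (e_of (a # c # ns)) else 0)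
     = (\<Sum>e3=1..?N. \<Sum>e2=1..?N. \<Sum>e1=1..?N. \<Sum>k=1..?N. if real (e3 * e2 * e1 * k * (e1 * e2 ^ 2 * e3 ^ 3)) \<le> B then real (e1 * e2 ^ 2 * e3 ^ 3) else 0)"
    unfolding numeral_4_eq_4 sum_Box_Suc by (simp add: d_of_def e_of_def cong: if_cong)
  also have "\<dots> \<le> (\<Sum>e3=1..?N. \<Sum>e2=1..?N. \<Sum>e1=1..?N. B * (1 / real e3 * (1 / real e2 * (1 / real e1))))"
  proof (intro sum_mono)
    fix e3 e2 e1 assume e: "e3 \<in> {1..?N}" "e2 \<in> {1..?N}" "e1 \<in> {1..?N}"
    define f where "f = e1 * e2 ^ 2 * e3 ^ 3"
    define x where "x = B / real (e3 * e2 * e1 * f)"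
    have pos: "0 < e1" "0 < e2" "0 < e3" "0 < f" using e by (auto simp: f_def)
    have "real (e3 * e2 * e1 * k * f) \<le> B \<longleftrightarrow> real k \<le> x" for k
      using pos by (simp add: x_def pos_le_divide_eq mult_ac)
    then have "(\<Sum>k=1..?N. if real (e3 * e2 * e1 * k * f) \<le> B then real f else 0) = (\<Sum>k\<in>{k\<in>{1..?N}. real k \<le> x}. real f)"
      by (simp only: sum.inter_filter[OF finite_atLeastAtMost])
    also have "\<dots> = real (card {k\<in>{1..?N}. real k \<le> x}) * real f" by simp
    also have "\<dots> \<le> x * real f" using B by (intro mult_right_mono card_le_floor) (auto simp: x_def)
    also have "\<dots> = B * (1 / real e3 * (1 / real e2 * (1 / real e1)))" using pos by (simp add: x_def)
    finally show "(\<Sum>k=1..?N. if real (e3 * e2 * e1 * k * (e1 * e2 ^ 2 * e3 ^ 3)) \<le> B then real (e1 * e2 ^ 2 * e3 ^ 3) else 0) \<le> B * (1 / real e3 * (1 / real e2 * (1 / real e1)))"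
      unfolding f_def .
  qed
  also have "\<dots> = B * ((\<Sum>e3=1..?N. 1 / real e3) * ((\<Sum>e2=1..?N. 1 / real e2) * (\<Sum>e1=1..?N. 1 / real e1)))"
    by (simp only: sum_distrib_left[symmetric] sum_distrib_right[symmetric])
  also have "\<dots> \<le> B * ((ln B + 1) * ((ln B + 1) * (ln B + 1)))"
    using sum_inverse_floor_le[OF B] B by (intro mult_left_mono mult_mono mult_nonneg_nonneg sum_nonneg) auto
  finally show ?thesis by (simp add: power3_eq_cube mult_ac)
qed

lemma d_of_Cons_Cons: "d_of (a # c # ns) = d_of (a' # c' # ns)" "e_of (a # c # ns) = e_of (a' # c' # ns)"
  by (simp_all add: d_of_def e_of_def)

text \<open>Each term is multiplied by B / (d^2 a c) >= 1. The sums over the four factors of d then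
  converge, to at most 3 each, so 81 = 3^4 and only a and c produce logarithms.\<close>

lemma sum_sqrt_d_of_le:
  assumes B: "1 \<le> B"
  shows "(\<Sum>n\<in>Box 6 (nat \<lfloor>B\<rfloor>). if real (d_of n ^ 2 * n ! 0 * n ! 1) \<le> B then sqrt (real (d_of n)) else 0) \<le> B * (81 * (ln B + 1) ^ 2)"
proof -
  let ?N = "nat \<lfloor>B\<rfloor>"
  let ?s = "\<lambda>x::nat. sqrt (real x) / real x ^ 2"
  let ?fs = "[\<lambda>x. 1 / real x, \<lambda>x. 1 / real x, ?s, ?s, ?s, ?s]"
  have "(\<Sum>n\<in>Box 6 ?N. if real (d_of n ^ 2 * n ! 0 * n ! 1) \<le> B then sqrt (real (d_of n)) else 0) \<le> (\<Sum>n\<in>Box 6 ?N. B * prod_list (map2 (\<lambda>f x. f x) ?fs n))"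
  proof (intro sum_mono)
    fix n assume "n \<in> Box 6 ?N"
    then obtain a c e3 e2 e1 k where n: "n = [a, c, e3, e2, e1, k]" "a \<in> {1..?N}" "c \<in> {1..?N}" "e3 \<in> {1..?N}" "e2 \<in> {1..?N}" "e1 \<in> {1..?N}" "k \<in> {1..?N}"
      by (rule Box_6_cases)
    define d where "d = d_of n"
    have d: "d = e3 * e2 * e1 * k" by (simp add: d_def d_of_def n(1))
    have e: "B * prod_list (map2 (\<lambda>f x. f x) ?fs n) = sqrt (real d) * (B / real (d ^ 2 * a * c))"
      unfolding n(1) d by (simp add: real_sqrt_mult power_mult_distrib mult_ac)
    have pos: "0 < real (d ^ 2 * a * c)" using n by (simp add: d)
    show "(if real (d_of n ^ 2 * n ! 0 * n ! 1) \<le> B then sqrt (real (d_of n)) else 0) \<le> B * prod_list (map2 (\<lambda>f x. f x) ?fs n)"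
    proof (cases "real (d ^ 2 * a * c) \<le> B")
      case True
      then have "1 \<le> B / real (d ^ 2 * a * c)" using pos by (simp add: le_divide_eq_1_pos del: of_nat_mult)
      then have "sqrt (real d) * 1 \<le> sqrt (real d) * (B / real (d ^ 2 * a * c))" by (intro mult_left_mono) auto
      then show ?thesis unfolding e d_def[symmetric] using True by (simp add: n(1))
    next
      case False
      then show ?thesis unfolding e d_def[symmetric] using B by (simp add: n(1))
    qed
  qed
  also have "\<dots> = B * ((\<Sum>x=1..?N. 1 / real x) * ((\<Sum>x=1..?N. 1 / real x) * (sum ?s {1..?N} * (sum ?s {1..?N} * (sum ?s {1..?N} * sum ?s {1..?N})))))"
  proof -
    have "length ?fs = 6" by simp
    then show ?thesis using sum_Box_prod[of ?fs ?N] by (simp only: list.map prod_list.Cons prod_list.Nil mult_1_right sum_distrib_left[symmetric])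
  qed
  also have "\<dots> \<le> B * ((ln B + 1) * ((ln B + 1) * (3 * (3 * (3 * 3)))))"
    using sum_inverse_floor_le[OF B] sum_inverse_three_halves_le[of ?N] B
    by (intro mult_left_mono mult_mono mult_nonneg_nonneg sum_nonneg) auto
  finally show ?thesis by (simp add: power2_eq_square mult_ac)
qed

text \<open>The window errors set the order: one logarithm from a and three from e3, e2, e1. The
  constant is 83 * 81 + 48.\<close>

lemma N1_error_sum_le:
  assumes B: "1 \<le> B"
    and P: "\<And>n. P n \<Longrightarrow> real (d_of n ^ 2 * n ! 0 * n ! 1) \<le> B \<and> real (d_of n * e_of n) \<le> B"
  shows "(\<Sum>n\<in>{n\<in>Box 6 (nat \<lfloor>B\<rfloor>). P n}. 83 * sqrt (real (d_of n))
      + 4 * min (sqrt (B / real (n ! 0 * n ! 1))) ((real (e_of n) / real (n ! 0 * n ! 1)) ^ 2 / sqrt (B / real (n ! 0 * n ! 1)))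
      + (if B \<le> 16 * real (d_of n ^ 2 * n ! 0 * n ! 1) then real (e_of n) / real (n ! 0 * n ! 1) else 0)) \<le> B * (6771 * (ln B + 1) ^ 4)"
proof -
  let ?N = "nat \<lfloor>B\<rfloor>"
  let ?E1 = "\<lambda>n. if real (d_of n ^ 2 * n ! 0 * n ! 1) \<le> B then sqrt (real (d_of n)) else 0"
  let ?E2 = "\<lambda>n. 4 * min (sqrt (B / real (n ! 0 * n ! 1))) ((real (e_of n) / real (n ! 0 * n ! 1)) ^ 2 / sqrt (B / real (n ! 0 * n ! 1)))
     + (if real (d_of n ^ 2 * n ! 0 * n ! 1) \<le> B \<and> B \<le> 16 * real (d_of n ^ 2 * n ! 0 * n ! 1) then real (e_of n) / real (n ! 0 * n ! 1) else 0)"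
  have E2: "(\<Sum>n\<in>Box 6 ?N. if real (d_of n * e_of n) \<le> B then ?E2 n else 0) \<le> 48 * (ln B + 1) * (B * (ln B + 1) ^ 3)"
  proof -
    have "(\<Sum>n\<in>Box 6 ?N. if real (d_of n * e_of n) \<le> B then ?E2 n else 0)
       \<le> (\<Sum>ns\<in>Box 4 ?N. \<Sum>a=1..?N. (if real (d_of (1 # 1 # ns) * e_of (1 # 1 # ns)) \<le> B then real (e_of (1 # 1 # ns)) else 0) * (48 * (1 / real a)))"
      unfolding numeral_6_eq_6 sum_Box_add_2
    proof (intro sum_mono)
      fix ns a assume ns: "ns \<in> Box 4 ?N" and a: "a \<in> {1..?N}"
      \<comment> \<open>The two leading 1s are placeholders; \<open>d_of\<close> and
        \<open>e_of\<close> ignore the first two entries.\<close>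
      define d e where "d = d_of (1 # 1 # ns)" and "e = e_of (1 # 1 # ns)"
      have pos: "0 < d" "0 < e" by (rule Box_4_cases[OF ns]; simp add: d_def e_def d_of_def e_of_def)+
      have de: "d_of (a # c # ns) = d" "e_of (a # c # ns) = e" for c unfolding d_def e_def by (rule d_of_Cons_Cons)+
      have nth: "(a # c # ns) ! 0 = a" "(a # c # ns) ! 1 = c" for c by simp_all
      show "(\<Sum>c=1..?N. if real (d_of (a # c # ns) * e_of (a # c # ns)) \<le> B then ?E2 (a # c # ns) else 0)
         \<le> (if real (d_of (1 # 1 # ns) * e_of (1 # 1 # ns)) \<le> B then real (e_of (1 # 1 # ns)) else 0) * (48 * (1 / real a))"
        unfolding de nth d_def[symmetric] e_def[symmetric]
        using sum_min_window_le[of B a d e ?N] a B pos by (auto simp: mult_ac)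
    qed
    also have "\<dots> = (\<Sum>ns\<in>Box 4 ?N. if real (d_of (1 # 1 # ns) * e_of (1 # 1 # ns)) \<le> B then real (e_of (1 # 1 # ns)) else 0) * (48 * (\<Sum>a=1..?N. 1 / real a))"
      by (simp only: sum_distrib_left[symmetric] sum_distrib_right[symmetric])
    also have "\<dots> \<le> (B * (ln B + 1) ^ 3) * (48 * (ln B + 1))"
      using sum_inverse_floor_le[OF B] sum_e_of_le[OF B, of 1 1] B
      by (intro mult_mono mult_left_mono mult_nonneg_nonneg sum_nonneg) auto
    finally show ?thesis by (simp add: mult_ac)
  qed
  have "(\<Sum>n\<in>{n\<in>Box 6 ?N. P n}. 83 * sqrt (real (d_of n))
      + 4 * min (sqrt (B / real (n ! 0 * n ! 1))) ((real (e_of n) / real (n ! 0 * n ! 1)) ^ 2 / sqrt (B / real (n ! 0 * n ! 1)))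
      + (if B \<le> 16 * real (d_of n ^ 2 * n ! 0 * n ! 1) then real (e_of n) / real (n ! 0 * n ! 1) else 0))
    \<le> (\<Sum>n\<in>Box 6 ?N. 83 * ?E1 n + (if real (d_of n * e_of n) \<le> B then ?E2 n else 0))"
    unfolding sum.inter_filter[OF finite_Box]
  proof (intro sum_mono)
    fix n
    have "0 \<le> ?E1 n" "0 \<le> ?E2 n" using B by auto
    then show "(if P n then 83 * sqrt (real (d_of n))
      + 4 * min (sqrt (B / real (n ! 0 * n ! 1))) ((real (e_of n) / real (n ! 0 * n ! 1)) ^ 2 / sqrt (B / real (n ! 0 * n ! 1)))
      + (if B \<le> 16 * real (d_of n ^ 2 * n ! 0 * n ! 1) then real (e_of n) / real (n ! 0 * n ! 1) else 0) else 0)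
      \<le> 83 * ?E1 n + (if real (d_of n * e_of n) \<le> B then ?E2 n else 0)"
      using P[of n] by (cases "P n") (simp_all del: of_nat_mult of_nat_power)
  qed
  also have "\<dots> = 83 * sum ?E1 (Box 6 ?N) + (\<Sum>n\<in>Box 6 ?N. if real (d_of n * e_of n) \<le> B then ?E2 n else 0)"
    by (simp only: sum.distrib sum_distrib_left)
  also have "\<dots> \<le> 83 * (B * (81 * (ln B + 1) ^ 2)) + 48 * (ln B + 1) * (B * (ln B + 1) ^ 3)"
    using sum_sqrt_d_of_le[OF B] E2 by linarith
  also have "\<dots> \<le> B * (6771 * (ln B + 1) ^ 4)"
  proof -
    have "(ln B + 1) ^ 2 \<le> (ln B + 1) ^ 4" using B by (intro power_increasing) auto
    then have "B * (6723 * (ln B + 1) ^ 2) \<le> B * (6723 * (ln B + 1) ^ 4)" using B by (intro mult_left_mono) auto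
    then show ?thesis by (simp add: algebra_simps power_numeral_reduce)
  qed
  finally show ?thesis .
qed

section \<open>The integral for the first singularity\<close>

lemma has_real_derivative_max_0_power:
  fixes x :: real
  shows "((\<lambda>x. max 0 x ^ Suc (Suc n)) has_real_derivative real (Suc (Suc n)) * max 0 x ^ Suc n) (at x)"
proof -
  consider "x < 0" | "x > 0" | "x = 0" by linarith
  then show ?thesis
  proof cases
    case 1
    have "((\<lambda>x. 0) has_real_derivative real (Suc (Suc n)) * max 0 x ^ Suc n) (at x)"
      using 1 by (auto intro!: derivative_eq_intros simp: max_def)
    then show ?thesis
      by (rule has_field_derivative_transform_within_open[where S = "{..<0}"]) (use 1 in auto)
  next
    case 2
    have "((\<lambda>x. x ^ Suc (Suc n)) has_real_derivative real (Suc (Suc n)) * x ^ Suc n) (at x)"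
      using DERIV_pow[of "Suc (Suc n)" x UNIV] by simp
    then have "((\<lambda>x. x ^ Suc (Suc n)) has_real_derivative real (Suc (Suc n)) * max 0 x ^ Suc n) (at x)"
      using 2 by (simp add: max_def)
    then show ?thesis
      by (rule has_field_derivative_transform_within_open[where S = "{0<..}"]) (use 2 in auto)
  next
    case 3
    have "((\<lambda>y::real. max 0 y ^ Suc n) \<longlongrightarrow> max 0 0 ^ Suc n) (at 0)" by (intro tendsto_intros)
    moreover have "(max 0 y ^ Suc (Suc n) - max 0 0 ^ Suc (Suc n)) / (y - 0) = max 0 y ^ Suc n" if "y \<noteq> 0" for y :: real
      using that by (cases "y < 0") (auto simp: max_def)
    ultimately have "((\<lambda>y::real. (max 0 y ^ Suc (Suc n) - max 0 0 ^ Suc (Suc n)) / (y - 0)) \<longlongrightarrow> max 0 0 ^ Suc n) (at 0)"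
      by (subst Lim_cong_within[where g = "\<lambda>y. max 0 y ^ Suc n"]) auto
    then show ?thesis unfolding 3 by (simp add: has_field_derivative_iff)
  qed
qed

lemma has_real_derivative_max_0_affine_power:
  fixes t :: real
  shows "((\<lambda>t. max 0 (a * t + b) ^ Suc (Suc n)) has_real_derivative real (Suc (Suc n)) * max 0 (a * t + b) ^ Suc n * a) (at t)"
proof (rule DERIV_chain2[where g = "\<lambda>t. a * t + b"])
  show "((\<lambda>x. max 0 x ^ Suc (Suc n)) has_real_derivative real (Suc (Suc n)) * max 0 (a * t + b) ^ Suc n) (at (a * t + b))"
    by (rule has_real_derivative_max_0_power)
  show "((\<lambda>t. a * t + b) has_real_derivative a) (at t)" by (auto intro!: derivative_eq_intros)
qed

text \<open>The arguments are the logarithms of e3, e2, e1, k. The condition is d e = k e1^2 e2^3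
  e3^4 <= B; the value is log(B / d^2) truncated at 0, left over from the sum of 1 / sqrt(a c) over
  a c <= B / d^2.\<close>

definition region1 :: "real \<Rightarrow> real list \<Rightarrow> real" where
  "region1 T ts = (if ts ! 3 + 2 * ts ! 2 + 3 * ts ! 1 + 4 * ts ! 0 \<le> T then max 0 (T - 2 * (ts ! 3 + ts ! 2 + ts ! 1 + ts ! 0)) else 0)"

lemma antitone_cutoff_region1:
  assumes "0 \<le> T"
  shows "antitone_cutoff 4 T T (region1 T)"
  unfolding antitone_cutoff_def
proof (intro conjI allI impI)
  fix ts us :: "real list" assume len: "length ts = 4" and nn: "\<forall>t\<in>set ts. 0 \<le> t" and le: "list_all2 (\<le>) ts us"
  obtain a b c d where ts: "ts = [a, b, c, d]" using len by (auto simp: numeral_4_eq_4 length_Suc_conv)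
  have "length us = 4" using len list_all2_lengthD[OF le] by simp
  then obtain a' b' c' d' where us: "us = [a', b', c', d']" by (auto simp: numeral_4_eq_4 length_Suc_conv)
  have ab: "0 \<le> a" "0 \<le> b" "0 \<le> c" "0 \<le> d" "a \<le> a'" "b \<le> b'" "c \<le> c'" "d \<le> d'" using nn le by (auto simp: ts us)
  show "0 \<le> region1 T us" by (simp add: region1_def)
  show "region1 T us \<le> region1 T ts" "region1 T ts \<le> T" using ab assms by (auto simp: region1_def ts us)
next
  fix ts :: "real list" assume len: "length ts = 4" and nn: "\<forall>t\<in>set ts. 0 \<le> t" and ex: "\<exists>t\<in>set ts. T < t"
  obtain a b c d where ts: "ts = [a, b, c, d]" using len by (auto simp: numeral_4_eq_4 length_Suc_conv)
  show "region1 T ts = 0" using nn ex by (auto simp: region1_def ts)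
qed

lemma integral_cutoff_0:
  fixes c T :: real
  assumes "c < 0"
  shows "integral {0..T} (\<lambda>t. if t \<le> c then F t else 0) = (0::real)"
proof -
  have "integral {0..T} (\<lambda>t. if t \<le> c then F t else 0) = integral {0..T} (\<lambda>t. 0)"
    using assms by (intro integral_cong) auto
  then show ?thesis by simp
qed

text \<open>Integration proceeds from k outwards to e3. The truncation at 0 is carried along as
  powers of \<open>max 0\<close>, which are differentiable everywhere from exponent 2 on; so the
  region need not be cut along the zero set of the linear form.\<close>

lemma integral_region1:
  assumes T: "0 \<le> T"
  shows "iterated_integral 4 T (region1 T) = 13 * T ^ 5 / 34560"
proof -
  let ?I1 = "\<lambda>a b c. (T / 2 - a - b - c) ^ 2 - max 0 (c + (2 * b + 3 * a - T / 2)) ^ 2"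
  let ?I2 = "\<lambda>a b. ((T / 2 - a - b) ^ 3 - 2 * (b / 2 + a) ^ 3 + max 0 (2 * b + (3 * a - T / 2)) ^ 3) / 3"
  let ?I3 = "\<lambda>a. (T / 2 - a) ^ 4 / 12 + a ^ 4 / 3 - 3 / 8 * (T / 6 + a / 3) ^ 4 - max 0 (3 * a - T / 2) ^ 4 / 24"
  have 1: "integral {0..T} (\<lambda>d. region1 T [a, b, c, d]) = (if c \<le> (T - 3 * b - 4 * a) / 2 then ?I1 a b c else 0)"
    if "0 \<le> a" "0 \<le> b" "0 \<le> c" for a b c
  proof -
    define w where "w = T - 2 * c - 3 * b - 4 * a"
    define u where "u = T / 2 - a - b - c"
    have r: "region1 T [a, b, c, d] = (if d \<le> w then 2 * max 0 (- 1 * d + u) else 0)" for d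
      by (auto simp: region1_def w_def u_def max_def)
    show ?thesis
    proof (cases "0 \<le> w")
      case True
      have "integral {0..T} (\<lambda>d. if d \<le> w then 2 * max 0 (- 1 * d + u) else 0) = - (max 0 (- 1 * w + u) ^ 2) - (- (max 0 (- 1 * 0 + u) ^ 2))"
      proof (rule integral_cutoff[where G = "\<lambda>d. - (max 0 (- 1 * d + u) ^ 2)"])
        show "((\<lambda>d. - (max 0 (- 1 * d + u) ^ 2)) has_real_derivative 2 * max 0 (- 1 * t + u)) (at t)" for t
          using DERIV_minus[OF has_real_derivative_max_0_affine_power[of "- 1" u 0 t]] by (simp add: numeral_2_eq_2)
      qed (use that True in \<open>auto simp: w_def\<close>)
      moreover have "max 0 (- 1 * 0 + u) = u" using True that by (auto simp: u_def w_def max_def)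
      moreover have "- 1 * w + u = c + (2 * b + 3 * a - T / 2)" by (simp add: w_def u_def)
      moreover have "c \<le> (T - 3 * b - 4 * a) / 2" using True by (simp add: w_def)
      ultimately show ?thesis unfolding r by (simp add: u_def)
    next
      case False
      then have "\<not> c \<le> (T - 3 * b - 4 * a) / 2" by (simp add: w_def)
      then show ?thesis unfolding r using integral_cutoff_0[of w T] False by simp
    qed
  qed
  have 2: "integral {0..T} (\<lambda>c. integral {0..T} (\<lambda>d. region1 T [a, b, c, d])) = (if b \<le> (T - 4 * a) / 3 then ?I2 a b else 0)"
    if "0 \<le> a" "0 \<le> b" for a b
  proof -
    define w where "w = (T - 3 * b - 4 * a) / 2"
    define v where "v = 2 * b + 3 * a - T / 2"
    have i: "integral {0..T} (\<lambda>c. integral {0..T} (\<lambda>d. region1 T [a, b, c, d])) = integral {0..T} (\<lambda>c. if c \<le> w then ?I1 a b c else 0)"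
      using that 1 by (intro integral_cong) (auto simp: w_def)
    show ?thesis
    proof (cases "0 \<le> w")
      case True
      have eq: "integral {0..T} (\<lambda>c. if c \<le> w then ?I1 a b c else 0)
        = (- ((T / 2 - a - b - w) ^ 3 / 3) - max 0 (1 * w + v) ^ 3 / 3) - (- ((T / 2 - a - b - 0) ^ 3 / 3) - max 0 (1 * 0 + v) ^ 3 / 3)"
      proof (rule integral_cutoff[where G = "\<lambda>c. - ((T / 2 - a - b - c) ^ 3 / 3) - max 0 (1 * c + v) ^ 3 / 3"])
        fix t
        have 1: "((\<lambda>c. max 0 (1 * c + v) ^ 3) has_real_derivative 3 * max 0 (1 * t + v) ^ 2) (at t)"
          using has_real_derivative_max_0_affine_power[of 1 v 1 t] by (simp add: numeral_2_eq_2 numeral_3_eq_3)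
        have "((\<lambda>c. - ((T / 2 - a - b - c) ^ 3 / 3)) has_real_derivative (T / 2 - a - b - t) ^ 2) (at t)"
          by (auto intro!: derivative_eq_intros)
        from DERIV_diff[OF this DERIV_cdivide[OF 1, of 3]]
        show "((\<lambda>c. - ((T / 2 - a - b - c) ^ 3 / 3) - max 0 (1 * c + v) ^ 3 / 3) has_real_derivative ?I1 a b t) (at t)"
          by (simp add: v_def)
      qed (use that True in \<open>auto simp: w_def\<close>)
      have q: "T / 2 - a - b - w = b / 2 + a" "1 * w + v = b / 2 + a" by (simp_all add: w_def v_def field_simps)
      have "max 0 (b / 2 + a) = b / 2 + a" using that by (simp add: max_def)
      moreover have "b \<le> (T - 4 * a) / 3" using True by (simp add: w_def)
      moreover have "1 * 0 + v = 2 * b + (3 * a - T / 2)" by (simp add: v_def)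
      ultimately show ?thesis unfolding i eq q by simp
    next
      case False
      then have "\<not> b \<le> (T - 4 * a) / 3" by (simp add: w_def)
      then show ?thesis unfolding i using integral_cutoff_0[of w T] False by simp
    qed
  qed
  have 3: "integral {0..T} (\<lambda>b. integral {0..T} (\<lambda>c. integral {0..T} (\<lambda>d. region1 T [a, b, c, d]))) = (if a \<le> T / 4 then ?I3 a else 0)"
    if "0 \<le> a" for a
  proof -
    define w where "w = (T - 4 * a) / 3"
    define m where "m = 3 * a - T / 2"
    have i: "integral {0..T} (\<lambda>b. integral {0..T} (\<lambda>c. integral {0..T} (\<lambda>d. region1 T [a, b, c, d]))) = integral {0..T} (\<lambda>b. if b \<le> w then ?I2 a b else 0)"
      using that 2 by (intro integral_cong) (auto simp: w_def)
    show ?thesis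
    proof (cases "0 \<le> w")
      case True
      let ?G = "\<lambda>b. - ((T / 2 - a - b) ^ 4 / 12) - (b / 2 + a) ^ 4 / 3 + max 0 (2 * b + m) ^ 4 / 24"
      have eq: "integral {0..T} (\<lambda>b. if b \<le> w then ?I2 a b else 0) = ?G w - ?G 0"
      proof (rule integral_cutoff[where G = ?G])
        fix t
        have 1: "((\<lambda>b. max 0 (2 * b + m) ^ 4) has_real_derivative 8 * max 0 (2 * t + m) ^ 3) (at t)"
          using has_real_derivative_max_0_affine_power[of 2 m 2 t] by (simp add: numeral_2_eq_2 numeral_3_eq_3 numeral_4_eq_4)
        have "((\<lambda>b. - ((T / 2 - a - b) ^ 4 / 12) - (b / 2 + a) ^ 4 / 3) has_real_derivative (T / 2 - a - t) ^ 3 / 3 - 2 * (t / 2 + a) ^ 3 / 3) (at t)"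
          by (auto intro!: derivative_eq_intros)
        from DERIV_add[OF this DERIV_cdivide[OF 1, of 24]]
        show "(?G has_real_derivative ?I2 a t) (at t)"
          by (simp add: m_def diff_divide_distrib add_divide_distrib)
      qed (use that True in \<open>auto simp: w_def\<close>)
      have q: "T / 2 - a - w = T / 6 + a / 3" "w / 2 + a = T / 6 + a / 3" "2 * w + m = T / 6 + a / 3" by (simp_all add: w_def m_def field_simps)
      have "max 0 (T / 6 + a / 3) = T / 6 + a / 3" using that T by (simp add: max_def)
      moreover have "a \<le> T / 4" using True by (simp add: w_def)
      ultimately show ?thesis unfolding i eq q by (simp add: m_def)
    next
      case False
      then have "\<not> a \<le> T / 4" by (simp add: w_def)
      then show ?thesis unfolding i using integral_cutoff_0[of w T] False by simp
    qed
  qed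
  have "iterated_integral 4 T (region1 T) = integral {0..T} (\<lambda>a. integral {0..T} (\<lambda>b. integral {0..T} (\<lambda>c. integral {0..T} (\<lambda>d. region1 T [a, b, c, d]))))"
    unfolding numeral_4_eq_4 iterated_integral.simps by (rule refl)
  also have "\<dots> = integral {0..T} (\<lambda>a. if a \<le> T / 4 then ?I3 a else 0)"
    using 3 by (intro integral_cong) auto
  also have "\<dots> = (- ((T / 2 - T / 4) ^ 5 / 60) + (T / 4) ^ 5 / 15 - 9 / 40 * (T / 6 + (T / 4) / 3) ^ 5 - max 0 (3 * (T / 4) + - (T / 2)) ^ 5 / 360)
      - (- ((T / 2 - 0) ^ 5 / 60) + 0 ^ 5 / 15 - 9 / 40 * (T / 6 + 0 / 3) ^ 5 - max 0 (3 * 0 + - (T / 2)) ^ 5 / 360)"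
  proof (rule integral_cutoff[where G = "\<lambda>a. - ((T / 2 - a) ^ 5 / 60) + a ^ 5 / 15 - 9 / 40 * (T / 6 + a / 3) ^ 5 - max 0 (3 * a + - (T / 2)) ^ 5 / 360"])
    fix t
    have 1: "((\<lambda>a. max 0 (3 * a + - (T / 2)) ^ 5) has_real_derivative 15 * max 0 (3 * t + - (T / 2)) ^ 4) (at t)"
      using has_real_derivative_max_0_affine_power[of 3 "- (T / 2)" 3 t] by (simp add: eval_nat_numeral)
    have "((\<lambda>a. - ((T / 2 - a) ^ 5 / 60) + a ^ 5 / 15 - 9 / 40 * (T / 6 + a / 3) ^ 5) has_real_derivative (T / 2 - t) ^ 4 / 12 + t ^ 4 / 3 - 3 / 8 * (T / 6 + t / 3) ^ 4) (at t)"
      by (auto intro!: derivative_eq_intros)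
    from DERIV_diff[OF this DERIV_cdivide[OF 1, of 360]]
    show "((\<lambda>a. - ((T / 2 - a) ^ 5 / 60) + a ^ 5 / 15 - 9 / 40 * (T / 6 + a / 3) ^ 5 - max 0 (3 * a + - (T / 2)) ^ 5 / 360) has_real_derivative ?I3 t) (at t)"
      by simp
  qed (use T in auto)
  \<comment> \<open>At a = T/4 all nonzero terms are multiples of (T/4)^5. In units of T^5 / 34560
    this end gives -6, and the end a = 0 gives 18 + 1.\<close>
  also have "\<dots> = 13 * T ^ 5 / 34560"
  proof -
    have "max 0 (3 * (T / 4) + - (T / 2)) = T / 4" "max 0 (3 * 0 + - (T / 2)) = 0" "T / 2 - T / 4 = T / 4" "T / 6 + (T / 4) / 3 = T / 4"
      using T by (auto simp: max_def)
    then show ?thesis by (simp add: power_divide)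
  qed
  finally show ?thesis .
qed

text \<open>Two things in one local factor: the 0/1 part is admissibility, and if p divides d, the
  factor 1 - omega / p is the proportion of the fibre in which p divides neither \<beta> nor
  \<delta>. Positions 2, 3, 4 decide whether p divides e, positions 2 to 5 whether it divides
  d.\<close>

definition weight1 :: "nat \<Rightarrow> nat list \<Rightarrow> real" where
  "weight1 p r = (if \<not> (r ! 0 \<ge> 1 \<and> r ! 1 \<ge> 1) \<and> \<not> ((r ! 0 \<ge> 1 \<or> r ! 1 \<ge> 1) \<and> (r ! 2 \<ge> 1 \<or> r ! 3 \<ge> 1 \<or> r ! 4 \<ge> 1))
       \<and> r ! 3 \<le> 1 \<and> r ! 4 \<le> 1 \<and> \<not> (r ! 3 \<ge> 1 \<and> r ! 4 \<ge> 1)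
     then if r ! 2 \<ge> 1 \<or> r ! 3 \<ge> 1 \<or> r ! 4 \<ge> 1 \<or> r ! 5 \<ge> 1
       then 1 - real (if r ! 2 \<ge> 1 \<or> r ! 3 \<ge> 1 \<or> r ! 4 \<ge> 1 then 1 else (if r ! 1 \<ge> 1 then 0 else 1) + (if r ! 0 \<ge> 1 then 0 else 1)) / real p
       else 1
     else 0)"

lemma weight1_list:
  "weight1 p [x0, x1, x2, x3, x4, x5] = (if \<not> (x0 \<ge> 1 \<and> x1 \<ge> 1) \<and> \<not> ((x0 \<ge> 1 \<or> x1 \<ge> 1) \<and> (x2 \<ge> 1 \<or> x3 \<ge> 1 \<or> x4 \<ge> 1))
       \<and> x3 \<le> 1 \<and> x4 \<le> 1 \<and> \<not> (x3 \<ge> 1 \<and> x4 \<ge> 1)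
     then if x2 \<ge> 1 \<or> x3 \<ge> 1 \<or> x4 \<ge> 1 \<or> x5 \<ge> 1
       then 1 - real (if x2 \<ge> 1 \<or> x3 \<ge> 1 \<or> x4 \<ge> 1 then 1 else (if x1 \<ge> 1 then 0 else 1) + (if x0 \<ge> 1 then 0 else 1)) / real p
       else 1
     else 0)"
proof -
  let ?r = "[x0, x1, x2, x3, x4, x5]"
  have nth: "?r ! 0 = x0" "?r ! 1 = x1" "?r ! 2 = x2" "?r ! 3 = x3" "?r ! 4 = x4" "?r ! 5 = x5" by simp_all
  show ?thesis unfolding weight1_def nth by (rule refl)
qed

lemma abs_weight1_le:
  assumes "prime p"
  shows "\<bar>weight1 p r\<bar> \<le> 1"
proof -
  have "0 \<le> 1 - real j / real p \<and> 1 - real j / real p \<le> 1" if "j \<le> 2" for j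
    using that prime_ge_2_nat[OF assms] by simp
  then show ?thesis unfolding weight1_def by (auto simp del: of_nat_add simp: abs_le_iff)
qed

text \<open>The extreme case is a prime that divides only k: it divides d but not e a c, so two
  residues are forbidden.\<close>

lemma weight1_unit:
  assumes "prime p" "length r = 6" "sum_list r = 1"
  shows "\<bar>weight1 p r - 1\<bar> \<le> 2 / real p"
proof -
  obtain a b c d e f where r: "r = [a, b, c, d, e, f]" using assms(2) by (auto simp: eval_nat_numeral length_Suc_conv)
  then have "a + b + c + d + e + f = 1" using assms(3) by simp
  then have "[a, b, c, d, e, f] \<in> {[1, 0, 0, 0, 0, 0], [0, 1, 0, 0, 0, 0], [0, 0, 1, 0, 0, 0], [0, 0, 0, 1, 0, 0], [0, 0, 0, 0, 1, 0], [0, 0, 0, 0, 0, 1]}"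
    by (auto simp: add_is_1)
  then show ?thesis unfolding r by (auto simp: weight1_def divide_right_mono)
qed

text \<open>With (1 - x)^5 taken out, the lists in which p divides at most k contribute 1 - 2 x^2,
  those with p | a or p | c contribute 2 x (1 + x), and those with p | e contribute 3 x; together 1
  + 5 x.\<close>

lemma density_weight1: "density [1, 1, 1, 2, 2, 1] (1 / real p) (weight1 p) = (1 - 1 / real p) ^ 5 * (1 + 5 / real p)"
proof -
  define x where "x = 1 / real p"
  have d: "a / real p = a * x" for a by (simp add: x_def)
  have "density [1, 1, 1, 2, 2, 1] x (weight1 p) = (1 - x) ^ 5 * (1 + 5 * x)"
    unfolding numeral_2_eq_2 density.simps weight1_def d
    by (simp add: lessThan_Suc numeral_3_eq_3 numeral_4_eq_4 eval_nat_numeral) (simp add: algebra_simps)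
  then show ?thesis unfolding x_def by simp
qed

lemma coprime_iff_no_prime_3:
  fixes a e3 e2 e1 N :: nat
  assumes "a \<in> {1..N}"
  shows "coprime a (e3 * e2 * e1) \<longleftrightarrow> (\<forall>p. prime p \<longrightarrow> p \<le> N \<longrightarrow> \<not> (p dvd a \<and> (p dvd e3 \<or> p dvd e2 \<or> p dvd e1)))"
proof -
  have "0 < a" "a \<le> N" using assms by auto
  moreover have "p dvd e3 * e2 * e1 \<longleftrightarrow> p dvd e3 \<or> p dvd e2 \<or> p dvd e1" if "prime p" for p
    using that by (simp add: prime_dvd_mult_iff disj_assoc)
  ultimately show ?thesis using coprime_iff_no_prime[of a N "e3 * e2 * e1"] by blast
qed

text \<open>Prime by prime, \<open>A\<close> is \<open>admissible1\<close>, and at the primes of d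
  the remaining factor is the density of the residues not counted by \<open>omega1\<close>.\<close>

lemma weight1_eq:
  assumes n: "n = [a, c, e3, e2, e1, k]" and N: "a \<in> {1..N}" "c \<in> {1..N}" "e3 \<in> {1..N}" "e2 \<in> {1..N}" "e1 \<in> {1..N}" "k \<in> {1..N}"
    and d: "d_of n \<le> N"
  shows "weight [1, 1, 1, 2, 2, 1] weight1 N n
     = (if admissible1 n then \<Prod>p\<in>prime_factors (d_of n). 1 - real (omega1 a c (e_of n) p) / real p else 0)"
proof -
  define A where "A p \<longleftrightarrow> \<not> (p dvd a \<and> p dvd c) \<and> \<not> ((p dvd a \<or> p dvd c) \<and> (p dvd e3 \<or> p dvd e2 \<or> p dvd e1)) \<and> \<not> p ^ 2 dvd e2 \<and> \<not> p ^ 2 dvd e1 \<and> \<not> (p dvd e2 \<and> p dvd e1)" for p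
  define v where "v p = 1 - real (omega1 a c (e_of n) p) / real p" for p
  have "d_of n \<noteq> 0" using n N by (simp add: d_of_def)
  then have dN: "d_of n \<in> {1..N}" using d by simp
  have loc: "local_weight [1, 1, 1, 2, 2, 1] weight1 p n = (if A p then if p dvd d_of n then v p else 1 else 0)" if p: "prime p" for p
  proof -
    have pd: "p dvd d_of n \<longleftrightarrow> p dvd e3 \<or> p dvd e2 \<or> p dvd e1 \<or> p dvd k"
      using p by (simp add: d_of_def n prime_dvd_mult_iff)
    have pe: "p dvd e_of n \<longleftrightarrow> p dvd e3 \<or> p dvd e2 \<or> p dvd e1"
      using p by (auto simp: e_of_def n prime_dvd_mult_iff prime_dvd_power_iff)
    have p2: "p dvd x" if "p ^ 2 dvd x" for x using that by (metis dvd_mult_left power2_eq_square)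
    have r: "map2 min [1, 1, 1, 2, 2, 1] (map (multiplicity p) n) = [if p dvd a then 1 else 0, if p dvd c then 1 else 0, if p dvd e3 then 1 else 0,
        if p ^ 2 dvd e2 then 2 else if p dvd e2 then 1 else 0, if p ^ 2 dvd e1 then 2 else if p dvd e1 then 1 else 0, if p dvd k then 1 else 0]"
      using N p by (simp add: n min_1_multiplicity min_2_multiplicity)
    have ge: "(if p ^ 2 dvd x then 2 else if p dvd x then 1 else 0) \<ge> (1::nat) \<longleftrightarrow> p dvd x"
      "(if p ^ 2 dvd x then 2 else if p dvd x then 1 else 0) \<le> (1::nat) \<longleftrightarrow> \<not> p ^ 2 dvd x" 
      "(if p dvd x then 1 else 0) \<ge> (1::nat) \<longleftrightarrow> p dvd x" for x using p2[of x] by auto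
    show ?thesis unfolding local_weight_def r weight1_list A_def v_def omega1_def pd pe ge by simp
  qed
  have "weight [1, 1, 1, 2, 2, 1] weight1 N n = (\<Prod>p\<in>{p. prime p \<and> p \<le> N}. if A p then if p dvd d_of n then v p else 1 else 0)"
    unfolding weight_def by (intro prod.cong[OF refl] loc) simp
  moreover have "(\<forall>p\<in>{p. prime p \<and> p \<le> N}. A p) \<longleftrightarrow> admissible1 n"
  proof -
    have nth: "n ! 0 = a" "n ! 1 = c" "n ! 2 = e3" "n ! 3 = e2" "n ! 4 = e1" by (simp_all add: n)
    have le: "0 < a" "a \<le> N" "0 < e1" "e1 \<le> N" using N by auto
    have A: "A p \<longleftrightarrow> \<not> p ^ 2 dvd e1 \<and> \<not> p ^ 2 dvd e2 \<and> \<not> (p dvd e1 \<and> p dvd e2) \<and> \<not> (p dvd a \<and> p dvd c)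
        \<and> \<not> (p dvd a \<and> (p dvd e3 \<or> p dvd e2 \<or> p dvd e1)) \<and> \<not> (p dvd c \<and> (p dvd e3 \<or> p dvd e2 \<or> p dvd e1))" for p
      unfolding A_def by argo
    show ?thesis
      unfolding admissible1_def nth A coprime_mult_left_iff coprime_iff_no_prime[OF le(1,2), of c] coprime_iff_no_prime[OF le(3,4), of e2]
        coprime_iff_no_prime_3[OF N(1)] coprime_iff_no_prime_3[OF N(2)] squarefree_iff_primes_le[OF N(4)] squarefree_iff_primes_le[OF N(5)]
      by (simp only: Ball_def mem_Collect_eq imp_conjL imp_conjR all_conj_distrib)
  qed
  ultimately show ?thesis unfolding prod_if_zero[OF finite_primes_le] prod_prime_factors_le[OF dN] v_def by simp
qed

section \<open>Summing out the first two variables\<close>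

lemma sum_inverse_sqrt_ge:
  assumes "1 \<le> x"
  shows "2 * sqrt x - 2 \<le> (\<Sum>n=1..nat \<lfloor>x\<rfloor>. 1 / sqrt (real n))"
proof -
  have "2 * sqrt (real (Suc M)) - 2 \<le> (\<Sum>n=1..M. 1 / sqrt (real n))" for M
  proof (induction M)
    case (Suc M)
    define u v where "u = sqrt (real (Suc M))" and "v = sqrt (real (Suc (Suc M)))"
    have uv: "0 < u" "u \<le> v" by (auto simp: u_def v_def)
    have "v ^ 2 - u ^ 2 = 1" by (simp add: u_def v_def)
    then have "(v - u) * (v + u) = 1" by (simp add: power2_eq_square algebra_simps)
    moreover have "(v - u) * (2 * u) \<le> (v - u) * (v + u)" using uv by (intro mult_left_mono) auto
    ultimately have "2 * (v - u) \<le> 1 / u" using uv by (simp add: pos_le_divide_eq mult_ac)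
    then show ?case using Suc by (simp add: u_def v_def)
  qed simp
  note this[of "nat \<lfloor>x\<rfloor>"]
  moreover have "sqrt x \<le> sqrt (real (Suc (nat \<lfloor>x\<rfloor>)))" using assms by simp linarith
  ultimately show ?thesis by linarith
qed

lemma ln_le_sum_inverse:
  assumes "1 \<le> x"
  shows "ln x \<le> (\<Sum>n=1..nat \<lfloor>x\<rfloor>. 1 / real n)"
proof -
  have "ln (real (Suc M)) \<le> (\<Sum>n=1..M. 1 / real n)" for M
  proof (induction M)
    case (Suc M)
    have "ln (real (Suc (Suc M))) - ln (real (Suc M)) \<le> 1 / real (Suc M)" by (rule ln_Suc_diff_bounds(2)) simp
    moreover have "(\<Sum>n=1..Suc M. 1 / real n) = (\<Sum>n=1..M. 1 / real n) + 1 / real (Suc M)" by simp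
    ultimately show ?case using Suc by linarith
  qed simp
  note this[of "nat \<lfloor>x\<rfloor>"]
  moreover have "ln x \<le> ln (real (Suc (nat \<lfloor>x\<rfloor>)))" using assms by (intro ln_mono) linarith+
  ultimately show ?thesis by linarith
qed

lemma sum_filter_le_floor:
  fixes F :: "nat \<Rightarrow> real"
  assumes "0 \<le> x" "nat \<lfloor>x\<rfloor> \<le> N" and "\<And>n. n \<in> {1..N} \<Longrightarrow> Q n \<longleftrightarrow> real n \<le> x"
  shows "(\<Sum>n=1..N. if Q n then F n else 0) = (\<Sum>n=1..nat \<lfloor>x\<rfloor>. F n)"
proof -
  have "{n\<in>{1..N}. Q n} = {1..nat \<lfloor>x\<rfloor>}"
  proof (intro set_eqI)
    fix n
    show "n \<in> {n\<in>{1..N}. Q n} \<longleftrightarrow> n \<in> {1..nat \<lfloor>x\<rfloor>}"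
      using assms(2) assms(3)[of n] le_nat_floor_iff[OF assms(1), of n] by (cases "n \<in> {1..N}") auto
  qed
  then show ?thesis by (simp only: sum.inter_filter[OF finite_atLeastAtMost, symmetric])
qed

text \<open>The sum over c <= X / a is 2 sqrt(X / a) up to a bounded error. The main parts form 2
  sqrt X times a harmonic sum; the errors, weighted by 1 / sqrt a, add up to O(sqrt X). For X < 1
  every term is 0, hence the \<open>max 0\<close>.\<close>

lemma sum_hyperbola_inverse_sqrt:
  assumes X: "0 < X" and N: "nat \<lfloor>X\<rfloor> \<le> N"
  shows "\<bar>(\<Sum>a=1..N. \<Sum>c=1..N. if real (a * c) \<le> X then 1 / sqrt (real (a * c)) else 0) - 2 * sqrt X * max 0 (ln X)\<bar> \<le> 4 * sqrt X"
proof (cases "1 \<le> X")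
  case False
  have "(\<Sum>a=1..N. \<Sum>c=1..N. if real (a * c) \<le> X then 1 / sqrt (real (a * c)) else 0) = 0"
  proof (intro sum.neutral ballI)
    fix a c assume "a \<in> {1..N}" "c \<in> {1..N}"
    then have "1 \<le> a * c" by simp
    then have "1 \<le> real (a * c)" by (metis of_nat_1 of_nat_mono)
    then show "(if real (a * c) \<le> X then 1 / sqrt (real (a * c)) else 0) = 0" using False by simp
  qed
  moreover have "max 0 (ln X) = 0" using False X by simp
  ultimately show ?thesis using X by simp
next
  case True
  define M where "M = nat \<lfloor>X\<rfloor>"
  have inner: "(\<Sum>c=1..N. if real (a * c) \<le> X then 1 / sqrt (real (a * c)) else 0) = (if real a \<le> X then 1 / sqrt (real a) * (\<Sum>c=1..nat \<lfloor>X / real a\<rfloor>. 1 / sqrt (real c)) else 0)"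
    if a: "a \<in> {1..N}" for a
  proof (cases "real a \<le> X")
    case True
    have "(\<Sum>c=1..N. if real (a * c) \<le> X then 1 / sqrt (real (a * c)) else 0) = (\<Sum>c=1..nat \<lfloor>X / real a\<rfloor>. 1 / sqrt (real (a * c)))"
    proof (rule sum_filter_le_floor)
      have "X / real a \<le> X / 1" using a X by (intro divide_left_mono) auto
      then have "nat \<lfloor>X / real a\<rfloor> \<le> nat \<lfloor>X\<rfloor>" by (intro nat_mono floor_mono) simp
      then show "nat \<lfloor>X / real a\<rfloor> \<le> N" using N by (rule order_trans)
    qed (use a X in \<open>auto simp: pos_le_divide_eq mult.commute\<close>)
    then show ?thesis using True by (simp add: sum_distrib_left real_sqrt_mult)
  next
    case False
    have "(\<Sum>c=1..N. if real (a * c) \<le> X then 1 / sqrt (real (a * c)) else 0) = 0"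
    proof (intro sum.neutral ballI)
      fix c assume "c \<in> {1..N}"
      then have "a \<le> a * c" by simp
      then have "real a \<le> real (a * c)" by (rule of_nat_mono)
      then show "(if real (a * c) \<le> X then 1 / sqrt (real (a * c)) else 0) = 0" using False by simp
    qed
    then show ?thesis using False by simp
  qed
  have "(\<Sum>a=1..N. \<Sum>c=1..N. if real (a * c) \<le> X then 1 / sqrt (real (a * c)) else 0)
     = (\<Sum>a=1..N. if real a \<le> X then 1 / sqrt (real a) * (\<Sum>c=1..nat \<lfloor>X / real a\<rfloor>. 1 / sqrt (real c)) else 0)"
    using inner by (intro sum.cong) auto
  also have "\<dots> = (\<Sum>a=1..M. 1 / sqrt (real a) * (\<Sum>c=1..nat \<lfloor>X / real a\<rfloor>. 1 / sqrt (real c)))"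
    unfolding M_def using X N by (intro sum_filter_le_floor) auto
  finally have S: "(\<Sum>a=1..N. \<Sum>c=1..N. if real (a * c) \<le> X then 1 / sqrt (real (a * c)) else 0) = (\<Sum>a=1..M. 1 / sqrt (real a) * (\<Sum>c=1..nat \<lfloor>X / real a\<rfloor>. 1 / sqrt (real c)))" .
  have sq: "1 / sqrt (real a) * (2 * sqrt (X / real a)) = 2 * sqrt X * (1 / real a)" if "a \<ge> 1" for a
    using that by (simp add: real_sqrt_divide)
  have up: "(\<Sum>a=1..M. 1 / sqrt (real a) * (\<Sum>c=1..nat \<lfloor>X / real a\<rfloor>. 1 / sqrt (real c))) \<le> 2 * sqrt X * (\<Sum>a=1..M. 1 / real a)"
    unfolding sum_distrib_left[of "2 * sqrt X"]
  proof (intro sum_mono)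
    fix a assume a: "a \<in> {1..M}"
    have "1 / sqrt (real a) * (\<Sum>c=1..nat \<lfloor>X / real a\<rfloor>. 1 / sqrt (real c)) \<le> 1 / sqrt (real a) * (2 * sqrt (X / real a))"
      using X by (intro mult_left_mono sum_inverse_sqrt_le) auto
    then show "1 / sqrt (real a) * (\<Sum>c=1..nat \<lfloor>X / real a\<rfloor>. 1 / sqrt (real c)) \<le> 2 * sqrt X * (1 / real a)" using sq[of a] a by simp
  qed
  have lo: "2 * sqrt X * (\<Sum>a=1..M. 1 / real a) - 2 * (\<Sum>a=1..M. 1 / sqrt (real a)) \<le> (\<Sum>a=1..M. 1 / sqrt (real a) * (\<Sum>c=1..nat \<lfloor>X / real a\<rfloor>. 1 / sqrt (real c)))"
    unfolding sum_distrib_left[of "2 * sqrt X"] sum_distrib_left[of 2] sum_subtractf[symmetric]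
  proof (intro sum_mono)
    fix a assume a: "a \<in> {1..M}"
    have "real a \<le> X" using a X le_nat_floor_iff[of X a] by (simp add: M_def)
    then have "1 \<le> X / real a" using a by simp
    then have "1 / sqrt (real a) * (2 * sqrt (X / real a) - 2) \<le> 1 / sqrt (real a) * (\<Sum>c=1..nat \<lfloor>X / real a\<rfloor>. 1 / sqrt (real c))"
      by (intro mult_left_mono sum_inverse_sqrt_ge) auto
    then show "2 * sqrt X * (1 / real a) - 2 * (1 / sqrt (real a)) \<le> 1 / sqrt (real a) * (\<Sum>c=1..nat \<lfloor>X / real a\<rfloor>. 1 / sqrt (real c))"
      using sq[of a] a by (simp add: right_diff_distrib)
  qed
  have r: "(\<Sum>a=1..M. 1 / sqrt (real a)) \<le> 2 * sqrt X" unfolding M_def using X by (intro sum_inverse_sqrt_le) simp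
  have s0: "0 \<le> 2 * sqrt X" using X by simp
  have "2 * sqrt X * (\<Sum>a=1..M. 1 / real a) \<le> 2 * sqrt X * (1 + ln X)" unfolding M_def by (intro mult_left_mono sum_inverse_le True s0)
  moreover have "2 * sqrt X * ln X \<le> 2 * sqrt X * (\<Sum>a=1..M. 1 / real a)" unfolding M_def by (intro mult_left_mono ln_le_sum_inverse True s0)
  moreover have "2 * sqrt X * (1 + ln X) = 2 * sqrt X + 2 * sqrt X * ln X" by (simp add: distrib_left)
  moreover have "max 0 (ln X) = ln X" using True by simp
  ultimately show ?thesis unfolding S abs_le_iff using up lo r s0 by simp
qed

text \<open>The main term 2 sqrt(B / (a c)) of a fibre divided by B, under the height conditions on
  the list. Multiplied by the product of the list it is not antitone, so \<open>sieve\<close> is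
  applied directly instead of \<open>sieve_log\<close>.\<close>

definition phi1 :: "real \<Rightarrow> nat list \<Rightarrow> real" where
  "phi1 B n = (if real (d_of n ^ 2 * n ! 0 * n ! 1) \<le> B \<and> real (d_of n * e_of n) \<le> B then 2 / sqrt (B * real (n ! 0 * n ! 1)) else 0)"

lemma sum_inverse_prod_list_4_le:
  assumes "1 \<le> B"
  shows "(\<Sum>ns\<in>Box 4 (nat \<lfloor>B\<rfloor>). 1 / real (prod_list ns)) \<le> (ln B + 1) ^ 4"
proof -
  let ?H = "\<Sum>x=1..nat \<lfloor>B\<rfloor>. 1 / real x"
  have step: "(\<Sum>ns\<in>Box (Suc k) (nat \<lfloor>B\<rfloor>). 1 / real (prod_list ns)) = ?H * (\<Sum>ns\<in>Box k (nat \<lfloor>B\<rfloor>). 1 / real (prod_list ns))" for k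
    unfolding sum_Box_Suc sum_product by simp
  have "(\<Sum>ns\<in>Box 4 (nat \<lfloor>B\<rfloor>). 1 / real (prod_list ns)) = ?H ^ 4"
    unfolding numeral_4_eq_4 step by simp
  also have "\<dots> \<le> (ln B + 1) ^ 4" by (intro power_mono sum_inverse_floor_le assms sum_nonneg) simp
  finally show ?thesis .
qed

lemma ln_of_nat_nonneg: "0 \<le> ln (real n)"
  by (cases "n = 0") auto

text \<open>With X = B / (D^2 sa sc) the double sum is a hyperbola sum, and
  \<open>\<kappa> * sqrt X = 2 / Pn\<close> removes the shift everywhere except in ln X, which
  differs from T - 2 ln D by ln (sa sc). The 8 comes from the hyperbola sum, the logarithm from this
  difference.\<close>

lemma sum_phi1_fibre:
  fixes s' ns :: "nat list"
  assumes B: "1 \<le> B" and s: "0 < sa" "0 < sc" "length s' = 4" "0 \<notin> set s'" and ns: "ns \<in> Box 4 N" and N: "nat \<lfloor>B\<rfloor> \<le> N"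
  shows "\<bar>real (prod_list (sa # sc # s')) * (\<Sum>a=1..N. \<Sum>c=1..N. phi1 B (lmul (sa # sc # s') (a # c # ns)))
      - 4 * (region1 (ln B) (map2 (\<lambda>x s. ln (real x) + s) ns (map (\<lambda>x. ln (real x)) s')) / real (prod_list ns))\<bar>
     \<le> (8 + 4 * ln (real (sa * sc))) * (1 / real (prod_list ns))"
proof -
  define T where "T = ln B"
  obtain n3 n2 n1 nk where n: "ns = [n3, n2, n1, nk]" "n3 \<in> {1..N}" "n2 \<in> {1..N}" "n1 \<in> {1..N}" "nk \<in> {1..N}"
    using ns by (rule Box_4_cases)
  obtain s3 s2 s1 sk where s': "s' = [s3, s2, s1, sk]" using s(3) by (auto simp: numeral_4_eq_4 length_Suc_conv)
  have pos: "0 < n3" "0 < n2" "0 < n1" "0 < nk" "0 < s3" "0 < s2" "0 < s1" "0 < sk" using n s(4) by (auto simp: s')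
  define x3 x2 x1 xk where "x3 = s3 * n3" and "x2 = s2 * n2" and "x1 = s1 * n1" and "xk = sk * nk"
  have x: "0 < x3" "0 < x2" "0 < x1" "0 < xk" using pos by (auto simp: x3_def x2_def x1_def xk_def)
  define D where "D = x3 * x2 * x1 * xk"
  define e where "e = x1 * x2 ^ 2 * x3 ^ 3"
  define Pn Ps where "Pn = n3 * n2 * n1 * nk" and "Ps = s3 * s2 * s1 * sk"
  have DP: "D = Ps * Pn" by (simp add: D_def Ps_def Pn_def x3_def x2_def x1_def xk_def)
  have p0: "0 < D" "0 < Pn" "0 < Ps" using pos x by (auto simp: D_def Pn_def Ps_def)
  have prods: "prod_list ns = Pn" "prod_list (sa # sc # s') = sa * sc * Ps" by (simp_all add: n s' Pn_def Ps_def)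
  have reg: "region1 T (map2 (\<lambda>x s. ln (real x) + s) ns (map (\<lambda>x. ln (real x)) s')) = (if real (D * e) \<le> B then max 0 (T - 2 * ln (real D)) else 0)"
  proof -
    have m: "map2 (\<lambda>x s. ln (real x) + s) ns (map (\<lambda>x. ln (real x)) s') = [ln (real x3), ln (real x2), ln (real x1), ln (real xk)]"
      using pos by (simp add: n s' x3_def x2_def x1_def xk_def ln_mult)
    have 1: "ln (real D) = ln (real xk) + ln (real x1) + ln (real x2) + ln (real x3)" using x by (simp add: D_def ln_mult)
    have "ln (real (D * e)) = ln (real xk) + 2 * ln (real x1) + 3 * ln (real x2) + 4 * ln (real x3)"
      using x by (simp add: D_def e_def ln_mult ln_realpow)
    moreover have "ln (real (D * e)) \<le> T \<longleftrightarrow> real (D * e) \<le> B"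
      unfolding T_def using B x by (intro ln_le_cancel_iff) (auto simp: D_def e_def)
    ultimately show ?thesis unfolding m by (simp add: region1_def 1)
  qed
  define X where "X = B / real (D ^ 2 * sa * sc)"
  have X0: "0 < X" using B p0 s by (simp add: X_def)
  define \<kappa> where "\<kappa> = real (sa * sc * Ps) * (2 / sqrt (B * real (sa * sc)))"
  define S where "S = (\<Sum>a=1..N. \<Sum>c=1..N. if real (a * c) \<le> X then 1 / sqrt (real (a * c)) else 0)"
  have phi: "phi1 B (lmul (sa # sc # s') (a # c # ns)) = (if real (D * e) \<le> B then 2 / sqrt (B * real (sa * sc)) * (if real (a * c) \<le> X then 1 / sqrt (real (a * c)) else 0) else 0)" for a c
  proof -
    have l: "lmul (sa # sc # s') (a # c # ns) = [sa * a, sc * c, x3, x2, x1, xk]" by (simp add: n s' x3_def x2_def x1_def xk_def)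
    have de: "d_of [sa * a, sc * c, x3, x2, x1, xk] = D" "e_of [sa * a, sc * c, x3, x2, x1, xk] = e" by (simp_all add: d_of_def e_of_def D_def e_def)
    have nth: "[sa * a, sc * c, x3, x2, x1, xk] ! 0 = sa * a" "[sa * a, sc * c, x3, x2, x1, xk] ! 1 = sc * c" by simp_all
    have pq: "0 < real (D ^ 2 * sa * sc)" using p0 s by simp
    have "real (a * c) \<le> X \<longleftrightarrow> real (a * c) * real (D ^ 2 * sa * sc) \<le> B" unfolding X_def by (rule pos_le_divide_eq[OF pq])
    then have 1: "real (D ^ 2 * (sa * a) * (sc * c)) \<le> B \<longleftrightarrow> real (a * c) \<le> X" by (simp add: mult_ac)
    have 2: "2 / sqrt (B * real (sa * a * (sc * c))) = 2 / sqrt (B * real (sa * sc)) * (1 / sqrt (real (a * c)))"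
      by (simp add: real_sqrt_mult mult_ac)
    show ?thesis unfolding l phi1_def de nth 1 2 by simp
  qed
  have sum: "real (prod_list (sa # sc # s')) * (\<Sum>a=1..N. \<Sum>c=1..N. phi1 B (lmul (sa # sc # s') (a # c # ns))) = (if real (D * e) \<le> B then \<kappa> * S else 0)"
  proof (cases "real (D * e) \<le> B")
    case True
    then show ?thesis unfolding phi prods \<kappa>_def S_def if_P[OF True] by (simp only: sum_distrib_left[symmetric] mult.assoc)
  next
    case False
    then show ?thesis unfolding phi if_not_P[OF False] by simp
  qed
  have "X \<le> B / 1" unfolding X_def
  proof (rule divide_left_mono)
    have "1 \<le> D ^ 2 * sa * sc" using p0 s by simp
    then show "1 \<le> real (D ^ 2 * sa * sc)" by (metis of_nat_1 of_nat_mono)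
  qed (use B p0 s in auto)
  then have "nat \<lfloor>X\<rfloor> \<le> nat \<lfloor>B\<rfloor>" by (intro nat_mono floor_mono) simp
  then have "nat \<lfloor>X\<rfloor> \<le> N" using N by simp
  note S = sum_hyperbola_inverse_sqrt[OF X0 this, folded S_def]
  have \<kappa>X: "\<kappa> * sqrt X = 2 / real Pn"
  proof -
    have r: "sqrt X = sqrt B / (real D * sqrt (real (sa * sc)))"
      unfolding X_def using p0 by (simp add: real_sqrt_divide real_sqrt_mult mult_ac)
    have q: "sqrt (real (sa * sc)) * sqrt (real (sa * sc)) = real (sa * sc)" by simp
    define \<tau> where "\<tau> = sqrt (real (sa * sc))"
    have t: "0 < \<tau>" "real (sa * sc) = \<tau> * \<tau>" using s q by (auto simp: \<tau>_def)
    have "\<kappa> = \<tau> * \<tau> * real Ps * (2 / (sqrt B * \<tau>))" unfolding \<kappa>_def t(2)[symmetric] by (simp add: real_sqrt_mult \<tau>_def)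
    then show ?thesis unfolding r \<tau>_def[symmetric] DP using t p0 B by (simp add: field_simps)
  qed
  have \<kappa>0: "0 \<le> \<kappa>" using B by (simp add: \<kappa>_def)
  have "\<bar>\<kappa> * S - 4 * max 0 (ln X) * (1 / real Pn)\<bar> = \<kappa> * \<bar>S - 2 * sqrt X * max 0 (ln X)\<bar>"
  proof -
    have "\<kappa> * (2 * sqrt X * max 0 (ln X)) = 2 * max 0 (ln X) * (\<kappa> * sqrt X)" by (simp only: mult_ac)
    also have "\<dots> = 4 * max 0 (ln X) * (1 / real Pn)" unfolding \<kappa>X by simp
    finally have "\<kappa> * S - 4 * max 0 (ln X) * (1 / real Pn) = \<kappa> * (S - 2 * sqrt X * max 0 (ln X))" by (simp only: right_diff_distrib)
    then show ?thesis using \<kappa>0 by (simp only: abs_mult abs_of_nonneg)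
  qed
  also have "\<dots> \<le> \<kappa> * (4 * sqrt X)" using \<kappa>0 S by (intro mult_left_mono)
  also have "\<dots> = 4 * (\<kappa> * sqrt X)" by (simp only: mult_ac)
  also have "\<dots> = 8 * (1 / real Pn)" unfolding \<kappa>X by simp
  finally have main: "\<bar>\<kappa> * S - 4 * max 0 (ln X) * (1 / real Pn)\<bar> \<le> 8 * (1 / real Pn)" .
  have L0: "0 \<le> ln (real (sa * sc))" by (rule ln_of_nat_nonneg)
  define u v where "u = max 0 (ln X)" and "v = max 0 (T - 2 * ln (real D))"
  have "ln X = T - ln (real (D ^ 2) * real (sa * sc))"
    unfolding X_def T_def using B p0 s by (subst ln_div) (simp_all add: mult.assoc)
  also have "ln (real (D ^ 2) * real (sa * sc)) = 2 * ln (real D) + ln (real (sa * sc))"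
    using p0 s by (subst ln_mult_pos) (simp_all add: ln_realpow)
  finally have "\<bar>u - v\<bar> \<le> ln (real (sa * sc))" unfolding u_def v_def using L0 by linarith
  then have f1: "\<bar>u - v\<bar> * (4 * (1 / real Pn)) \<le> ln (real (sa * sc)) * (4 * (1 / real Pn))"
    by (rule mult_right_mono) simp
  have f2: "4 * u * (1 / real Pn) - 4 * (v / real Pn) = (u - v) * (4 * (1 / real Pn))"
    by (simp add: left_diff_distrib diff_divide_distrib mult_ac)
  have f3: "\<bar>(u - v) * (4 * (1 / real Pn))\<bar> = \<bar>u - v\<bar> * (4 * (1 / real Pn))"
    by (simp only: abs_mult) simp
  have second: "\<bar>4 * u * (1 / real Pn) - 4 * (v / real Pn)\<bar> \<le> 4 * ln (real (sa * sc)) * (1 / real Pn)"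
    unfolding f2 f3 using f1 by (simp only: mult_ac)
  show ?thesis
  proof (cases "real (D * e) \<le> B")
    case True
    have "(8 + 4 * ln (real (sa * sc))) * (1 / real Pn) = 8 * (1 / real Pn) + 4 * ln (real (sa * sc)) * (1 / real Pn)" by (rule distrib_right)
    then show ?thesis unfolding prods T_def[symmetric] reg sum[unfolded prods] if_P[OF True] v_def[symmetric] using main[folded u_def] second by linarith
  next
    case False
    have "0 \<le> (8 + 4 * ln (real (sa * sc))) * (1 / real Pn)" using L0 by simp
    then show ?thesis unfolding prods T_def[symmetric] reg sum[unfolded prods] if_not_P[OF False] by simp
  qed
qed

text \<open>The first two entries of s enter through the fibre estimate, the other four as shifts in
  \<open>sum_Box_log\<close>; together they form the logarithm of the whole product. The 24 is 8 + 4
  * 4.\<close>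

lemma sum_phi1_lmul:
  fixes s :: "nat list"
  assumes B: "1 \<le> B" and s: "length s = 6" "0 \<notin> set s"
  shows "\<bar>real (prod_list s) * (\<Sum>m\<in>Box 6 (nat \<lfloor>B\<rfloor>). phi1 B (lmul s m)) - 4 * iterated_integral 4 (ln B) (region1 (ln B))\<bar>
      \<le> 24 * (ln B + 1) ^ 4 + 4 * (ln B + 1) ^ 4 * ln (real (prod_list s))"
proof -
  define T where "T = ln B"
  define N where "N = nat \<lfloor>B\<rfloor>"
  have T: "0 \<le> T" "exp T = B" using B by (auto simp: T_def)
  obtain sa sc s' where ss: "s = sa # sc # s'" "length s' = 4" using s(1)[unfolded numeral_6_eq_6] unfolding length_Suc_conv by blast
  have s0: "0 < sa" "0 < sc" "0 \<notin> set s'" using s(2) by (auto simp: ss)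
  define \<sigma> where "\<sigma> = map (\<lambda>x. ln (real x)) s'"
  define \<Psi> where "\<Psi> ns = region1 T (map2 (\<lambda>x s. ln (real x) + s) ns \<sigma>) / real (prod_list ns)" for ns
  define f where "f ns = real (prod_list s) * (\<Sum>a=1..N. \<Sum>c=1..N. phi1 B (lmul s (a # c # ns)))" for ns
  define L where "L = ln (real (sa * sc))"
  have L0: "0 \<le> L" unfolding L_def by (rule ln_of_nat_nonneg)
  have total: "real (prod_list s) * (\<Sum>m\<in>Box 6 N. phi1 B (lmul s m)) = (\<Sum>ns\<in>Box 4 N. f ns)"
    unfolding numeral_6_eq_6 sum_Box_add_2 f_def sum_distrib_left by (rule refl)
  have "\<bar>(\<Sum>ns\<in>Box 4 N. f ns) - 4 * (\<Sum>ns\<in>Box 4 N. \<Psi> ns)\<bar> \<le> (\<Sum>ns\<in>Box 4 N. \<bar>f ns - 4 * \<Psi> ns\<bar>)"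
    unfolding sum_distrib_left sum_subtractf[symmetric] by (rule sum_abs)
  also have "\<dots> \<le> (\<Sum>ns\<in>Box 4 N. (8 + 4 * L) * (1 / real (prod_list ns)))"
    unfolding f_def \<Psi>_def \<sigma>_def L_def ss(1) T_def using B s0 ss(2) by (intro sum_mono sum_phi1_fibre[where N = N]) (auto simp: N_def)
  also have "\<dots> \<le> (8 + 4 * L) * (T + 1) ^ 4"
    unfolding sum_distrib_left[symmetric] N_def T_def using L0 by (intro mult_left_mono sum_inverse_prod_list_4_le B) auto
  finally have 1: "\<bar>(\<Sum>ns\<in>Box 4 N. f ns) - 4 * (\<Sum>ns\<in>Box 4 N. \<Psi> ns)\<bar> \<le> (8 + 4 * L) * (T + 1) ^ 4" .
  have \<sigma>: "length \<sigma> = 4" "\<forall>t\<in>set \<sigma>. 0 \<le> t"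
    by (auto simp: \<sigma>_def ss ln_of_nat_nonneg)
  have "\<bar>(\<Sum>ns\<in>Box 4 N. \<Psi> ns) - iterated_integral 4 T (region1 T)\<bar> \<le> (4 + sum_list \<sigma>) * (T + 1) ^ 3 * T"
    using sum_Box_log[OF T(1) antitone_cutoff_region1[OF T(1)] \<sigma>] unfolding \<Psi>_def N_def T(2) by simp
  also have "\<dots> \<le> (4 + sum_list \<sigma>) * (T + 1) ^ 3 * (T + 1)"
    using T \<sigma>(2) by (intro mult_left_mono mult_nonneg_nonneg add_nonneg_nonneg sum_list_nonneg) auto
  also have "\<dots> = (4 + sum_list \<sigma>) * (T + 1) ^ 4" by (simp add: numeral_4_eq_4 numeral_3_eq_3 mult_ac)
  finally have 2: "\<bar>(\<Sum>ns\<in>Box 4 N. \<Psi> ns) - iterated_integral 4 T (region1 T)\<bar> \<le> (4 + sum_list \<sigma>) * (T + 1) ^ 4" .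
  have lnp: "ln (real (prod_list s)) = L + sum_list \<sigma>"
  proof -
    have "ln (real (prod_list s')) = sum_list \<sigma>" unfolding \<sigma>_def by (rule ln_prod_list[OF s0(3)])
    moreover have "prod_list s' \<noteq> 0" using s0 by (simp add: prod_list_zero_iff)
    ultimately show ?thesis using s0 by (simp add: ss L_def ln_mult mult.assoc[symmetric] del: mult.assoc)
  qed
  have "24 * (T + 1) ^ 4 + 4 * (T + 1) ^ 4 * ln (real (prod_list s)) = (8 + 4 * L) * (T + 1) ^ 4 + 4 * ((4 + sum_list \<sigma>) * (T + 1) ^ 4)"
    unfolding lnp by (simp add: algebra_simps)
  then show ?thesis unfolding T_def[symmetric] N_def[symmetric] total using 1 2 by linarith
qed

text \<open>Every entry of the list divides d^2 a c, which is at most B where \<open>phi1\<close>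
  does not vanish.\<close>

lemma supported_phi1:
  assumes "1 \<le> B"
  shows "supported 6 (nat \<lfloor>B\<rfloor>) (phi1 B)"
  unfolding supported_def
proof (intro allI impI)
  fix n :: "nat list" assume n: "length n = 6" "0 \<notin> set n" "n \<notin> Box 6 (nat \<lfloor>B\<rfloor>)"
  obtain a c e3 e2 e1 k where n': "n = [a, c, e3, e2, e1, k]" using n(1) by (auto simp: eval_nat_numeral length_Suc_conv)
  define P where "P = d_of n ^ 2 * n ! 0 * n ! 1"
  have P0: "P > 0" using n(2) by (auto simp: P_def n' d_of_def)
  have "x \<le> P" if "x \<in> set n" for x
  proof (rule dvd_imp_le[OF _ P0])
    show "x dvd P" using that by (auto simp: P_def n' d_of_def power2_eq_square)
  qed
  moreover obtain x where "x \<in> set n" "x \<notin> {1..nat \<lfloor>B\<rfloor>}" using n(1,3) unfolding Box_def by blast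
  moreover have "1 \<le> x" if "x \<in> set n" for x using that n(2) by (metis One_nat_def Suc_leI neq0_conv)
  ultimately have "\<not> P \<le> nat \<lfloor>B\<rfloor>" by fastforce
  then have "\<not> real P \<le> B" using assms le_nat_floor_iff[of B P] by simp
  then show "phi1 B n = 0" by (simp add: phi1_def P_def)
qed

section \<open>The asymptotic formula for the first singularity\<close>

lemma N1_half:
  "N1 B = 2 * card {(x0, x1, x2, x3, x4). (x0, x1, x2, x3, x4) \<in> dP4 \<and> x2 > 0 \<and> x3 > 0 \<and> integral1 (x0, x1, x2, x3, x4) \<and> real_of_int (H1 (x0, x1, x2, x3, x4)) \<le> B}"
  unfolding N1_def
proof (rule point_count_half)
  show "integral1 (- x0, - x1, x2, - x3, x4) = integral1 (x0, x1, x2, x3, x4)" for x0 x1 x2 x3 x4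
    by (simp add: integral1_def)
  show "H1 (- x0, - x1, x2, - x3, x4) = H1 (x0, x1, x2, x3, x4)" for x0 x1 x2 x3 x4
    by (simp add: H1_def)
qed

text \<open>The constant is 2 * 4 * 13 / 34560: the sign of \<open>x3\<close>, the summation over a
  and c, and the integral.\<close>

lemma asymptotic_N1:
  obtains C where "\<And>B. B \<ge> 1 \<Longrightarrow> \<bar>real (N1 B) - 13 / 4320 * prime_prod (\<lambda>p. (1 - 1 / p) ^ 5 * (1 + 5 / p)) * B * ln B ^ 5\<bar> \<le> C * (B * (ln B + 1) ^ 4)"
proof -
  let ?D = "\<lambda>p::real. (1 - 1 / p) ^ 5 * (1 + 5 / p)"
  have len: "length [1, 1, 1, 2, 2, 1::nat] = 6" by simp
  obtain K where K: "K \<ge> 0" and Kb: "\<And>N \<Phi> M K0 K1. \<lbrakk>supported 6 N \<Phi>; 0 \<le> K0; 0 \<le> K1;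
       \<And>s. length s = 6 \<Longrightarrow> 0 \<notin> set s \<Longrightarrow>
         \<bar>real (prod_list s) * (\<Sum>m\<in>Box 6 N. \<Phi> (lmul s m)) - M\<bar> \<le> K0 + K1 * ln (real (prod_list s))\<rbrakk> \<Longrightarrow>
       \<bar>(\<Sum>n\<in>Box 6 N. weight [1, 1, 1, 2, 2, 1] weight1 N n * \<Phi> n) - prime_prod ?D * M\<bar> \<le> K * (K0 + K1)"
  proof (rule sieve[where f = weight1 and cs = "[1, 1, 1, 2, 2, 1]" and C = 2 and D = ?D, unfolded len])
    show "weight1 p (replicate 6 0) = 1" for p by (simp add: weight1_def)
  qed ((rule abs_weight1_le weight1_unit density_weight1; assumption) | blast)+
  have "\<bar>real (N1 B) - 13 / 4320 * prime_prod ?D * B * ln B ^ 5\<bar> \<le> (56 * K + 13542) * (B * (ln B + 1) ^ 4)" if B: "B \<ge> 1" for B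
  proof -
    define T where "T = ln B"
    define N where "N = nat \<lfloor>B\<rfloor>"
    have T: "0 \<le> T" using B by (simp add: T_def)
    define P where "P n \<longleftrightarrow> admissible1 n \<and> real (d_of n ^ 2 * n ! 0 * n ! 1) \<le> B \<and> real (d_of n * e_of n) \<le> B" for n :: "nat list"
    define w where "w n = (\<Prod>p\<in>prime_factors (d_of n). 1 - real (omega1 (n ! 0) (n ! 1) (e_of n) p) / real p)" for n
    define err where "err n = 83 * sqrt (real (d_of n))
      + 4 * min (sqrt (B / real (n ! 0 * n ! 1))) ((real (e_of n) / real (n ! 0 * n ! 1)) ^ 2 / sqrt (B / real (n ! 0 * n ! 1)))
      + (if B \<le> 16 * real (d_of n ^ 2 * n ! 0 * n ! 1) then real (e_of n) / real (n ! 0 * n ! 1) else 0)" for n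
    define W where "W n = weight [1, 1, 1, 2, 2, 1] weight1 N n * phi1 B n" for n
    have main: "\<bar>real (card (SIGMA n:{n\<in>Box 6 N. P n}. fibre1 B n)) - B * (prime_prod ?D * (4 * (13 * T ^ 5 / 34560)))\<bar>
       \<le> B * (28 * K * (T + 1) ^ 4) + (\<Sum>n\<in>{n\<in>Box 6 N. P n}. err n)"
    proof (rule card_Sigma_asymptotic[where W = W and v = "\<lambda>n. w n * (2 / sqrt (B * real (n ! 0 * n ! 1)))"])
      fix n assume n: "n \<in> Box 6 N"
      then obtain a c e3 e2 e1 k where n': "n = [a, c, e3, e2, e1, k]" "a \<in> {1..N}" "c \<in> {1..N}" "e3 \<in> {1..N}" "e2 \<in> {1..N}" "e1 \<in> {1..N}" "k \<in> {1..N}"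
        by (rule Box_6_cases)
      have nth: "n ! 0 = a" "n ! 1 = c" by (simp_all add: n')
      have ac: "0 < a" "0 < c" using n' by auto
      have dN: "d_of n \<le> N" if "real (d_of n ^ 2 * n ! 0 * n ! 1) \<le> B"
      proof -
        have "d_of n dvd d_of n ^ 2 * a * c" by (simp add: power2_eq_square)
        moreover have "0 < d_of n ^ 2 * a * c" using n' by (simp add: d_of_def)
        ultimately have "d_of n \<le> d_of n ^ 2 * a * c" by (rule dvd_imp_le)
        then have "real (d_of n) \<le> real (d_of n ^ 2 * a * c)" by (rule of_nat_mono)
        then have "real (d_of n) \<le> B" using that unfolding nth by linarith
        then show ?thesis using le_nat_floor_iff[of B "d_of n"] B by (simp add: N_def)
      qed
      show "W n = (if P n then w n * (2 / sqrt (B * real (n ! 0 * n ! 1))) else 0)"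
      proof (cases "real (d_of n ^ 2 * n ! 0 * n ! 1) \<le> B \<and> real (d_of n * e_of n) \<le> B")
        case True
        then have "d_of n \<le> N" using dN by blast
        then have "weight [1, 1, 1, 2, 2, 1] weight1 N n = (if admissible1 n then w n else 0)"
          unfolding w_def nth by (rule weight1_eq[OF n'])
        then show ?thesis using True by (simp only: W_def phi1_def P_def if_True simp_thms) simp
      next
        case False
        then have "\<not> P n" "phi1 B n = 0" unfolding P_def phi1_def by auto
        then show ?thesis unfolding W_def by simp
      qed
      assume P: "P n"
      have pos: "0 < a" "0 < c" "0 < e3" "0 < e2" "0 < e1" "0 < k" using n' by auto
      have P': "admissible1 n" "real (d_of n ^ 2 * a * c) \<le> B" using P unfolding P_def nth by auto
      note fib = card_fibre1[OF B n'(1) pos P']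
      show "finite (fibre1 B n)" by (rule fib(1))
      have "B * (2 / sqrt (B * real (a * c))) = 2 * sqrt (B / real (a * c))"
      proof -
        have "B = sqrt B * sqrt B" using B by simp
        then have "B * (2 / sqrt (B * real (a * c))) = sqrt B * sqrt B * (2 / (sqrt B * sqrt (real (a * c))))" by (simp only: real_sqrt_mult)
        also have "\<dots> = 2 * (sqrt B / sqrt (real (a * c)))"
        proof -
          have "x * x * (2 / (x * y)) = 2 * (x / y)" if "x \<noteq> 0" for x y :: real
            using that by (cases "y = 0") (simp_all add: field_simps)
          then show ?thesis using B by (metis less_le_trans real_sqrt_gt_0_iff zero_less_one less_irrefl)
        qed
        finally show ?thesis by (simp only: real_sqrt_divide)
      qed
      then have "B * (w n * (2 / sqrt (B * real (a * c)))) = w n * (2 * sqrt (B / real (a * c)))" unfolding mult.left_commute[of B "w n"] by (rule arg_cong)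
      then show "\<bar>real (card (fibre1 B n)) - B * (w n * (2 / sqrt (B * real (n ! 0 * n ! 1))))\<bar> \<le> err n"
        using fib(2) unfolding w_def err_def nth by (simp only:)
    next
      have "\<bar>(\<Sum>n\<in>Box 6 N. weight [1, 1, 1, 2, 2, 1] weight1 N n * phi1 B n) - prime_prod ?D * (4 * iterated_integral 4 T (region1 T))\<bar> \<le> K * (24 * (T + 1) ^ 4 + 4 * (T + 1) ^ 4)"
        unfolding N_def T_def using B by (intro Kb supported_phi1 sum_phi1_lmul) auto
      then show "\<bar>(\<Sum>n\<in>Box 6 N. W n) - prime_prod ?D * (4 * (13 * T ^ 5 / 34560))\<bar> \<le> 28 * K * (T + 1) ^ 4"
        unfolding W_def integral_region1[OF T] by (simp add: mult_ac)
    qed (use B in auto)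
    have card: "real (N1 B) = 2 * real (card (SIGMA n:{n\<in>Box 6 N. P n}. fibre1 B n))"
      unfolding N1_half card_N1_solutions[OF B] P_def N_def by simp
    have err: "(\<Sum>n\<in>{n\<in>Box 6 N. P n}. err n) \<le> B * (6771 * (T + 1) ^ 4)"
      unfolding err_def N_def T_def by (rule N1_error_sum_le[OF B]) (simp add: P_def)
    have "2 * (B * (prime_prod ?D * (4 * (13 * T ^ 5 / 34560)))) = 13 / 4320 * prime_prod ?D * B * T ^ 5" by simp
    moreover have "(56 * K + 13542) * (B * (T + 1) ^ 4) = 2 * (B * (28 * K * (T + 1) ^ 4) + B * (6771 * (T + 1) ^ 4))"
      by (simp add: algebra_simps)
    ultimately show ?thesis unfolding T_def[symmetric] by (intro double_count_bound[OF card main err])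
  qed
  then show ?thesis by (rule that)
qed

theorem theorem1:
  shows "(\<lambda>B. real (N1 B) - 13 / 4320 * prime_prod (\<lambda>p. (1 - 1 / p) ^ 5 * (1 + 5 / p)) * B * ln B ^ 5)
       \<in> O[at_top](\<lambda>B :: real. B * ln B ^ 4 * ln (ln B)) \<and>
    (\<lambda>B. real (N2 B) - 1 / 32 * prime_prod (\<lambda>p. (1 - 1 / p) ^ 3 * (1 + 3 / p)) * B * ln B ^ 4)
       \<in> O[at_top](\<lambda>B :: real. B * ln B ^ 3 * ln (ln B)) \<and>
    (\<lambda>B. real (N3 B) - 1 / 8 * prime_prod (\<lambda>p. (1 - 1 / p) ^ 2 * (1 + 2 / p - 1 / p ^ 2)) * B * ln B ^ 3)
       \<in> O[at_top](\<lambda>B :: real. B * ln B ^ 2 * ln (ln B)) \<and>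
    (\<lambda>B. real (N4 B) - 2 * prime_prod (\<lambda>p. (1 - 1 / p) * (1 + 1 / p)) * B * ln B ^ 2)
       \<in> O[at_top](\<lambda>B :: real. B * ln B * ln (ln B)) \<and>
    (\<forall>B. N5 B = N6 B) \<and>
    (\<lambda>B. real (N5 B) - 7 / 24 * prime_prod (\<lambda>p. (1 - 1 / p) ^ 2 * (1 + 2 / p)) * B * ln B ^ 3)
       \<in> O[at_top](\<lambda>B :: real. B * ln B ^ 2 * ln (ln B)) \<and>
    (\<lambda>B. real (N6 B) - 7 / 24 * prime_prod (\<lambda>p. (1 - 1 / p) ^ 2 * (1 + 2 / p)) * B * ln B ^ 3)
       \<in> O[at_top](\<lambda>B :: real. B * ln B ^ 2 * ln (ln B))"
proof -
  obtain C1 where C1: "\<And>B. B \<ge> 1 \<Longrightarrow> \<bar>real (N1 B) - 13 / 4320 * prime_prod (\<lambda>p. (1 - 1 / p) ^ 5 * (1 + 5 / p)) * B * ln B ^ 5\<bar> \<le> C1 * (B * (ln B + 1) ^ 4)"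
    by (rule asymptotic_N1) blast
  obtain C2 where C2: "\<And>B. B \<ge> 1 \<Longrightarrow> \<bar>real (N2 B) - 1 / 32 * prime_prod (\<lambda>p. (1 - 1 / p) ^ 3 * (1 + 3 / p)) * B * ln B ^ 4\<bar> \<le> C2 * (B * (ln B + 1) ^ 3)"
    by (rule asymptotic_N2) blast
  obtain C3 where C3: "\<And>B. B \<ge> 1 \<Longrightarrow> \<bar>real (N3 B) - 1 / 8 * prime_prod (\<lambda>p. (1 - 1 / p) ^ 2 * (1 + 2 / p - 1 / p ^ 2)) * B * ln B ^ 3\<bar> \<le> C3 * (B * (ln B + 1) ^ 2)"
    by (rule asymptotic_N3) blast
  obtain C4 where C4: "\<And>B. B \<ge> 1 \<Longrightarrow> \<bar>real (N4 B) - 2 * prime_prod (\<lambda>p. (1 - 1 / p) * (1 + 1 / p)) * B * ln B ^ 2\<bar> \<le> C4 * (B * (ln B + 1) ^ 1)"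
    by (rule asymptotic_N4) blast
  obtain C5 where C5: "\<And>B. B \<ge> 1 \<Longrightarrow> \<bar>real (N5 B) - 7 / 24 * prime_prod (\<lambda>p. (1 - 1 / p) ^ 2 * (1 + 2 / p)) * B * ln B ^ 3\<bar> \<le> C5 * (B * (ln B + 1) ^ 2)"
    by (rule asymptotic_N5) blast
  note O4 = bigo_of_bound[OF C4, unfolded power_one_right]
  note O5 = bigo_of_bound[OF C5]
  show ?thesis
    using bigo_of_bound[OF C1] bigo_of_bound[OF C2] bigo_of_bound[OF C3] O4 O5 O5[unfolded N5_eq_N6] N5_eq_N6 by blast
qed

end
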